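(* Let $b_1<0<b_2$, let $Q_{12},Q_{21}\in L^1[0,1]$ (complex-valued), and let $a,b,c,d\in\mathbb{C}$ with $ad-bc\neq 0$. Let $L_{C,D}(Q)$ be the operator in $L^2([0,1];\mathbb{C}^2)$ associated with the boundary value problem $$-iB^{-1}y'+Q(x)y=\lambda y,\qquad y=\operatorname{col}(y_1,y_2),\quad x\in[0,1],\qquad B=\begin{pmatrix}b_1&0\\ 0&b_2\end{pmatrix},\quad Q=\begin{pmatrix}0&Q_{12}\\ Q_{21}&0\end{pmatrix},$$ $$y_1(0)+b\,y_2(0)+a\,y_1(1)=0,\qquad d\,y_2(0)+c\,y_1(1)+y_2(1)=0 .$$ Assume that these boundary conditions are strictly regular. Then the system of root vectors of the operator $L_{C,D}(Q)$ forms a Riesz basis in $L^2[0,1]\otimes\mathbb{C}^2$.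
   Context: The operator $L_{C,D}(Q)$ acts by $y\mapsto -iB^{-1}y'+Qy$ on the domain of all $y\in W^1_1([0,1];\mathbb{C}^2)$ (absolutely continuous $\mathbb{C}^2$-valued functions) such that $-iB^{-1}y'+Qy\in L^2([0,1];\mathbb{C}^2)$ and $y$ satisfies the two boundary conditions. Boundary conditions of the form $y_1(0)+b\,y_2(0)+a\,y_1(1)=0$, $d\,y_2(0)+c\,y_1(1)+y_2(1)=0$ with $a,b,c,d\in\mathbb{C}$ and $ad-bc\ne0$ are called regular. They are called strictly regular if, in addition, the sequence $\{\lambda_n^0\}_{n\in\mathbb{Z}}$ of eigenvalues (counted with multiplicity) of the unperturbed problem ($Q=0$), i.e. the sequence of zeros, counted with multiplicity, of the entire function $$\Delta_0(\lambda)=d+a e^{i(b_1+b_2)\lambda}+(ad-bc)e^{ib_1\lambda}+e^{ib_2\lambda},$$ is asymptotically separated: there exist $\delta>0$ and $n_0\in\mathbb{N}$ such that $|\lambda_j^0-\lambda_k^0|>2\delta$ for all $j\neq k$ with $|j|,|k|\ge n_0$ (zeros enumerated with $|\lambda_n^0|\to\infty$ as $|n|\to\infty$). Root vectors are eigenvectors and associated (generalized eigen-) vectors; the root vectors system consists of a basis of each root subspace, with the vectors properly normalized. A system in a Hilbert space $\mathfrak{H}$ is a Riesz basis if some linear homeomorphism of $\mathfrak{H}$ maps it onto an orthonormal basis. *)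

theory Defs
  imports "HOL-Complex_Analysis.Complex_Analysis"
begin

text \<open>The notation for coefficients of power series clashes with that for vector components.\<close>

no_notation fps_nth (infixl "$" 75)

section \<open>The Hilbert space \<open>L\<^sup>2([0,1]; \<complex>\<^sup>2)\<close>\<close>

abbreviation unit_leb :: "real measure" where
  "unit_leb \<equiv> lebesgue_on {0..1}"

definition sq_integrable :: "(real \<Rightarrow> complex^2) \<Rightarrow> bool" where
  "sq_integrable f \<longleftrightarrow>
     f \<in> borel_measurable unit_leb \<and> integrable unit_leb (\<lambda>x. (norm (f x))\<^sup>2)"

lemma norm_add_sq_le: "(norm (u + v))\<^sup>2 \<le> 2 * (norm u)\<^sup>2 + 2 * (norm v)\<^sup>2"
  for u v :: "'a::real_normed_vector"
proof -
  have "(norm (u + v))\<^sup>2 \<le> (norm u + norm v)\<^sup>2"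
    by (intro power_mono norm_triangle_ineq) auto
  also have "\<dots> \<le> 2 * (norm u)\<^sup>2 + 2 * (norm v)\<^sup>2"
    using zero_le_power2[of "norm u - norm v"] by (simp add: power2_eq_square algebra_simps)
  finally show ?thesis .
qed

lemma norm_vector_scalar_mult: "norm (c *s v) = cmod c * norm v" for v :: "complex^2"
  by (simp add: norm_vec_def L2_set_def norm_mult power_mult_distrib real_sqrt_mult
      flip: sum_distrib_left)

lemma measurable_vector_scalar_mult [measurable (raw)]:
  fixes f :: "'a \<Rightarrow> complex^2"
  assumes [measurable]: "f \<in> borel_measurable M"
  shows "(\<lambda>x. c *s f x) \<in> borel_measurable M"
proof -
  have "linear (\<lambda>v::complex^2. c *s v)"
    by (rule linearI) (auto simp: vec_eq_iff algebra_simps)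
  then have "continuous_on UNIV (\<lambda>v::complex^2. c *s v)"
    by (rule linear_continuous_on[OF linear_conv_bounded_linear[THEN iffD1]])
  from borel_measurable_continuous_on[OF this assms] show ?thesis .
qed

lemma sq_integrable_zero: "sq_integrable (\<lambda>_. 0)"
  by (simp add: sq_integrable_def)

lemma sq_integrable_add:
  assumes "sq_integrable f" "sq_integrable g"
  shows "sq_integrable (\<lambda>x. f x + g x)"
proof -
  have [measurable]: "f \<in> borel_measurable unit_leb" "g \<in> borel_measurable unit_leb"
    using assms by (auto simp: sq_integrable_def)
  have "integrable unit_leb (\<lambda>x. (norm (f x + g x))\<^sup>2)"
    by (rule Bochner_Integration.integrable_bound
        [where f = "\<lambda>x. 2 * (norm (f x))\<^sup>2 + 2 * (norm (g x))\<^sup>2"])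
       (use assms norm_add_sq_le in \<open>auto simp: sq_integrable_def intro!: AE_I2\<close>)
  then show ?thesis
    by (simp add: sq_integrable_def)
qed

lemma sq_integrable_scaleC: "sq_integrable f \<Longrightarrow> sq_integrable (\<lambda>x. c *s f x)"
  by (auto simp: sq_integrable_def norm_vector_scalar_mult power_mult_distrib
      intro: measurable_vector_scalar_mult)

lemma sq_integrable_scaleR: "sq_integrable f \<Longrightarrow> sq_integrable (\<lambda>x. r *\<^sub>R f x)"
  by (auto simp: sq_integrable_def power_mult_distrib)

lemma sq_integrable_uminus: "sq_integrable f \<Longrightarrow> sq_integrable (\<lambda>x. - f x)"
  by (auto simp: sq_integrable_def)

lemma sq_integrable_diff:
  "sq_integrable f \<Longrightarrow> sq_integrable g \<Longrightarrow> sq_integrable (\<lambda>x. f x - g x)"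
  using sq_integrable_add[OF _ sq_integrable_uminus, of f g] by simp

lemma integrable_inner_sq_integrable:
  assumes "sq_integrable f" "sq_integrable g"
  shows "integrable unit_leb (\<lambda>x. f x \<bullet> g x)"
proof -
  have [measurable]: "f \<in> borel_measurable unit_leb" "g \<in> borel_measurable unit_leb"
    using assms by (auto simp: sq_integrable_def)
  have *: "\<bar>u \<bullet> v\<bar> \<le> (norm u)\<^sup>2 + (norm v)\<^sup>2" for u v :: "complex^2"
    using Cauchy_Schwarz_ineq2[of u v] zero_le_power2[of "norm u - norm v"]
      mult_nonneg_nonneg[of "norm u" "norm v"]
    by (simp add: power2_eq_square algebra_simps)
  show ?thesis
    by (rule Bochner_Integration.integrable_bound
        [where f = "\<lambda>x. (norm (f x))\<^sup>2 + (norm (g x))\<^sup>2"])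
       (use assms * in \<open>auto simp: sq_integrable_def intro!: AE_I2\<close>)
qed

definition L2_rel :: "(real \<Rightarrow> complex^2) \<Rightarrow> (real \<Rightarrow> complex^2) \<Rightarrow> bool" where
  "L2_rel f g \<longleftrightarrow> sq_integrable f \<and> sq_integrable g \<and> (AE x in unit_leb. f x = g x)"

quotient_type L2 = "real \<Rightarrow> complex^2" / partial: L2_rel
  morphisms rep_L2 abs_L2
proof (rule part_equivpI)
  show "\<exists>f. L2_rel f f"
    by (auto simp: L2_rel_def intro!: sq_integrable_zero)
  show "symp L2_rel"
    by (auto simp: symp_def L2_rel_def elim: AE_mp)
  show "transp L2_rel"
    unfolding transp_def L2_rel_def by (auto elim: AE_mp)
qed

instantiation L2 :: real_vector
begin

lift_definition zero_L2 :: L2 is "\<lambda>_. 0"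
  by (simp add: L2_rel_def sq_integrable_zero)

lift_definition plus_L2 :: "L2 \<Rightarrow> L2 \<Rightarrow> L2" is "\<lambda>f g x. f x + g x"
  by (auto simp: L2_rel_def intro: sq_integrable_add)

lift_definition minus_L2 :: "L2 \<Rightarrow> L2 \<Rightarrow> L2" is "\<lambda>f g x. f x - g x"
  by (auto simp: L2_rel_def intro: sq_integrable_diff)

lift_definition uminus_L2 :: "L2 \<Rightarrow> L2" is "\<lambda>f x. - f x"
  by (auto simp: L2_rel_def intro: sq_integrable_uminus)

lift_definition scaleR_L2 :: "real \<Rightarrow> L2 \<Rightarrow> L2" is "\<lambda>r f x. r *\<^sub>R f x"
  by (auto simp: L2_rel_def intro: sq_integrable_scaleR)

instance
  by standard
    (transfer; auto simp: L2_rel_def algebra_simps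
      intro!: sq_integrable_zero sq_integrable_add sq_integrable_scaleR sq_integrable_uminus
        sq_integrable_diff)+

end

lift_definition scaleC :: "complex \<Rightarrow> L2 \<Rightarrow> L2" (infixr "*\<^sub>C" 75) is "\<lambda>c f x. c *s f x"
  by (auto simp: L2_rel_def intro: sq_integrable_scaleC)

global_interpretation L2: vector_space scaleC
  by standard
    (transfer; auto simp: L2_rel_def vector_add_ldistrib vector_sadd_rdistrib vector_smult_assoc
      intro!: sq_integrable_add sq_integrable_scaleC)+

instantiation L2 :: real_inner
begin

lift_definition inner_L2 :: "L2 \<Rightarrow> L2 \<Rightarrow> real" is "\<lambda>f g. \<integral>x. f x \<bullet> g x \<partial>unit_leb"
  unfolding L2_rel_def by (intro integral_cong_AE) (auto simp: sq_integrable_def)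

definition norm_L2 :: "L2 \<Rightarrow> real" where
  "norm_L2 u = sqrt (u \<bullet> u)"

definition sgn_L2 :: "L2 \<Rightarrow> L2" where
  "sgn_L2 u = u /\<^sub>R norm u"

definition dist_L2 :: "L2 \<Rightarrow> L2 \<Rightarrow> real" where
  "dist_L2 u v = norm (u - v)"

definition uniformity_L2 :: "(L2 \<times> L2) filter" where
  "uniformity_L2 = (INF e\<in>{0<..}. principal {(x, y). dist x y < e})"

definition open_L2 :: "L2 set \<Rightarrow> bool" where
  "open_L2 U \<longleftrightarrow> (\<forall>x\<in>U. eventually (\<lambda>(x', y). x' = x \<longrightarrow> y \<in> U) uniformity)"

instance
proof
  fix u v w :: L2 and r :: real
  show "u \<bullet> v = v \<bullet> u"
    by transfer (simp add: inner_commute)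
  show "(u + v) \<bullet> w = u \<bullet> w + v \<bullet> w"
    by transfer (simp add: L2_rel_def inner_add_left integrable_inner_sq_integrable)
  show "(r *\<^sub>R u) \<bullet> v = r * (u \<bullet> v)"
    by transfer (simp add: L2_rel_def)
  show "0 \<le> u \<bullet> u"
    by transfer simp
  show "u \<bullet> u = 0 \<longleftrightarrow> u = 0"
  proof transfer
    fix f assume f: "L2_rel f f"
    then have "integrable unit_leb (\<lambda>x. f x \<bullet> f x)"
      by (simp add: L2_rel_def integrable_inner_sq_integrable)
    then have "(\<integral>x. f x \<bullet> f x \<partial>unit_leb) = 0 \<longleftrightarrow> (AE x in unit_leb. f x \<bullet> f x = 0)"
      by (intro integral_nonneg_eq_0_iff_AE) auto
    also have "\<dots> \<longleftrightarrow> L2_rel f (\<lambda>_. 0)"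
      using f by (simp add: L2_rel_def sq_integrable_zero)
    finally show "(\<integral>x. f x \<bullet> f x \<partial>unit_leb) = 0 \<longleftrightarrow> L2_rel f (\<lambda>_. 0)" .
  qed
qed (fact norm_L2_def sgn_L2_def dist_L2_def uniformity_L2_def open_L2_def)+

end

lift_definition cinner :: "L2 \<Rightarrow> L2 \<Rightarrow> complex" is
  "\<lambda>f g. \<integral>x. (\<Sum>i\<in>UNIV. f x $ i * cnj (g x $ i)) \<partial>unit_leb"
proof -
  fix f f' g g' :: "real \<Rightarrow> complex^2"
  assume *: "L2_rel f f'" "L2_rel g g'"
  have meas: "(\<lambda>x. h x $ i) \<in> borel_measurable unit_leb"
    if "h \<in> borel_measurable unit_leb" for h :: "real \<Rightarrow> complex^2" and i
    using borel_measurable_continuous_on[OF _ that, of "\<lambda>v. v $ i"]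
    by (simp add: continuous_on_component)
  have [measurable]: "f \<in> borel_measurable unit_leb" "f' \<in> borel_measurable unit_leb"
    "g \<in> borel_measurable unit_leb" "g' \<in> borel_measurable unit_leb"
    using * by (auto simp: L2_rel_def sq_integrable_def)
  note [measurable] = meas[of f] meas[of f'] meas[of g] meas[of g']
  have [measurable]: "cnj \<in> borel_measurable borel"
    by (intro borel_measurable_continuous_onI continuous_intros)
  show "(\<integral>x. (\<Sum>i\<in>UNIV. f x $ i * cnj (g x $ i)) \<partial>unit_leb) =
        (\<integral>x. (\<Sum>i\<in>UNIV. f' x $ i * cnj (g' x $ i)) \<partial>unit_leb)"
  proof (rule integral_cong_AE)
    show "AE x in unit_leb. (\<Sum>i\<in>UNIV. f x $ i * cnj (g x $ i)) =
        (\<Sum>i\<in>UNIV. f' x $ i * cnj (g' x $ i))"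
      using * by (auto simp: L2_rel_def elim!: AE_mp)
  qed measurable
qed


section \<open>Riesz bases\<close>

definition orthonormal_basis :: "L2 set \<Rightarrow> bool" where
  "orthonormal_basis E \<longleftrightarrow>
     (\<forall>u\<in>E. \<forall>v\<in>E. cinner u v = (if u = v then 1 else 0)) \<and> closure (L2.span E) = UNIV"

definition riesz_basis :: "L2 set \<Rightarrow> bool" where
  "riesz_basis S \<longleftrightarrow>
     (\<exists>T T'. Vector_Spaces.linear scaleC scaleC T \<and> homeomorphism UNIV UNIV T T' \<and>
        orthonormal_basis (T ` S))"


section \<open>Root vectors\<close>

text \<open>A (possibly unbounded, not everywhere defined) operator is represented by its graph
  \<open>G\<close>, that is, \<open>(u, v) \<in> G\<close> iff \<open>u\<close> lies in the domain and is mapped to \<open>v\<close>.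
  \<open>power_kernel G \<mu> n\<close> is the kernel of \<open>(G - \<mu>)\<^sup>n\<close>, with the natural domain of the power.\<close>

fun power_kernel :: "(L2 \<times> L2) set \<Rightarrow> complex \<Rightarrow> nat \<Rightarrow> L2 set" where
  "power_kernel G \<mu> 0 = {0}"
| "power_kernel G \<mu> (Suc n) = {u. \<exists>v. (u, v) \<in> G \<and> v - \<mu> *\<^sub>C u \<in> power_kernel G \<mu> n}"

definition root_subspace :: "(L2 \<times> L2) set \<Rightarrow> complex \<Rightarrow> L2 set" where
  "root_subspace G \<mu> = (\<Union>n. power_kernel G \<mu> n)"

text \<open>If \<open>\<mu>\<close> is not an eigenvalue, the root subspace is \<open>{0}\<close> and contributes the empty basis.\<close>

definition root_vectors_system :: "(L2 \<times> L2) set \<Rightarrow> L2 set \<Rightarrow> bool" where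
  "root_vectors_system G S \<longleftrightarrow>
     (\<exists>\<B> :: complex \<Rightarrow> L2 set.
        (\<forall>\<mu>. L2.independent (\<B> \<mu>) \<and> L2.span (\<B> \<mu>) = root_subspace G \<mu> \<and>
             (\<forall>u\<in>\<B> \<mu>. norm u = 1)) \<and>
        S = (\<Union>\<mu>. \<B> \<mu>))"


section \<open>The operator \<open>L\<^bsub>C,D\<^esub>(Q)\<close>\<close>

text \<open>The functions of class \<open>W\<^sup>1\<^sub>1\<close> on \<open>[0,1]\<close>.\<close>

definition abs_continuous_on_unit :: "(real \<Rightarrow> complex^2) \<Rightarrow> bool" where
  "abs_continuous_on_unit y \<longleftrightarrow>
     (\<forall>\<epsilon>>0. \<exists>\<delta>>0. \<forall>P :: (real \<times> real) set.
        finite P \<and> (\<forall>(s, t)\<in>P. 0 \<le> s \<and> s \<le> t \<and> t \<le> 1) \<and>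
        disjoint_family_on (\<lambda>(s, t). {s<..<t}) P \<and> (\<Sum>(s, t)\<in>P. t - s) < \<delta>
        \<longrightarrow> (\<Sum>(s, t)\<in>P. norm (y t - y s)) < \<epsilon>)"

definition B_mat :: "real \<Rightarrow> real \<Rightarrow> complex^2^2" where
  "B_mat b1 b2 = vector [vector [of_real b1, 0], vector [0, of_real b2]]"

definition Q_mat :: "(real \<Rightarrow> complex) \<Rightarrow> (real \<Rightarrow> complex) \<Rightarrow> real \<Rightarrow> complex^2^2" where
  "Q_mat Q12 Q21 x = vector [vector [0, Q12 x], vector [Q21 x, 0]]"

text \<open>The derivative is arbitrary where \<open>y\<close> is not differentiable; for absolutely continuous
  \<open>y\<close> these points form a null set.\<close>

definition diff_expr ::
  "real \<Rightarrow> real \<Rightarrow> (real \<Rightarrow> complex^2^2) \<Rightarrow> (real \<Rightarrow> complex^2) \<Rightarrow> real \<Rightarrow> complex^2" where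
  "diff_expr b1 b2 Q y x =
     (- \<i>) *s (matrix_inv (B_mat b1 b2) *v vector_derivative y (at x within {0..1})) + Q x *v y x"

definition boundary_conds ::
  "complex \<Rightarrow> complex \<Rightarrow> complex \<Rightarrow> complex \<Rightarrow> (real \<Rightarrow> complex^2) \<Rightarrow> bool" where
  "boundary_conds a b c d y \<longleftrightarrow>
     y 0 $ 1 + b * y 0 $ 2 + a * y 1 $ 1 = 0 \<and>
     d * y 0 $ 2 + c * y 1 $ 1 + y 1 $ 2 = 0"

definition L_op ::
  "real \<Rightarrow> real \<Rightarrow> (real \<Rightarrow> complex^2^2) \<Rightarrow> complex \<Rightarrow> complex \<Rightarrow> complex \<Rightarrow> complex
    \<Rightarrow> (L2 \<times> L2) set" where
  "L_op b1 b2 Q a b c d =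
     {(abs_L2 y, abs_L2 (diff_expr b1 b2 Q y)) | y.
        abs_continuous_on_unit y \<and> sq_integrable (diff_expr b1 b2 Q y) \<and>
        boundary_conds a b c d y}"


section \<open>Strictly regular boundary conditions\<close>

definition char_det0 ::
  "real \<Rightarrow> real \<Rightarrow> complex \<Rightarrow> complex \<Rightarrow> complex \<Rightarrow> complex \<Rightarrow> complex \<Rightarrow> complex" where
  "char_det0 b1 b2 a b c d z =
     d + a * exp (\<i> * of_real (b1 + b2) * z) + (a * d - b * c) * exp (\<i> * of_real b1 * z)
       + exp (\<i> * of_real b2 * z)"

text \<open>An enumeration of the zeros of \<open>f\<close>, each repeated according to its multiplicity, with
  \<open>\<bar>z\<^sub>n\<bar> \<rightarrow> \<infinity>\<close> as \<open>\<bar>n\<bar> \<rightarrow> \<infinity>\<close> (the filter \<open>cofinite\<close> on the integers).\<close>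

definition enumerates_zeros :: "(int \<Rightarrow> complex) \<Rightarrow> (complex \<Rightarrow> complex) \<Rightarrow> bool" where
  "enumerates_zeros z f \<longleftrightarrow>
     (\<forall>n. f (z n) = 0) \<and>
     (\<forall>w. f w = 0 \<longrightarrow> finite {n. z n = w} \<and> int (card {n. z n = w}) = zorder f w) \<and>
     filterlim z at_infinity cofinite"

definition asymptotically_separated :: "(int \<Rightarrow> complex) \<Rightarrow> bool" where
  "asymptotically_separated z \<longleftrightarrow>
     (\<exists>\<delta>>0. \<exists>n0::nat. \<forall>j k. j \<noteq> k \<and> \<bar>j\<bar> \<ge> int n0 \<and> \<bar>k\<bar> \<ge> int n0
        \<longrightarrow> cmod (z j - z k) > 2 * \<delta>)"

definition regular_bc :: "complex \<Rightarrow> complex \<Rightarrow> complex \<Rightarrow> complex \<Rightarrow> bool" where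
  "regular_bc a b c d \<longleftrightarrow> a * d - b * c \<noteq> 0"

definition strictly_regular_bc ::
  "real \<Rightarrow> real \<Rightarrow> complex \<Rightarrow> complex \<Rightarrow> complex \<Rightarrow> complex \<Rightarrow> bool" where
  "strictly_regular_bc b1 b2 a b c d \<longleftrightarrow>
     regular_bc a b c d \<and>
     (\<exists>z. enumerates_zeros z (char_det0 b1 b2 a b c d) \<and> asymptotically_separated z)"

end

theory Submission
  imports Defs
begin

text \<open>In a half plane \<open>Im \<lambda> \<ge> -H\<close>, a solution with \<open>|\<lambda>|\<close> large satisfies \<open>y\<^sub>1(x) \<approx> y\<^sub>1(1) exp(-i b\<^sub>1 \<lambda> (1 - x))\<close> and
  \<open>y\<^sub>2(x) \<approx> y\<^sub>2(0) exp(i b\<^sub>2 \<lambda> x)\<close> uniformly in \<open>x\<close>, by a Riemann--Lebesgue lemma; the other half plane follows by reflection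
  \<open>x \<mapsto> 1 - x\<close>. Hence the characteristic determinant is asymptotically \<open>\<Delta>\<^sub>0\<close>, and strict regularity makes the
  far eigenvalues simple, separated and confined to a strip. Their eigenfunctions have a biorthogonal
  family, given by the transposed problem, which is of the same type; the pairing of corresponding normalized
  eigenfunctions stays away from \<open>0\<close>. Both families satisfy a Bessel inequality. If \<open>f\<close> is orthogonal to all root
  vectors, then \<open>\<langle>R(\<lambda>)g, f\<rangle>\<close> is entire and bounded, hence constant, which forces \<open>f = 0\<close>. A complete system
  with these properties is a Riesz basis, finitely many finite-dimensional root subspaces being added separately.\<close>

section \<open>Absolutely continuous functions\<close>

text \<open>With \<open>Q12\<close> and \<open>Q21\<close> merely integrable, no asymptotics with a
  rate are available and eigenvalues are never located individually. Every estimate is an absorption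
  argument with an arbitrarily small error, or a compactness argument in which a translate of the
  leading determinant depends on its centre only through the two numbers \<open>E1 l\<close> and
  \<open>E2 l\<close>. In the upper half plane a solution is controlled by \<open>y 0 $ 2\<close>
  and \<open>y 1 $ 1\<close>, the values at the ends from which the exponentials do not grow. The
  form \<open>pair\<close> is bilinear and crosses the components; this keeps the transposed problem
  within the same theory, with the parameters \<open>- b2\<close>, \<open>- b1\<close> and the same
  potentials. The lower bound for the pairing at two nearby eigenvalues does double duty: at equal
  ones it gives simplicity and the normalization of the dual, at distinct ones it contradicts
  orthogonality and so gives separation. The operator is defined by pointwise derivatives of
  absolutely continuous functions, whereas the analysis uses integral equations (\<open>acd\<close>,
  \<open>solves\<close>); the measure theory at the beginning passes between the two.\<close>

lemma absolutely_integrable_on_unit_iff: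
 fixes f :: "real => 'a::euclidean_space"
 shows "f absolutely_integrable_on {0..1} \<longleftrightarrow> integrable unit_leb f"
 by (simp add: set_integrable_def integrable_restrict_space)

text \<open>For positive \<open>K\<close> this is the radial retraction of the plane onto the closed
  disc of radius \<open>K\<close>.\<close>

definition clamp_norm :: "real => complex => complex" where
 "clamp_norm K z = (K / max K (norm z)) *\<^sub>R z"

lemma clamp_norm_le: "K > 0 ==> norm (clamp_norm K z) <= K" by (auto simp: clamp_norm_def max_def divide_simps)

lemma clamp_norm_le_norm: "K > 0 ==> norm (clamp_norm K z) <= norm z"
 by (auto simp: clamp_norm_def max_def divide_simps mult_left_le_one_le)

lemma clamp_norm_eq: "K > 0 ==> norm z <= K ==> clamp_norm K z = z" by (auto simp: clamp_norm_def max_def)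

lemma continuous_clamp_norm: "K > 0 ==> continuous_on UNIV (clamp_norm K)"
 unfolding clamp_norm_def by (intro continuous_intros) (auto simp: max_def)

text \<open>Two approximations are chained. Truncation at a high level costs little in L1, by
  dominated convergence with majorant \<open>2 * norm (f x)\<close>. A measurable function is an
  almost everywhere limit of continuous functions \<open>h n\<close>; clamping these at the same
  level supplies the majorant \<open>2 * K\<close>, so one of the clamped functions is close to the
  truncation.\<close>

lemma absolutely_integrable_approx_continuous:
 fixes f :: "real => complex"
 assumes f: "f absolutely_integrable_on {0..1}" and "e > 0"
 obtains g where "continuous_on UNIV g" "(\<integral>x. norm (f x - g x) \<partial>unit_leb) < e"
proof -
 have fi: "integrable unit_leb f" using f by (simp add: absolutely_integrable_on_unit_iff)
 then have [measurable]: "f \<in> borel_measurable unit_leb" by simp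
 have [measurable]: "(%x. clamp_norm K (f x)) \<in> borel_measurable unit_leb" if "K > 0" for K
  by (rule borel_measurable_continuous_on[OF continuous_clamp_norm[OF that]]) simp
 have "(%n. \<integral>x. norm (f x - clamp_norm (real (Suc n)) (f x)) \<partial>unit_leb) \<longlonglongrightarrow>
    (\<integral>x. 0 \<partial>unit_leb)"
 proof (rule integral_dominated_convergence[where w = "%x. 2 * norm (f x)"])
  show "integrable unit_leb (%x. 2 * norm (f x))" using fi by simp
  show "AE x in unit_leb. (%n. norm (f x - clamp_norm (real (Suc n)) (f x))) \<longlonglongrightarrow> 0"
  proof (rule AE_I2)
   fix x
   have "eventually (%n. real (Suc n) >= norm (f x)) sequentially" by real_asymp
   then have "eventually (%n. norm (f x - clamp_norm (real (Suc n)) (f x)) = 0) sequentially" by eventually_elim (simp add: clamp_norm_eq)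
   then show "(%n. norm (f x - clamp_norm (real (Suc n)) (f x))) \<longlonglongrightarrow> 0" by (rule tendsto_eventually)
  qed
  show "AE x in unit_leb. norm (norm (f x - clamp_norm (real (Suc n)) (f x))) <= 2 * norm (f x)" for n
  proof (rule AE_I2)
   fix x show "norm (norm (f x - clamp_norm (real (Suc n)) (f x))) <= 2 * norm (f x)"
    using norm_triangle_ineq4[of "f x" "clamp_norm (real (Suc n)) (f x)"]
     clamp_norm_le_norm[of "real (Suc n)" "f x"] by simp
  qed
 qed auto
 then have "eventually (%n. (\<integral>x. norm (f x - clamp_norm (real (Suc n)) (f x)) \<partial>unit_leb) < e/2) sequentially"
  using \<open>e > 0\<close> by (auto dest!: order_tendstoD(2)[where a = "e/2"])
 then obtain n where n: "(\<integral>x. norm (f x - clamp_norm (real (Suc n)) (f x)) \<partial>unit_leb) < e/2"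
  by (auto simp: eventually_sequentially)
 define K where "K = real (Suc n)"
 have K: "K > 0" by (simp add: K_def)
 have "f measurable_on {0..1}" by (subst measurable_on_iff_borel_measurable) auto
 then obtain N h where N: "negligible N" and h: "!!n. continuous_on UNIV (h n)"
  and lim: "!!x. x \<notin> N ==> (%n. h n x) \<longlonglongrightarrow> (if x \<in> {0..1} then f x else 0)"
  unfolding measurable_on_def by auto
 have ch: "continuous_on UNIV (%x. clamp_norm K (h n x))" for n using continuous_on_compose2[OF continuous_clamp_norm[OF K] h] by auto
 have [measurable]: "(%x. clamp_norm K (h n x)) \<in> borel_measurable unit_leb" for n
  using continuous_imp_measurable_on_sets_lebesgue[OF continuous_on_subset[OF ch]] by auto
 have N0: "AE x in unit_leb. x \<notin> N" using N unfolding negligible_iff_null_sets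
  by (subst AE_restrict_space_iff) (auto dest: AE_not_in)
 have "(%n. \<integral>x. norm (clamp_norm K (f x) - clamp_norm K (h n x)) \<partial>unit_leb) \<longlonglongrightarrow>
    (\<integral>x. 0 \<partial>unit_leb)"
 proof (rule integral_dominated_convergence[where w = "%x. 2 * K"])
  show "AE x in unit_leb. (%n. norm (clamp_norm K (f x) - clamp_norm K (h n x))) \<longlonglongrightarrow> 0" using N0 AE_space
  proof eventually_elim
   case (elim x)
   have "(%n. h n x) \<longlonglongrightarrow> f x" using elim lim[of x] by auto
   then have "(%n. clamp_norm K (h n x)) \<longlonglongrightarrow> clamp_norm K (f x)"
    using continuous_clamp_norm[OF K] by (intro isCont_tendsto_compose[of _ "clamp_norm K"])
      (auto simp: continuous_on_eq_continuous_at)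
   then have "(%n. norm (clamp_norm K (f x) - clamp_norm K (h n x))) \<longlonglongrightarrow> norm (clamp_norm K (f x) - clamp_norm K (f x))"
    by (intro tendsto_intros)
   then show ?case by simp
  qed
  show "AE x in unit_leb. norm (norm (clamp_norm K (f x) - clamp_norm K (h n x))) <= 2 * K" for n
  proof (rule AE_I2)
   fix x show "norm (norm (clamp_norm K (f x) - clamp_norm K (h n x))) <= 2 * K"
    using norm_triangle_ineq4[of "clamp_norm K (f x)" "clamp_norm K (h n x)"]
     clamp_norm_le[OF K, of "f x"] clamp_norm_le[OF K, of "h n x"] by simp
  qed
 qed (use K in auto)
 then have "eventually (%n. (\<integral>x. norm (clamp_norm K (f x) - clamp_norm K (h n x)) \<partial>unit_leb) < e/2) sequentially"
  using \<open>e > 0\<close> by (auto dest!: order_tendstoD(2)[where a = "e/2"])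
 then obtain m where m: "(\<integral>x. norm (clamp_norm K (f x) - clamp_norm K (h m x)) \<partial>unit_leb) < e/2"
  by (auto simp: eventually_sequentially)
 let ?g = "%x. clamp_norm K (h m x)"
 have b: "integrable unit_leb (%x. clamp_norm K (u x))"
  if "(%x. clamp_norm K (u x)) \<in> borel_measurable unit_leb" for u :: "real => complex"
  by (rule Bochner_Integration.integrable_bound[where f = "%_. K"]) (use that clamp_norm_le[OF K] K in auto)
 have i1: "integrable unit_leb (%x. norm (f x - clamp_norm K (f x)))" and i2: "integrable unit_leb (%x. norm (clamp_norm K (f x) - ?g x))"
  and i3: "integrable unit_leb (%x. norm (f x - ?g x))"
  using fi b[of f] b[of "h m"] K by auto
 have tri: "norm (u - w) <= norm (u - v) + norm (v - w)" for u v w :: complex using norm_triangle_ineq[of "u - v" "v - w"] by simp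
 have "(\<integral>x. norm (f x - ?g x) \<partial>unit_leb) \<le>
   (\<integral>x. norm (f x - clamp_norm K (f x)) + norm (clamp_norm K (f x) - ?g x) \<partial>unit_leb)"
  by (intro integral_mono i3 Bochner_Integration.integrable_add i1 i2)
    (rule tri)
 also have "\<dots> < e" using n m i1 i2 unfolding K_def[symmetric] by (subst Bochner_Integration.integral_add) auto
 finally show ?thesis using that[of ?g] ch by blast
qed

text \<open>\<open>acd F f\<close>: the function \<open>F\<close> is absolutely continuous on \<open>[0,1]\<close> with derivative \<open>f\<close>, in
  integral form.\<close>

definition acd :: "(real => complex) => (real => complex) => bool" where
 "acd F f \<longleftrightarrow> f absolutely_integrable_on {0..1} \<and>
   (\<forall>x\<in>{0..1}. F x - F 0 = integral {0..x} f)"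

lemma acd_eq: "acd F f ==> x \<in> {0..1} ==> F x = F 0 + integral {0..x} f" unfolding acd_def by (metis add.commute diff_add_cancel)

lemma ai_sub:
 fixes f :: "real => 'a::euclidean_space"
 assumes "f absolutely_integrable_on {0..1}" "0 <= x" "y <= 1"
 shows "f absolutely_integrable_on {x..y}"
 by (rule absolutely_integrable_on_subinterval[OF assms(1)]) (use assms in auto)

lemma io_sub:
 fixes f :: "real => 'a::euclidean_space"
 assumes "f absolutely_integrable_on {0..1}" "0 <= x" "y <= 1"
 shows "f integrable_on {x..y}"
 using ai_sub[OF assms] set_lebesgue_integral_eq_integral(1) by blast

lemma norm_io_sub:
 fixes f :: "real => 'a::euclidean_space"
 assumes "f absolutely_integrable_on {0..1}" "0 <= x" "y <= 1"
 shows "(%x. norm (f x)) integrable_on {x..y}"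
 using ai_sub[OF assms] by (auto simp: absolutely_integrable_on_def)

lemma norm_integral_le:
 fixes f :: "real => 'a::euclidean_space"
 assumes "f absolutely_integrable_on {0..1}" "0 <= x" "y <= 1"
 shows "norm (integral {x..y} f) <= integral {x..y} (%x. norm (f x))"
 by (rule integral_norm_bound_integral) (use io_sub norm_io_sub assms in auto)

lemma nn_integral_subset_le:
 fixes f :: "real => real"
 assumes "f absolutely_integrable_on {0..1}" "0 <= x" "y <= 1" "!!t. t \<in> {0..1} ==> f t >= 0"
 shows "integral {x..y} f <= integral {0..1} f"
 by (rule integral_subset_le) (use io_sub[OF assms(1-3)] io_sub[OF assms(1), of 0 1] assms in auto)

lemma integral_norm_subset_le:
 fixes f :: "real => 'a::euclidean_space"
 assumes "f absolutely_integrable_on {0..1}" "0 <= x" "y <= 1"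
 shows "integral {x..y} (%x. norm (f x)) <= integral {0..1} (%x. norm (f x))"
 by (rule nn_integral_subset_le) (use assms absolutely_integrable_norm[OF assms(1)] in \<open>auto simp: o_def\<close>)

lemma acd_ai: "acd F f ==> f absolutely_integrable_on {0..1}" by (simp add: acd_def)

lemma acd_diff_eq:
 assumes "acd F f" "0 <= x" "x <= y" "y <= 1"
 shows "F y - F x = integral {x..y} f"
proof -
 have "integral {0..x} f + integral {x..y} f = integral {0..y} f" by (rule Henstock_Kurzweil_Integration.integral_combine)
    (use assms io_sub[OF acd_ai[OF assms(1)], of 0 y] in auto)
 moreover have "F x = F 0 + integral {0..x} f" "F y = F 0 + integral {0..y} f" by (rule acd_eq[OF assms(1)]; use assms in simp)+
 ultimately show ?thesis by (metis add_diff_cancel_left add_diff_cancel_left' add.assoc)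
qed

lemma acd_continuous:
 assumes "acd F f" shows "continuous_on {0..1} F"
proof -
 have "continuous_on {0..1} (%x. F 0 + integral {0..x} f)" by (intro continuous_intros indefinite_integral_continuous_1)
   (use io_sub[OF acd_ai[OF assms], of 0 1] in auto)
 moreover have "continuous_on {0..1} F \<longleftrightarrow> continuous_on {0..1} (%x. F 0 + integral {0..x} f)"
  by (rule continuous_on_cong[OF refl acd_eq[OF assms]])
 ultimately show ?thesis by simp
qed

lemma acd_bounded:
 assumes "acd F f" obtains M where "M >= 0" "!!x. x \<in> {0..1} ==> norm (F x) <= M"
proof -
 have "compact (F ` {0..1})" by (intro compact_continuous_image acd_continuous[OF assms]) auto
 then obtain B where "\<forall>x\<in>F ` {0..1}. norm x <= B" using compact_imp_bounded bounded_iff by blast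
 then show ?thesis using that[of "max B 0"] by force
qed

lemma ai_bounded_mult:
 fixes f :: "real => complex"
 assumes "f absolutely_integrable_on {0..1}" "h \<in> borel_measurable unit_leb"
  "!!x. x \<in> {0..1} ==> norm (h x) <= M"
 shows "(%x. h x * f x) absolutely_integrable_on {0..1}"
 unfolding absolutely_integrable_on_unit_iff
proof (rule Bochner_Integration.integrable_bound[where f = "%x. M * norm (f x)"])
 show "integrable unit_leb (%x. M * norm (f x))" using assms(1) by (auto simp: absolutely_integrable_on_unit_iff)
 have "f \<in> borel_measurable unit_leb" using assms(1) by (auto simp: absolutely_integrable_on_unit_iff)
 then show "(%x. h x * f x) \<in> borel_measurable unit_leb" using assms(2) by simp
 show "AE x in unit_leb. norm (h x * f x) <= norm (M * norm (f x))"
  using assms(3) by (intro AE_I2) (auto simp: norm_mult intro!: mult_right_mono order_trans[OF _ abs_ge_self])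
qed

lemma continuous_unit_measurable:
 fixes h :: "real => 'a::euclidean_space"
 shows "continuous_on {0..1} h ==> h \<in> borel_measurable unit_leb"
 by (rule continuous_imp_measurable_on_sets_lebesgue) auto

lemma ai_cont_mult:
 fixes f :: "real => complex"
 assumes "f absolutely_integrable_on {0..1}" "continuous_on {0..1} h"
 shows "(%x. h x * f x) absolutely_integrable_on {0..1}"
proof -
 have "compact (h ` {0..1})" by (intro compact_continuous_image assms) auto
 then obtain B where "\<forall>x\<in>h ` {0..1}. norm x <= B" using compact_imp_bounded bounded_iff by blast
 then show ?thesis by (intro ai_bounded_mult[OF assms(1) continuous_unit_measurable[OF assms(2)], of B]) auto
qed

lemma ai_cont:
 fixes h :: "real => complex"
 shows "continuous_on {0..1} h ==> h absolutely_integrable_on {0..1}"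
 by (rule absolutely_integrable_continuous_real)

lemma acd_cong:
 assumes "acd F f" "!!x. x \<in> {0..1} ==> F x = G x" "!!x. x \<in> {0..1} ==> f x = g x"
 shows "acd G g"
proof -
 have "integral {0..x} f = integral {0..x} g" if "x \<in> {0..1}" for x by (rule integral_cong) (use that assms in auto)
 moreover have "g absolutely_integrable_on {0..1}"
  using acd_ai[OF assms(1)] set_integrable_cong[OF refl refl, of "{0..1}" f g lebesgue] assms(3) by simp
 ultimately show ?thesis using assms by (simp add: acd_def)
qed

lemma acd_of_C1:
 assumes "!!x. x \<in> {0..1} ==> (F has_vector_derivative f x) (at x within {0..1})"
  "continuous_on {0..1} f"
 shows "acd F f"
 unfolding acd_def
proof (intro conjI ballI)
 show "f absolutely_integrable_on {0..1}" using assms(2) by (rule ai_cont)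
 fix x :: real assume x: "x \<in> {0..1}"
 have "(f has_integral (F x - F 0)) {0..x}" by (rule fundamental_theorem_of_calculus)
    (use x in \<open>auto intro!: has_vector_derivative_within_subset[OF assms(1)]\<close>)
 then show "F x - F 0 = integral {0..x} f" by (simp add: integral_unique)
qed

lemma acd_indef: "f absolutely_integrable_on {0..1} ==> acd (%x. c + integral {0..x} f) f" by (auto simp: acd_def)

lemma acd_const: "acd (%x. c) (%x. 0)" by (rule acd_of_C1) auto

lemma acd_add: "acd F f ==> acd G g ==> acd (%x. F x + G x) (%x. f x + g x)"
 by (auto simp: acd_def set_integral_add io_sub integral_add[OF io_sub io_sub] add_diff_add)

lemma acd_cmult: "acd F f ==> acd (%x. c * F x) (%x. c * f x)" by (auto simp: acd_def simp flip: right_diff_distrib)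

lemma acd_diff: "acd F f ==> acd G g ==> acd (%x. F x - G x) (%x. f x - g x)"
 using acd_add[of F f "%x. (-1) * G x" "%x. (-1) * g x"] acd_cmult[of G g "-1"] by simp

lemma integral_norm_unit:
 fixes f :: "real => complex"
 assumes "f absolutely_integrable_on {0..1}"
 shows "(\<integral>x. norm (f x) \<partial>unit_leb) = integral {0..1} (%x. norm (f x))"
 by (rule lebesgue_integral_eq_integral) (use assms in \<open>auto simp: absolutely_integrable_on_unit_iff\<close>)

lemma ai_of_real: "D absolutely_integrable_on {0..1} ==> (%x. complex_of_real (D x)) absolutely_integrable_on {0..1}"
 for D :: "real => real"
 by (simp add: absolutely_integrable_on_unit_iff)

lemma integral_of_real:
 fixes D :: "real => real"
 assumes "D absolutely_integrable_on {0..1}" "x \<in> {0..1}"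
 shows "integral {0..x} (%x. complex_of_real (D x)) = complex_of_real (integral {0..x} D)"
 using integral_linear[OF io_sub[OF assms(1), of 0 x] bounded_linear_of_real[where 'a = complex]] assms(2)
 by (simp add: o_def)

section \<open>Lebesgue's differentiation theorem on the unit interval\<close>

text \<open>The weak (1,1) estimate for the Hardy-Littlewood maximal function, stated without that
  function. The exceptional centres are enclosed in a measurable \<open>G\<close>: Vitali's covering
  lemma selects disjoint balls whose fivefold enlargements cover all of them. The constant 10 is the
  length of such an enlargement per unit of radius.\<close>

lemma weak_type_maximal:
 fixes h :: "real => real"
 assumes h: "integrable lebesgue h" "!!x. h x >= 0" and alp: "alp > 0"
 shows "\<exists>G\<in>lmeasurable. measure lebesgue G <= 10 / alp * (\<integral>x. h x \<partial>lebesgue) \<and>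
  (\<forall>x r. r > 0 --> (LINT t:ball x r|lebesgue. h t) > alp * r --> x \<in> G)"
proof -
 define E where "E = {x. \<exists>r>0. (LINT t:ball x r|lebesgue. h t) > alp * r}"
 define I where "I = (\<integral>x. h x \<partial>lebesgue)"
 obtain r where r: "!!x. x \<in> E ==> r x > 0" "!!x. x \<in> E ==> (LINT t:ball x (r x)|lebesgue. h t) > alp * r x"
  using bchoice[of E "%x r. r > 0 \<and> (LINT t:ball x r|lebesgue. h t) > alp * r"] unfolding E_def by auto
 have si: "set_integrable lebesgue A h" if "A \<in> sets lebesgue" for A
  unfolding set_integrable_def using h(1) that by (intro integrable_mult_indicator)
 have le_I: "(LINT t:A|lebesgue. h t) <= I" if "A \<in> sets lebesgue" for A unfolding I_def set_lebesgue_integral_def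
  by (rule integral_mono[OF si[OF that, unfolded set_integrable_def] h(1)]) (auto simp: indicator_def h(2))
 \<comment> \<open>Vitali's lemma needs bounded radii; the total mass \<open>I\<close> bounds
   them.\<close>
 have rB: "0 < r x \<and> r x <= I / alp" if "x \<in> E" for x using r[OF that] le_I[of "ball x (r x)"] alp by (auto simp: field_simps)
 have "E \<subseteq> (\<Union>x\<in>E. ball x (r x))" using r(1) by auto
 from Vitali_covering_lemma_balls[where S = E and K = E and a = "%x. x" and r = r, OF this rB]
 obtain C where C: "countable C" "C \<subseteq> E"
   "pairwise (%i j. disjnt (ball i (r i)) (ball j (r j))) C"
   "E \<subseteq> (\<Union>i\<in>C. ball i (5 * r i))" by auto
 define G where "G = (\<Union>i\<in>C. ball i (5 * r i))"
 have bd: "measure lebesgue (\<Union>i\<in>F. ball i (5 * r i)) <= 10 / alp * I" if F: "F \<subseteq> C" "finite F" for F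
 proof -
  have "measure lebesgue (\<Union>i\<in>F. ball i (5 * r i)) <= (\<Sum>i\<in>F. measure lebesgue (ball i (5 * r i)))"
   by (rule measure_UNION_le) (use F in auto)
  also have "\<dots> = (\<Sum>i\<in>F. 10 * r i)"
  proof (rule sum.cong)
   fix i assume "i \<in> F"
   then have "r i > 0" using F C(2) r(1) by blast
   then show "measure lebesgue (ball i (5 * r i)) = 10 * r i" by (simp add: ball_eq_greaterThanLessThan measure_lborel_Ioo)
  qed simp
  also have "\<dots> <= (\<Sum>i\<in>F. 10 / alp * (LINT t:ball i (r i)|lebesgue. h t))"
   by (rule sum_mono) (use F C r(2) alp in \<open>auto simp: field_simps intro!: less_imp_le\<close>)
  also have "\<dots> = 10 / alp * (LINT t:(\<Union>i\<in>F. ball i (r i))|lebesgue. h t)" by (subst set_integral_finite_Union)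
     (use F C(3) si in \<open>auto simp: sum_distrib_left disjoint_family_on_def pairwise_def disjnt_def\<close>)
  also have "\<dots> <= 10 / alp * I" by (intro mult_left_mono le_I) (use alp F in auto)
  finally show ?thesis .
 qed
 show ?thesis
 proof (intro bexI[of _ G] conjI allI impI)
  show "G \<in> lmeasurable" unfolding G_def by (rule fmeasurable_UN_bound[OF C(1) _ bd]) auto
  show "measure lebesgue G <= 10 / alp * (\<integral>x. h x \<partial>lebesgue)" unfolding G_def I_def[symmetric]
   by (rule measure_UN_bound[OF C(1) _ bd]) auto
  fix x r assume "r > (0::real)" "(LINT t:ball x r|lebesgue. h t) > alp * r"
  then have "x \<in> E" by (auto simp: E_def)
  then show "x \<in> G" using C(4) unfolding G_def by blast
 qed
qed

lemma superlevel_measure_le: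
 fixes h :: "real => real"
 assumes h: "integrable lebesgue h" "!!x. h x >= 0" and alp: "alp > 0"
 shows "{x. h x >= alp} \<in> lmeasurable" "measure lebesgue {x. h x >= alp} <= 1 / alp * (\<integral>x. h x \<partial>lebesgue)"
proof -
 have "{x\<in>space lebesgue. h x >= alp} \<in> sets lebesgue" using h(1) by measurable
 moreover have "emeasure lebesgue {x\<in>space lebesgue. h x >= alp} < \<infinity>"
  using integral_Markov_inequality[OF h(1) _ alp] h(2) by (auto intro: le_less_trans)
 ultimately show "{x. h x >= alp} \<in> lmeasurable" by (intro fmeasurableI) simp_all
 show "measure lebesgue {x. h x >= alp} <= 1 / alp * (\<integral>x. h x \<partial>lebesgue)"
  using integral_Markov_inequality_measure[OF h(1) sets.empty_sets _ alp] h(2) by simp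
qed

text \<open>The increments of \<open>F\<close> are compared with those of a primitive of a
  continuous \<open>g\<close> close to \<open>f\<close> in L1. Outside a set of measure at most
  \<open>ep\<close>, the mass of \<open>f - g\<close> on a neighbouring interval costs
  \<open>2 * alp\<close> per unit length, the oscillation of \<open>g\<close> costs
  \<open>alp\<close> and the difference \<open>g x - f x\<close> costs \<open>alp\<close>; this is
  the factor 4 in \<open>bad\<close>. As \<open>ep\<close> is arbitrary, \<open>bad alp\<close> is a
  null set.\<close>

lemma lebesgue_differentiation:
 assumes F: "acd F f"
 shows "AE x in unit_leb. (F has_vector_derivative f x) (at x within {0..1})"
proof -
 have fa: "f absolutely_integrable_on {0..1}" using F by (rule acd_ai)
 define bad where "bad alp = {x\<in>{0..1}. \<not> (\<forall>\<^sub>F y in at x within {0..1}. norm (F y - F x - (y - x) *\<^sub>R f x) <= 4 * alp * norm (y - x))}" for alp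
 have neg: "negligible (bad alp)" if alp: "alp > 0" for alp unfolding negligible_outer_le
 proof (intro allI impI)
  fix ep :: real assume ep: "ep > 0"
  \<comment> \<open>11 = 10 + 1 adds the constants of the maximal estimate and of Chebyshev's
    inequality for the level set of \<open>h\<close>.\<close>
  define eta where "eta = ep * alp / 11"
  have eta: "eta > 0" using ep alp by (simp add: eta_def)
  obtain g where g: "continuous_on UNIV g" "(\<integral>x. norm (f x - g x) \<partial>unit_leb) < eta"
   by (rule absolutely_integrable_approx_continuous[OF fa eta])
  have ga: "g absolutely_integrable_on {0..1}" by (intro ai_cont continuous_on_subset[OF g(1)]) auto
  have da: "(%x. f x - g x) absolutely_integrable_on {0..1}" by (intro set_integral_diff fa ga)
  define h where "h x = indicator {0..1} x *\<^sub>R norm (f x - g x)" for x :: real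
  have hi: "integrable lebesgue h" using absolutely_integrable_norm[OF da] unfolding h_def set_integrable_def o_def .
  have h0: "h x >= 0" for x by (simp add: h_def)
  have hI: "(\<integral>x. h x \<partial>lebesgue) < eta" using g(2) by (subst (asm) integral_restrict_space) (auto simp: h_def)
  obtain G where G: "G \<in> lmeasurable" "measure lebesgue G <= 10 / alp * (\<integral>x. h x \<partial>lebesgue)"
   "!!x r. r > 0 ==> (LINT t:ball x r|lebesgue. h t) > alp * r ==> x \<in> G"
   using weak_type_maximal[OF hi h0 alp] by auto
  let ?G2 = "{x. h x >= alp}"
  note G2 = superlevel_measure_le[OF hi h0 alp]
  have "measure lebesgue (G \<union> ?G2) <= 11 / alp * (\<integral>x. h x \<partial>lebesgue)"
  proof -
   have "measure lebesgue (G \<union> ?G2) <= measure lebesgue G + measure lebesgue ?G2" using G(1) G2(1) by (intro measure_Un_le) auto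
   also have "\<dots> <= 10 / alp * (\<integral>x. h x \<partial>lebesgue) + 1 / alp * (\<integral>x. h x \<partial>lebesgue)"
    using G(2) G2(2) by (rule add_mono)
   also have "\<dots> = 11 / alp * (\<integral>x. h x \<partial>lebesgue)" by (simp add: field_simps)
   finally show ?thesis .
  qed
  also have "\<dots> <= 11 / alp * eta" using hI alp by (intro mult_left_mono) auto
  also have "\<dots> = ep" using alp by (simp add: eta_def)
  finally have mT: "measure lebesgue (G \<union> ?G2) <= ep" .
  have "bad alp \<subseteq> G \<union> ?G2"
  proof (rule ccontr)
   assume "\<not> ?thesis"
   then obtain x where "x \<in> bad alp" "x \<notin> G" "x \<notin> ?G2" by blast
   then have x: "x \<in> {0..1}" "x \<notin> G" "h x <= alp"
     and nx: "\<not> (\<forall>\<^sub>F y in at x within {0..1}. norm (F y - F x - (y - x) *\<^sub>R f x) <= 4 * alp * norm (y - x))"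
    by (auto simp: bad_def not_less)
   have "isCont g x" using g(1) by (simp add: continuous_on_eq_continuous_at)
   then obtain dlt where dlt: "dlt > 0" "!!t. dist t x < dlt ==> dist (g t) (g x) < alp"
    unfolding continuous_at_eps_delta using alp by metis
   have fg: "norm (g x - f x) <= alp" using x by (simp add: h_def norm_minus_commute)
   have key: "norm (F v - F u - (v - u) *\<^sub>R f x) <= 4 * alp * (v - u)"
    if uv: "0 <= u" "u < v" "v <= 1" "v - u < dlt" "x = u \<or> x = v" for u v
   proof -
    have io: "f integrable_on {u..v}" "g integrable_on {u..v}" "(%x. f x - g x) integrable_on {u..v}"
     using io_sub[OF fa] io_sub[OF ga] io_sub[OF da] uv by auto
    have "F v - F u = integral {u..v} f" using acd_diff_eq[OF F] uv by auto
    moreover have "integral {u..v} (%t. g t - g x) = integral {u..v} g - (v - u) *\<^sub>R g x"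
     using integral_diff[OF io(2) integrable_const_ivl[of "g x" u v]] uv by simp
    ultimately have eq: "F v - F u - (v - u) *\<^sub>R f x = integral {u..v} (%t. f t - g t) + integral {u..v} (%t. g t - g x) + (v - u) *\<^sub>R (g x - f x)"
     using io uv by (simp add: integral_diff algebra_simps)
    have "norm (integral {u..v} (%t. f t - g t)) <= 2 * alp * (v - u)"
    proof -
     have "norm (integral {u..v} (%t. f t - g t)) <= integral {u..v} (%t. norm (f t - g t))"
      by (rule norm_integral_le[OF da]) (use uv in auto)
     also have "\<dots> = integral {u..v} h" by (rule integral_cong) (use uv in \<open>auto simp: h_def\<close>)
     also have "\<dots> = (LINT t:{u..v}|lebesgue. h t)"
     proof (rule set_lebesgue_integral_eq_integral(2)[symmetric])
      show "set_integrable lebesgue {u..v} h" unfolding set_integrable_def by (rule integrable_mult_indicator[OF _ hi]) auto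
     qed
     \<comment> \<open>Since \<open>x\<close> is an end point of the closed interval, the open ball
       of twice its length contains it.\<close>
     also have "\<dots> <= (LINT t:ball x (2 * (v - u))|lebesgue. h t)" unfolding set_lebesgue_integral_def
      by (rule integral_mono[OF integrable_mult_indicator[OF _ hi] integrable_mult_indicator[OF _ hi]])
        (use uv h0 in \<open>auto simp: indicator_def dist_real_def\<close>)
     also have "\<dots> <= alp * (2 * (v - u))" using G(3)[of "2 * (v - u)" x] x(2) uv by force
     finally show ?thesis by (simp add: mult.commute mult.left_commute)
    qed
    moreover have "norm (integral {u..v} (%t. g t - g x)) <= alp * (v - u)"
    proof -
     have "norm (g t - g x) <= alp" if "t \<in> {u..v}" for t using dlt(2)[of t] that uv by (auto simp: dist_norm)
     moreover have "continuous_on {u..v} (%t. g t - g x)"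
      by (intro continuous_on_diff continuous_on_const continuous_on_subset[OF g(1)] subset_UNIV)
     ultimately have "norm (integral {u..v} (%t. g t - g x)) <= alp * (v - u)" using uv by (intro integral_bound) auto
     then show ?thesis .
    qed
    moreover have "norm ((v - u) *\<^sub>R (g x - f x)) <= alp * (v - u)" using fg uv by (simp add: mult.commute mult_left_mono)
    ultimately show ?thesis unfolding eq
     using norm_triangle_ineq[of "integral {u..v} (%t. f t - g t) + integral {u..v} (%t. g t - g x)" "(v - u) *\<^sub>R (g x - f x)"]
      norm_triangle_ineq[of "integral {u..v} (%t. f t - g t)" "integral {u..v} (%t. g t - g x)"]
     by linarith
   qed
   have "\<forall>\<^sub>F y in at x within {0..1}. norm (F y - F x - (y - x) *\<^sub>R f x) <= 4 * alp * norm (y - x)"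
    unfolding eventually_at
   proof (intro exI[of _ dlt] conjI ballI impI dlt(1))
    fix y :: real assume y: "y \<in> {0..1}" "y ~= x \<and> dist y x < dlt"
    show "norm (F y - F x - (y - x) *\<^sub>R f x) <= 4 * alp * norm (y - x)"
    proof (cases "x < y")
     case True
     then show ?thesis using key[of x y] x y by (auto simp: dist_real_def)
    next
     case False
     have "norm (F y - F x - (y - x) *\<^sub>R f x) = norm (F x - F y - (x - y) *\<^sub>R f x)"
      by (subst norm_minus_commute) (simp add: algebra_simps)
     then show ?thesis using False key[of y x] x y by (auto simp: dist_real_def)
    qed
   qed
   then show False using nx by simp
  qed
  then show "\<exists>T. bad alp \<subseteq> T \<and> T \<in> lmeasurable \<and> measure lebesgue T <= ep"
   using mT G(1) G2(1) by (intro exI[of _ "G \<union> ?G2"]) auto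
 qed
 have "negligible (\<Union>n. bad (1 / real (Suc n)))" by (rule negligible_countable_Union) (auto intro!: neg)
 then have "AE x in lebesgue. x \<notin> (\<Union>n. bad (1 / real (Suc n)))" unfolding negligible_iff_null_sets by (rule AE_not_in)
 then have "AE x in unit_leb. x \<notin> (\<Union>n. bad (1 / real (Suc n)))" by (subst AE_restrict_space_iff) auto
 then show ?thesis using AE_space
 proof eventually_elim
  case (elim x)
  then have x: "x \<in> {0..1}" and nb: "!!n. x \<notin> bad (1 / real (Suc n))" by auto
  show ?case unfolding has_vector_derivative_def has_derivative_within_alt2
  proof (intro conjI allI impI)
   show "bounded_linear (%t. t *\<^sub>R f x)" by (rule bounded_linear_scaleR_left)
   fix e :: real assume e: "e > 0"
   then obtain n where n: "1 / real (Suc n) < e / 4" using nat_approx_posE[of "e/4"] by auto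
   have "\<forall>\<^sub>F y in at x within {0..1}. norm (F y - F x - (y - x) *\<^sub>R f x) <= 4 * (1 / real (Suc n)) * norm (y - x)"
    using nb[of n] x unfolding bad_def by blast
   then show "\<forall>\<^sub>F y in at x within {0..1}. norm (F y - F x - (y - x) *\<^sub>R f x) <= e * norm (y - x)"
   proof eventually_elim
    case (elim y)
    have "4 * (1 / real (Suc n)) * norm (y - x) <= e * norm (y - x)" using n by (intro mult_right_mono) auto
    with elim show ?case by linarith
   qed
  qed
 qed
qed

lemma acd_deriv_cong_AE:
 assumes "acd F f" "AE x in unit_leb. f x = g x"
 shows "acd F g"
proof -
 have "AE x in lebesgue. x \<in> {0..1} --> f x = g x" using assms(2) by (subst (asm) AE_restrict_space_iff) auto
 then obtain N where N: "negligible N" "{x. \<not> (x \<in> {0..1} --> f x = g x)} \<subseteq> N"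
  unfolding eventually_ae_filter by (auto simp: negligible_iff_null_sets)
 show ?thesis unfolding acd_def
 proof (intro conjI ballI)
  show "g absolutely_integrable_on {0..1}" by (rule absolutely_integrable_spike[OF acd_ai[OF assms(1)] N(1)]) (use N(2) in auto)
  fix x :: real assume x: "x \<in> {0..1}"
  have "F x - F 0 = integral {0..x} f" using assms(1) x by (simp add: acd_def)
  also have "\<dots> = integral {0..x} g" by (rule integral_spike[OF N(1)]) (use N(2) x in auto)
  finally show "F x - F 0 = integral {0..x} g" .
 qed
qed

section \<open>Equivalence of the epsilon-delta form and the integral form of absolute
  continuity\<close>

definition interval_family :: "real => real => (real \<times> real) set => bool" where
 "interval_family s t P \<longleftrightarrow> finite P \<and> (\<forall>(u, v)\<in>P. s <= u \<and> u <= v \<and> v <= t) \<and>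
   disjoint_family_on (%(s, t). {s<..<t}) P"

definition vsum :: "(real => 'a::real_normed_vector) => (real \<times> real) set => real" where
 "vsum y P = (\<Sum>(u, v)\<in>P. norm (y v - y u))"

definition abs_cont :: "(real => 'a::real_normed_vector) => bool" where
 "abs_cont y \<longleftrightarrow> (\<forall>ep>0. \<exists>dlt>0. \<forall>P. interval_family 0 1 P \<and> (\<Sum>(s, t)\<in>P. t - s) < dlt --> vsum y P < ep)"

lemma vsum_real: "vsum y P = (\<Sum>(u, v)\<in>P. \<bar>y v - y u\<bar>)" for y :: "real => real" by (simp add: vsum_def)

text \<open>A comparison principle that covers components of vectors, real and imaginary parts,
  differences and products alike: it suffices to control the increments of \<open>w\<close> by those
  of \<open>y\<close> and \<open>z\<close>.\<close>

lemma abs_cont_le: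
 assumes y: "abs_cont y" and z: "abs_cont z"
  and le: "!!s t. s \<in> {0..1} ==> t \<in> {0..1} ==> norm (w t - w s) <= M * (norm (y t - y s) + norm (z t - z s))"
 shows "abs_cont w"
 unfolding abs_cont_def
proof (intro allI impI)
 fix ep :: real assume "ep > 0"
 define K where "K = \<bar>M\<bar> + 1"
 have K: "K > 0" "M <= K" by (auto simp: K_def)
 have e: "ep / K / 2 > 0" using \<open>ep > 0\<close> K by simp
 obtain d1 where d1: "d1 > 0" "!!P. interval_family 0 1 P ==> (\<Sum>(s, t)\<in>P. t - s) < d1 ==> vsum y P < ep / K / 2"
  using y e unfolding abs_cont_def by meson
 obtain d2 where d2: "d2 > 0" "!!P. interval_family 0 1 P ==> (\<Sum>(s, t)\<in>P. t - s) < d2 ==> vsum z P < ep / K / 2"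
  using z e unfolding abs_cont_def by meson
 show "\<exists>dlt>0. \<forall>P. interval_family 0 1 P \<and> (\<Sum>(s, t)\<in>P. t - s) < dlt --> vsum w P < ep"
 proof (intro exI[of _ "min d1 d2"] conjI allI impI)
  fix P assume P: "interval_family 0 1 P \<and> (\<Sum>(s, t)\<in>P. t - s) < min d1 d2"
  have "vsum w P <= K * (vsum y P + vsum z P)" unfolding vsum_def sum.distrib[symmetric] sum_distrib_left
  proof (rule sum_mono, clarify)
   fix s t assume "(s, t) \<in> P"
   then have "s \<in> {0..1}" "t \<in> {0..1}" using P by (auto simp: interval_family_def)
   from order_trans[OF le[OF this] mult_right_mono[OF K(2)]]
   show "norm (w t - w s) <= K * (norm (y t - y s) + norm (z t - z s))" by simp
  qed
  also have "\<dots> < K * (ep / K / 2 + ep / K / 2)"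
   using P d1(2)[of P] d2(2)[of P] K(1) by (intro mult_strict_left_mono add_strict_mono) auto
  finally show "vsum w P < ep" using K(1) by simp
 qed (use d1 d2 in auto)
qed

lemma vsum_neutral: "(!!u v. (u, v) \<in> P ==> u = v) ==> vsum y P = 0" unfolding vsum_def by (rule sum.neutral) (auto split: prod.splits)

lemma interval_familyD:
 assumes "interval_family s t P" "(u, v) \<in> P" shows "s <= u" "u <= v" "v <= t"
 using assms by (auto simp: interval_family_def)

lemma interval_family_disjoint:
 assumes "interval_family s t P" "(u, v) \<in> P" "(u', v') \<in> P" "u < x" "x < v" "u' < x" "x < v'"
 shows "(u, v) = (u', v')"
proof (rule ccontr)
 assume "(u, v) ~= (u', v')"
 then have "{u<..<v} \<inter> {u'<..<v'} = {}" using assms unfolding interval_family_def disjoint_family_on_def by fastforce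
 then show False using assms by auto
qed

lemma interval_familyI:
 assumes "finite P" "!!u v. (u, v) \<in> P ==> s <= u \<and> u <= v \<and> v <= t"
  "!!u v u' v' x. (u, v) \<in> P ==> (u', v') \<in> P ==> u < x ==> x < v ==> u' < x ==> x < v' ==> (u, v) = (u', v')"
 shows "interval_family s t P"
 unfolding interval_family_def disjoint_family_on_def
proof (intro conjI ballI impI)
 fix p q assume pq: "p \<in> P" "q \<in> P" "p ~= q"
 obtain u v u' v' where "p = (u, v)" "q = (u', v')" by (cases p, cases q)
 then show "(case p of (s, t) => {s<..<t}) \<inter> (case q of (s, t) => {s<..<t}) = {}" using assms(3)[of u v u' v'] pq by fastforce
qed (use assms in auto)

lemma interval_family_length_le:
 assumes P: "interval_family s t P" and U: "U \<in> lmeasurable" "!!u v. (u, v) \<in> P ==> {u<..<v} \<subseteq> U"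
 shows "(\<Sum>(u, v)\<in>P. v - u) <= measure lebesgue U"
proof -
 have fin: "finite P" using P by (simp add: interval_family_def)
 have "(\<Sum>(u, v)\<in>P. v - u) = (\<Sum>p\<in>P. measure lebesgue (case p of (u, v) => {u<..<v}))"
  by (rule sum.cong) (use interval_familyD[OF P] in \<open>auto simp: measure_lborel_Ioo\<close>)
 also have "\<dots> = measure lebesgue (\<Union>p\<in>P. (case p of (u, v) => {u<..<v}))" by (rule measure_finite_Union[symmetric])
    (use P in \<open>auto simp: interval_family_def split: prod.splits\<close>)
 also have "\<dots> <= measure lebesgue U"
  by (rule measure_mono_fmeasurable[OF _ _ U(1)]) (use U(2) fin in \<open>auto split: prod.splits\<close>)
 finally show ?thesis .
qed

lemma interval_family_length_le_diff:
 assumes P: "interval_family s t P" and "s <= t"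
 shows "(\<Sum>(u, v)\<in>P. v - u) <= t - s"
proof -
 have "{u<..<v} \<subseteq> {s..t}" if "(u, v) \<in> P" for u v using interval_familyD[OF P that] by auto
 then show ?thesis using interval_family_length_le[OF P, of "{s..t}"] assms(2) by simp
qed

text \<open>Every interval is clipped at \<open>m\<close> with \<open>min\<close> and with
  \<open>max\<close>; one that straddles \<open>m\<close> is cut in two, and the triangle inequality
  applies.\<close>

lemma interval_family_split:
 fixes y :: "real => real"
 assumes P: "interval_family s t P" and m: "s <= m" "m <= t"
 shows "\<exists>P1 P2. interval_family s m P1 \<and> interval_family m t P2 \<and> vsum y P <= vsum y P1 + vsum y P2"
proof -
 have fin: "finite P" using P by (simp add: interval_family_def)
 define h1 where "h1 = (%(u, v). (min u m, min v m))"
 define h2 where "h2 = (%(u, v). (max u m, max v m))"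
 have f1: "interval_family s m (h1 ` P)"
 proof (rule interval_familyI)
  show "finite (h1 ` P)" using fin by simp
  fix u v assume "(u, v) \<in> h1 ` P"
  then obtain a b where ab: "(a, b) \<in> P" "u = min a m" "v = min b m" by (auto simp: h1_def)
  show "s <= u \<and> u <= v \<and> v <= m" using interval_familyD[OF P ab(1)] m unfolding ab by auto
 next
  fix u v u' v' x assume "(u, v) \<in> h1 ` P" "(u', v') \<in> h1 ` P" and x: "u < x" "x < v" "u' < x" "x < v'"
  then obtain a b a' b' where *: "(a, b) \<in> P" "(a', b') \<in> P" "(u, v) = h1 (a, b)" "(u', v') = h1 (a', b')" by auto
  with x have "a < x" "x < b" "a' < x" "x < b'" by (auto simp: h1_def min_def split: if_splits)
  from interval_family_disjoint[OF P *(1,2) this] * show "(u, v) = (u', v')" by simp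
 qed
 have f2: "interval_family m t (h2 ` P)"
 proof (rule interval_familyI)
  show "finite (h2 ` P)" using fin by simp
  fix u v assume "(u, v) \<in> h2 ` P"
  then obtain a b where ab: "(a, b) \<in> P" "u = max a m" "v = max b m" by (auto simp: h2_def)
  show "m <= u \<and> u <= v \<and> v <= t" using interval_familyD[OF P ab(1)] m unfolding ab by auto
 next
  fix u v u' v' x assume "(u, v) \<in> h2 ` P" "(u', v') \<in> h2 ` P" and x: "u < x" "x < v" "u' < x" "x < v'"
  then obtain a b a' b' where *: "(a, b) \<in> P" "(a', b') \<in> P" "(u, v) = h2 (a, b)" "(u', v') = h2 (a', b')" by auto
  with x have "a < x" "x < b" "a' < x" "x < b'" by (auto simp: h2_def max_def split: if_splits)
  from interval_family_disjoint[OF P *(1,2) this] * show "(u, v) = (u', v')" by simp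
 qed
 have reindex: "vsum y (h ` P) = (\<Sum>p\<in>P. \<bar>y (snd (h p)) - y (fst (h p))\<bar>)"
  if h: "!!u v x. fst (h (u, v)) < x ==> x < snd (h (u, v)) ==> u < x \<and> x < v"
   "!!p. p \<in> P ==> fst (h p) <= snd (h p)" for h
 proof -
  have "vsum y (h ` P) = sum ((%p. \<bar>y (snd p) - y (fst p)\<bar>) \<circ> h) P" unfolding vsum_real case_prod_beta
  proof (rule sum.reindex_nontrivial[OF fin])
   fix p q assume pq: "p \<in> P" "q \<in> P" "p ~= q" "h p = h q"
   show "\<bar>y (snd (h p)) - y (fst (h p))\<bar> = 0"
   proof (rule ccontr)
    assume "\<bar>y (snd (h p)) - y (fst (h p))\<bar> ~= 0"
    then have "fst (h p) < snd (h p)" using h(2)[OF pq(1)] by (cases "fst (h p) = snd (h p)") auto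
    then obtain x where x: "fst (h p) < x" "x < snd (h p)" using dense by blast
    have "p = q" using interval_family_disjoint[OF P, of "fst p" "snd p" "fst q" "snd q" x]
      h(1)[of "fst p" "snd p" x] h(1)[of "fst q" "snd q" x] x pq by simp
    then show False using pq by simp
   qed
  qed
  then show ?thesis by simp
 qed
 have "vsum y P <= (\<Sum>p\<in>P. \<bar>y (snd (h1 p)) - y (fst (h1 p))\<bar> + \<bar>y (snd (h2 p)) - y (fst (h2 p))\<bar>)"
  unfolding vsum_real by (rule sum_mono) (auto simp: h1_def h2_def min_def max_def)
 also have "\<dots> = vsum y (h1 ` P) + vsum y (h2 ` P)"
 proof -
  have "fst (h1 p) <= snd (h1 p)" "fst (h2 p) <= snd (h2 p)" if "p \<in> P" for p
   using interval_familyD[OF P, of "fst p" "snd p"] that by (auto simp: h1_def h2_def case_prod_beta)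
  moreover have "u < x \<and> x < v" if "fst (h1 (u, v)) < x" "x < snd (h1 (u, v))" for u v x
   using that by (auto simp: h1_def min_def split: if_splits)
  moreover have "u < x \<and> x < v" if "fst (h2 (u, v)) < x" "x < snd (h2 (u, v))" for u v x
   using that by (auto simp: h2_def max_def split: if_splits)
  ultimately have "vsum y (h1 ` P) = (\<Sum>p\<in>P. \<bar>y (snd (h1 p)) - y (fst (h1 p))\<bar>)"
    "vsum y (h2 ` P) = (\<Sum>p\<in>P. \<bar>y (snd (h2 p)) - y (fst (h2 p))\<bar>)"
   by (intro reindex; blast)+
  then show ?thesis by (simp only: sum.distrib)
 qed
 finally show ?thesis using f1 f2 by blast
qed

lemma interval_family_Un:
 fixes y :: "real => real"
 assumes P: "interval_family s m P" and Q: "interval_family m t Q" and "s <= m" "m <= t"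
 shows "interval_family s t (P \<union> Q)" "vsum y (P \<union> Q) = vsum y P + vsum y Q"
proof -
 have fin: "finite P" "finite Q" using P Q by (simp_all add: interval_family_def)
 show "interval_family s t (P \<union> Q)"
 proof (rule interval_familyI)
  show "finite (P \<union> Q)" using fin by simp
  fix u v assume "(u, v) \<in> P \<union> Q" then show "s <= u \<and> u <= v \<and> v <= t"
   using interval_familyD[OF P, of u v] interval_familyD[OF Q, of u v] assms(3,4) by auto
 next
  fix u v u' v' x assume *: "(u, v) \<in> P \<union> Q" "(u', v') \<in> P \<union> Q" "u < x" "x < v" "u' < x" "x < v'"
  have a: "x <= m" if "(a, b) \<in> P" "a < x" "x < b" for a b using interval_familyD[OF P that(1)] that by simp
  have b: "x > m" if "(a, b) \<in> Q" "a < x" "x < b" for a b using interval_familyD[OF Q that(1)] that by simp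
  show "(u, v) = (u', v')"
  proof -
   consider "(u, v) \<in> P" "(u', v') \<in> P" | "(u, v) \<in> Q" "(u', v') \<in> Q" | "(u, v) \<in> P" "(u', v') \<in> Q"
    | "(u, v) \<in> Q" "(u', v') \<in> P" using *(1,2) by blast
   then show ?thesis
   proof cases
    case 1 then show ?thesis by (rule interval_family_disjoint[OF P _ _ *(3-6)])
   next
    case 2 then show ?thesis by (rule interval_family_disjoint[OF Q _ _ *(3-6)])
   next
    case 3 then show ?thesis using a[OF 3(1) *(3,4)] b[OF 3(2) *(5,6)] by simp
   next
    case 4 then show ?thesis using b[OF 4(1) *(3,4)] a[OF 4(2) *(5,6)] by simp
   qed
  qed
 qed
 have "u = v" if "(u, v) \<in> P \<inter> Q" for u v using interval_familyD[OF P, of u v] interval_familyD[OF Q, of u v] that by auto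
 then have "(\<Sum>(u, v)\<in>P \<inter> Q. \<bar>y v - y u\<bar>) = 0" using vsum_neutral[of "P \<inter> Q" y] by (simp add: vsum_real)
 then show "vsum y (P \<union> Q) = vsum y P + vsum y Q"
  using sum.union_inter[OF fin, of "%(u, v). \<bar>y v - y u\<bar>"] by (simp add: vsum_real)
qed

lemma interval_family_mono: "interval_family s t P ==> s' <= s ==> t <= t' ==> interval_family s' t' P"
 unfolding interval_family_def by fastforce

text \<open>With the delta that belongs to the error 1, the unit interval is cut into finitely many
  cells shorter than delta; each cell contributes at most 1 to the variation.\<close>

lemma abs_cont_vsum_bounded:
 fixes y :: "real => real"
 assumes "abs_cont y"
 shows "\<exists>M. \<forall>P. interval_family 0 1 P --> vsum y P <= M"
proof -
 obtain dlt where dlt: "dlt > 0" "!!P. interval_family 0 1 P ==> (\<Sum>(s, t)\<in>P. t - s) < dlt ==> vsum y P < 1"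
  using assms unfolding abs_cont_def by (metis zero_less_one)
 obtain n where n: "1 / real (Suc n) < dlt" using nat_approx_posE[OF dlt(1)] by auto
 define N where "N = real (Suc n)"
 have N: "N > 0" by (simp add: N_def)
 have "vsum y P <= real k" if "k <= Suc n" "interval_family 0 (real k / N) P" for k P using that
 proof (induction k arbitrary: P)
  case 0
  have "u = v" if "(u, v) \<in> P" for u v using interval_familyD[OF 0(2) that] by simp
  then have "vsum y P = 0" by (rule vsum_neutral)
  then show ?case by simp
 next
  case (Suc k)
  have "real k / N <= real (Suc k) / N" using N by (intro divide_right_mono) auto
  then obtain P1 P2 where *: "interval_family 0 (real k / N) P1" "interval_family (real k / N) (real (Suc k) / N) P2"
    "vsum y P <= vsum y P1 + vsum y P2"
   using interval_family_split[OF Suc.prems(2), of "real k / N" y] N by auto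
  have "(\<Sum>(s, t)\<in>P2. t - s) <= real (Suc k) / N - real k / N" by (rule interval_family_length_le_diff[OF *(2)]) fact
  also have "\<dots> < dlt" using n by (simp add: N_def diff_divide_distrib[symmetric])
  finally have l: "(\<Sum>(s, t)\<in>P2. t - s) < dlt" .
  have "real (Suc k) / N <= 1" using Suc.prems(1) by (simp add: N_def)
  then have "interval_family 0 1 P2" using *(2) N by (auto intro: interval_family_mono)
  from dlt(2)[OF this l] *(3) Suc.IH[OF _ *(1)] Suc.prems(1) show ?case by simp
 qed
 from this[of "Suc n"] show ?thesis by (intro exI[of _ "real (Suc n)"]) (simp add: N_def)
qed

text \<open>The total variation function of an absolutely continuous function is absolutely continuous,
  so \<open>y\<close> is a difference of monotone absolutely continuous functions.\<close>

lemma abs_cont_decompose: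
 fixes y :: "real => real"
 assumes y: "abs_cont y"
 shows "\<exists>A. abs_cont A \<and> (\<forall>s t. 0 <= s --> s <= t --> t <= 1 --> \<bar>y t - y s\<bar> <= A t - A s)"
proof -
 obtain M where M: "!!P. interval_family 0 1 P ==> vsum y P <= M" using abs_cont_vsum_bounded[OF y] by auto
 define V where "V s t = (SUP P\<in>{P. interval_family s t P}. vsum y P)" for s t
 have bdd: "bdd_above (vsum y ` {P. interval_family s t P})" if "0 <= s" "t <= 1" for s t
  by (rule bdd_aboveI[of _ M]) (use M interval_family_mono that in blast)
 have ne: "{P. interval_family s t P} ~= {}" for s t by (auto intro!: exI[of _ "{}"] simp: interval_family_def disjoint_family_on_def)
 have Vge: "vsum y P <= V s t" if "interval_family s t P" "0 <= s" "t <= 1" for s t P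
  unfolding V_def by (rule cSUP_upper[OF _ bdd]) (use that in auto)
 have Vle: "V s t <= c" if "!!P. interval_family s t P ==> vsum y P <= c" for s t c
  unfolding V_def by (rule cSUP_least[OF ne]) (use that in auto)
 have Vapp: "\<exists>P. interval_family s t P \<and> vsum y P > V s t - eta" if "eta > 0" for s t eta
 proof (rule ccontr)
  assume "\<not> ?thesis"
  then have "V s t <= V s t - eta" by (intro Vle) (auto simp: not_less)
  then show False using that by simp
 qed
 have up: "V 0 t <= V 0 s + V s t" if "0 <= s" "s <= t" "t <= 1" for s t
 proof (rule Vle)
  fix P assume "interval_family 0 t P"
  from interval_family_split[OF this, of s y] that obtain P1 P2 where
   "interval_family 0 s P1" "interval_family s t P2" "vsum y P <= vsum y P1 + vsum y P2" by auto
  with Vge[of 0 s P1] Vge[of s t P2] that show "vsum y P <= V 0 s + V s t" by simp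
 qed
 have low: "\<bar>y t - y s\<bar> <= V 0 t - V 0 s" if st: "0 <= s" "s <= t" "t <= 1" for s t
 proof -
  have "V 0 s <= V 0 t - \<bar>y t - y s\<bar>"
  proof (rule Vle)
   fix P assume P: "interval_family 0 s P"
   have Q: "interval_family s t {(s, t)}" using st by (intro interval_familyI) auto
   have "vsum y (P \<union> {(s, t)}) <= V 0 t" by (rule Vge[OF interval_family_Un(1)[OF P Q]]) (use st in auto)
   then show "vsum y P <= V 0 t - \<bar>y t - y s\<bar>" using interval_family_Un(2)[OF P Q, of y] st by (simp add: vsum_real)
  qed
  then show ?thesis by simp
 qed
 have "abs_cont (V 0)" unfolding abs_cont_def
 proof (intro allI impI)
  fix ep :: real assume ep: "ep > 0"
  then obtain dlt where dlt: "dlt > 0" "!!P. interval_family 0 1 P ==> (\<Sum>(s, t)\<in>P. t - s) < dlt ==> vsum y P < ep / 2"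
   using y unfolding abs_cont_def by (metis half_gt_zero)
  show "\<exists>dlt>0. \<forall>P. interval_family 0 1 P \<and> (\<Sum>(s, t)\<in>P. t - s) < dlt --> vsum (V 0) P < ep"
  proof (intro exI conjI allI impI, rule dlt(1))
   fix P assume "interval_family 0 1 P \<and> (\<Sum>(s, t)\<in>P. t - s) < dlt"
   then have P: "interval_family 0 1 P" and len: "(\<Sum>(s, t)\<in>P. t - s) < dlt" by auto
   have fin: "finite P" using P by (simp add: interval_family_def)
   \<comment> \<open>Every interval of \<open>P\<close> receives a subdivision whose variation is
     optimal up to \<open>eta\<close>, at a total loss of at most \<open>ep / 2\<close>. The union
     of these subdivisions has total length still below \<open>dlt\<close>, so its variation is
     below \<open>ep / 2\<close>.\<close>
   define eta where "eta = ep / (2 * (real (card P) + 1))"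
   have eta: "eta > 0" using ep by (simp add: eta_def)
   have "\<exists>Q. interval_family (fst p) (snd p) Q \<and> vsum y Q > V (fst p) (snd p) - eta" for p using Vapp[OF eta] by blast
   then obtain Q0 where Q0: "!!p. interval_family (fst p) (snd p) (Q0 p)" "!!p. vsum y (Q0 p) > V (fst p) (snd p) - eta" by metis
   \<comment> \<open>Degenerate intervals are dropped so that the subdivisions of different
     intervals of \<open>P\<close> have no element in common.\<close>
   define Q where "Q p = {(u, v) \<in> Q0 p. u < v}" for p
   have Qsub: "Q p \<subseteq> Q0 p" for p by (auto simp: Q_def)
   have finQ0: "finite (Q0 p)" for p using Q0(1)[of p] by (simp add: interval_family_def)
   have finQ: "finite (Q p)" for p by (rule finite_subset[OF Qsub finQ0])
   have Qf: "interval_family (fst p) (snd p) (Q p)" for p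
    using Q0(1)[of p] Qsub[of p] finQ[of p] disjoint_family_on_mono[OF Qsub, of "%(s, t). {s<..<t}" p]
    unfolding interval_family_def by blast
   have Qs: "vsum y (Q p) = vsum y (Q0 p)" for p unfolding vsum_real
   proof (rule sum.mono_neutral_left[OF finQ0 Qsub], clarify)
    fix u v assume "(u, v) \<in> Q0 p" "(u, v) \<notin> Q p"
    then have "u = v" using interval_familyD[OF Q0(1)[of p], of u v] by (auto simp: Q_def)
    then show "\<bar>y v - y u\<bar> = 0" by simp
   qed
   have Qd: "(u, v) \<in> Q p ==> u < v \<and> fst p <= u \<and> v <= snd p" for u v p
    using interval_familyD[OF Qf[of p], of u v] by (auto simp: Q_def)
   have uniq: "p = q" if "p \<in> P" "q \<in> P" "(u, v) \<in> Q p" "(u', v') \<in> Q q" "u < x" "x < v" "u' < x" "x < v'" for p q u v u' v' x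
    using interval_family_disjoint[OF P, of "fst p" "snd p" "fst q" "snd q" x] that Qd[OF that(3)] Qd[OF that(4)]
    by (auto simp: prod_eq_iff)
   have disj: "Q p \<inter> Q q = {}" if "p \<in> P" "q \<in> P" "p ~= q" for p q
   proof (rule ccontr)
    assume "Q p \<inter> Q q ~= {}"
    then obtain u v where uv: "(u, v) \<in> Q p" "(u, v) \<in> Q q" by auto
    then obtain x where "u < x" "x < v" using Qd dense by blast
    then show False using uniq[OF that(1,2) uv] that(3) by blast
   qed
   have QU: "interval_family 0 1 (\<Union>p\<in>P. Q p)"
   proof (rule interval_familyI)
    show "finite (\<Union>p\<in>P. Q p)" using fin finQ by auto
    fix u v assume "(u, v) \<in> (\<Union>p\<in>P. Q p)"
    then obtain p where p: "p \<in> P" "(u, v) \<in> Q p" by auto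
    show "0 <= u \<and> u <= v \<and> v <= 1" using Qd[OF p(2)] interval_familyD[OF P, of "fst p" "snd p"] p by auto
   next
    fix u v u' v' x assume "(u, v) \<in> (\<Union>p\<in>P. Q p)" "(u', v') \<in> (\<Union>p\<in>P. Q p)" and x: "u < x" "x < v" "u' < x" "x < v'"
    then obtain p q where pq: "p \<in> P" "(u, v) \<in> Q p" "q \<in> P" "(u', v') \<in> Q q" by auto
    then have "p = q" using uniq x by blast
    then show "(u, v) = (u', v')" using interval_family_disjoint[OF Qf[of p], of u v u' v' x] pq x by auto
   qed
   have "(\<Sum>(s, t)\<in>(\<Union>p\<in>P. Q p). t - s) = (\<Sum>p\<in>P. \<Sum>(s, t)\<in>Q p. t - s)"
    by (rule sum.UNION_disjoint) (use fin finQ disj in auto)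
   also have "\<dots> <= (\<Sum>(s, t)\<in>P. t - s)"
   proof (rule sum_mono)
    fix p assume "p \<in> P"
    then have "fst p <= snd p" using interval_familyD[OF P, of "fst p" "snd p"] by simp
    from interval_family_length_le_diff[OF Qf this]
    show "(\<Sum>(s, t)\<in>Q p. t - s) <= (case p of (s, t) => t - s)" by (simp add: case_prod_beta)
   qed
   also note len
   finally have "vsum y (\<Union>p\<in>P. Q p) < ep / 2" using dlt(2)[OF QU] by simp
   moreover have "vsum y (\<Union>p\<in>P. Q p) = (\<Sum>p\<in>P. vsum y (Q p))" unfolding vsum_real
    by (rule sum.UNION_disjoint) (use fin finQ disj in auto)
   moreover have "vsum (V 0) P <= (\<Sum>p\<in>P. vsum y (Q p) + eta)" unfolding vsum_real[of "V 0"]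
   proof (rule sum_mono)
    fix p assume p: "p \<in> P"
    then have st: "0 <= fst p" "fst p <= snd p" "snd p <= 1" using interval_familyD[OF P, of "fst p" "snd p"] by auto
    have "\<bar>V 0 (snd p) - V 0 (fst p)\<bar> = V 0 (snd p) - V 0 (fst p)" using low[OF st] by simp
    also have "\<dots> <= V (fst p) (snd p)" using up[OF st] by simp
    also have "\<dots> <= vsum y (Q p) + eta" using Q0(2)[of p] Qs[of p] by simp
    finally show "(case p of (u, v) => \<bar>V 0 v - V 0 u\<bar>) <= vsum y (Q p) + eta" by (simp add: case_prod_beta)
   qed
   moreover have "(\<Sum>p\<in>P. vsum y (Q p) + eta) = (\<Sum>p\<in>P. vsum y (Q p)) + real (card P) * eta" by (simp add: sum.distrib)
   moreover have "real (card P) * eta <= ep / 2" using ep by (simp add: eta_def field_simps)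
   ultimately show "vsum (V 0) P < ep" by linarith
  qed
 qed
 then show ?thesis using low by blast
qed

lemma abs_cont_continuous:
 fixes y :: "real => real"
 assumes y: "abs_cont y" shows "continuous_on {0..1} y"
 unfolding continuous_on_iff
proof (intro ballI allI impI)
 fix x e :: real assume x: "x \<in> {0..1}" and e: "e > 0"
 then obtain dlt where dlt: "dlt > 0" "!!P. interval_family 0 1 P ==> (\<Sum>(s, t)\<in>P. t - s) < dlt ==> vsum y P < e"
  using y unfolding abs_cont_def by metis
 have key: "\<bar>y v - y u\<bar> < e" if "0 <= u" "u <= v" "v <= 1" "v - u < dlt" for u v
  using dlt(2)[of "{(u, v)}"] that by (auto simp: vsum_real intro!: interval_familyI)
 show "\<exists>d>0. \<forall>x'\<in>{0..1}. dist x' x < d --> dist (y x') (y x) < e"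
 proof (intro exI conjI ballI impI, rule dlt(1))
  fix x' :: real assume "x' \<in> {0..1}" "dist x' x < dlt"
  then show "dist (y x') (y x) < e" using key[of x x'] key[of x' x] x by (cases "x <= x'") (auto simp: dist_real_def abs_minus_commute)
 qed
qed

text \<open>The Stieltjes measure of \<open>A\<close> is absolutely continuous with respect to
  Lebesgue measure, and \<open>D\<close> is its Radon-Nikodym derivative. A compact null set is
  covered by cells of a fine grid that stay inside an open set of measure below delta, so the
  increments of \<open>A\<close> over the cells sum to less than \<open>ep\<close>. Inner regularity
  extends this to all Borel null sets.\<close>

lemma mono_abs_cont_integral:
 fixes A :: "real => real"
 assumes A: "abs_cont A" and mono: "!!s t. 0 <= s ==> s <= t ==> t <= 1 ==> A s <= A t"
 shows "\<exists>D :: real => real. D absolutely_integrable_on {0..1} \<and>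
  (\<forall>x\<in>{0..1}. A x - A 0 = integral {0..x} D)"
proof -
 \<comment> \<open>A Stieltjes measure needs a monotone function on the whole line, so
   \<open>A\<close> is continued by constants; \<open>nu\<close> below restricts the measure to the
   unit interval again.\<close>
 define A' where "A' x = A (max 0 (min 1 x))" for x :: real
 have A'eq: "A' x = A x" if "x \<in> {0..1}" for x using that by (auto simp: A'_def)
 have A'm: "A' x <= A' y" if "x <= y" for x y unfolding A'_def by (rule mono) (use that in auto)
 have "continuous_on UNIV A'" unfolding A'_def
  by (rule continuous_on_compose2[OF abs_cont_continuous[OF A]]) (auto intro!: continuous_intros)
 then have rc: "continuous (at_right a) A'" for a
  by (auto simp: continuous_on_eq_continuous_at intro: continuous_at_imp_continuous_at_within)
 define mu where "mu = interval_measure A'"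
 have setsmu[measurable_cong, simp]: "sets mu = sets borel" by (simp add: mu_def)
 have cA': "continuous_on UNIV A'" by fact
 have Icc: "emeasure mu {a..b} = ennreal (A' b - A' a)" if "a <= b" for a b unfolding mu_def
  by (rule emeasure_interval_measure_Icc) (use that A'm cA' in auto)
 have Ioc: "emeasure mu {a<..b} = ennreal (A' b - A' a)" if "a <= b" for a b unfolding mu_def
  by (rule emeasure_interval_measure_Ioc) (use that A'm rc in auto)
 define nu where "nu = density mu (indicator {0..1})"
 have setsnu[measurable_cong, simp]: "sets nu = sets borel" by (simp add: nu_def)
 have nu: "emeasure nu B = emeasure mu ({0..1} \<inter> B)" if "B \<in> sets borel" for B
  unfolding nu_def using that by (subst emeasure_density) (auto simp flip: indicator_inter_arith)
 have fin: "finite_measure nu"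
 proof
  have "space nu = UNIV" by (simp add: nu_def mu_def)
  then show "emeasure nu (space nu) ~= \<infinity>" using nu[of UNIV] Icc[of 0 1] by simp
 qed
 have compact_null: "emeasure mu K <= ennreal ep" if K: "compact K" "K \<subseteq> {0..1}" "emeasure lborel K = 0" and ep: "ep > 0" for K ep
 proof -
  obtain dlt where dlt: "dlt > 0" "!!P. interval_family 0 1 P ==> (\<Sum>(s, t)\<in>P. t - s) < dlt ==> vsum A P < ep"
   using A ep unfolding abs_cont_def by metis
  have Kb: "K \<in> sets borel" using K(1) by (intro borel_closed compact_imp_closed)
  obtain U where U: "open U" "K \<subseteq> U" "emeasure lborel (U - K) < ennreal dlt" by (rule outer_regular_lborel[OF Kb dlt(1)])
  have "emeasure lborel U < ennreal dlt" using U(1,3) Kb K(3) by (subst (asm) emeasure_Diff_null_set) (auto simp: null_sets_def)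
  then have Ul: "emeasure lebesgue U < ennreal dlt" using U(1) by simp
  then have Um: "U \<in> lmeasurable" using U(1) by (intro fmeasurableI) (auto intro: less_trans)
  have Udlt: "measure lebesgue U < dlt" using Ul dlt(1) by (simp add: emeasure_eq_measure2[OF Um] ennreal_less_iff)
  have "\<exists>d>0. \<forall>x\<in>K. \<forall>y\<in>- U. d <= dist x y" by (rule separate_compact_closed[OF K(1)]) (use U in auto)
  then obtain d where d: "d > 0" "!!x y. x \<in> K ==> y \<notin> U ==> d <= dist x y" by auto
  \<comment> \<open>The mesh is smaller than the distance from \<open>K\<close> to the complement of
    \<open>U\<close>, so a grid cell that meets \<open>K\<close> is contained in
    \<open>U\<close>.\<close>
  obtain m where m: "1 / real (Suc m) < d" using nat_approx_posE[OF d(1)] by auto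
  define n where "n = real (Suc m)"
  have n: "n > 0" by (simp add: n_def)
  define q where "q i = real i / n" for i
  define J where "J = {i. i < Suc m \<and> {q i..q (Suc i)} \<inter> K ~= {}}"
  define P where "P = (%i. (q i, q (Suc i))) ` J"
  have J: "finite J" by (simp add: J_def)
  have q: "0 <= q i" "q i <= q (Suc i)" "q (Suc i) <= 1" if "i \<in> J" for i using that n by (auto simp: q_def J_def n_def field_simps)
  have inj: "inj_on (%i. (q i, q (Suc i))) J" using n by (auto simp: inj_on_def q_def)
  have P: "interval_family 0 1 P"
  proof (rule interval_familyI)
   show "finite P" using J by (simp add: P_def)
   fix u v assume "(u, v) \<in> P" then show "0 <= u \<and> u <= v \<and> v <= 1" using q by (auto simp: P_def)
  next
   fix u v u' v' x assume "(u, v) \<in> P" "(u', v') \<in> P" and x: "u < x" "x < v" "u' < x" "x < v'"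
   then obtain i j where ij: "u = q i" "v = q (Suc i)" "u' = q j" "v' = q (Suc j)" by (auto simp: P_def)
   have "real i < x * n" "x * n < real (Suc i)" "real j < x * n" "x * n < real (Suc j)" using x n unfolding ij q_def by (simp_all add: field_simps)
   then have "i = j" by linarith
   then show "(u, v) = (u', v')" using ij by simp
  qed
  have "{u<..<v} \<subseteq> U" if "(u, v) \<in> P" for u v
  proof
   fix z assume z: "z \<in> {u<..<v}"
   have "\<exists>i x. u = q i \<and> v = q (Suc i) \<and> x \<in> K \<and> q i <= x \<and> x <= q (Suc i)" using \<open>(u, v) \<in> P\<close> by (fastforce simp: P_def J_def)
   then obtain i x where i: "u = q i" "v = q (Suc i)" "x \<in> K" "q i <= x" "x <= q (Suc i)" by blast
   have "dist x z <= q (Suc i) - q i" using z i by (auto simp: dist_real_def)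
   also have "\<dots> < d" using m by (simp add: q_def n_def flip: diff_divide_distrib)
   finally show "z \<in> U" using d(2)[OF i(3)] by fastforce
  qed
  then have vs: "vsum A P < ep" using interval_family_length_le[OF P Um] Udlt by (intro dlt(2)[OF P]) fastforce
  have cover: "K \<subseteq> (\<Union>i\<in>J. {q i..q (Suc i)})"
  proof
   fix x assume x: "x \<in> K"
   have x1: "0 <= x * n" "x * n <= real (Suc m)" using K(2) x n by (auto simp: n_def mult_le_cancel_right1)
   have "\<exists>i<Suc m. real i <= x * n \<and> x * n <= real (Suc i)"
   proof (cases "nat \<lfloor>x * n\<rfloor> < Suc m")
    case True then show ?thesis using x1 by (intro exI[of _ "nat \<lfloor>x * n\<rfloor>"]) linarith
   next
    case False then show ?thesis using x1 by (intro exI[of _ m]) linarith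
   qed
   then obtain i where "i < Suc m" "x \<in> {q i..q (Suc i)}" using n by (auto simp: q_def field_simps)
   then show "x \<in> (\<Union>i\<in>J. {q i..q (Suc i)})" using x by (intro UN_I[of i]) (auto simp: J_def)
  qed
  have "emeasure mu K <= emeasure mu (\<Union>i\<in>J. {q i..q (Suc i)})" by (rule emeasure_mono[OF cover]) (use J in auto)
  also have "\<dots> <= (\<Sum>i\<in>J. emeasure mu {q i..q (Suc i)})" by (rule emeasure_subadditive_finite) (use J in auto)
  also have "\<dots> = (\<Sum>i\<in>J. ennreal \<bar>A (q (Suc i)) - A (q i)\<bar>)"
  proof (rule sum.cong)
   fix i assume i: "i \<in> J"
   have "A' (q i) = A (q i)" "A' (q (Suc i)) = A (q (Suc i))" by (rule A'eq; use q[OF i] in auto)+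
   then show "emeasure mu {q i..q (Suc i)} = ennreal \<bar>A (q (Suc i)) - A (q i)\<bar>" using Icc[OF q(2)[OF i]] A'm[OF q(2)[OF i]] by simp
  qed simp
  also have "\<dots> = ennreal (vsum A P)" unfolding P_def vsum_real by (subst sum.reindex[OF inj]) simp
  also have "\<dots> <= ennreal ep" using vs by (intro ennreal_leI) simp
  finally show ?thesis .
 qed
 have null: "emeasure nu N = 0" if N: "N \<in> sets borel" "emeasure lborel N = 0" for N
 proof -
  have "emeasure nu K <= 0" if K: "K \<subseteq> N" "compact K" for K
  proof (rule ennreal_le_epsilon)
   fix e :: real assume "0 < e"
   have "emeasure lborel ({0..1} \<inter> K) <= emeasure lborel N" by (rule emeasure_mono) (use K N in auto)
   then show "emeasure nu K <= 0 + ennreal e"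
    using compact_null[of "{0..1} \<inter> K" e] \<open>0 < e\<close> K N(2) nu[of K] by (simp add: compact_Int compact_imp_closed borel_closed)
  qed
  moreover have "emeasure nu N = (SUP K\<in>{K. K \<subseteq> N \<and> compact K}. emeasure nu K)"
   by (rule inner_regular) (use fin N(1) in \<open>auto simp: finite_measure.emeasure_finite\<close>)
  ultimately have "emeasure nu N <= 0" by (simp only:) (rule SUP_least, blast)
  then show ?thesis by simp
 qed
 have ac: "absolutely_continuous lborel nu" unfolding absolutely_continuous_def using null by (auto simp: null_sets_def)
 obtain D where D: "D \<in> borel_measurable lborel" "AE x in lborel. RN_deriv lborel nu x = ennreal (D x)" "!!x. 0 <= D x"
  using sigma_finite_measure.real_RN_deriv[OF sigma_finite_lborel fin ac] by auto
 have [measurable]: "D \<in> borel_measurable borel" using D(1) by simp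
 have "density lborel (RN_deriv lborel nu) = nu" by (rule sigma_finite_measure.density_RN_deriv[OF sigma_finite_lborel ac]) simp
 then have eqB: "emeasure nu B = (\<integral>\<^sup>+x. ennreal (D x * indicator B x) \<partial>lborel)" if "B \<in> sets borel" for B
 proof -
  have "emeasure (density lborel (RN_deriv lborel nu)) B = (\<integral>\<^sup>+x. RN_deriv lborel nu x * indicator B x \<partial>lborel)"
   using that by (intro emeasure_density) auto
  also have "\<dots> = (\<integral>\<^sup>+x. ennreal (D x * indicator B x) \<partial>lborel)"
   by (rule nn_integral_cong_AE) (use D(2) in \<open>eventually_elim, auto simp: indicator_def\<close>)
  finally show ?thesis using \<open>density lborel (RN_deriv lborel nu) = nu\<close> by simp
 qed
 have hi: "(D has_integral (A x - A 0)) {0..x}" if x: "x \<in> {0..1}" for x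
 proof -
  have "emeasure nu {0<..x} = ennreal (A x - A 0)"
   using nu[of "{0<..x}"] Ioc[of 0 x] A'eq[of x] A'eq[of 0] x by (simp add: Int_absorb1 subset_iff)
  with eqB[of "{0<..x}"] have "(\<integral>\<^sup>+t. ennreal (D t * indicator {0<..x} t) \<partial>lborel) = ennreal (A x - A 0)" by simp
  then have "((%t. D t * indicator {0<..x} t) has_integral (A x - A 0)) UNIV"
   by (intro nn_integral_has_integral) (use D(3) mono[of 0 x] x in auto)
  then have "((%t. if t \<in> {0..x} then D t else 0) has_integral (A x - A 0)) UNIV"
   by (rule has_integral_spike[OF negligible_sing[of 0], rotated]) (auto simp: indicator_def)
  then show ?thesis by (simp only: has_integral_restrict_UNIV)
 qed
 show ?thesis
 proof (intro exI[of _ D] conjI ballI)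
  show "D absolutely_integrable_on {0..1}"
   by (rule nonnegative_absolutely_integrable_1) (use hi[of 1] D(3) in \<open>auto intro: has_integral_integrable\<close>)
  fix x :: real assume "x \<in> {0..1}"
  from integral_unique[OF hi[OF this]] show "A x - A 0 = integral {0..x} D" by (rule sym)
 qed
qed

text \<open>\<open>y\<close> is the difference of \<open>A\<close> and \<open>A - y\<close>, both
  monotone because \<open>A\<close> dominates the increments of \<open>y\<close>.\<close>

lemma abs_cont_integral:
 fixes y :: "real => real"
 assumes y: "abs_cont y"
 shows "\<exists>D :: real => real. D absolutely_integrable_on {0..1} \<and>
  (\<forall>x\<in>{0..1}. y x - y 0 = integral {0..x} D)"
proof -
 obtain A where A: "abs_cont A" "!!s t. 0 <= s ==> s <= t ==> t <= 1 ==> \<bar>y t - y s\<bar> <= A t - A s"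
  using abs_cont_decompose[OF y] by blast
 define C where "C x = A x - y x" for x
 have "abs_cont C" by (rule abs_cont_le[OF A(1) y, where M = 1]) (simp add: C_def)
 have "A s <= A t" if "0 <= s" "s <= t" "t <= 1" for s t using A(2)[OF that] by simp
 then obtain D1 where D1: "D1 absolutely_integrable_on {0..1}"
  "!!x. x \<in> {0..1} ==> A x - A 0 = integral {0..x} D1" using mono_abs_cont_integral[OF A(1)] by auto
 have "C s <= C t" if "0 <= s" "s <= t" "t <= 1" for s t using A(2)[OF that] by (simp add: C_def)
 then obtain D2 where D2: "D2 absolutely_integrable_on {0..1}"
  "!!x. x \<in> {0..1} ==> C x - C 0 = integral {0..x} D2" using mono_abs_cont_integral[OF \<open>abs_cont C\<close>] by auto
 show ?thesis
 proof (intro exI[of _ "%x. D1 x - D2 x"] conjI ballI)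
  show "(%x. D1 x - D2 x) absolutely_integrable_on {0..1}" by (intro set_integral_diff D1 D2)
  fix x :: real assume x: "x \<in> {0..1}"
  have "integral {0..x} (%x. D1 x - D2 x) = integral {0..x} D1 - integral {0..x} D2"
   by (rule integral_diff) (use io_sub[OF D1(1)] io_sub[OF D2(1)] x in auto)
  then show "y x - y 0 = integral {0..x} (%x. D1 x - D2 x)" using D1(2)[OF x] D2(2)[OF x] by (simp add: C_def)
 qed
qed

text \<open>Absolute continuity of the integral: \<open>f\<close> is split into a part of L1 norm
  below \<open>ep / 2\<close>, harmless on every family of intervals, and a continuous part bounded
  by \<open>M\<close>, which contributes at most \<open>M\<close> times the total length.\<close>

lemma acd_imp_abs_cont:
 assumes F: "acd F f" shows "abs_cont F"
 unfolding abs_cont_def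
proof (intro allI impI)
 fix ep :: real assume e: "ep > 0"
 have fa: "f absolutely_integrable_on {0..1}" using F by (rule acd_ai)
 obtain g where g: "continuous_on UNIV g" "(\<integral>x. norm (f x - g x) \<partial>unit_leb) < ep/2"
  using absolutely_integrable_approx_continuous[OF fa, of "ep/2"] e by auto
 have ga: "g absolutely_integrable_on {0..1}" by (intro ai_cont continuous_on_subset[OF g(1)]) auto
 have da: "(%x. f x - g x) absolutely_integrable_on {0..1}" by (intro set_integral_diff fa ga)
 have "compact (g ` {0..1})" by (intro compact_continuous_image continuous_on_subset[OF g(1)]) auto
 then obtain B where B: "\<forall>x\<in>g ` {0..1}. norm x <= B" using compact_imp_bounded bounded_iff by blast
 define M where "M = max B 1"
 have M: "M > 0" "!!x. x \<in> {0..1} ==> norm (g x) <= M" using B by (force simp: M_def)+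
 define h where "h x = norm (f x - g x)" for x
 have hi: "set_integrable lebesgue {0..1} h" using absolutely_integrable_norm[OF da] unfolding h_def o_def .
 have hs: "set_integrable lebesgue A h" if "A \<in> sets lebesgue" "A \<subseteq> {0..1}" for A using set_integrable_subset[OF hi that] .
 show "\<exists>dlt>0. \<forall>P. interval_family 0 1 P \<and> (\<Sum>(s, t)\<in>P. t - s) < dlt --> vsum F P < ep"
  unfolding interval_family_def vsum_def
 proof (intro exI[of _ "ep / (2 * M)"] conjI allI impI)
  show "0 < ep / (2 * M)" using e M by simp
  fix P :: "(real \<times> real) set"
  assume P: "(finite P \<and> (\<forall>(s, t)\<in>P. 0 <= s \<and> s <= t \<and> t <= 1) \<and>
    disjoint_family_on (%(s, t). {s<..<t}) P) \<and> (\<Sum>(s, t)\<in>P. t - s) < ep / (2 * M)"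
  have one: "norm (F t - F s) <= (LINT x:{s<..<t}|lebesgue. h x) + M * (t - s)" if st: "(s, t) \<in> P" for s t
  proof -
   have st': "0 <= s" "s <= t" "t <= 1" using P st by auto
   have "F t - F s = integral {s..t} f" using acd_diff_eq[OF F] st' by auto
   also have "\<dots> = integral {s..t} (%x. f x - g x) + integral {s..t} g"
    using io_sub[OF fa, of s t] io_sub[OF ga, of s t] st' by (simp add: integral_diff)
   finally have "norm (F t - F s) <= norm (integral {s..t} (%x. f x - g x)) + norm (integral {s..t} g)" using norm_triangle_ineq by metis
   also have "norm (integral {s..t} (%x. f x - g x)) <= integral {s..t} h" unfolding h_def
    by (rule norm_integral_le[OF da]) (use st' in auto)
   also have "integral {s..t} h = integral {s<..<t} h" using integral_open_interval_real by metis
   also have "\<dots> = (LINT x:{s<..<t}|lebesgue. h x)"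
    by (rule set_lebesgue_integral_eq_integral(2)[symmetric], rule hs) (use st' in auto)
   also have "norm (integral {s..t} g) <= M * (t - s)"
    by (rule integral_bound) (use st' M(2) in \<open>auto intro: continuous_on_subset[OF g(1)]\<close>)
   finally show ?thesis by simp
  qed
  have "(\<Sum>(s, t)\<in>P. norm (F t - F s)) <= (\<Sum>p\<in>P. (LINT x:(case p of (s, t) => {s<..<t})|lebesgue. h x) + M * (snd p - fst p))"
   by (rule sum_mono) (use one in auto)
  also have "\<dots> = (LINT x:(\<Union>p\<in>P. case p of (s, t) => {s<..<t})|lebesgue. h x) + M * (\<Sum>(s, t)\<in>P. t - s)"
  proof -
   have "(LINT x:(\<Union>p\<in>P. case p of (s, t) => {s<..<t})|lebesgue. h x) = (\<Sum>p\<in>P. (LINT x:(case p of (s, t) => {s<..<t})|lebesgue. h x))"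
   proof (rule set_integral_finite_Union)
    fix p assume p: "p \<in> P"
    obtain s t where st: "p = (s, t)" by (cases p)
    then have "0 <= s" "s <= t" "t <= 1" using P p by auto
    then show "set_integrable lebesgue (case p of (s, t) => {s<..<t}) h" unfolding st prod.case by (intro hs) auto
   qed (use P in auto)
   then show ?thesis by (simp add: sum.distrib sum_distrib_left case_prod_beta)
  qed
  also have "(LINT x:(\<Union>p\<in>P. case p of (s, t) => {s<..<t})|lebesgue. h x) <= (LINT x:{0..1}|lebesgue. h x)"
  proof -
   have sub: "(\<Union>p\<in>P. case p of (s, t) => {s<..<t}) \<subseteq> {0..1}" using P by fastforce
   have "set_integrable lebesgue (\<Union>p\<in>P. case p of (s, t) => {s<..<t}) h" by (rule hs[OF _ sub]) (use P in auto)
   then show ?thesis unfolding set_lebesgue_integral_def by (intro integral_mono hi[unfolded set_integrable_def])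
     (use sub in \<open>auto simp: set_integrable_def indicator_def h_def split: if_splits\<close>)
  qed
  also have "(LINT x:{0..1}|lebesgue. h x) < ep / 2"
   using g(2) by (subst (asm) integral_restrict_space) (auto simp: h_def set_lebesgue_integral_def)
  also have "M * (\<Sum>(s, t)\<in>P. t - s) <= ep / 2" using P M by (auto simp: field_simps intro: less_imp_le)
  finally show "(\<Sum>(s, t)\<in>P. norm (F t - F s)) < ep" by simp
 qed
qed

lemma abs_cont_imp_acd:
 assumes y: "abs_cont y" shows "\<exists>f. acd y f"
proof -
 have "abs_cont (%x. Re (y x))" "abs_cont (%x. Im (y x))" by (rule abs_cont_le[OF y y, where M = 1], simp flip: minus_complex.sel,
    rule order_trans[OF abs_Re_le_cmod] order_trans[OF abs_Im_le_cmod], simp)+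
 then obtain D1 D2 where D: "D1 absolutely_integrable_on {0..1}" "D2 absolutely_integrable_on {0..1}"
  "!!x. x \<in> {0..1} ==> Re (y x) - Re (y 0) = integral {0..x} D1" "!!x. x \<in> {0..1} ==> Im (y x) - Im (y 0) = integral {0..x} D2"
  using abs_cont_integral by meson
 have "acd (%x. of_real (Re (y x)) + \<i> * of_real (Im (y x))) (%x. of_real (D1 x) + \<i> * of_real (D2 x))"
  by (intro acd_add acd_cmult) (auto simp: acd_def ai_of_real integral_of_real D simp flip: of_real_diff)
 then show ?thesis by (auto simp: complex_eq[symmetric])
qed

text \<open>The product is absolutely continuous in the epsilon-delta sense and so has some
  integrable derivative \<open>h\<close>; the differentiation theorem and the pointwise product rule
  identify \<open>h\<close> almost everywhere. All later integrations by parts with integrable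
  derivatives rest on this.\<close>

lemma acd_mult:
 assumes F: "acd F f" and G: "acd G g"
 shows "acd (%x. F x * G x) (%x. F x * g x + G x * f x)"
proof -
 obtain M1 where M1: "!!x. x \<in> {0..1} ==> norm (F x) <= M1" using acd_bounded[OF F] by blast
 obtain M2 where M2: "!!x. x \<in> {0..1} ==> norm (G x) <= M2" using acd_bounded[OF G] by blast
 have "abs_cont (%x. F x * G x)"
 proof (rule abs_cont_le[OF acd_imp_abs_cont[OF F] acd_imp_abs_cont[OF G], where M = "max M1 M2"])
  fix s t :: real assume st: "s \<in> {0..1}" "t \<in> {0..1}"
  have "F t * G t - F s * G s = G s * (F t - F s) + F t * (G t - G s)" by (simp add: algebra_simps)
  also have "norm \<dots> <= max M1 M2 * norm (F t - F s) + max M1 M2 * norm (G t - G s)"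
   by (intro norm_triangle_le add_mono; unfold norm_mult; intro mult_right_mono) (use M1[OF st(2)] M2[OF st(1)] in auto)
  finally show "norm (F t * G t - F s * G s) <= max M1 M2 * (norm (F t - F s) + norm (G t - G s))" by (simp add: distrib_left)
 qed
 then obtain h where h: "acd (%x. F x * G x) h" using abs_cont_imp_acd by blast
 have "AE x in unit_leb. h x = F x * g x + G x * f x"
  using lebesgue_differentiation[OF h] lebesgue_differentiation[OF F] lebesgue_differentiation[OF G] AE_space
 proof eventually_elim
  case (elim x)
  then show ?case using has_vector_derivative_mult[OF elim(2,3)]
    vector_derivative_unique_within_closed_interval[of 0 1 x "%x. F x * G x" "h x" "F x * g x + f x * G x"] by (simp add: mult.commute)
 qed
 then show ?thesis by (rule acd_deriv_cong_AE[OF h])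
qed

section \<open>The Hilbert space and Riesz bases\<close>

lemma L2_rel_refl_iff: "L2_rel f f \<longleftrightarrow> sq_integrable f" by (simp add: L2_rel_def)

lemma sq_integrable_rep: "sq_integrable (rep_L2 u)" using Quotient3_rep_reflp[OF Quotient3_L2, of u] by (simp add: L2_rel_def)

lemma abs_rep_L2: "abs_L2 (rep_L2 u) = u" using Quotient3_abs_rep[OF Quotient3_L2] by blast

lemma abs_L2_eqI: "sq_integrable f ==> sq_integrable g ==> AE x in unit_leb. f x = g x ==> abs_L2 f = abs_L2 g"
 using Quotient3_rel_abs[OF Quotient3_L2, of f g] by (simp add: L2_rel_def)

lemma abs_L2_eq_iff: "sq_integrable f ==> sq_integrable g ==> abs_L2 f = abs_L2 g \<longleftrightarrow> (AE x in unit_leb. f x = g x)"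
 using Quotient3_rel[OF Quotient3_L2, of f g] by (auto simp: L2_rel_def)

lemma L2_cases: obtains f where "sq_integrable f" "u = abs_L2 f" using sq_integrable_rep abs_rep_L2 by metis

lemma abs_L2_plus: "sq_integrable f ==> sq_integrable g ==> abs_L2 f + abs_L2 g = abs_L2 (%x. f x + g x)"
 by (simp add: plus_L2.abs_eq L2_rel_refl_iff)

lemma abs_L2_minus: "sq_integrable f ==> sq_integrable g ==> abs_L2 f - abs_L2 g = abs_L2 (%x. f x - g x)"
 by (simp add: minus_L2.abs_eq L2_rel_refl_iff)

lemma abs_L2_scaleC: "sq_integrable f ==> c *\<^sub>C abs_L2 f = abs_L2 (%x. c *s f x)" by (simp add: scaleC.abs_eq L2_rel_refl_iff)

lemma cinner_abs: "sq_integrable f ==> sq_integrable g ==>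
  cinner (abs_L2 f) (abs_L2 g) = (\<integral>x. (\<Sum>i\<in>UNIV. f x $ i * cnj (g x $ i)) \<partial>unit_leb)"
 by (simp add: cinner.abs_eq L2_rel_refl_iff)

lemma norm_abs_sq: "sq_integrable f ==> (norm (abs_L2 f))^2 = (\<integral>x. (norm (f x))^2 \<partial>unit_leb)"
 by (simp add: power2_norm_eq_inner inner_L2.abs_eq L2_rel_refl_iff)

lemma measurable_vec_nth_unit:
 fixes h :: "'a => complex^2"
 assumes "h \<in> borel_measurable M"
 shows "(%x. h x $ i) \<in> borel_measurable M"
 using borel_measurable_continuous_on[OF _ assms, of "%v. v $ i"] by (simp add: continuous_on_component)

lemma measurable_cnj: "f \<in> borel_measurable M ==> (%x. cnj (f x)) \<in> borel_measurable M"
 by (rule borel_measurable_continuous_on[of cnj]) (auto intro!: continuous_intros)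

lemma integrable_sq_prod:
 assumes f: "f \<in> borel_measurable unit_leb" "integrable unit_leb (%x. (norm (f x))^2)"
  and g: "g \<in> borel_measurable unit_leb" "integrable unit_leb (%x. (norm (g x))^2)"
 shows "integrable unit_leb (%x. f x * g x :: complex)"
proof (rule Bochner_Integration.integrable_bound[where f = "%x. (norm (f x))^2 + (norm (g x))^2"])
 show "AE x in unit_leb. norm (f x * g x) <= norm ((norm (f x))^2 + (norm (g x))^2)"
 proof (rule AE_I2)
  fix x
  have "2 * (norm (f x) * norm (g x)) <= (norm (f x))^2 + (norm (g x))^2" using sum_squares_bound[of "norm (f x)" "norm (g x)"] by simp
  moreover have "0 <= norm (f x) * norm (g x)" by simp
  ultimately show "norm (f x * g x) <= norm ((norm (f x))^2 + (norm (g x))^2)" unfolding norm_mult real_norm_def by linarith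
 qed
qed (use assms in auto)

lemma sq_integrable_nth:
 assumes "sq_integrable f"
 shows "(%x. f x $ i) \<in> borel_measurable unit_leb" "integrable unit_leb (%x. (norm (f x $ i))^2)"
proof -
 show m: "(%x. f x $ i) \<in> borel_measurable unit_leb" using assms measurable_vec_nth_unit by (auto simp: sq_integrable_def)
 show "integrable unit_leb (%x. (norm (f x $ i))^2)" by (rule Bochner_Integration.integrable_bound[where f = "%x. (norm (f x))^2"])
    (use assms m in \<open>auto simp: sq_integrable_def intro!: AE_I2 power_mono Finite_Cartesian_Product.norm_nth_le\<close>)
qed

lemma integrable_nth_cnj:
 assumes "sq_integrable f" "sq_integrable g"
 shows "integrable unit_leb (%x. f x $ i * cnj (g x $ j))"
 by (rule integrable_sq_prod)
   (use sq_integrable_nth[OF assms(1)] sq_integrable_nth[OF assms(2)] in \<open>auto intro: measurable_cnj\<close>)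

lemma norm_sq_vec2: "(norm (v :: complex^2))^2 = (norm (v $ 1))^2 + (norm (v $ 2))^2" by (simp add: norm_vec_def L2_set_def sum_2)

lemma cinner_add_left: "cinner (u + v) w = cinner u w + cinner v w"
proof -
 obtain f g h where "sq_integrable f" "u = abs_L2 f" "sq_integrable g" "v = abs_L2 g" "sq_integrable h" "w = abs_L2 h" by (metis L2_cases)
 then show ?thesis using integrable_nth_cnj[of f h] integrable_nth_cnj[of g h] sq_integrable_add[of f g]
  by (simp add: abs_L2_plus cinner_abs sum_2 distrib_right)
qed

lemma cinner_scaleC_left: "cinner (c *\<^sub>C u) w = c * cinner u w"
proof -
 obtain f h where "sq_integrable f" "u = abs_L2 f" "sq_integrable h" "w = abs_L2 h" by (metis L2_cases)
 then show ?thesis using integrable_nth_cnj[of f h] sq_integrable_scaleC[of f c]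
  by (simp add: abs_L2_scaleC cinner_abs sum_2 mult.assoc flip: distrib_left)
qed

lemma cinner_commute: "cinner u v = cnj (cinner v u)"
proof -
 obtain f h where "sq_integrable f" "u = abs_L2 f" "sq_integrable h" "v = abs_L2 h" by (metis L2_cases)
 then show ?thesis
  by (simp only: cinner_abs Bochner_Integration.integral_cnj[symmetric]) (rule Bochner_Integration.integral_cong, auto simp: mult.commute)
qed

lemma inner_eq_Re_cinner: "u \<bullet> v = Re (cinner u v)"
proof -
 obtain f h where *: "sq_integrable f" "u = abs_L2 f" "sq_integrable h" "v = abs_L2 h" by (metis L2_cases)
 then have "integrable unit_leb (%x. \<Sum>i\<in>UNIV. f x $ i * cnj (h x $ i))"
  using integrable_nth_cnj[of f h] by (auto intro: Bochner_Integration.integrable_sum)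
 from integral_Re[OF this] * show ?thesis by (simp add: cinner_abs inner_L2.abs_eq L2_rel_refl_iff inner_vec_def inner_complex_def sum_2)
qed

lemma cinner_self: "cinner u u = of_real ((norm u)^2)"
proof -
 have "Im (cinner u u) = 0" using cinner_commute[of u u] by (simp add: complex_eq_iff)
 then show ?thesis by (simp add: complex_eq_iff power2_norm_eq_inner inner_eq_Re_cinner)
qed

lemma norm_scaleC: "norm (c *\<^sub>C u) = cmod c * norm u"
proof -
 have "of_real ((norm (c *\<^sub>C u))^2) = c * cnj c * of_real ((norm u)^2)" unfolding cinner_self[symmetric] cinner_scaleC_left
  by (subst cinner_commute) (simp add: cinner_scaleC_left cinner_self)
 then have "(norm (c *\<^sub>C u))^2 = (cmod c * norm u)^2" by (metis complex_norm_square of_real_eq_iff of_real_mult power_mult_distrib)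
 then show ?thesis by simp
qed

lemma cinner_zero_left [simp]: "cinner 0 v = 0" using cinner_scaleC_left[of 0 0 v] by simp

lemma cinner_diff_left: "cinner (u - v) w = cinner u w - cinner v w" using cinner_add_left[of "u - v" v w] by simp

lemma cinner_add_right: "cinner w (u + v) = cinner w u + cinner w v" by (subst (1 2 3) cinner_commute) (simp add: cinner_add_left)

lemma cinner_diff_right: "cinner w (u - v) = cinner w u - cinner w v" by (subst (1 2 3) cinner_commute) (simp add: cinner_diff_left)

lemma cinner_scaleC_right: "cinner w (c *\<^sub>C u) = cnj c * cinner w u" by (subst (1 2) cinner_commute) (simp add: cinner_scaleC_left)

lemma cinner_zero_right [simp]: "cinner v 0 = 0" by (subst cinner_commute) simp

lemma cinner_sum_left: "cinner (\<Sum>i\<in>A. f i) w = (\<Sum>i\<in>A. cinner (f i) w)"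
 by (induction A rule: infinite_finite_induct) (auto simp: cinner_add_left)

lemma cinner_sum_right: "cinner w (\<Sum>i\<in>A. f i) = (\<Sum>i\<in>A. cinner w (f i))"
 by (induction A rule: infinite_finite_induct) (auto simp: cinner_add_right)

lemma cinner_self_eq_0 [simp]: "cinner u u = 0 \<longleftrightarrow> u = 0" by (simp add: cinner_self)

lemma cinner_Cauchy_Schwarz: "norm (cinner u v) <= norm u * norm v"
proof (cases "cinner u v = 0")
 case False
 define c where "c = cnj (cinner u v) / norm (cinner u v)"
 have c: "norm c = 1" using False by (simp add: c_def norm_divide)
 have "c * cinner u v = of_real (norm (cinner u v))"
  using False complex_norm_square[of "cinner u v"] by (simp add: c_def power2_eq_square field_simps)
 then have "norm (cinner u v) = (c *\<^sub>C u) \<bullet> v" by (simp add: inner_eq_Re_cinner cinner_scaleC_left)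
 also have "\<dots> <= norm (c *\<^sub>C u) * norm v" by (rule norm_cauchy_schwarz)
 finally show ?thesis using c by (simp add: norm_scaleC)
qed simp

lemma scaleR_scaleC: "r *\<^sub>R u = of_real r *\<^sub>C u"
proof -
 obtain f where f: "sq_integrable f" "u = abs_L2 f" by (metis L2_cases)
 have "(%x. r *\<^sub>R f x) = (%x. of_real r *s f x)"
  by (rule ext) (simp only: vec_eq_iff vector_scaleR_component vector_smult_component, simp add: scaleR_conv_of_real)
 then show ?thesis using f by (simp add: scaleR_L2.abs_eq scaleC.abs_eq L2_rel_refl_iff)
qed

lemma bounded_linear_cinner_left: "bounded_linear (%u. cinner u v)" by (rule bounded_linear_intro[where K = "norm v"])
   (auto simp: cinner_add_left scaleR_scaleC cinner_scaleC_left scaleR_conv_of_real cinner_Cauchy_Schwarz)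

lemma bounded_linear_cinner_right: "bounded_linear (%u. cinner v u)" by (rule bounded_linear_intro[where K = "norm v"])
   (auto simp: cinner_add_right scaleR_scaleC cinner_scaleC_right scaleR_conv_of_real cinner_Cauchy_Schwarz
    mult.commute[of _ "norm v"])

lemma bounded_linear_scaleC: "bounded_linear (%u. c *\<^sub>C u)" by (rule bounded_linear_intro[where K = "norm c"])
   (auto simp: L2.scale_right_distrib scaleR_scaleC norm_scaleC mult.commute)

lemma nn_integral_norm_sq:
 assumes "sq_integrable f"
 shows "(\<integral>\<^sup>+x. ennreal ((norm (f x))^2) \<partial>unit_leb) = ennreal ((norm (abs_L2 f))^2)"
 unfolding norm_abs_sq[OF assms]
 by (rule nn_integral_eq_integral) (use assms in \<open>auto simp: sq_integrable_def\<close>)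

lemma integral_norm_le_L2:
 assumes f: "sq_integrable f"
 shows "integrable unit_leb (%x. norm (f x))" "(\<integral>x. norm (f x) \<partial>unit_leb) <= norm (abs_L2 f)"
proof -
 have fm: "f \<in> borel_measurable unit_leb" "integrable unit_leb (%x. (norm (f x))^2)" using f by (auto simp: sq_integrable_def)
 have fin: "finite_measure unit_leb" by (rule finite_measure_lebesgue_on) auto
 interpret finite_measure unit_leb by fact
 show 1: "integrable unit_leb (%x. norm (f x))"
 proof (rule Bochner_Integration.integrable_bound[where f = "%x. 1 + (norm (f x))^2"])
  show "AE x in unit_leb. norm (norm (f x)) <= norm (1 + (norm (f x))^2)"
  proof (rule AE_I2)
   fix x have "2 * norm (f x) <= 1 + (norm (f x))^2" using sum_squares_bound[of 1 "norm (f x)"] by simp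
   then show "norm (norm (f x)) <= norm (1 + (norm (f x))^2)" using norm_ge_zero[of "f x"] zero_le_power2[of "norm (f x)"] unfolding real_norm_def by linarith
  qed
 qed (use fm in auto)
 define m where "m = (\<integral>x. norm (f x) \<partial>unit_leb)"
 have "0 <= (\<integral>x. (norm (f x) - m)^2 \<partial>unit_leb)" by simp
 also have "\<dots> = (\<integral>x. ((norm (f x))^2 - 2 * m * norm (f x)) + m^2 \<partial>unit_leb)"
  by (rule Bochner_Integration.integral_cong) (auto simp: power2_eq_square algebra_simps)
 also have "\<dots> = (norm (abs_L2 f))^2 - 2 * m * m + m^2"
  using fm 1 unfolding norm_abs_sq[OF f] m_def by (simp add: measure_restrict_space)
 finally have "m^2 <= (norm (abs_L2 f))^2" by (simp add: power2_eq_square)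
 then show "m <= norm (abs_L2 f)" by (rule power2_le_imp_le) simp
qed

text \<open>The Riesz-Fischer argument. Along a subsequence consecutive differences have norm at
  most \<open>(1/2)^k\<close>; the unit interval has measure 1, so their L1 norms are summable too
  and the representatives converge almost everywhere. Fatou's lemma bounds the L2 distance to the
  limit.\<close>

instance L2 :: banach
proof
 fix X :: "nat => L2" assume X: "Cauchy X"
 have "\<exists>N. \<forall>m\<ge>N. \<forall>n\<ge>N. norm (X m - X n) < (1/2)^k" for k :: nat
  using X unfolding Cauchy_def dist_norm by (metis zero_less_power half_gt_zero zero_less_one)
 then obtain N where N: "!!k m n. m >= N k ==> n >= N k ==> norm (X m - X n) < (1/2)^k" by metis
 \<comment> \<open>The sum makes \<open>s\<close> monotone and at least \<open>N\<close>; the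
   summand \<open>k\<close> makes it strictly increasing, as a subsequence requires.\<close>
 define s where "s k = (\<Sum>j\<le>k. N j) + k" for k
 have sN: "s k >= N k" for k unfolding s_def using member_le_sum[of k "{..k}" N] by simp
 have smono: "s j <= s k" if "j <= k" for j k unfolding s_def by (intro add_mono sum_mono2) (use that in auto)
 define f where "f k = rep_L2 (X (s k))" for k
 have sf: "sq_integrable (f k)" and Xf: "X (s k) = abs_L2 (f k)" for k by (auto simp: f_def sq_integrable_rep abs_rep_L2)
 have [measurable]: "f k \<in> borel_measurable unit_leb" for k using sf[of k] by (simp add: sq_integrable_def)
 have dn: "norm (abs_L2 (%x. f j x - f k x)) <= (1/2)^k" if "k <= j" for j k using N[of k "s j" "s k"] sN[of k] sN[of j] smono[OF that] sf
  by (simp add: Xf abs_L2_minus less_imp_le)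
 define d where "d k x = norm (f (Suc k) x - f k x)" for k x
 have [measurable]: "d k \<in> borel_measurable unit_leb" for k unfolding d_def by measurable
 have "(\<integral>\<^sup>+x. ennreal (d k x) \<partial>unit_leb) <= ennreal ((1/2)^k)" for k
 proof -
  have sd: "sq_integrable (%x. f (Suc k) x - f k x)" by (intro sq_integrable_diff sf)
  have "(\<integral>\<^sup>+x. ennreal (d k x) \<partial>unit_leb) = ennreal (\<integral>x. d k x \<partial>unit_leb)"
   unfolding d_def by (rule nn_integral_eq_integral[OF integral_norm_le_L2(1)[OF sd]]) auto
  also have "\<dots> <= ennreal ((1/2)^k)" using integral_norm_le_L2(2)[OF sd] dn[of k "Suc k"] unfolding d_def by (intro ennreal_leI) simp
  finally show ?thesis .
 qed
 then have "(\<Sum>k. \<integral>\<^sup>+x. ennreal (d k x) \<partial>unit_leb) <= (\<Sum>k. ennreal ((1/2)^k))" by (intro suminf_le) auto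
 also have "\<dots> < \<infinity>" by (subst suminf_ennreal2) (auto intro: summable_geometric)
 finally have "(\<integral>\<^sup>+x. (\<Sum>k. ennreal (d k x)) \<partial>unit_leb) ~= \<infinity>" by (subst nn_integral_suminf) auto
 then have "AE x in unit_leb. (\<Sum>k. ennreal (d k x)) ~= \<infinity>" by (intro nn_integral_PInf_AE) auto
 then have conv: "AE x in unit_leb. convergent (%k. f k x)"
 proof eventually_elim
  case (elim x)
  then have "summable (%k. d k x)" by (intro summable_suminf_not_top) (auto simp: d_def)
  then have "summable (%k. f (Suc k) x - f k x)" unfolding d_def by (rule summable_norm_cancel)
  then have "convergent (%n. (\<Sum>k<n. f (Suc k) x - f k x))" by (simp add: summable_iff_convergent)
  then have "convergent (%n. (f n x - f 0 x))" by (simp add: sum_lessThan_telescope[of "%k. f k x"])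
  then have "convergent (%n. (f n x - f 0 x) + f 0 x)" by (intro convergent_add convergent_const)
  then show ?case by simp
 qed
 define g where "g x = lim (%k. f k x)" for x
 have [measurable]: "g \<in> borel_measurable unit_leb" unfolding g_def by (rule borel_measurable_lim_metric) auto
 have lim: "AE x in unit_leb. (%k. f k x) \<longlonglongrightarrow> g x"
  using conv by eventually_elim (simp add: g_def convergent_LIMSEQ_iff)
 have fat: "(\<integral>\<^sup>+x. ennreal ((norm (g x - f k x))^2) \<partial>unit_leb) <= ennreal (((1/2)^k)^2)" for k
 proof -
  have "(\<integral>\<^sup>+x. ennreal ((norm (g x - f k x))^2) \<partial>unit_leb) =
    (\<integral>\<^sup>+x. liminf (%j. ennreal ((norm (f j x - f k x))^2)) \<partial>unit_leb)"
  proof (rule nn_integral_cong_AE)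
   show "AE x in unit_leb. ennreal ((norm (g x - f k x))^2) = liminf (%j. ennreal ((norm (f j x - f k x))^2))" using lim
   proof eventually_elim
    case (elim x)
    have "(%j. ennreal ((norm (f j x - f k x))^2)) \<longlonglongrightarrow> ennreal ((norm (g x - f k x))^2)"
     by (intro tendsto_ennrealI tendsto_intros elim)
    then show ?case using lim_imp_Liminf[OF sequentially_bot] by metis
   qed
  qed
  also have "\<dots> <= liminf (%j. \<integral>\<^sup>+x. ennreal ((norm (f j x - f k x))^2) \<partial>unit_leb)"
   by (rule nn_integral_liminf) auto
  also have "\<dots> <= ennreal (((1/2)^k)^2)"
  proof (rule Liminf_le)
   show "\<forall>\<^sub>F j in sequentially. (\<integral>\<^sup>+x. ennreal ((norm (f j x - f k x))^2) \<partial>unit_leb) <= ennreal (((1/2)^k)^2)"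
    unfolding eventually_sequentially
   proof (intro exI[of _ k] allI impI)
    fix j assume "k <= j"
    have "(norm (abs_L2 (%x. f j x - f k x)))^2 <= ((1/2)^k)^2" by (rule power_mono[OF dn[OF \<open>k <= j\<close>]]) simp
    then show "(\<integral>\<^sup>+x. ennreal ((norm (f j x - f k x))^2) \<partial>unit_leb) <= ennreal (((1/2)^k)^2)"
     by (subst nn_integral_norm_sq) (auto intro: sq_integrable_diff sf ennreal_leI)
   qed
  qed simp
  finally show ?thesis .
 qed
 have sgf: "sq_integrable (%x. g x - f k x)" for k
 proof -
  have "integrable unit_leb (%x. (norm (g x - f k x))^2)"
   by (rule integrableI_bounded) (use fat[of k] in \<open>auto intro: le_less_trans\<close>)
  then show ?thesis by (simp add: sq_integrable_def)
 qed
 have sg: "sq_integrable g" using sq_integrable_add[OF sgf[of 0] sf[of 0]] by simp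
 have gn: "norm (abs_L2 g - X (s k)) <= (1/2)^k" for k
 proof -
  have "ennreal ((norm (abs_L2 (%x. g x - f k x)))^2) <= ennreal (((1/2)^k)^2)" using fat[of k] nn_integral_norm_sq[OF sgf[of k]] by simp
  then have "(norm (abs_L2 (%x. g x - f k x)))^2 <= ((1/2)^k)^2" by (simp add: ennreal_le_iff)
  then have "norm (abs_L2 (%x. g x - f k x)) <= (1/2)^k" by (rule power2_le_imp_le) simp
  then show ?thesis by (simp add: Xf abs_L2_minus sg sf)
 qed
 have "(%k. abs_L2 g - X (s k)) \<longlonglongrightarrow> 0"
  by (rule Lim_null_comparison[OF always_eventually[OF allI[OF gn]]]) (rule LIMSEQ_realpow_zero, auto)
 then have "(%k. abs_L2 g - (abs_L2 g - X (s k))) \<longlonglongrightarrow> abs_L2 g - 0" by (intro tendsto_intros)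
 then have sub: "(X \<circ> s) \<longlonglongrightarrow> abs_L2 g" by (simp add: o_def)
 have "s j < s (Suc j)" for j by (simp add: s_def)
 then have "strict_mono s" by (simp add: strict_mono_Suc_iff)
 then show "convergent X" using Cauchy_converges_subseq[OF X _ sub] by (auto simp: convergent_def)
qed

section \<open>Bessel sequences, Gram-Schmidt and criteria for Riesz bases\<close>

text \<open>All natural numbers serve as indices and zero vectors are allowed: a family over a
  smaller index set is padded with zeros, so finite families need no separate treatment.\<close>

definition bessel :: "real => (nat => L2) => bool" where
 "bessel C v \<longleftrightarrow> C >= 0 \<and> (\<forall>f F. finite F --> (\<Sum>n\<in>F. (cmod (cinner f (v n)))^2) <= C * (norm f)^2)"

lemma besselD: "bessel C v ==> finite F ==> (\<Sum>n\<in>F. (cmod (cinner f (v n)))^2) <= C * (norm f)^2" by (simp add: bessel_def)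

text \<open>Synthesis is the adjoint of analysis and has the same norm: expanding
  \<open>cinner s s\<close> and applying the Cauchy-Schwarz inequality bounds the square of
  \<open>norm s\<close> by a multiple of \<open>norm s\<close>, which cancels.\<close>

lemma bessel_synthesis:
 assumes "bessel C v" "finite F"
 shows "(norm (\<Sum>n\<in>F. c n *\<^sub>C v n))^2 <= C * (\<Sum>n\<in>F. (cmod (c n))^2)"
proof -
 define s where "s = (\<Sum>n\<in>F. c n *\<^sub>C v n)"
 have C: "C >= 0" using assms by (simp add: bessel_def)
 have "of_real ((norm s)^2) = (\<Sum>n\<in>F. cnj (c n) * cinner s (v n))"
  unfolding cinner_self[symmetric] by (subst (2) s_def) (simp add: cinner_sum_right cinner_scaleC_right)
 then have "(norm s)^2 = cmod (\<Sum>n\<in>F. cnj (c n) * cinner s (v n))" by (metis norm_of_real abs_of_nonneg zero_le_power2)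
 also have "\<dots> <= (\<Sum>n\<in>F. \<bar>cmod (c n)\<bar> * \<bar>cmod (cinner s (v n))\<bar>)"
  by (rule order_trans[OF norm_sum]) (simp add: norm_mult)
 also have "\<dots> <= L2_set (%n. cmod (c n)) F * L2_set (%n. cmod (cinner s (v n))) F" by (rule L2_set_mult_ineq)
 also have "\<dots> <= sqrt (\<Sum>n\<in>F. (cmod (c n))^2) * (sqrt C * norm s)"
 proof (rule mult_mono)
  have "L2_set (%n. cmod (cinner s (v n))) F <= sqrt (C * (norm s)^2)"
   unfolding L2_set_def by (rule real_sqrt_le_mono[OF besselD[OF assms]])
  then show "L2_set (%n. cmod (cinner s (v n))) F <= sqrt C * norm s" by (simp add: real_sqrt_mult)
 qed (auto simp: L2_set_def sum_nonneg)
 finally have "norm s * norm s <= (sqrt (\<Sum>n\<in>F. (cmod (c n))^2) * sqrt C) * norm s" by (simp add: power2_eq_square mult.assoc)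
 then have "norm s <= sqrt (\<Sum>n\<in>F. (cmod (c n))^2) * sqrt C" by (cases "norm s = 0") (auto simp: C sum_nonneg mult_le_cancel_right)
 then have "(norm s)^2 <= (sqrt (\<Sum>n\<in>F. (cmod (c n))^2) * sqrt C)^2" by (rule power_mono) simp
 also have "\<dots> = C * (\<Sum>n\<in>F. (cmod (c n))^2)" using C by (simp add: power_mult_distrib sum_nonneg mult.commute)
 finally show ?thesis by (simp add: s_def)
qed

text \<open>Analysis with \<open>v\<close> followed by synthesis with \<open>u\<close>. If
  \<open>v\<close> is biorthogonal to \<open>u\<close>, this is a projection onto the closed span of
  the \<open>u n\<close>; with an orthonormal sequence \<open>e\<close> in place of \<open>u\<close>
  it carries \<open>u n\<close> to \<open>e n\<close>.\<close>

definition frame_op :: "(nat => L2) => (nat => L2) => L2 => L2" where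
 "frame_op v u f = (\<Sum>n. cinner f (v n) *\<^sub>C u n)"

lemma frame_op:
 assumes v: "bessel A v" and u: "bessel B u"
 shows frame_op_sums: "(%n. cinner f (v n) *\<^sub>C u n) sums frame_op v u f"
  and frame_op_norm: "norm (frame_op v u f) <= sqrt (A * B) * norm f"
proof -
 have AB: "A >= 0" "B >= 0" using assms by (auto simp: bessel_def)
 have summ: "summable (%n. (cmod (cinner f (v n)))^2)"
  by (rule summableI_nonneg_bounded[where x = "A * (norm f)^2"]) (use besselD[OF v] in auto)
 have "summable (%n. cinner f (v n) *\<^sub>C u n)" unfolding summable_Cauchy
 proof (intro allI impI)
  fix e :: real assume e: "e > 0"
  have "e^2 / (B + 1) > 0" using e AB by simp
  with summ obtain N where N: "!!m n. m >= N ==> norm (\<Sum>k=m..<n. (cmod (cinner f (v k)))^2) < e^2 / (B + 1)"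
   unfolding summable_Cauchy by metis
  show "\<exists>N. \<forall>m\<ge>N. \<forall>n. norm (\<Sum>k=m..<n. cinner f (v k) *\<^sub>C u k) < e"
  proof (intro exI[of _ N] allI impI)
   fix m n assume m: "N <= m"
   have "(norm (\<Sum>k=m..<n. cinner f (v k) *\<^sub>C u k))^2 <= B * (\<Sum>k=m..<n. (cmod (cinner f (v k)))^2)"
    by (rule bessel_synthesis[OF u]) simp
   also have "\<dots> <= (B + 1) * (\<Sum>k=m..<n. (cmod (cinner f (v k)))^2)" by (intro mult_right_mono sum_nonneg) auto
   also have "\<dots> < (B + 1) * (e^2 / (B + 1))" using N[OF m, of n] AB by (intro mult_strict_left_mono) auto
   finally have "(norm (\<Sum>k=m..<n. cinner f (v k) *\<^sub>C u k))^2 < e^2" using AB by simp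
   then show "norm (\<Sum>k=m..<n. cinner f (v k) *\<^sub>C u k) < e" by (rule power2_less_imp_less) (use e in simp)
  qed
 qed
 then show s: "(%n. cinner f (v n) *\<^sub>C u n) sums frame_op v u f" unfolding frame_op_def by (rule summable_sums)
 have "(%m. (norm (\<Sum>n<m. cinner f (v n) *\<^sub>C u n))^2) \<longlonglongrightarrow> (norm (frame_op v u f))^2"
  using s unfolding sums_def by (intro tendsto_intros)
 moreover have "(norm (\<Sum>n<m. cinner f (v n) *\<^sub>C u n))^2 <= B * (A * (norm f)^2)" for m
  using bessel_synthesis[OF u, of "{..<m}" "%n. cinner f (v n)"] besselD[OF v, of "{..<m}" f] AB
  by (meson finite_lessThan mult_left_mono order_trans)
 ultimately have "(norm (frame_op v u f))^2 <= B * (A * (norm f)^2)" by (intro tendsto_upperbound[OF _ always_eventually]) auto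
 then have "(norm (frame_op v u f))^2 <= (sqrt (A * B) * norm f)^2" using AB by (simp add: power_mult_distrib mult_ac)
 then show "norm (frame_op v u f) <= sqrt (A * B) * norm f" by (rule power2_le_imp_le) (use AB in auto)
qed

lemma frame_op_add:
 assumes "bessel A v" "bessel B u"
 shows "frame_op v u (f + g) = frame_op v u f + frame_op v u g"
 using sums_unique2[OF frame_op_sums[OF assms, of "f + g"] ]
  sums_add[OF frame_op_sums[OF assms, of f] frame_op_sums[OF assms, of g]]
 by (simp add: cinner_add_left L2.scale_left_distrib)

lemma frame_op_scaleC:
 assumes "bessel A v" "bessel B u"
 shows "frame_op v u (c *\<^sub>C f) = c *\<^sub>C frame_op v u f"
 using sums_unique2[OF frame_op_sums[OF assms, of "c *\<^sub>C f"] ]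
  bounded_linear.sums[OF bounded_linear_scaleC frame_op_sums[OF assms, of f], of c]
 by (simp add: cinner_scaleC_left)

lemma frame_op_bounded_linear:
 assumes "bessel A v" "bessel B u"
 shows "bounded_linear (frame_op v u)"
 by (rule bounded_linear_intro[where K = "sqrt (A * B)"]) (use frame_op_add[OF assms] frame_op_scaleC[OF assms] frame_op_norm[OF assms]
   in \<open>auto simp: scaleR_scaleC mult.commute\<close>)

lemma cinner_frame_op:
 assumes "bessel A v" "bessel B u"
 shows "cinner (frame_op v u f) g = cinner f (frame_op u v g)"
proof -
 have "(%n. cinner f (v n) * cinner (u n) g) sums cinner (frame_op v u f) g"
  using bounded_linear.sums[OF bounded_linear_cinner_left frame_op_sums[OF assms, of f], of g]
  by (simp add: cinner_scaleC_left)
 moreover have "(%n. cinner f (v n) * cinner (u n) g) sums cinner f (frame_op u v g)"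
  using bounded_linear.sums[OF bounded_linear_cinner_right frame_op_sums[OF assms(2,1), of g], of f]
  by (simp add: cinner_scaleC_right cinner_commute[of g] mult.commute)
 ultimately show ?thesis by (rule sums_unique2)
qed

lemma frame_op_single:
 assumes "!!n. cinner f (v n) = (if n = m then c else 0)"
 shows "frame_op v u f = c *\<^sub>C u m"
proof -
 have "(%n. cinner f (v n) *\<^sub>C u n) = (%n. if n = m then c *\<^sub>C u m else 0)" using assms by auto
 then show ?thesis unfolding frame_op_def using sums_unique[OF sums_single[of m "%_. c *\<^sub>C u m"]] by simp
qed

lemma eq_on_dense_span:
 assumes T: "bounded_linear T" "!!c f. T (c *\<^sub>C f) = c *\<^sub>C T f"
  and eq: "!!s. s \<in> S ==> T s = s" and dense: "closure (L2.span S) = UNIV"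
 shows "T f = f"
proof -
 have "closed {f. T f = f}" by (intro closed_Collect_eq continuous_intros linear_continuous_on T)
 moreover have "L2.span S \<subseteq> {f. T f = f}"
 proof
  fix f assume "f \<in> L2.span S"
  then show "f \<in> {f. T f = f}" by (induction rule: L2.span_induct_alt) (use eq T in \<open>auto simp: linear_simps\<close>)
 qed
 ultimately have "closure (L2.span S) \<subseteq> {f. T f = f}" by (rule closure_minimal[rotated])
 then show ?thesis using dense by auto
qed

text \<open>Division by 0 yields 0, so a vector that depends on its predecessors produces the zero
  vector. For every input sequence the output consists of orthonormal vectors and zeros.\<close>

fun gs :: "(nat => L2) => nat => L2" where
 "gs u n = (let w = u n - (\<Sum>k<n. cinner (u n) (gs u k) *\<^sub>C gs u k) in of_real (1 / norm w) *\<^sub>C w)"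

declare gs.simps [simp del]

definition gsw :: "(nat => L2) => nat => L2" where
 "gsw u n = u n - (\<Sum>k<n. cinner (u n) (gs u k) *\<^sub>C gs u k)"

lemma gs_eq: "gs u n = of_real (1 / norm (gsw u n)) *\<^sub>C gsw u n" by (subst gs.simps) (simp add: gsw_def Let_def)

lemma gs_norm: "norm (gs u n) = (if gsw u n = 0 then 0 else 1)" by (simp add: gs_eq norm_scaleC norm_divide)

lemma gs_orth: "j < n ==> cinner (gs u n) (gs u j) = 0"
proof (induction n arbitrary: j rule: less_induct)
 case (less n)
 have sym: "cinner (gs u k) (gs u j) = 0" if "k < n" "k ~= j" for k
  using less.IH[of k j] less.IH[of j k] cinner_commute[of "gs u k" "gs u j"] that less.prems
  by (cases "j < k") auto
 have self: "cinner (gs u j) (gs u j) *\<^sub>C gs u j = gs u j" unfolding cinner_self gs_norm by (auto simp: gs_eq)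
 have s2: "cinner (u n) (gs u j) * cinner (gs u j) (gs u j) = cinner (u n) (gs u j)"
  using arg_cong[OF self, of "%z. cinner (u n) z"] by (simp add: cinner_scaleC_right cinner_self mult.commute)
 have "cinner (gsw u n) (gs u j) = cinner (u n) (gs u j) - (\<Sum>k<n. cinner (u n) (gs u k) * cinner (gs u k) (gs u j))"
  by (simp add: gsw_def cinner_diff_left cinner_sum_left cinner_scaleC_left)
 also have "(\<Sum>k<n. cinner (u n) (gs u k) * cinner (gs u k) (gs u j)) =
   (\<Sum>k<n. if k = j then cinner (u n) (gs u j) * cinner (gs u j) (gs u j) else 0)"
  by (rule sum.cong) (auto simp: sym)
 also have "\<dots> = cinner (u n) (gs u j)" using less.prems s2 by simp
 finally show ?case by (simp add: gs_eq[of u n] cinner_scaleC_left)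
qed

lemma gs_cinner: "cinner (gs u n) (gs u m) = (if n = m \<and> gsw u n ~= 0 then 1 else 0)"
 using gs_orth[of m n u] gs_orth[of n m u] cinner_commute[of "gs u n" "gs u m"]
 by (cases n m rule: linorder_cases) (auto simp: cinner_self gs_norm)

lemma gs_in_span: "gs u n \<in> L2.span (u ` {..n})"
proof (induction n rule: less_induct)
 case (less n)
 have "gs u k \<in> L2.span (u ` {..n})" if "k < n" for k
  using less[OF that] L2.span_mono[of "u ` {..k}" "u ` {..n}"] that by (auto simp: image_mono)
 then have "gsw u n \<in> L2.span (u ` {..n})"
  unfolding gsw_def by (intro L2.span_diff L2.span_sum L2.span_scale) (auto intro: L2.span_base)
 then show ?case unfolding gs_eq by (rule L2.span_scale)
qed

lemma in_span_gs: "u n \<in> L2.span (gs u ` {..n})"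
proof -
 have "gsw u n = of_real (norm (gsw u n)) *\<^sub>C gs u n" by (cases "gsw u n = 0") (auto simp: gs_eq)
 then have "u n = of_real (norm (gsw u n)) *\<^sub>C gs u n + (\<Sum>k<n. cinner (u n) (gs u k) *\<^sub>C gs u k)"
  by (simp add: gsw_def algebra_simps)
 also have "\<dots> \<in> L2.span (gs u ` {..n})" by (intro L2.span_add L2.span_sum L2.span_scale L2.span_base) auto
 finally show ?thesis .
qed

lemma orthonormal_bessel:
 assumes "finite F" and on: "!!j k. j \<in> F ==> k \<in> F ==> j ~= k ==> cinner (e j) (e k) = 0"
  "!!k. k \<in> F ==> e k = 0 \<or> cinner (e k) (e k) = 1"
 shows "(\<Sum>k\<in>F. (cmod (cinner f (e k)))^2) <= (norm f)^2"
proof -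
 define c where "c k = cinner f (e k)" for k
 define s where "s = (\<Sum>k\<in>F. c k *\<^sub>C e k)"
 define N where "N = (\<Sum>k\<in>F. (cmod (c k))^2)"
 have q: "of_real ((cmod w)^2) = w * cnj w" for w by (rule complex_norm_square)
 have fs: "cinner f s = of_real N"
  by (simp add: s_def cinner_sum_right cinner_scaleC_right N_def q mult.commute flip: c_def del: of_real_power)
 have "cinner s (e k) = c k" if "k \<in> F" for k
 proof -
  have "cinner s (e k) = (\<Sum>j\<in>F. if k = j then c k else 0)"
   unfolding s_def cinner_sum_left cinner_scaleC_left using on(1) on(2)[OF that] that by (intro sum.cong) (auto simp: c_def)
  then show ?thesis using assms(1) that by simp
 qed
 then have ss: "cinner s s = of_real N"
  by (subst (2) s_def) (simp add: cinner_sum_right cinner_scaleC_right N_def q mult.commute del: of_real_power)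
 have sf: "cinner s f = of_real N" using cinner_commute[of s f] fs by simp
 have "cinner (f - s) (f - s) = of_real ((norm f)^2) - of_real N"
  unfolding cinner_diff_left cinner_diff_right fs ss sf cinner_self[of f] by simp
 then have "(norm (f - s))^2 = (norm f)^2 - N" unfolding cinner_self of_real_diff[symmetric] of_real_eq_iff .
 then show ?thesis using zero_le_power2[of "norm (f - s)"] by (simp add: N_def c_def)
qed

lemma bessel_gs: "bessel 1 (gs u)"
proof -
 have "gs u n = 0" if "gsw u n = 0" for n using that by (simp add: gs_eq)
 then show ?thesis unfolding bessel_def by (intro conjI allI impI; simp) (rule orthonormal_bessel; auto simp: gs_cinner)
qed

text \<open>The isomorphism sends \<open>u n\<close> to the orthonormal vectors obtained from the \<open>u n\<close> by the
  Gram--Schmidt process.\<close>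

theorem riesz_basis_criterion:
 assumes u: "bessel A u" and v: "bessel B v" and bi: "!!m n. cinner (u m) (v n) = (if m = n \<and> n \<in> I then 1 else 0)"
  and zero: "!!n. n \<notin> I ==> u n = 0"
  and dense: "closure (L2.span (u ` I)) = UNIV"
 shows "riesz_basis (u ` I)"
proof -
 define e where "e = gs u"
 have e: "bessel 1 e" unfolding e_def by (rule bessel_gs)
 \<comment> \<open>For \<open>n\<close> in \<open>I\<close> the remainder cannot vanish:
   \<open>v n\<close> annihilates all earlier \<open>u k\<close>, but not
   \<open>u n\<close>.\<close>
 have nz: "gsw u n = 0 \<longleftrightarrow> n \<notin> I" for n
 proof
  assume w: "gsw u n = 0"
  have "L2.span (u ` {..<n}) \<subseteq> {f. cinner f (v n) = 0}"
  proof
   fix f assume "f \<in> L2.span (u ` {..<n})"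
   then show "f \<in> {f. cinner f (v n) = 0}" by (induction rule: L2.span_induct_alt) (auto simp: cinner_add_left cinner_scaleC_left bi)
  qed
  moreover have "u n \<in> L2.span (u ` {..<n})"
  proof -
   have "u n = (\<Sum>k<n. cinner (u n) (gs u k) *\<^sub>C gs u k)" using w by (simp add: gsw_def)
   also have "\<dots> \<in> L2.span (u ` {..<n})"
   proof (intro L2.span_sum L2.span_scale)
    fix k assume "k \<in> {..<n}"
    then have "u ` {..k} \<subseteq> u ` {..<n}" by (intro image_mono) auto
    then show "gs u k \<in> L2.span (u ` {..<n})" using gs_in_span[of u k] L2.span_mono by blast
   qed
   finally show ?thesis .
  qed
  ultimately show "n \<notin> I" using bi[of n n] by auto
 next
  assume "n \<notin> I"
  then have un: "u n = 0" by (rule zero)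
  show "gsw u n = 0" unfolding gsw_def un by simp
 qed
 have eI: "cinner (e m) (e n) = (if m = n \<and> n \<in> I then 1 else 0)" for m n unfolding e_def gs_cinner nz by auto
 have e0: "e n = 0" if "n \<notin> I" for n using nz[of n] that by (simp add: e_def gs_eq)
 \<comment> \<open>\<open>T\<close> and \<open>T'\<close> exchange \<open>u n\<close> and
   \<open>e n\<close>; being bounded and inverse to each other on the two dense spans, they are
   inverse everywhere.\<close>
 define T where "T = frame_op v e"
 define T' where "T' = frame_op e u"
 have Tu: "T (u n) = e n" for n
 proof (cases "n \<in> I")
  case True then show ?thesis unfolding T_def by (subst frame_op_single[where m = n and c = 1]) (auto simp: bi)
 next
  case False then show ?thesis unfolding T_def by (subst frame_op_single[where m = n and c = 0]) (auto simp: bi e0)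
 qed
 have Te: "T' (e n) = u n" for n
 proof (cases "n \<in> I")
  case True then show ?thesis unfolding T'_def by (subst frame_op_single[where m = n and c = 1]) (auto simp: eI)
 next
  case False then show ?thesis unfolding T'_def by (subst frame_op_single[where m = n and c = 0]) (auto simp: eI zero)
 qed
 have bT: "bounded_linear T" "bounded_linear T'" unfolding T_def T'_def using frame_op_bounded_linear u v e by blast+
 have sT: "T (c *\<^sub>C f) = c *\<^sub>C T f" "T' (c *\<^sub>C f) = c *\<^sub>C T' f" for c f
  unfolding T_def T'_def using frame_op_scaleC u v e by blast+
 have "L2.span (u ` I) \<subseteq> L2.span (e ` I)"
 proof (rule L2.span_minimal)
  show "u ` I \<subseteq> L2.span (e ` I)"
  proof
   fix x assume "x \<in> u ` I"
   then obtain n where "x = u n" by auto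
   moreover have "u n \<in> L2.span (e ` {..n})" unfolding e_def by (rule in_span_gs)
   moreover have "L2.span (e ` {..n}) \<subseteq> L2.span (insert 0 (e ` I))" by (rule L2.span_mono) (use e0 in blast)
   ultimately show "x \<in> L2.span (e ` I)" by (auto simp: L2.span_insert_0)
  qed
 qed auto
 then have dense': "closure (L2.span (e ` I)) = UNIV" using dense closure_mono by blast
 have TT: "T' (T f) = f" for f by (rule eq_on_dense_span[of "%f. T' (T f)", OF _ _ _ dense])
    (use bounded_linear_compose[OF bT(2,1)] in \<open>auto simp: sT Tu Te\<close>)
 have TT': "T (T' f) = f" for f by (rule eq_on_dense_span[of "%f. T (T' f)", OF _ _ _ dense'])
    (use bounded_linear_compose[OF bT(1,2)] in \<open>auto simp: sT Tu Te\<close>)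
 have "homeomorphism UNIV UNIV T T'"
 proof -
  have "surj T" by (rule surjI[of T T', OF TT'])
  moreover have "surj T'" by (rule surjI[of T' T, OF TT])
  ultimately show ?thesis unfolding homeomorphism_def using TT TT' bT linear_continuous_on by blast
 qed
 moreover have "Vector_Spaces.linear scaleC scaleC T" by unfold_locales (use bT(1) sT in \<open>auto simp: linear_simps\<close>)
 moreover have "T ` (u ` I) = e ` I" by (auto simp: Tu image_image)
 moreover have "orthonormal_basis (e ` I)" unfolding orthonormal_basis_def using dense' eI by auto (metis zero_neq_one)+
 ultimately show ?thesis unfolding riesz_basis_def by metis
qed

text \<open>Append \<open>w\<close> to an enumeration of \<open>F\<close>. Its Gram-Schmidt
  remainder \<open>r\<close> is orthogonal to \<open>F\<close>, nonzero because \<open>w\<close> is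
  outside the span, and pairs with \<open>w\<close> to the square of its own norm; a rescaling gives
  1.\<close>

lemma exists_dual_vector:
 assumes F: "finite F" and w: "w \<notin> L2.span F"
 shows "\<exists>r. (\<forall>x\<in>F. cinner x r = 0) \<and> cinner w r = 1"
proof -
 obtain N and f :: "nat => L2" where f: "F = f ` {i. i < N}" using F finite_imp_nat_seg_image_inj_on by metis
 define u where "u n = (if n < N then f n else w)" for n
 have uF: "u ` {..<N} = F" unfolding f by (auto simp: u_def)
 define r where "r = gsw u N"
 have gsF: "gs u k \<in> L2.span F" if "k < N" for k
 proof -
  have "u ` {..k} \<subseteq> F" unfolding uF[symmetric] using that by (intro image_mono) auto
  then show ?thesis using gs_in_span[of u k] L2.span_mono by blast
 qed
 have r0: "r ~= 0"
 proof
  assume "r = 0"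
  then have "w = (\<Sum>k<N. cinner (u N) (gs u k) *\<^sub>C gs u k)" by (simp add: r_def gsw_def u_def)
  also have "\<dots> \<in> L2.span F" by (intro L2.span_sum L2.span_scale gsF) auto
  finally show False using w by simp
 qed
 have rg: "cinner (gs u k) r = 0" if "k < N" for k
 proof -
  have "r = of_real (norm r) *\<^sub>C gs u N" using r0 by (simp add: gs_eq r_def)
  then show ?thesis using that by (metis gs_cinner cinner_scaleC_right mult_zero_right nat_neq_iff)
 qed
 have xr: "cinner x r = 0" if xF: "x \<in> F" for x
 proof -
  obtain n where n: "n < N" "x = u n" using xF unfolding uF[symmetric] by auto
  have "L2.span (gs u ` {..n}) \<subseteq> {x. cinner x r = 0}"
  proof
   fix f assume "f \<in> L2.span (gs u ` {..n})"
   then show "f \<in> {x. cinner x r = 0}"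
    by (induction rule: L2.span_induct_alt) (use n in \<open>auto simp: cinner_add_left cinner_scaleC_left rg\<close>)
  qed
  then show ?thesis using in_span_gs[of u n] n by auto
 qed
 have "cinner w r = cinner r r + (\<Sum>k<N. cinner (u N) (gs u k) * cinner (gs u k) r)"
  by (simp add: r_def gsw_def u_def cinner_diff_left cinner_sum_left cinner_scaleC_left)
 then have wr: "cinner w r = of_real ((norm r)^2)" by (simp add: rg cinner_self)
 show ?thesis by (intro exI[of _ "of_real (1 / (norm r)^2) *\<^sub>C r"]) (use r0 in \<open>auto simp: cinner_scaleC_right xr wr\<close>)
qed

lemma bessel_shift:
 assumes "bessel C v"
 shows "\<exists>C'. bessel C' (%n. if n < k then w n else v (n - k))"
proof (intro exI)
 let ?C' = "(\<Sum>i<k. (norm (w i))^2) + C"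
 show "bessel ?C' (%n. if n < k then w n else v (n - k))" unfolding bessel_def
 proof (intro conjI allI impI)
  show "0 <= ?C'" using assms by (auto simp: bessel_def intro!: add_nonneg_nonneg sum_nonneg)
  fix f and F :: "nat set" assume F: "finite F"
  let ?g = "%n. (cmod (cinner f (if n < k then w n else v (n - k))))^2"
  have "sum ?g F = sum ?g (F \<inter> {..<k}) + sum ?g (F - {..<k})" using F by (rule sum.Int_Diff)
  also have "sum ?g (F \<inter> {..<k}) <= (\<Sum>i<k. (cmod (cinner f (w i)))^2)" by (rule order_trans[OF sum_mono2[of "{..<k}"]]) auto
  also have "\<dots> <= (\<Sum>i<k. (norm (w i))^2 * (norm f)^2)"
  proof (rule sum_mono)
   fix i
   have "(cmod (cinner f (w i)))^2 <= (norm f * norm (w i))^2" by (rule power_mono[OF cinner_Cauchy_Schwarz]) simp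
   then show "(cmod (cinner f (w i)))^2 <= (norm (w i))^2 * (norm f)^2" by (simp add: power_mult_distrib mult.commute)
  qed
  also have "sum ?g (F - {..<k}) = (\<Sum>n\<in>(%n. n - k) ` (F - {..<k}). (cmod (cinner f (v n)))^2)"
   by (subst sum.reindex) (auto simp: inj_on_def intro!: sum.cong)
  also have "\<dots> <= C * (norm f)^2" by (rule besselD[OF assms]) (use F in auto)
  finally show "sum ?g F <= ?C' * (norm f)^2" by (simp add: sum_distrib_right distrib_right)
 qed
qed

text \<open>The dual vectors \<open>d j\<close> of the finite set \<open>W\<close> need not
  annihilate the \<open>u n\<close>. The operator \<open>P = frame_op v u\<close> fixes every
  \<open>u n\<close> and kills \<open>W\<close>, and its adjoint is \<open>frame_op u v\<close>;
  subtracting the adjoint applied to \<open>d j\<close> makes the vector orthogonal to all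
  \<open>u n\<close> without changing its products with \<open>W\<close>. The enlarged families are
  then biorthogonal.\<close>

lemma riesz_basis_criterion_finite:
 assumes u: "bessel A u" and v: "bessel B v" and bi: "!!m n. cinner (u m) (v n) = (if m = n \<and> n \<in> I then 1 else 0)"
  and zero: "!!n. n \<notin> I ==> u n = 0"
  and W: "finite W" "L2.independent W" "!!w n. w \<in> W ==> cinner w (v n) = 0"
  and dense: "closure (L2.span (W \<union> u ` I)) = UNIV"
 shows "riesz_basis (W \<union> u ` I)"
proof -
 define k where "k = card W"
 obtain w where w: "bij_betw w {..<k} W" using ex_bij_betw_nat_finite[OF W(1)] by (auto simp: k_def atLeast0LessThan)
 have wW: "w i \<in> W" if "i < k" for i using w that by (auto simp: bij_betw_def)
 have winj: "w i = w j \<longleftrightarrow> i = j" if "i < k" "j < k" for i j using w that by (auto simp: bij_betw_def inj_on_def)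
 have "\<exists>d. (\<forall>x\<in>W - {w j}. cinner x d = 0) \<and> cinner (w j) d = 1" if "j < k" for j
  by (rule exists_dual_vector) (use W wW[OF that] in \<open>auto simp: L2.dependent_def\<close>)
 then obtain d where d: "!!j x. j < k ==> x \<in> W - {w j} ==> cinner x (d j) = 0" "!!j. j < k ==> cinner (w j) (d j) = 1" by metis
 have wd: "cinner (w i) (d j) = (if i = j then 1 else 0)" if "i < k" "j < k" for i j
  using d[OF that(2)] wW[OF that(1)] winj[OF that] by auto
 define P where "P = frame_op v u"
 have Pw: "P (w i) = 0" if "i < k" for i using frame_op_single[of "w i" v 0 0 u] W(3)[OF wW[OF that]] by (simp add: P_def)
 have Pu: "P (u n) = u n" for n
 proof (cases "n \<in> I")
  case True then show ?thesis unfolding P_def by (subst frame_op_single[where m = n and c = 1]) (auto simp: bi)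
 next
  case False then show ?thesis unfolding P_def by (subst frame_op_single[where m = n and c = 0]) (auto simp: bi zero)
 qed
 have Pad: "cinner f (frame_op u v g) = cinner (P f) g" for f g unfolding P_def using cinner_frame_op[OF v u] by simp
 define u' where "u' n = (if n < k then w n else u (n - k))" for n
 define v' where "v' n = (if n < k then d n - frame_op u v (d n) else v (n - k))" for n
 obtain A' where A': "bessel A' u'" unfolding u'_def using bessel_shift[OF u] by blast
 obtain B' where B': "bessel B' v'" unfolding v'_def using bessel_shift[OF v, of k "%n. d n - frame_op u v (d n)"] by blast
 define I' where "I' = {..<k} \<union> {n. k <= n \<and> n - k \<in> I}"
 have img: "u' ` I' = W \<union> u ` I"
 proof -
  have "u' ` {..<k} = W" using w by (auto simp: u'_def bij_betw_def)
  moreover have "u' ` {n. k <= n \<and> n - k \<in> I} = u ` I"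
  proof
   show "u ` I \<subseteq> u' ` {n. k <= n \<and> n - k \<in> I}"
   proof
    fix x assume "x \<in> u ` I"
    then obtain n where "n \<in> I" "x = u n" by auto
    then show "x \<in> u' ` {n. k <= n \<and> n - k \<in> I}" by (intro image_eqI[of _ _ "n + k"]) (auto simp: u'_def)
   qed
  qed (auto simp: u'_def)
  ultimately show ?thesis by (simp add: I'_def image_Un)
 qed
 have bi': "cinner (u' m) (v' n) = (if m = n \<and> n \<in> I' then 1 else 0)" for m n
 proof -
  consider "m < k" "n < k" | "m < k" "\<not> n < k" | "\<not> m < k" "n < k" | "\<not> m < k" "\<not> n < k" by blast
  then show ?thesis
  proof cases
   case 1 then show ?thesis by (auto simp: u'_def v'_def I'_def cinner_diff_right Pad Pw wd)
  next
   case 2 then show ?thesis by (auto simp: u'_def v'_def I'_def W(3) wW)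
  next
   case 3 then show ?thesis by (auto simp: u'_def v'_def I'_def cinner_diff_right Pad Pu)
  next
   case 4 then show ?thesis by (auto simp: u'_def v'_def I'_def bi)
  qed
 qed
 have z: "u' n = 0" if "n \<notin> I'" for n using that zero by (auto simp: u'_def I'_def)
 have dn: "closure (L2.span (u' ` I')) = UNIV" using dense by (simp only: img)
 have "riesz_basis (u' ` I')" by (rule riesz_basis_criterion[OF A' B' bi' z dn])
 then show ?thesis by (simp add: img)
qed

section \<open>The operator in terms of integrated first order systems\<close>

text \<open>The equation \<open>(L - l) y = g\<close> without boundary conditions, solved for the
  derivatives and integrated; \<open>p\<close> and \<open>q\<close> are the entries
  \<open>Q12\<close> and \<open>Q21\<close> of the potential.\<close>

definition solves :: "real => real => (real => complex) => (real => complex) => complex =>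
  (real => complex^2) => (real => complex^2) => bool" where
 "solves b1 b2 p q l g y \<longleftrightarrow>
   acd (%x. y x $ 1) (%x. \<i> * b1 * (l * y x $ 1 + g x $ 1 - p x * y x $ 2)) \<and>
   acd (%x. y x $ 2) (%x. \<i> * b2 * (l * y x $ 2 + g x $ 2 - q x * y x $ 1))"

lemma sq_integrable_cong_AE:
 assumes f: "sq_integrable f" and eq: "AE x in unit_leb. f x = g x"
 shows "sq_integrable g"
proof -
 have "(%x. if x \<in> {0..1} then f x else 0) \<in> borel_measurable lebesgue"
  using f by (subst borel_measurable_if) (auto simp: sq_integrable_def)
 moreover have "AE x in lebesgue. (if x \<in> {0..1} then f x else 0) = (if x \<in> {0..1} then g x else 0)"
  using eq by (subst (asm) AE_restrict_space_iff) (auto elim!: eventually_mono)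
 ultimately have "(%x. if x \<in> {0..1} then g x else 0) \<in> borel_measurable lebesgue" by (rule borel_measurable_AE)
 then have m: "g \<in> borel_measurable unit_leb" by (subst (asm) borel_measurable_if) auto
 have "integrable unit_leb (%x. (norm (f x))^2) \<longleftrightarrow> integrable unit_leb (%x. (norm (g x))^2)"
  by (rule integrable_cong_AE) (use f m eq in \<open>auto simp: sq_integrable_def elim!: eventually_mono\<close>)
 then show ?thesis using f m by (simp add: sq_integrable_def)
qed

lemma abs_L2_cong_AE:
 assumes "sq_integrable f" "AE x in unit_leb. f x = g x"
 shows "abs_L2 f = abs_L2 g"
 using abs_L2_eqI[OF assms(1) sq_integrable_cong_AE[OF assms] assms(2)] .

lemma abs_continuous_on_unit_iff:
 "abs_continuous_on_unit y \<longleftrightarrow> (\<exists>f1 f2. acd (%x. y x $ 1) f1 \<and> acd (%x. y x $ 2) f2)"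
proof -
 have eq: "abs_continuous_on_unit y \<longleftrightarrow> abs_cont y"
  by (simp add: abs_continuous_on_unit_def abs_cont_def interval_family_def vsum_def)
 show ?thesis unfolding eq
 proof
  assume y: "abs_cont y"
  have "abs_cont (%x. y x $ k)" for k
  proof (rule abs_cont_le[OF y y, where M = 1])
   fix s t show "norm (y t $ k - y s $ k) <= 1 * (norm (y t - y s) + norm (y t - y s))"
    using order_trans[OF Finite_Cartesian_Product.norm_nth_le[of "y t - y s" k], of "2 * norm (y t - y s)"] by simp
  qed
  then show "\<exists>f1 f2. acd (%x. y x $ 1) f1 \<and> acd (%x. y x $ 2) f2" using abs_cont_imp_acd by blast
 next
  assume "\<exists>f1 f2. acd (%x. y x $ 1) f1 \<and> acd (%x. y x $ 2) f2"
  then have f: "abs_cont (%x. y x $ 1)" "abs_cont (%x. y x $ 2)" using acd_imp_abs_cont by blast+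
  show "abs_cont y"
  proof (rule abs_cont_le[OF f, where M = 1])
   have tri: "norm v <= norm (v $ 1) + norm (v $ 2)" for v :: "complex^2" by (rule power2_le_imp_le) (auto simp: norm_sq_vec2 power2_sum)
   fix s t show "norm (y t - y s) <= 1 * (norm (y t $ 1 - y s $ 1) + norm (y t $ 2 - y s $ 2))" using tri[of "y t - y s"] by simp
  qed
 qed
qed

lemma diff_expr_nth:
 assumes "b1 ~= 0" "b2 ~= 0"
 shows "diff_expr b1 b2 (Q_mat p q) y x $ 1 = - \<i> * vector_derivative y (at x within {0..1}) $ 1 / b1 + p x * y x $ 2"
  "diff_expr b1 b2 (Q_mat p q) y x $ 2 = - \<i> * vector_derivative y (at x within {0..1}) $ 2 / b2 + q x * y x $ 1"
proof -
 define M :: "complex^2^2" where "M = vector [vector [1 / of_real b1, 0], vector [0, 1 / of_real b2]]"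
 have 1: "B_mat b1 b2 ** M = mat 1" "M ** B_mat b1 b2 = mat 1"
  using assms by (auto simp: M_def B_mat_def matrix_matrix_mult_def vec_eq_iff sum_2 forall_2 mat_def)
 have "B_mat b1 b2 ** matrix_inv (B_mat b1 b2) = mat 1 \<and> matrix_inv (B_mat b1 b2) ** B_mat b1 b2 = mat 1"
  unfolding matrix_inv_def by (rule someI[of _ M]) (use 1 in simp)
 then have "matrix_inv (B_mat b1 b2) = M" using 1(1) by (metis matrix_mul_assoc matrix_mul_lid matrix_mul_rid)
 then show "diff_expr b1 b2 (Q_mat p q) y x $ 1 = - \<i> * vector_derivative y (at x within {0..1}) $ 1 / b1 + p x * y x $ 2"
  "diff_expr b1 b2 (Q_mat p q) y x $ 2 = - \<i> * vector_derivative y (at x within {0..1}) $ 2 / b2 + q x * y x $ 1"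
  by (auto simp: diff_expr_def Q_mat_def matrix_vector_mult_def sum_2 M_def)
qed

lemma has_vector_derivative_vec2:
 fixes y :: "real => complex^2"
 assumes "((%x. y x $ 1) has_vector_derivative d1) (at x within S)" "((%x. y x $ 2) has_vector_derivative d2) (at x within S)"
 shows "(y has_vector_derivative (vector [d1, d2] :: complex^2)) (at x within S)"
proof -
 have bl: "bounded_linear (%z. axis k z :: complex^2)" for k
  by (rule linear_conv_bounded_linear[THEN iffD1], rule linearI) (auto simp: axis_def vec_eq_iff)
 have "((%x. axis 1 (y x $ 1) + axis 2 (y x $ 2) :: complex^2) has_vector_derivative (axis 1 d1 + axis 2 d2)) (at x within S)"
  by (intro has_vector_derivative_add bounded_linear.has_vector_derivative[OF bl] assms)
 moreover have "(%x. axis 1 (y x $ 1) + axis 2 (y x $ 2)) = y" by (auto simp: axis_def vec_eq_iff forall_2)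
 moreover have "axis 1 d1 + axis 2 d2 = (vector [d1, d2] :: complex^2)" by (auto simp: axis_def vec_eq_iff forall_2)
 ultimately show ?thesis by simp
qed

text \<open>Both directions rest on the differentiation theorem: the pointwise derivative in
  \<open>diff_expr\<close> agrees almost everywhere with the integrand of \<open>acd\<close>, so
  \<open>g\<close> and \<open>diff_expr\<close> represent the same element of L2.\<close>

lemma L_op_iff:
 assumes b: "b1 ~= 0" "b2 ~= 0"
 shows "(u, v) \<in> L_op b1 b2 (Q_mat p q) a b c d \<longleftrightarrow>
  (\<exists>y g. u = abs_L2 y \<and> v = abs_L2 g \<and> sq_integrable g \<and> solves b1 b2 p q 0 g y \<and> boundary_conds a b c d y)"
proof
 have vd: "AE x in unit_leb. vector_derivative y (at x within {0..1}) = vector [f1 x, f2 x]"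
  if f: "acd (%x. y x $ 1) f1" "acd (%x. y x $ 2) f2" for y :: "real => complex^2" and f1 f2
  using lebesgue_differentiation[OF f(1)] lebesgue_differentiation[OF f(2)] AE_space
 proof eventually_elim
  case (elim x)
  then show ?case by (intro vector_derivative_within_closed_interval has_vector_derivative_vec2) auto
 qed
 { assume "(u, v) \<in> L_op b1 b2 (Q_mat p q) a b c d"
  then obtain y where y: "u = abs_L2 y" "v = abs_L2 (diff_expr b1 b2 (Q_mat p q) y)" "abs_continuous_on_unit y"
   "sq_integrable (diff_expr b1 b2 (Q_mat p q) y)" "boundary_conds a b c d y"
   by (auto simp: L_op_def)
  obtain f1 f2 where f: "acd (%x. y x $ 1) f1" "acd (%x. y x $ 2) f2" using y(3) abs_continuous_on_unit_iff by blast
  define g where "g = diff_expr b1 b2 (Q_mat p q) y"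
  have "acd (%x. y x $ 1) (%x. \<i> * b1 * (0 * y x $ 1 + g x $ 1 - p x * y x $ 2))" by (rule acd_deriv_cong_AE[OF f(1)])
     (use vd[OF f] in \<open>eventually_elim, use b in \<open>simp add: g_def diff_expr_nth\<close>\<close>)
  moreover have "acd (%x. y x $ 2) (%x. \<i> * b2 * (0 * y x $ 2 + g x $ 2 - q x * y x $ 1))" by (rule acd_deriv_cong_AE[OF f(2)])
     (use vd[OF f] in \<open>eventually_elim, use b in \<open>simp add: g_def diff_expr_nth\<close>\<close>)
  ultimately have "solves b1 b2 p q 0 g y" by (simp add: solves_def)
  then show "\<exists>y g. u = abs_L2 y \<and> v = abs_L2 g \<and> sq_integrable g \<and> solves b1 b2 p q 0 g y \<and> boundary_conds a b c d y"
   using y g_def by blast }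
 { assume "\<exists>y g. u = abs_L2 y \<and> v = abs_L2 g \<and> sq_integrable g \<and> solves b1 b2 p q 0 g y \<and> boundary_conds a b c d y"
  then obtain y g where y: "u = abs_L2 y" "v = abs_L2 g" "sq_integrable g" "solves b1 b2 p q 0 g y" "boundary_conds a b c d y" by blast
  have f: "acd (%x. y x $ 1) (%x. \<i> * b1 * (0 * y x $ 1 + g x $ 1 - p x * y x $ 2))"
   "acd (%x. y x $ 2) (%x. \<i> * b2 * (0 * y x $ 2 + g x $ 2 - q x * y x $ 1))"
   using y(4) by (auto simp: solves_def)
  then have ac: "abs_continuous_on_unit y" using abs_continuous_on_unit_iff by blast
  have ae: "AE x in unit_leb. g x = diff_expr b1 b2 (Q_mat p q) y x"
   using vd[OF f] by eventually_elim (use b in \<open>simp add: vec_eq_iff forall_2 diff_expr_nth\<close>)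
  have "v = abs_L2 (diff_expr b1 b2 (Q_mat p q) y)" "sq_integrable (diff_expr b1 b2 (Q_mat p q) y)"
   using abs_L2_cong_AE[OF y(3) ae] sq_integrable_cong_AE[OF y(3) ae] y(2) by auto
  then show "(u, v) \<in> L_op b1 b2 (Q_mat p q) a b c d" unfolding L_op_def using y ac by blast }
qed

section \<open>Linear first order systems\<close>

abbreviation "L1n f \<equiv> integral {0..1::real} (%x. norm (f x :: complex))"

lemma acd_power: "acd K k ==> acd (%x. K x ^ Suc n) (%x. of_nat (Suc n) * K x ^ n * k x)"
proof (induction n)
 case 0 then show ?case by simp
next
 case (Suc n)
 from acd_mult[OF Suc.prems Suc.IH[OF Suc.prems]] show ?case by (rule acd_cong) (auto simp: algebra_simps)
qed

lemma ai_norm: "f absolutely_integrable_on {0..1} ==> (%x. norm (f x)) absolutely_integrable_on {0..1}" for f :: "real => complex"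
 by (drule absolutely_integrable_norm) (simp add: o_def)

text \<open>The substitution rule for the primitive of a merely integrable function, obtained from
  the product rule for \<open>acd\<close>. It is the source of the factorials in the Picard
  iteration.\<close>

lemma integral_power_primitive:
 fixes k :: "real => real"
 assumes k: "k absolutely_integrable_on {0..1}" and x: "x \<in> {0..1}"
 defines "K \<equiv> %x. integral {0..x} k"
 shows "(%t. K t ^ n * k t) absolutely_integrable_on {0..1}"
  "integral {0..x} (%t. K t ^ n * k t) = K x ^ Suc n / real (Suc n)"
proof -
 have kc: "acd (%x. complex_of_real (K x)) (%x. complex_of_real (k x))"
  unfolding acd_def using ai_of_real[OF k] by (auto simp: K_def integral_of_real[OF k])
 have K0: "K 0 = 0" by (simp add: K_def)
 from acd_power[OF kc, of n] have pc: "acd (%x. complex_of_real (K x) ^ Suc n) (%x. of_nat (Suc n) * complex_of_real (K x) ^ n * complex_of_real (k x))" .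
 have cK: "continuous_on {0..1} K" unfolding K_def by (rule indefinite_integral_continuous_1) (use io_sub[OF k, of 0 1] in auto)
 have "(%t. complex_of_real (K t) ^ n * complex_of_real (k t)) absolutely_integrable_on {0..1}"
  by (rule ai_cont_mult[OF ai_of_real[OF k]]) (intro continuous_intros cK)
 then have "integrable unit_leb (%t. complex_of_real (K t ^ n * k t))" by (simp add: absolutely_integrable_on_unit_iff)
 then show ai: "(%t. K t ^ n * k t) absolutely_integrable_on {0..1}"
  unfolding absolutely_integrable_on_unit_iff by (drule_tac integrable_Re) simp
 have "complex_of_real (K x) ^ Suc n - complex_of_real (K 0) ^ Suc n = integral {0..x} (%x. of_nat (Suc n) * complex_of_real (K x) ^ n * complex_of_real (k x))"
  using pc x by (simp only: acd_def)
 also have "\<dots> = of_nat (Suc n) * integral {0..x} (%x. complex_of_real (K x ^ n * k x))"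
  by (simp only: mult.assoc integral_mult_right of_real_mult of_real_power)
 also have "\<dots> = of_nat (Suc n) * of_real (integral {0..x} (%t. K t ^ n * k t))" by (simp only: integral_of_real[OF ai x])
 finally have "complex_of_real (K x ^ Suc n) = of_real (real (Suc n) * integral {0..x} (%t. K t ^ n * k t))" by (simp add: K0)
 then have "K x ^ Suc n = real (Suc n) * integral {0..x} (%t. K t ^ n * k t)" by (simp only: of_real_eq_iff)
 then show "integral {0..x} (%t. K t ^ n * k t) = K x ^ Suc n / real (Suc n)" by (simp add: field_simps del: of_nat_Suc)
qed

lemma tendsto_integral_mult_uniform:
 fixes S :: "nat => real => complex"
 assumes m: "m absolutely_integrable_on {0..1}" and S: "!!n. continuous_on {0..1} (S n)"
  and lim: "uniform_limit {0..1} S y sequentially" and x: "x \<in> {0..1}"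
 shows "(%n. integral {0..x} (%t. m t * S n t :: complex)) \<longlonglongrightarrow> integral {0..x} (%t. m t * y t)"
proof -
 have cy: "continuous_on {0..1} y" by (rule uniform_limit_theorem[OF _ lim]) (use S in auto)
 have i1: "(%t. m t * S n t) absolutely_integrable_on {0..1}" for n using ai_cont_mult[OF m S] by (simp add: mult.commute)
 have i2: "(%t. m t * y t) absolutely_integrable_on {0..1}" using ai_cont_mult[OF m cy] by (simp add: mult.commute)
 show ?thesis
 proof (rule tendstoI)
  fix e :: real assume e: "e > 0"
  define M where "M = L1n m"
  have M0: "M >= 0" unfolding M_def by (rule integral_nonneg) (use norm_io_sub[OF m, of 0 1] in auto)
  have "e / (M + 1) > 0" using e M0 by simp
  from uniform_limitD[OF lim this]
  show "\<forall>\<^sub>F n in sequentially. dist (integral {0..x} (%t. m t * S n t)) (integral {0..x} (%t. m t * y t)) < e"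
  proof eventually_elim
   case (elim n)
   have "integral {0..x} (%t. m t * S n t) - integral {0..x} (%t. m t * y t) = integral {0..x} (%t. m t * S n t - m t * y t)"
    by (rule integral_diff[symmetric]) (use io_sub[OF i1] io_sub[OF i2] x in auto)
   also have "norm \<dots> <= integral {0..x} (%t. e / (M + 1) * norm (m t))"
   proof (rule integral_norm_bound_integral)
    show "(%t. m t * S n t - m t * y t) integrable_on {0..x}" by (rule integrable_diff) (use io_sub[OF i1] io_sub[OF i2] x in auto)
    show "(%t. e / (M + 1) * norm (m t)) integrable_on {0..x}" using norm_io_sub[OF m, of 0 x] x by (intro integrable_on_mult_right) auto
    fix t assume t: "t \<in> {0..x}"
    have "norm (m t * S n t - m t * y t) = norm (m t) * dist (S n t) (y t)" by (simp add: dist_norm norm_mult flip: right_diff_distrib)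
    also have "\<dots> <= norm (m t) * (e / (M + 1))" using elim t x by (intro mult_left_mono) (auto intro: less_imp_le)
    finally show "norm (m t * S n t - m t * y t) <= e / (M + 1) * norm (m t)" by (simp only: mult.commute)
   qed
   also have "\<dots> = e / (M + 1) * integral {0..x} (%t. norm (m t))" by (rule integral_mult_right)
   also have "\<dots> <= e / (M + 1) * M" unfolding M_def using integral_norm_subset_le[OF m, of 0 x] x e M0[unfolded M_def]
    by (intro mult_left_mono) auto
   also have "\<dots> < e" using e M0 by (simp add: field_simps)
   finally show ?case by (simp add: dist_norm)
  qed
 qed
qed

locale linear_system =
 fixes m11 m12 m21 m22 :: "real => complex"
 assumes ai: "m11 absolutely_integrable_on {0..1}" "m12 absolutely_integrable_on {0..1}"
  "m21 absolutely_integrable_on {0..1}" "m22 absolutely_integrable_on {0..1}"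
begin

definition k :: "real => real" where "k x = norm (m11 x) + norm (m12 x) + norm (m21 x) + norm (m22 x)"
definition K :: "real => real" where "K x = integral {0..x} k"

lemma k_ai: "k absolutely_integrable_on {0..1}" unfolding k_def by (intro set_integral_add ai_norm ai)

lemma k_nonneg: "k x >= 0" by (simp add: k_def)

lemma K_bounds: assumes "x \<in> {0..1}" shows "0 <= K x" "K x <= K 1"
proof -
 show "0 <= K x" unfolding K_def by (rule integral_nonneg) (use io_sub[OF k_ai, of 0 x] assms k_nonneg in auto)
 show "K x <= K 1" unfolding K_def by (rule nn_integral_subset_le[OF k_ai]) (use assms k_nonneg in auto)
qed

lemma K1: "K 1 = L1n m11 + L1n m12 + L1n m21 + L1n m22" unfolding K_def k_def
 by (intro integral_unique has_integral_add integrable_integral norm_io_sub ai) auto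

lemma ai_app:
 assumes "continuous_on {0..1} z1" "continuous_on {0..1} z2"
 shows "(%t. m11 t * z1 t + m12 t * z2 t) absolutely_integrable_on {0..1}"
  "(%t. m21 t * z1 t + m22 t * z2 t) absolutely_integrable_on {0..1}"
 using ai_cont_mult[OF ai(1) assms(1)] ai_cont_mult[OF ai(2) assms(2)] ai_cont_mult[OF ai(3) assms(1)] ai_cont_mult[OF ai(4) assms(2)]
 by (auto simp: mult.commute intro!: set_integral_add)

text \<open>One Picard step reproduces the bound with \<open>n\<close> raised by one. Measuring with
  the primitive \<open>K\<close> of the coefficients instead of powers of \<open>x\<close> makes the
  iteration converge on the whole interval for integrable coefficients.\<close>

lemma step_bound:
 assumes c: "continuous_on {0..1} z1" "continuous_on {0..1} z2"
  and bd: "!!x. x \<in> {0..1} ==> norm (z1 x) + norm (z2 x) <= A * K x ^ n / fact n"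
  and x: "x \<in> {0..1}"
 shows "norm (integral {0..x} (%t. m11 t * z1 t + m12 t * z2 t)) + norm (integral {0..x} (%t. m21 t * z1 t + m22 t * z2 t))
   <= A * K x ^ Suc n / fact (Suc n)"
proof -
 note a = ai_app[OF c]
 note i = ai_norm[OF a(1)] ai_norm[OF a(2)]
 have "norm (integral {0..x} (%t. m11 t * z1 t + m12 t * z2 t)) + norm (integral {0..x} (%t. m21 t * z1 t + m22 t * z2 t))
  <= integral {0..x} (%t. norm (m11 t * z1 t + m12 t * z2 t)) + integral {0..x} (%t. norm (m21 t * z1 t + m22 t * z2 t))"
  by (intro add_mono norm_integral_le a) (use x in auto)
 also have "\<dots> = integral {0..x} (%t. norm (m11 t * z1 t + m12 t * z2 t) + norm (m21 t * z1 t + m22 t * z2 t))"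
  by (rule integral_add[symmetric]) (use io_sub[OF i(1), of 0 x] io_sub[OF i(2), of 0 x] x in auto)
 also have "\<dots> <= integral {0..x} (%t. (A / fact n) * (K t ^ n * k t))"
 proof (rule integral_le)
  show "(%t. norm (m11 t * z1 t + m12 t * z2 t) + norm (m21 t * z1 t + m22 t * z2 t)) integrable_on {0..x}"
   by (rule integrable_add) (use io_sub[OF i(1), of 0 x] io_sub[OF i(2), of 0 x] x in auto)
  show "(%t. (A / fact n) * (K t ^ n * k t)) integrable_on {0..x}"
   using io_sub[OF integral_power_primitive(1)[OF k_ai x, of n], of 0 x] x unfolding K_def
   by (intro integrable_on_mult_right) auto
  fix t assume t: "t \<in> {0..x}"
  have t1: "t \<in> {0..1}" using t x by auto
  have "norm (m11 t * z1 t + m12 t * z2 t) + norm (m21 t * z1 t + m22 t * z2 t) \<le>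
   norm (m11 t) * norm (z1 t) + norm (m12 t) * norm (z2 t) + (norm (m21 t) * norm (z1 t) + norm (m22 t) * norm (z2 t))"
   by (intro add_mono norm_triangle_le) (simp_all add: norm_mult)
  also have "\<dots> <= k t * norm (z1 t) + k t * norm (z2 t)" unfolding k_def by (simp add: algebra_simps)
  also have "\<dots> = k t * (norm (z1 t) + norm (z2 t))" by (simp add: algebra_simps)
  also have "\<dots> <= k t * (A * K t ^ n / fact n)" by (intro mult_left_mono bd t1 k_nonneg)
  finally show "norm (m11 t * z1 t + m12 t * z2 t) + norm (m21 t * z1 t + m22 t * z2 t) <= (A / fact n) * (K t ^ n * k t)"
   by (simp add: mult_ac)
 qed
 also have "\<dots> = (A / fact n) * (K x ^ Suc n / real (Suc n))"
  unfolding integral_mult_right K_def integral_power_primitive(2)[OF k_ai x] ..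
 also have "\<dots> = A * K x ^ Suc n / fact (Suc n)" by (simp add: fact_Suc mult.commute del: of_nat_Suc)
 finally show ?thesis .
qed

text \<open>A solution with zero initial data is reproduced by the integral operator, so
  \<open>step_bound\<close> bounds it by a constant times \<open>K x ^ n / fact n\<close> for every
  \<open>n\<close>.\<close>

lemma unique_zero:
 assumes y: "acd y1 (%x. m11 x * y1 x + m12 x * y2 x)" "acd y2 (%x. m21 x * y1 x + m22 x * y2 x)"
  and 0: "y1 0 = 0" "y2 0 = 0" and x: "x \<in> {0..1}"
 shows "y1 x = 0" "y2 x = 0"
proof -
 note c = acd_continuous[OF y(1)] acd_continuous[OF y(2)]
 obtain M1 where M1: "M1 >= 0" "!!x. x \<in> {0..1} ==> norm (y1 x) <= M1" using acd_bounded[OF y(1)] by blast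
 obtain M2 where M2: "M2 >= 0" "!!x. x \<in> {0..1} ==> norm (y2 x) <= M2" using acd_bounded[OF y(2)] by blast
 have bd: "norm (y1 x) + norm (y2 x) <= (M1 + M2) * K x ^ n / fact n" if "x \<in> {0..1}" for n x using that
 proof (induction n arbitrary: x)
  case 0 then show ?case using M1(2) M2(2) by (simp add: add_mono)
 next
  case (Suc n)
  have "y1 x = integral {0..x} (%t. m11 t * y1 t + m12 t * y2 t)" "y2 x = integral {0..x} (%t. m21 t * y1 t + m22 t * y2 t)"
   using acd_eq[OF y(1) Suc.prems] acd_eq[OF y(2) Suc.prems] 0 by auto
  then show ?case using step_bound[OF c Suc.IH Suc.prems] by simp
 qed
 have "(%n. (M1 + M2) * (K x ^ n / fact n)) \<longlonglongrightarrow> (M1 + M2) * 0"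
  by (intro tendsto_mult_left) (use summable_LIMSEQ_zero[OF summable_exp[of "K x"]] in \<open>simp add: field_simps\<close>)
 then have "norm (y1 x) + norm (y2 x) <= (M1 + M2) * 0" by (rule tendsto_lowerbound[OF _ always_eventually]) (use bd[OF x] in auto)
 then have "norm (y1 x) = 0 \<and> norm (y2 x) = 0" using norm_ge_zero[of "y1 x"] norm_ge_zero[of "y2 x"] by linarith
 then show "y1 x = 0" "y2 x = 0" by auto
qed

context
 fixes v1 v2 :: complex and h1 h2 :: "real => complex"
 assumes h: "h1 absolutely_integrable_on {0..1}" "h2 absolutely_integrable_on {0..1}"
begin

text \<open>The increments of the Picard iteration rather than the iterates: the solution is the sum
  of all \<open>Z n\<close>.\<close>

fun Z :: "nat => (real => complex) \<times> (real => complex)" where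
 "Z 0 = ((%x. v1 + integral {0..x} h1), (%x. v2 + integral {0..x} h2))"
| "Z (Suc n) = ((%x. integral {0..x} (%t. m11 t * fst (Z n) t + m12 t * snd (Z n) t)),
   (%x. integral {0..x} (%t. m21 t * fst (Z n) t + m22 t * snd (Z n) t)))"

definition A where "A = norm v1 + norm v2 + L1n h1 + L1n h2"

lemma Z_cont: "continuous_on {0..1} (fst (Z n))" "continuous_on {0..1} (snd (Z n))"
proof (induction n)
 case 0
 show "continuous_on {0..1} (fst (Z 0))" "continuous_on {0..1} (snd (Z 0))"
  using acd_continuous[OF acd_indef[OF h(1)]] acd_continuous[OF acd_indef[OF h(2)]] by auto
next
 case (Suc n)
 from acd_continuous[OF acd_indef[OF ai_app(1)[OF Suc], of 0]] acd_continuous[OF acd_indef[OF ai_app(2)[OF Suc], of 0]]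
 show "continuous_on {0..1} (fst (Z (Suc n)))" "continuous_on {0..1} (snd (Z (Suc n)))" by auto
qed

lemma Z_bound: "x \<in> {0..1} ==> norm (fst (Z n) x) + norm (snd (Z n) x) <= A * K x ^ n / fact n"
proof (induction n arbitrary: x)
 case 0
 have "norm (integral {0..x} h1) <= L1n h1" "norm (integral {0..x} h2) <= L1n h2"
  using norm_integral_le[OF h(1), of 0 x] integral_norm_subset_le[OF h(1), of 0 x]
   norm_integral_le[OF h(2), of 0 x] integral_norm_subset_le[OF h(2), of 0 x] 0 by auto
 then show ?case using norm_triangle_ineq[of v1 "integral {0..x} h1"] norm_triangle_ineq[of v2 "integral {0..x} h2"] by (simp add: A_def)
next
 case (Suc n)
 show ?case using step_bound[OF Z_cont Suc.IH Suc.prems] by simp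
qed

lemma A_nonneg: "A >= 0"
proof -
 have "L1n h1 >= 0" by (rule integral_nonneg) (use norm_io_sub[OF h(1), of 0 1] in auto)
 moreover have "L1n h2 >= 0" by (rule integral_nonneg) (use norm_io_sub[OF h(2), of 0 1] in auto)
 ultimately show ?thesis by (simp add: A_def)
qed

lemma Z_bound1:
 assumes "x \<in> {0..1}" shows "norm (fst (Z n) x) + norm (snd (Z n) x) <= A * (K 1 ^ n / fact n)"
proof -
 have "A * (K x ^ n / fact n) <= A * (K 1 ^ n / fact n)" by (intro mult_left_mono divide_right_mono power_mono K_bounds assms A_nonneg) auto
 then show ?thesis using Z_bound[OF assms, of n] by simp
qed

lemma existence:
 "\<exists>y1 y2. acd y1 (%x. m11 x * y1 x + m12 x * y2 x + h1 x) \<and> acd y2 (%x. m21 x * y1 x + m22 x * y2 x + h2 x) \<and>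
   y1 0 = v1 \<and> y2 0 = v2 \<and> (\<forall>x\<in>{0..1}. norm (y1 x) + norm (y2 x) <= A * exp (K 1))"
proof -
 have es: "(%n. A * (K 1 ^ n / fact n)) sums (A * exp (K 1))"
  using exp_converges[of "K 1"] by (intro sums_mult) (simp add: divide_inverse mult.commute)
 note summ = sums_summable[OF es]
 define S1 where "S1 n x = (\<Sum>i<n. fst (Z i) x)" for n x
 define S2 where "S2 n x = (\<Sum>i<n. snd (Z i) x)" for n x
 define y1 where "y1 x = (\<Sum>i. fst (Z i) x)" for x
 define y2 where "y2 x = (\<Sum>i. snd (Z i) x)" for x
 have b: "norm (fst (Z n) x) <= A * (K 1 ^ n / fact n)" "norm (snd (Z n) x) <= A * (K 1 ^ n / fact n)"
  if "x \<in> {0..1}" for n x using Z_bound1[OF that, of n] norm_ge_zero[of "fst (Z n) x"] norm_ge_zero[of "snd (Z n) x"] by linarith+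
 have u1: "uniform_limit {0..1} S1 y1 sequentially" unfolding S1_def y1_def by (rule Weierstrass_m_test[OF b(1) summ])
 have u2: "uniform_limit {0..1} S2 y2 sequentially" unfolding S2_def y2_def by (rule Weierstrass_m_test[OF b(2) summ])
 have cS: "continuous_on {0..1} (S1 n)" "continuous_on {0..1} (S2 n)" for n unfolding S1_def S2_def by (intro continuous_on_sum Z_cont)+
 have cy: "continuous_on {0..1} y1" "continuous_on {0..1} y2" using uniform_limit_theorem[OF _ u1] uniform_limit_theorem[OF _ u2] cS by auto
 have l: "(%n. S1 n x) \<longlonglongrightarrow> y1 x" "(%n. S2 n x) \<longlonglongrightarrow> y2 x" if "x \<in> {0..1}" for x
  using tendsto_uniform_limitI[OF u1 that] tendsto_uniform_limitI[OF u2 that] by auto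
 have step: "S1 (Suc n) x = v1 + integral {0..x} h1 + (integral {0..x} (%t. m11 t * S1 n t) + integral {0..x} (%t. m12 t * S2 n t)) \<and>
   S2 (Suc n) x = v2 + integral {0..x} h2 + (integral {0..x} (%t. m21 t * S1 n t) + integral {0..x} (%t. m22 t * S2 n t))"
  if x: "x \<in> {0..1}" for n x
 proof -
  have io: "(%t. m t * z t) integrable_on {0..x}" if "m absolutely_integrable_on {0..1}" "continuous_on {0..1} z" for m z :: "real => complex"
   using io_sub[OF ai_cont_mult[OF that], of 0 x] x by (simp add: mult.commute)
  have "integral {0..x} (%t. m t * (\<Sum>i<n. z i t)) = (\<Sum>i<n. integral {0..x} (%t. m t * z i t))"
   if "m absolutely_integrable_on {0..1}" "!!i. continuous_on {0..1} (z i)" for m and z :: "nat => real => complex"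
   unfolding sum_distrib_left using io that by (intro integral_sum) auto
  note s = this
  have a: "integral {0..x} (%t. m t * z t + m' t * z' t) = integral {0..x} (%t. m t * z t) + integral {0..x} (%t. m' t * z' t)"
   if "m absolutely_integrable_on {0..1}" "continuous_on {0..1} z" "m' absolutely_integrable_on {0..1}" "continuous_on {0..1} z'" for m z m' z' :: "real => complex"
   by (intro integral_add io that)
  show ?thesis
   unfolding S1_def S2_def sum.lessThan_Suc_shift s[OF ai(1) Z_cont(1)] s[OF ai(2) Z_cont(2)] s[OF ai(3) Z_cont(1)] s[OF ai(4) Z_cont(2)]
   by (simp add: a[OF ai(1) Z_cont(1) ai(2) Z_cont(2)] a[OF ai(3) Z_cont(1) ai(4) Z_cont(2)] sum.distrib)
 qed
 have y1eq: "y1 x = v1 + integral {0..x} h1 + (integral {0..x} (%t. m11 t * y1 t) + integral {0..x} (%t. m12 t * y2 t))"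
  if x: "x \<in> {0..1}" for x
 proof (rule LIMSEQ_unique)
  show "(%n. S1 (Suc n) x) \<longlonglongrightarrow> y1 x" using l(1)[OF x] by (rule LIMSEQ_Suc)
  show "(%n. S1 (Suc n) x) \<longlonglongrightarrow> v1 + integral {0..x} h1 + (integral {0..x} (%t. m11 t * y1 t) + integral {0..x} (%t. m12 t * y2 t))"
   unfolding conjunct1[OF step[OF x]]
   by (intro tendsto_intros tendsto_integral_mult_uniform ai cS u1 u2 x)
 qed
 have y2eq: "y2 x = v2 + integral {0..x} h2 + (integral {0..x} (%t. m21 t * y1 t) + integral {0..x} (%t. m22 t * y2 t))"
  if x: "x \<in> {0..1}" for x
 proof (rule LIMSEQ_unique)
  show "(%n. S2 (Suc n) x) \<longlonglongrightarrow> y2 x" using l(2)[OF x] by (rule LIMSEQ_Suc)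
  show "(%n. S2 (Suc n) x) \<longlonglongrightarrow> v2 + integral {0..x} h2 + (integral {0..x} (%t. m21 t * y1 t) + integral {0..x} (%t. m22 t * y2 t))"
   unfolding conjunct2[OF step[OF x]]
   by (intro tendsto_intros tendsto_integral_mult_uniform ai cS u1 u2 x)
 qed
 have mk: "acd y (%x. m x * y1 x + m' x * y2 x + h x)"
  if y: "!!x. x \<in> {0..1} ==> y x = v + integral {0..x} h + (integral {0..x} (%t. m t * y1 t) + integral {0..x} (%t. m' t * y2 t))"
   and m: "m absolutely_integrable_on {0..1}" "m' absolutely_integrable_on {0..1}" "h absolutely_integrable_on {0..1}"
  for y m m' h v
 proof -
  have aa: "(%x. m x * y1 x) absolutely_integrable_on {0..1}" "(%x. m' x * y2 x) absolutely_integrable_on {0..1}"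
   using ai_cont_mult[OF m(1) cy(1)] ai_cont_mult[OF m(2) cy(2)] by (auto simp: mult.commute)
  have "acd (%x. (0 + integral {0..x} (%t. m t * y1 t)) + (0 + integral {0..x} (%t. m' t * y2 t)) + (v + integral {0..x} h)) (%x. m x * y1 x + m' x * y2 x + h x)"
   by (intro acd_add acd_indef aa m)
  then show ?thesis by (rule acd_cong) (simp_all only: y, simp)
 qed
 have "y1 0 = v1" "y2 0 = v2" using y1eq[of 0] y2eq[of 0] by auto
 moreover have "norm (y1 x) + norm (y2 x) <= A * exp (K 1)" if x: "x \<in> {0..1}" for x
 proof (rule tendsto_upperbound)
  show "(%n. norm (S1 n x) + norm (S2 n x)) \<longlonglongrightarrow> norm (y1 x) + norm (y2 x)" by (intro tendsto_intros l x)
  show "\<forall>\<^sub>F n in sequentially. norm (S1 n x) + norm (S2 n x) <= A * exp (K 1)"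
  proof (rule always_eventually, rule allI)
   fix n
   have "norm (S1 n x) + norm (S2 n x) <= (\<Sum>i<n. norm (fst (Z i) x)) + (\<Sum>i<n. norm (snd (Z i) x))"
    unfolding S1_def S2_def by (intro add_mono norm_sum)
   also have "\<dots> <= (\<Sum>i<n. A * (K 1 ^ i / fact i))" unfolding sum.distrib[symmetric] by (intro sum_mono Z_bound1 x)
   also have "\<dots> <= A * exp (K 1)" unfolding sums_unique[OF es] by (rule sum_le_suminf[OF summ]) (use A_nonneg K_bounds[of 1] in auto)
   finally show "norm (S1 n x) + norm (S2 n x) <= A * exp (K 1)" .
  qed
 qed simp
 ultimately show ?thesis using mk[OF y1eq ai(1,2) h(1)] mk[OF y2eq ai(3,4) h(2)] by blast
qed

end

end

section \<open>Existence, uniqueness and bounds for the system with a spectral parameter\<close>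

definition n1 :: "complex^2 => real" where "n1 v = norm (v $ 1) + norm (v $ 2)"
definition aiv :: "(real => complex^2) => bool" where
 "aiv g \<longleftrightarrow> (\<forall>i. (%x. g x $ i) absolutely_integrable_on {0..1})"
definition nrm1 :: "(real => complex^2) => real" where
 "nrm1 g = L1n (%x. g x $ 1) + L1n (%x. g x $ 2)"

lemma n1_nonneg: "n1 v >= 0" by (simp add: n1_def)
lemma n1_zero [simp]: "n1 0 = 0" by (simp add: n1_def)
lemma n1_scale: "n1 (c *s v) = norm c * n1 v" by (simp add: n1_def norm_mult algebra_simps)
lemma n1_nth_le: "norm (v $ i) <= n1 v" using exhaust_2[of i] by (auto simp: n1_def)
lemma n1_eq_0_iff: "n1 v = 0 \<longleftrightarrow> v = 0" by (auto simp: n1_def vec_eq_iff forall_2 add_nonneg_eq_0_iff)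

lemma L1n_nonneg: "f absolutely_integrable_on {0..1} ==> L1n f >= 0" by (rule integral_nonneg) (use norm_io_sub[of f 0 1] in auto)

lemma L1n_add_le:
 assumes "f absolutely_integrable_on {0..1}" "g absolutely_integrable_on {0..1}"
 shows "L1n (%x. f x + g x) <= L1n f + L1n g"
proof -
 have "L1n (%x. f x + g x) <= integral {0..1} (%x. norm (f x) + norm (g x))" by (rule integral_le)
    (use norm_io_sub[OF set_integral_add(1)[OF assms], of 0 1] norm_io_sub[OF assms(1), of 0 1] norm_io_sub[OF assms(2), of 0 1] norm_triangle_ineq in \<open>auto intro!: integrable_add\<close>)
 also have "\<dots> = L1n f + L1n g" by (rule integral_add) (use norm_io_sub[OF assms(1), of 0 1] norm_io_sub[OF assms(2), of 0 1] in auto)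
 finally show ?thesis .
qed

lemma L1n_cmult: "L1n (%x. c * f x) = norm c * L1n f" by (simp add: norm_mult)

lemma L1n_le_sup:
 assumes "f absolutely_integrable_on {0..1}" "!!x. x \<in> {0..1} ==> norm (f x) <= M"
 shows "L1n f <= M"
 using integral_le[OF norm_io_sub[OF assms(1), of 0 1] integrable_const_ivl[of M 0 1]] assms(2) by simp

lemma aiv_zero [simp]: "aiv (%x. 0)" by (simp add: aiv_def)
lemma aiv_add: "aiv f ==> aiv g ==> aiv (%x. f x + g x)" by (simp add: aiv_def set_integral_add)
lemma aiv_scale: "aiv f ==> aiv (%x. c *s f x)" by (simp add: aiv_def)
lemma nrm1_nonneg: "aiv g ==> nrm1 g >= 0" unfolding nrm1_def aiv_def by (intro add_nonneg_nonneg L1n_nonneg) auto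
lemma nrm1_add: "aiv f ==> aiv g ==> nrm1 (%x. f x + g x) <= nrm1 f + nrm1 g"
 using L1n_add_le[of "%x. f x $ 1" "%x. g x $ 1"] L1n_add_le[of "%x. f x $ 2" "%x. g x $ 2"]
 by (simp add: nrm1_def aiv_def)
lemma nrm1_scale: "nrm1 (%x. c *s g x) = norm c * nrm1 g" by (simp add: nrm1_def L1n_cmult distrib_left)
lemma nrm1_le_sup:
 assumes "aiv y" "!!x. x \<in> {0..1} ==> n1 (y x) <= M" shows "nrm1 y <= 2 * M"
proof -
 have "L1n (%x. y x $ i) <= M" for i by (rule L1n_le_sup) (use assms n1_nth_le order_trans in \<open>auto simp: aiv_def\<close>, blast)
 from add_mono[OF this[of 1] this[of 2]] show ?thesis by (simp add: nrm1_def)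
qed

lemma sq_integrable_aiv: assumes "sq_integrable g" shows "aiv g" "nrm1 g <= 2 * norm (abs_L2 g)"
proof -
 have g: "integrable unit_leb (%x. norm (g x))" by (rule integral_norm_le_L2[OF assms])
 have i: "integrable unit_leb (%x. g x $ i)" for i by (rule Bochner_Integration.integrable_bound[OF g])
    (use sq_integrable_nth(1)[OF assms] Finite_Cartesian_Product.norm_nth_le in auto)
 then show a: "aiv g" by (simp add: aiv_def absolutely_integrable_on_unit_iff)
 have "L1n (%x. g x $ i) <= norm (abs_L2 g)" for i
 proof -
  have "L1n (%x. g x $ i) = (\<integral>x. norm (g x $ i) \<partial>unit_leb)"
   by (rule integral_norm_unit[symmetric]) (use a in \<open>simp add: aiv_def\<close>)
  also have "\<dots> <= (\<integral>x. norm (g x) \<partial>unit_leb)"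
   by (rule integral_mono) (use i g Finite_Cartesian_Product.norm_nth_le in auto)
  also have "\<dots> <= norm (abs_L2 g)" by (rule integral_norm_le_L2[OF assms])
  finally show ?thesis .
 qed
 from add_mono[OF this[of 1] this[of 2]] show "nrm1 g <= 2 * norm (abs_L2 g)" by (simp add: nrm1_def)
qed

locale ode =
 fixes b1 b2 :: real and p q :: "real => complex"
 assumes p: "p absolutely_integrable_on {0..1}" and q: "q absolutely_integrable_on {0..1}"
begin

abbreviation "sol \<equiv> solves b1 b2 p q"

lemma sol_acd: "sol l g y ==> acd (%x. y x $ 1) (%x. \<i> * b1 * (l * y x $ 1 + g x $ 1 - p x * y x $ 2))"
 "sol l g y ==> acd (%x. y x $ 2) (%x. \<i> * b2 * (l * y x $ 2 + g x $ 2 - q x * y x $ 1))"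
 by (auto simp: solves_def)

lemma sol_cont: "sol l g y ==> continuous_on {0..1} (%x. y x $ i)" using exhaust_2[of i] sol_acd[THEN acd_continuous] by metis

lemma sol_aiv: "sol l g y ==> aiv y" unfolding aiv_def by (intro allI ai_cont sol_cont)

lemma sol_add: "sol l f y ==> sol l g z ==> sol l (%x. f x + g x) (%x. y x + z x)"
 unfolding solves_def by (intro conjI; elim conjE; erule (1) acd_cong[OF acd_add]; simp add: algebra_simps)

lemma sol_scale: "sol l f y ==> sol l (%x. c *s f x) (%x. c *s y x)"
 unfolding solves_def by (intro conjI; elim conjE; erule acd_cong[OF acd_cmult[where c = c]]; simp add: algebra_simps)

lemma sol_zero: "sol l (%x. 0) (%x. 0)" unfolding solves_def using acd_const[of 0] by simp

lemma sol_cong: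
 assumes "sol l g y" "!!x. x \<in> {0..1} ==> y x = z x" "!!x. x \<in> {0..1} ==> l *s y x + g x = l' *s z x + g' x"
 shows "sol l' g' z"
proof -
 have "l * y x $ i + g x $ i = l' * z x $ i + g' x $ i" if "x \<in> {0..1}" for x i
  using arg_cong[OF assms(3)[OF that], of "%v. v $ i"] by simp
 then show ?thesis unfolding solves_def
  by (intro conjI acd_cong[OF sol_acd(1)[OF assms(1)]] acd_cong[OF sol_acd(2)[OF assms(1)]]) (auto simp: assms(2))
qed

lemma sol_shift: "sol l g y ==> sol l' (%x. g x + (l - l') *s y x) y" by (erule sol_cong) (auto simp: vec_eq_iff algebra_simps)

lemma sol_diff: "sol l f y ==> sol l g z ==> sol l (%x. f x - g x) (%x. y x - z x)"
 using sol_add[of l f y "%x. (-1) *s g x" "%x. (-1) *s z x"] sol_scale[of l g z "-1"]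
 by (simp add: vector_sneg_minus1[symmetric])

definition gr :: "complex => real" where
 "gr l = exp ((\<bar>b1\<bar> + \<bar>b2\<bar>) * (2 * norm l + L1n p + L1n q)) * (1 + \<bar>b1\<bar> + \<bar>b2\<bar>)"

lemma gr_pos: "gr l >= 1"
proof -
 have "0 <= (\<bar>b1\<bar> + \<bar>b2\<bar>) * (2 * norm l + L1n p + L1n q)"
  using L1n_nonneg[OF p] L1n_nonneg[OF q] by (intro mult_nonneg_nonneg) auto
 then have "1 * 1 <= gr l" unfolding gr_def by (intro mult_mono) auto
 then show ?thesis by simp
qed

lemma ls: "linear_system (%x. \<i> * b1 * l) (%x. - \<i> * b1 * p x) (%x. - \<i> * b2 * q x) (%x. \<i> * b2 * l)"
 by unfold_locales (intro set_integrable_mult_right p q ai_cont continuous_intros)+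

lemma sol_exists:
 assumes g: "aiv g"
 shows "\<exists>y. sol l g y \<and> y 0 = v \<and> (\<forall>x\<in>{0..1}. n1 (y x) <= (n1 v + nrm1 g) * gr l)"
proof -
 interpret linear_system "%x. \<i> * b1 * l" "%x. - \<i> * b1 * p x" "%x. - \<i> * b2 * q x" "%x. \<i> * b2 * l" by (rule ls)
 have gi: "(%x. g x $ i) absolutely_integrable_on {0..1}" for i using g by (simp add: aiv_def)
 have h: "(%x. \<i> * b1 * g x $ 1) absolutely_integrable_on {0..1}" "(%x. \<i> * b2 * g x $ 2) absolutely_integrable_on {0..1}"
  using gi by auto
 obtain y1 y2 where y: "acd y1 (%x. \<i> * b1 * l * y1 x + - \<i> * b1 * p x * y2 x + \<i> * b1 * g x $ 1)"
   "acd y2 (%x. - \<i> * b2 * q x * y1 x + \<i> * b2 * l * y2 x + \<i> * b2 * g x $ 2)" "y1 0 = v $ 1" "y2 0 = v $ 2"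
   "!!x. x \<in> {0..1} ==> norm (y1 x) + norm (y2 x) <= A (v $ 1) (v $ 2) (%x. \<i> * b1 * g x $ 1) (%x. \<i> * b2 * g x $ 2) * exp (K 1)"
  using existence[OF h, of "v $ 1" "v $ 2"] by blast
 define y :: "real => complex^2" where "y x = vector [y1 x, y2 x]" for x
 have "sol l g y" unfolding solves_def y_def by (intro conjI acd_cong[OF y(1)] acd_cong[OF y(2)]) (auto simp: algebra_simps)
 moreover have "y 0 = v" using y(3,4) by (simp add: y_def vec_eq_iff forall_2)
 moreover have "n1 (y x) <= (n1 v + nrm1 g) * gr l" if x: "x \<in> {0..1}" for x
 proof -
  have Kle: "K 1 <= (\<bar>b1\<bar> + \<bar>b2\<bar>) * (2 * norm l + L1n p + L1n q)"
  proof -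
   have "K 1 = \<bar>b1\<bar> * norm l + \<bar>b1\<bar> * L1n p + \<bar>b2\<bar> * L1n q + \<bar>b2\<bar> * norm l"
    unfolding K1 by (simp add: norm_mult)
   also have "\<dots> <= (\<bar>b1\<bar> + \<bar>b2\<bar>) * (2 * norm l + L1n p + L1n q)"
    using L1n_nonneg[OF p] L1n_nonneg[OF q] by (simp add: algebra_simps)
   finally show ?thesis .
  qed
  have gn: "0 <= L1n (%x. g x $ i)" for i by (rule L1n_nonneg[OF gi])
  have Ale: "A (v $ 1) (v $ 2) (%x. \<i> * b1 * g x $ 1) (%x. \<i> * b2 * g x $ 2) <= (n1 v + nrm1 g) * (1 + \<bar>b1\<bar> + \<bar>b2\<bar>)"
   unfolding A_def[OF h] n1_def nrm1_def using gn[of 1] gn[of 2] by (simp add: norm_mult algebra_simps)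
  have "n1 (y x) <= A (v $ 1) (v $ 2) (%x. \<i> * b1 * g x $ 1) (%x. \<i> * b2 * g x $ 2) * exp (K 1)"
   using y(5)[OF x] by (simp add: n1_def y_def)
  also have "\<dots> <= ((n1 v + nrm1 g) * (1 + \<bar>b1\<bar> + \<bar>b2\<bar>)) * exp ((\<bar>b1\<bar> + \<bar>b2\<bar>) * (2 * norm l + L1n p + L1n q))"
   using Ale Kle nrm1_nonneg[OF g] n1_nonneg[of v] by (intro mult_mono) auto
  finally show ?thesis by (simp add: gr_def mult_ac)
 qed
 ultimately show ?thesis by blast
qed

lemma sol_unique:
 assumes y: "sol l g y" "sol l g z" "y 0 = z 0" and x: "x \<in> {0..1}"
 shows "y x = z x"
proof -
 interpret linear_system "%x. \<i> * b1 * l" "%x. - \<i> * b1 * p x" "%x. - \<i> * b2 * q x" "%x. \<i> * b2 * l" by (rule ls)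
 have d: "sol l (%x. 0) (%x. y x - z x)" using sol_diff[OF y(1,2)] by simp
 have "(y x - z x) $ 1 = 0" "(y x - z x) $ 2 = 0"
  by (rule unique_zero[where ?y1.0 = "%x. (y x - z x) $ 1" and ?y2.0 = "%x. (y x - z x) $ 2", OF _ _ _ _ x];
    (rule acd_cong[OF sol_acd(1)[OF d]] acd_cong[OF sol_acd(2)[OF d]])?; simp add: y(3) algebra_simps)+
 then show ?thesis by (simp add: vec_eq_iff forall_2)
qed

text \<open>Values outside the unit interval are left to the choice operator, which is why
  equalities between solutions are asserted only on the interval.\<close>

definition SOL :: "complex => complex^2 => (real => complex^2) => real => complex^2" where
 "SOL l v g = (SOME y. sol l g y \<and> y 0 = v \<and> (\<forall>x\<in>{0..1}. n1 (y x) <= (n1 v + nrm1 g) * gr l))"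

lemma SOL:
 assumes "aiv g"
 shows "sol l g (SOL l v g)" "SOL l v g 0 = v" "x \<in> {0..1} ==> n1 (SOL l v g x) <= (n1 v + nrm1 g) * gr l"
 using someI_ex[OF sol_exists[OF assms, of l v]] unfolding SOL_def[symmetric] by auto

lemma SOL_eq: "sol l g y ==> aiv g ==> x \<in> {0..1} ==> SOL l (y 0) g x = y x" using sol_unique[OF SOL(1)] SOL(2) by blast

section \<open>Analytic dependence on the spectral parameter\<close>

text \<open>Uniform convergence passes to the limit in the integrated equation. The right-hand side
  has the form met by partial sums of a power series in \<open>h\<close>: a scalar multiple of
  \<open>g\<close> and \<open>h\<close> times the previous partial sum.\<close>

lemma sol_uniform_limit:
 assumes S: "!!n. sol l (%x. c n *s g x + h *s W n x) (S n)" and g: "aiv g" and W: "!!n i. continuous_on {0..1} (%x. W n x $ i)"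
  and lS: "!!i. uniform_limit {0..1} (%n x. S n x $ i) (%x. y x $ i) sequentially"
  and lW: "!!i. uniform_limit {0..1} (%n x. W n x $ i) (%x. w x $ i) sequentially"
  and c: "c \<longlonglongrightarrow> c0"
 shows "sol l (%x. c0 *s g x + h *s w x) y"
proof -
 have gi: "(%x. g x $ i) absolutely_integrable_on {0..1}" for i using g by (simp add: aiv_def)
 have cS: "continuous_on {0..1} (%x. S n x $ i)" for n i by (rule sol_cont[OF S])
 have cy: "continuous_on {0..1} (%x. y x $ i)" for i by (rule uniform_limit_theorem[OF _ lS]) (use cS in auto)
 have cw: "continuous_on {0..1} (%x. w x $ i)" for i by (rule uniform_limit_theorem[OF _ lW]) (use W in auto)
 have main: "acd (%x. y x $ i) (%x. \<i> * b * (l * y x $ i + (c0 * g x $ i + h * w x $ i) - r x * y x $ j))"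
  if a: "!!n. acd (%x. S n x $ i) (%x. \<i> * b * (l * S n x $ i + (c n * g x $ i + h * W n x $ i) - r x * S n x $ j))"
   and r: "r absolutely_integrable_on {0..1}" for i j :: 2 and b :: real and r
 proof -
  have one: "(%x::real. 1 :: complex) absolutely_integrable_on {0..1}" by (rule ai_cont) auto
  have rm: "(%x. r x * z x) absolutely_integrable_on {0..1}" if "continuous_on {0..1} z" for z :: "real => complex"
   using ai_cont_mult[OF r that] by (simp add: mult.commute)
  have aid: "(%x. \<i> * b * (l * Y x + (C * g x $ i + h * V x) - r x * X x)) absolutely_integrable_on {0..1}"
   if "continuous_on {0..1} Y" "continuous_on {0..1} V" "continuous_on {0..1} X" for C and Y V X :: "real => complex"
   by (intro set_integrable_mult_right set_integral_diff set_integral_add ai_cont gi rm that)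
  have split: "integral {0..x} (%x. \<i> * b * (l * Y x + (C * g x $ i + h * V x) - r x * X x)) =
   \<i> * b * (l * integral {0..x} (%x. 1 * Y x) + (C * integral {0..x} (%x. g x $ i) + h * integral {0..x} (%x. 1 * V x)) - integral {0..x} (%x. r x * X x))"
   if x: "x \<in> {0..1}" and z: "continuous_on {0..1} Y" "continuous_on {0..1} V" "continuous_on {0..1} X" for C x and Y V X :: "real => complex"
  proof -
   have "Y integrable_on {0..x}" "V integrable_on {0..x}" "(%x. g x $ i) integrable_on {0..x}" "(%x. r x * X x) integrable_on {0..x}"
    using x io_sub[OF ai_cont[OF z(1)], of 0 x] io_sub[OF ai_cont[OF z(2)], of 0 x] io_sub[OF gi, of 0 x] io_sub[OF rm[OF z(3)], of 0 x] by auto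
   then show ?thesis unfolding mult_1
    by (intro integral_unique has_integral_mult_right has_integral_add has_integral_diff integrable_integral)
  qed
  show ?thesis unfolding acd_def
  proof (intro conjI ballI aid cy cw)
   fix x :: real assume x: "x \<in> {0..1}"
   have l1: "(%n. S n x $ i - S n 0 $ i) \<longlonglongrightarrow> y x $ i - y 0 $ i"
    by (intro tendsto_diff tendsto_uniform_limitI[OF lS] x) simp
   have "S n x $ i - S n 0 $ i = \<i> * b * (l * integral {0..x} (%x. 1 * S n x $ i) + (c n * integral {0..x} (%x. g x $ i) + h * integral {0..x} (%x. 1 * W n x $ i)) - integral {0..x} (%x. r x * S n x $ j))" for n
    unfolding split[OF x cS W cS, symmetric] using a[of n] x by (simp only: acd_def)
   moreover have "(%n. \<i> * b * (l * integral {0..x} (%x. 1 * S n x $ i) + (c n * integral {0..x} (%x. g x $ i) + h * integral {0..x} (%x. 1 * W n x $ i)) - integral {0..x} (%x. r x * S n x $ j)))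
    \<longlonglongrightarrow> \<i> * b * (l * integral {0..x} (%x. 1 * y x $ i) + (c0 * integral {0..x} (%x. g x $ i) + h * integral {0..x} (%x. 1 * w x $ i)) - integral {0..x} (%x. r x * y x $ j))"
    by (intro tendsto_intros tendsto_integral_mult_uniform one r cS W lS lW x c)
   ultimately have l2: "(%n. S n x $ i - S n 0 $ i) \<longlonglongrightarrow> \<i> * b * (l * integral {0..x} (%x. 1 * y x $ i) + (c0 * integral {0..x} (%x. g x $ i) + h * integral {0..x} (%x. 1 * w x $ i)) - integral {0..x} (%x. r x * y x $ j))"
    by simp
   show "y x $ i - y 0 $ i = integral {0..x} (%x. \<i> * b * (l * y x $ i + (c0 * g x $ i + h * w x $ i) - r x * y x $ j))"
    unfolding split[OF x cy cw cy] by (rule LIMSEQ_unique[OF l1 l2])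
  qed
 qed
 show ?thesis unfolding solves_def using main[OF _ p, of 1 b1 2] main[OF _ q, of 2 b2 1] S unfolding solves_def by simp
qed

text \<open>Taylor coefficients in \<open>h\<close> of the solution at \<open>mu + h\<close> whose
  initial value has the coefficients \<open>v\<close> and whose inhomogeneity is \<open>g\<close>
  times the series with coefficients \<open>dlt\<close>. The parameter \<open>h\<close> moves to the
  right-hand side of the equation at \<open>mu\<close>, so comparing powers puts the previous
  coefficient there.\<close>

fun pc :: "complex => (nat => complex^2) => (nat => complex) => (real => complex^2) => nat => real => complex^2" where
 "pc mu v dlt g 0 = SOL mu (v 0) (%x. dlt 0 *s g x)"
| "pc mu v dlt g (Suc k) = SOL mu (v (Suc k)) (%x. dlt (Suc k) *s g x + pc mu v dlt g k x)"

lemma pc_sol: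
 assumes g: "aiv g"
 shows "sol mu (%x. dlt k *s g x + (if k = 0 then 0 else pc mu v dlt g (k - 1) x)) (pc mu v dlt g k)"
  "pc mu v dlt g k 0 = v k"
proof -
 have *: "sol mu (%x. dlt k *s g x + (if k = 0 then 0 else pc mu v dlt g (k - 1) x)) (pc mu v dlt g k) \<and> pc mu v dlt g k 0 = v k"
 proof (induction k)
  case 0
  then show ?case using SOL(1,2)[OF aiv_scale[OF g]] by simp
 next
  case (Suc k)
  then have "aiv (pc mu v dlt g k)" using sol_aiv by blast
  from SOL(1,2)[OF aiv_add[OF aiv_scale[OF g] this]] show ?case by simp
 qed
 then show "sol mu (%x. dlt k *s g x + (if k = 0 then 0 else pc mu v dlt g (k - 1) x)) (pc mu v dlt g k)"
  "pc mu v dlt g k 0 = v k" by auto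
qed

text \<open>The recursion multiplies bounds by at most \<open>2 * C\<close>, where \<open>C\<close>
  is the growth factor of solutions and 2 is lost in passing from the supremum of \<open>n1\<close>
  to \<open>nrm1\<close>; the ratio \<open>1 + 2 * C\<close> also absorbs the constant term.\<close>

lemma pc_bound:
 assumes g: "aiv g" and M: "!!k. n1 (v k) <= M" "!!k. norm (dlt k) <= M"
 shows "\<exists>A D. A >= 0 \<and> D >= 1 \<and> (\<forall>k. \<forall>x\<in>{0..1}. n1 (pc mu v dlt g k x) <= A * D ^ k)"
proof (intro exI conjI allI ballI)
 define C where "C = gr mu"
 have C: "C >= 1" unfolding C_def by (rule gr_pos)
 have M0: "M >= 0" using M(2)[of 0] norm_ge_zero order_trans by blast
 define A where "A = M * (1 + nrm1 g) * C"
 have G: "nrm1 g >= 0" by (rule nrm1_nonneg[OF g])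
 show A0: "A >= 0" unfolding A_def using M0 G C by auto
 define D where "D = 1 + 2 * C"
 show D: "1 + 2 * C >= 1" using C by simp
 fix k and x :: real assume "x \<in> {0..1}"
 then show "n1 (pc mu v dlt g k x) <= A * (1 + 2 * C) ^ k"
 proof (induction k arbitrary: x)
  case 0
  have "n1 (pc mu v dlt g 0 x) <= (n1 (v 0) + nrm1 (%x. dlt 0 *s g x)) * C" unfolding pc.simps C_def by (rule SOL(3)[OF aiv_scale[OF g] 0])
  also have "\<dots> <= (M + M * nrm1 g) * C" unfolding nrm1_scale using M[of 0] G C by (intro mult_right_mono add_mono) auto
  finally show ?case by (simp add: A_def algebra_simps)
 next
  case (Suc k)
  have av: "aiv (pc mu v dlt g k)" using pc_sol(1)[OF g] sol_aiv by blast
  have "n1 (pc mu v dlt g (Suc k) x) <= (n1 (v (Suc k)) + nrm1 (%x. dlt (Suc k) *s g x + pc mu v dlt g k x)) * C"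
   unfolding pc.simps C_def by (rule SOL(3)[OF aiv_add[OF aiv_scale[OF g] av] Suc.prems])
  also have "\<dots> <= (M + (M * nrm1 g + 2 * (A * (1 + 2 * C) ^ k))) * C"
  proof (intro mult_right_mono add_mono M order_trans[OF nrm1_add[OF aiv_scale[OF g] av]])
   show "nrm1 (%x. dlt (Suc k) *s g x) <= M * nrm1 g" unfolding nrm1_scale using M(2)[of "Suc k"] G by (intro mult_right_mono) auto
   show "nrm1 (pc mu v dlt g k) <= 2 * (A * (1 + 2 * C) ^ k)" by (rule nrm1_le_sup[OF av Suc.IH])
  qed (use C in auto)
  also have "\<dots> = A + 2 * C * (A * (1 + 2 * C) ^ k)" by (simp add: A_def algebra_simps)
  also have "\<dots> <= A * (1 + 2 * C) ^ k + 2 * C * (A * (1 + 2 * C) ^ k)"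
  proof -
   have "A * 1 <= A * (1 + 2 * C) ^ k" by (rule mult_left_mono[OF one_le_power A0]) (use C in auto)
   then show ?thesis by simp
  qed
  also have "\<dots> = A * (1 + 2 * C) ^ Suc k" by (simp add: algebra_simps)
  finally show ?case .
 qed
qed

lemma pc_series:
 assumes g: "aiv g" and bd: "!!k x. x \<in> {0..1} ==> n1 (pc mu v dlt g k x) <= A * D ^ k" and AD: "A >= 0" "D >= 1"
  and h: "norm h * D < 1"
  and ds: "(%k. dlt k * h ^ k) sums d" and vs: "!!i. (%k. v k $ i * h ^ k) sums (w $ i)"
  and x: "x \<in> {0..1}"
 shows "(%k. pc mu v dlt g k x $ i * h ^ k) sums (SOL (mu + h) w (%x. d *s g x) x $ i)"
  "uniform_limit {0..1} (%n x. \<Sum>k<n. pc mu v dlt g k x $ i * h ^ k) (%x. SOL (mu + h) w (%x. d *s g x) x $ i) sequentially"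
proof -
 define P where "P = pc mu v dlt g"
 define y :: "real => complex^2" where "y x = (\<chi> i. \<Sum>k. P k x $ i * h ^ k)" for x
 define S :: "nat => real => complex^2" where "S n x = (\<Sum>k<n. (h ^ k) *s P k x)" for n x
 have Sn: "S n x $ i = (\<Sum>k<n. P k x $ i * h ^ k)" for n x i by (simp add: S_def mult.commute)
 have summ: "summable (%k. A * (norm h * D) ^ k)"
  by (intro summable_mult summable_geometric) (use h AD in \<open>simp add: abs_mult\<close>)
 have b: "norm (P k x $ i * h ^ k) <= A * (norm h * D) ^ k" if "x \<in> {0..1}" for k x i
 proof -
  have "norm (P k x $ i) <= A * D ^ k" unfolding P_def by (rule order_trans[OF n1_nth_le bd[OF that]])
  then have "norm (P k x $ i) * norm h ^ k <= A * D ^ k * norm h ^ k" by (rule mult_right_mono) simp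
  then show ?thesis by (simp add: norm_mult norm_power power_mult_distrib mult_ac)
 qed
 have ul: "uniform_limit {0..1} (%n x. S n x $ i) (%x. y x $ i) sequentially" for i
  unfolding Sn y_def vec_lambda_beta by (rule Weierstrass_m_test[OF b summ])
 have Psol: "sol mu (%x. dlt k *s g x + (if k = 0 then 0 else P (k - 1) x)) (P k)" for k unfolding P_def by (rule pc_sol[OF g])
 have Ssol: "sol mu (%x. (\<Sum>k<Suc n. dlt k * h ^ k) *s g x + h *s S n x) (S (Suc n))" for n
 proof (induction n)
  case 0
  show ?case by (rule sol_cong[OF Psol[of 0]]) (simp_all add: S_def)
 next
  case (Suc n)
  have "sol mu (%x. ((\<Sum>k<Suc n. dlt k * h ^ k) *s g x + h *s S n x) + h ^ Suc n *s (dlt (Suc n) *s g x + (if Suc n = 0 then 0 else P (Suc n - 1) x)))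
    (%x. S (Suc n) x + h ^ Suc n *s P (Suc n) x)"
   by (rule sol_add[OF Suc.IH sol_scale[OF Psol[of "Suc n"]]])
  then show ?case by (rule sol_cong) (simp_all add: S_def vec_eq_iff algebra_simps sum_distrib_left)
 qed
 have cS: "continuous_on {0..1} (%x. S n x $ i)" for n i unfolding Sn by (intro continuous_intros sol_cont[OF Psol])
 have "sol mu (%x. d *s g x + h *s y x) y"
 proof (rule sol_uniform_limit[OF Ssol g cS])
  show "uniform_limit {0..1} (%n x. S (Suc n) x $ i) (%x. y x $ i) sequentially" for i
   using ul[of i] filterlim_compose[OF _ filterlim_Suc] unfolding o_def by fastforce
  show "(%n. \<Sum>k<Suc n. dlt k * h ^ k) \<longlonglongrightarrow> d" using ds unfolding sums_def by (rule LIMSEQ_Suc)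
 qed (rule ul)
 then have ys: "sol (mu + h) (%x. d *s g x) y" by (rule sol_cong) (simp_all add: vec_eq_iff algebra_simps)
 have P0: "P k 0 = v k" for k unfolding P_def by (rule pc_sol[OF g])
 have y0: "y 0 = w" unfolding y_def P0 vec_eq_iff using vs by (simp add: sums_iff)
 have yS: "SOL (mu + h) w (%x. d *s g x) x = y x" if "x \<in> {0..1}" for x using SOL_eq[OF ys aiv_scale[OF g] that] y0 by simp
 have "uniform_limit {0..1} (%n x. \<Sum>k<n. P k x $ i * h ^ k) (%x. SOL (mu + h) w (%x. d *s g x) x $ i) sequentially"
  using ul[of i] unfolding Sn by (rule uniform_limit_cong'[THEN iffD1, rotated 2]) (simp_all add: yS)
 then show "uniform_limit {0..1} (%n x. \<Sum>k<n. pc mu v dlt g k x $ i * h ^ k) (%x. SOL (mu + h) w (%x. d *s g x) x $ i) sequentially"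
  by (simp add: P_def)
 from tendsto_uniform_limitI[OF this x]
 show "(%k. pc mu v dlt g k x $ i * h ^ k) sums (SOL (mu + h) w (%x. d *s g x) x $ i)" by (simp add: sums_def)
qed

lemma SOL_holomorphic:
 assumes g: "aiv g" and x: "x \<in> {0..1}"
 shows "(%l. SOL l v g x $ i) holomorphic_on UNIV"
proof -
 have "\<exists>r>0. (%l. SOL l v g x $ i) holomorphic_on ball mu r" for mu
 proof -
  define v' where "v' k = (if k = 0 then v else 0)" for k :: nat
  define d' where "d' k = (if k = 0 then 1 else 0 :: complex)" for k :: nat
  have vb: "n1 (v' k) <= n1 v + 1" and db: "norm (d' k) <= n1 v + 1" for k using n1_nonneg[of v] by (auto simp: v'_def d'_def)
  obtain A D where "A >= 0 \<and> D >= 1 \<and> (\<forall>k. \<forall>x\<in>{0..1}. n1 (pc mu v' d' g k x) <= A * D ^ k)"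
   using pc_bound[of g v' _ d' mu, OF g vb db] by blast
  then have AD: "A >= 0" "D >= 1" "!!k x. x \<in> {0..1} ==> n1 (pc mu v' d' g k x) <= A * D ^ k" by auto
  have "(%l. SOL l v g x $ i) holomorphic_on ball mu (1 / D)"
  proof (rule power_series_holomorphic)
   fix l assume "l \<in> ball mu (1 / D)"
   then have h: "norm (l - mu) * D < 1" using AD by (simp add: dist_norm norm_minus_commute field_simps)
   have 1: "(%k. d' k * (l - mu) ^ k) sums 1"
    using sums_single[of 0 "%k. d' k * (l - mu) ^ k"] by (simp add: d'_def if_distrib[of "%z. z * _"] cong: if_cong)
   have 2: "(%k. v' k $ i * (l - mu) ^ k) sums (v $ i)" for i
    using sums_single[of 0 "%k. v $ i * (l - mu) ^ k"] by (simp add: v'_def if_distrib[of "%z. z $ i * _"] cong: if_cong)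
   from pc_series(1)[OF g AD(3,1,2) h 1 2 x, of i]
   show "(%k. pc mu v' d' g k x $ i * (l - mu) ^ k) sums SOL l v g x $ i" by simp
  qed
  then show ?thesis using AD by (intro exI[of _ "1/D"]) auto
 qed
 then have "(%l. SOL l v g x $ i) field_differentiable at mu" for mu
  by (meson holomorphic_on_imp_differentiable_at open_ball centre_in_ball)
 then show ?thesis by (simp add: holomorphic_on_def)
qed

end

section \<open>The boundary value problem and its transpose\<close>

text \<open>Crossing the components interchanges the rows of the transposed system, so that its
  parameters \<open>- b2\<close>, \<open>- b1\<close> come again in the order negative, positive.
  Composition with \<open>cc\<close> recovers the inner product.\<close>

definition pair :: "(real => complex^2) => (real => complex^2) => complex" where
 "pair y h = integral {0..1} (%x. h x $ 2 * y x $ 1) + integral {0..1} (%x. h x $ 1 * y x $ 2)"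

definition cc :: "(real => complex^2) => real => complex^2" where
 "cc f x = vector [cnj (f x $ 2), cnj (f x $ 1)]"

definition contv :: "(real => complex^2) => bool" where
 "contv y \<longleftrightarrow> (\<forall>i. continuous_on {0..1} (%x. y x $ i))"

lemma contv_aiv: "contv y ==> aiv y" by (auto simp: contv_def aiv_def intro: ai_cont)

lemma contv_continuous: "contv y ==> continuous_on {0..1} y"
proof -
 assume "contv y"
 then have "continuous_on {0..1} (%x. \<chi> i. y x $ i)" by (intro continuous_on_vec_lambda) (simp add: contv_def)
 then show ?thesis by simp
qed

lemma contv_sq_integrable: assumes "contv y" shows "sq_integrable y"
proof -
 have c: "continuous_on {0..1} y" by (rule contv_continuous[OF assms])
 have "continuous_on {0..1} (%x. (norm (y x))^2)" by (intro continuous_intros c)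
 from absolutely_integrable_continuous_real[OF this]
 have "integrable unit_leb (%x. (norm (y x))^2)" by (simp add: absolutely_integrable_on_unit_iff)
 then show ?thesis using continuous_unit_measurable[OF c] by (simp add: sq_integrable_def)
qed

lemma norm_contv_le: "contv y ==> (!!x. x \<in> {0..1} ==> n1 (y x) <= M) ==> norm (abs_L2 y) <= M"
proof -
 assume y: "contv y" and M: "!!x. x \<in> {0..1} ==> n1 (y x) <= M"
 have M0: "M >= 0" using M[of 0] n1_nonneg order_trans by auto
 have s: "sq_integrable y" by (rule contv_sq_integrable[OF y])
 have nb: "norm (y x) <= n1 (y x)" for x by (rule power2_le_imp_le) (auto simp: norm_sq_vec2 power2_sum n1_def)
 have "(norm (abs_L2 y))^2 = (\<integral>x. (norm (y x))^2 \<partial>unit_leb)" by (rule norm_abs_sq[OF s])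
 also have "\<dots> <= (\<integral>x. M^2 \<partial>unit_leb)"
 proof (rule integral_mono_AE)
  interpret finite_measure unit_leb by (rule finite_measure_lebesgue_on) auto
  show "integrable unit_leb (%x. M^2)" by simp
  show "AE x in unit_leb. (norm (y x))^2 <= M^2"
   using AE_space by eventually_elim (use M nb order_trans in \<open>auto intro!: power_mono, blast\<close>)
 qed (use s in \<open>simp add: sq_integrable_def\<close>)
 also have "\<dots> = M^2" by (simp add: measure_restrict_space)
 finally show ?thesis using M0 by (rule power2_le_imp_le)
qed

lemma sq_integrable_cc: assumes "sq_integrable f" shows "sq_integrable (cc f)"
proof -
 have m: "f \<in> borel_measurable unit_leb" using assms by (simp add: sq_integrable_def)
 have "continuous_on UNIV (%v::complex^2. (\<chi> i. cnj (v $ (3 - i))) :: complex^2)" by (intro continuous_on_vec_lambda continuous_intros)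
 moreover have "cc f = (%x. (\<chi> i. cnj (f x $ (3 - i))))" by (auto simp: cc_def vec_eq_iff forall_2)
 ultimately have "cc f \<in> borel_measurable unit_leb" using borel_measurable_continuous_on[OF _ m] by simp
 moreover have "(norm (cc f x))^2 = (norm (f x))^2" for x by (simp add: norm_sq_vec2 cc_def)
 ultimately show ?thesis using assms by (simp add: sq_integrable_def)
qed

lemma pair_ai: "contv y ==> aiv h ==> (%x. h x $ i * y x $ j) absolutely_integrable_on {0..1}"
 using ai_cont_mult[of "%x. h x $ i" "%x. y x $ j"] by (simp add: contv_def aiv_def mult.commute)

lemma cinner_pair:
 assumes "contv y" "sq_integrable f"
 shows "cinner (abs_L2 y) (abs_L2 f) = pair y (cc f)"
proof -
 have a: "aiv (cc f)" by (rule sq_integrable_aiv(1)[OF sq_integrable_cc[OF assms(2)]])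
 have i: "(\<integral>x. cc f x $ i * y x $ j \<partial>unit_leb) = integral {0..1} (%x. cc f x $ i * y x $ j)" for i j
  by (rule lebesgue_integral_eq_integral) (use pair_ai[OF assms(1) a] in \<open>auto simp: absolutely_integrable_on_unit_iff\<close>)
 have "cinner (abs_L2 y) (abs_L2 f) = (\<integral>x. cc f x $ 2 * y x $ 1 + cc f x $ 1 * y x $ 2 \<partial>unit_leb)"
  by (simp add: cinner_abs contv_sq_integrable assms sum_2 cc_def mult.commute)
 also have "\<dots> = pair y (cc f)" unfolding pair_def i[symmetric] by (rule Bochner_Integration.integral_add)
    (use pair_ai[OF assms(1) a] in \<open>auto simp: absolutely_integrable_on_unit_iff\<close>)
 finally show ?thesis .
qed

lemma pair_commute: "pair y z = pair z y" by (simp add: pair_def mult.commute)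

lemma cc_cc: "cc (cc f) = f" by (auto simp: cc_def vec_eq_iff forall_2)

lemma pair_add: "contv y ==> contv z ==> aiv h ==> pair (%x. y x + z x) h = pair y h + pair z h" unfolding pair_def
 using io_sub[OF pair_ai[of y h 2 1], of 0 1] io_sub[OF pair_ai[of z h 2 1], of 0 1]
  io_sub[OF pair_ai[of y h 1 2], of 0 1] io_sub[OF pair_ai[of z h 1 2], of 0 1]
 by (simp add: distrib_left integral_add)

lemma pair_scale: "pair (%x. c *s y x) h = c * pair y h" by (simp add: pair_def distrib_left mult.left_commute[of _ c])

lemma contv_sum: "(!!k. contv (P k)) ==> contv (%x. \<Sum>k<n. c k *s P k x)" for n :: nat
 unfolding contv_def by (auto intro!: continuous_on_sum continuous_on_mult continuous_on_const)

lemma pair_sum: "(!!k. contv (P k)) ==> aiv h ==> pair (%x. \<Sum>k<n. c k *s P k x) h = (\<Sum>k<n. c k * pair (P k) h)" for n :: nat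
proof (induction n)
 case 0 then show ?case by (simp add: pair_def)
next
 case (Suc n)
 have "contv (%x. c n *s P n x)" using Suc.prems(1)[of n] by (auto simp: contv_def intro!: continuous_on_mult continuous_on_const)
 then show ?case using Suc pair_add[OF contv_sum[of P c n] _ Suc.prems(2)] by (simp add: pair_scale)
qed

lemma powser_eq_0:
 fixes a :: "nat => complex"
 assumes "r > 0" "!!w. norm w < r ==> (%k. a k * w ^ k) sums 0"
 shows "a k = 0"
proof (rule ccontr)
 assume k: "a k ~= 0"
 have "a 0 = 0" using assms(2)[of 0] assms(1) by simp
 then have "k > 0" using k by (cases k) auto
 show False
 proof (rule powser_0_nonzero[of r 0 a "%_. 0" k])
  show "(%n. a n * (x - 0) ^ n) sums 0" if "norm (x - 0) < r" for x using assms(2)[of x] that by simp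
  fix s :: real assume s: "0 < s" "!!z::complex. z \<in> cball 0 s - {0} ==> (0::complex) ~= 0"
  show False using s(2)[of "of_real s"] s(1) by simp
 qed (use assms(1) k \<open>k > 0\<close> in auto)
qed

text \<open>The Taylor series of an entire function converges at distance 1 from its centre, so the
  coefficients tend to 0 and are bounded, as \<open>pc_bound\<close> requires.\<close>

lemma entire_coeffs:
 assumes "F holomorphic_on UNIV"
 obtains c M where "!!k. norm (c k) <= M" "!!w. norm w < 1 ==> (%k. c k * w ^ k) sums F (mu + w)"
proof -
 define c where "c k = (deriv ^^ k) F mu / fact k" for k
 have s: "(%k. c k * w ^ k) sums F (mu + w)" for w using holomorphic_power_series[of F mu "norm w + 1" "mu + w"] assms
  by (auto simp: c_def dist_norm intro: holomorphic_on_subset)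
 have "summable c" using s[of 1] by (simp add: sums_iff)
 then have "Bseq c" by (intro convergent_imp_Bseq) (auto intro: summable_LIMSEQ_zero convergentI)
 then obtain M where "!!k. norm (c k) <= M" unfolding Bseq_def by blast
 then show ?thesis using that s by blast
qed

locale bvp = ode +
 fixes a b c d :: complex
 assumes b1: "b1 < 0" and b2: "0 < b2" and reg: "a * d - b * c ~= 0"
begin

abbreviation "bc \<equiv> boundary_conds a b c d"
abbreviation "op \<equiv> L_op b1 b2 (Q_mat p q) a b c d"
definition B1 :: "(real => complex^2) => complex" where "B1 y = y 0 $ 1 + b * y 0 $ 2 + a * y 1 $ 1"
definition B2 :: "(real => complex^2) => complex" where "B2 y = d * y 0 $ 2 + c * y 1 $ 1 + y 1 $ 2"

lemma bc_iff: "bc y \<longleftrightarrow> B1 y = 0 \<and> B2 y = 0" by (simp add: boundary_conds_def B1_def B2_def)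

lemma B_add: "B1 (%x. y x + z x) = B1 y + B1 z" "B2 (%x. y x + z x) = B2 y + B2 z" by (simp_all add: B1_def B2_def algebra_simps)
lemma B_scale: "B1 (%x. e *s y x) = e * B1 y" "B2 (%x. e *s y x) = e * B2 y" by (simp_all add: B1_def B2_def algebra_simps)
lemma bc_add: "bc y ==> bc z ==> bc (%x. y x + z x)" by (simp add: bc_iff B_add)
lemma bc_scale: "bc y ==> bc (%x. e *s y x)" by (simp add: bc_iff B_scale)
lemma bc_diff: "bc y ==> bc z ==> bc (%x. y x - z x)"
 using bc_add[OF _ bc_scale[of z "-1"], of y] by (simp add: vector_sneg_minus1[symmetric])

lemma sol_contv: "sol l g y ==> contv y" by (simp add: contv_def sol_cont)

definition "phi1 l = SOL l (vector [1, 0]) (%x. 0)"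
definition "phi2 l = SOL l (vector [0, 1]) (%x. 0)"
definition "psi g l = SOL l 0 g"
definition "\<Delta> l = B1 (phi1 l) * B2 (phi2 l) - B1 (phi2 l) * B2 (phi1 l)"
text \<open>Cramer's rule without the division: with this initial value and the inhomogeneity
  \<open>\<Delta> l\<close> times \<open>g\<close> both boundary forms vanish. Thus
  \<open>Y g l\<close> is \<open>\<Delta> l\<close> times the resolvent applied to \<open>g\<close>,
  and it stays entire in \<open>l\<close> across the eigenvalues.\<close>

definition vv :: "(real => complex^2) => complex => complex^2" where
 "vv g l = vector [B1 (phi2 l) * B2 (psi g l) - B1 (psi g l) * B2 (phi2 l), B2 (phi1 l) * B1 (psi g l) - B1 (phi1 l) * B2 (psi g l)]"
definition "Y g l = SOL l (vv g l) (%x. \<Delta> l *s g x)"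

lemma sol_comb:
 assumes y: "sol l (%x. e *s g x) y" and g: "aiv g" and x: "x \<in> {0..1}"
 shows "y x = y 0 $ 1 *s phi1 l x + y 0 $ 2 *s phi2 l x + e *s psi g l x"
proof -
 have "sol l (%x. (y 0 $ 1 *s 0 + y 0 $ 2 *s 0) + e *s g x) (%x. (y 0 $ 1 *s phi1 l x + y 0 $ 2 *s phi2 l x) + e *s psi g l x)"
  unfolding phi1_def phi2_def psi_def by (intro sol_add sol_scale SOL(1) g) auto
 then have "sol l (%x. e *s g x) (%x. y 0 $ 1 *s phi1 l x + y 0 $ 2 *s phi2 l x + e *s psi g l x)" by (rule sol_cong) auto
 from sol_unique[OF y this _ x] show ?thesis by (simp add: phi1_def phi2_def psi_def SOL g vec_eq_iff forall_2)
qed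

lemma B_comb:
 assumes y: "sol l (%x. e *s g x) y" and g: "aiv g"
 shows "B1 y = y 0 $ 1 * B1 (phi1 l) + y 0 $ 2 * B1 (phi2 l) + e * B1 (psi g l)"
  "B2 y = y 0 $ 1 * B2 (phi1 l) + y 0 $ 2 * B2 (phi2 l) + e * B2 (psi g l)"
proof -
 define v where "v = y 0"
 have *: "y 0 = v $ 1 *s phi1 l 0 + v $ 2 *s phi2 l 0 + e *s psi g l 0" "y 1 = v $ 1 *s phi1 l 1 + v $ 2 *s phi2 l 1 + e *s psi g l 1"
  unfolding v_def by (rule sol_comb[OF assms]; simp)+
 show "B1 y = y 0 $ 1 * B1 (phi1 l) + y 0 $ 2 * B1 (phi2 l) + e * B1 (psi g l)"
  "B2 y = y 0 $ 1 * B2 (phi1 l) + y 0 $ 2 * B2 (phi2 l) + e * B2 (psi g l)"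
  unfolding v_def[symmetric] unfolding B1_def B2_def * by (simp_all add: algebra_simps)
qed

lemma Y: assumes g: "aiv g" shows "sol l (%x. \<Delta> l *s g x) (Y g l)" "bc (Y g l)"
proof -
 show s: "sol l (%x. \<Delta> l *s g x) (Y g l)" unfolding Y_def by (rule SOL(1)[OF aiv_scale[OF g]])
 have "Y g l 0 = vv g l" unfolding Y_def by (rule SOL(2)[OF aiv_scale[OF g]])
 then show "bc (Y g l)" unfolding bc_iff B_comb[OF s g] \<Delta>_def by (simp add: vv_def algebra_simps)
qed

lemma zero_of_\<Delta>_nz:
 assumes "\<Delta> l ~= 0" "sol l (%x. 0) y" "bc y" "x \<in> {0..1}"
 shows "y x = 0"
proof -
 have s: "sol l (%x. 0 *s 0) y" by (rule sol_cong[OF assms(2)]) auto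
 have 1: "y 0 $ 1 * B1 (phi1 l) + y 0 $ 2 * B1 (phi2 l) = 0" "y 0 $ 1 * B2 (phi1 l) + y 0 $ 2 * B2 (phi2 l) = 0"
  using B_comb[OF s] assms(3) by (auto simp: bc_iff)
 have "y 0 $ 1 * \<Delta> l = (y 0 $ 1 * B1 (phi1 l) + y 0 $ 2 * B1 (phi2 l)) * B2 (phi2 l) - (y 0 $ 1 * B2 (phi1 l) + y 0 $ 2 * B2 (phi2 l)) * B1 (phi2 l)"
  by (simp add: \<Delta>_def algebra_simps)
 moreover have "y 0 $ 2 * \<Delta> l = (y 0 $ 1 * B2 (phi1 l) + y 0 $ 2 * B2 (phi2 l)) * B1 (phi1 l) - (y 0 $ 1 * B1 (phi1 l) + y 0 $ 2 * B1 (phi2 l)) * B2 (phi1 l)"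
  by (simp add: \<Delta>_def algebra_simps)
 ultimately have "y 0 = 0" using assms(1) unfolding 1 by (simp add: vec_eq_iff forall_2)
 then show ?thesis using sol_unique[OF assms(2) sol_zero] assms(4) by simp
qed

lemma eigenfunction_exists:
 assumes "\<Delta> l = 0"
 shows "\<exists>y. sol l (%x. 0) y \<and> bc y \<and> y 0 ~= 0"
proof -
 obtain s t where st: "s * B1 (phi1 l) + t * B1 (phi2 l) = 0" "s * B2 (phi1 l) + t * B2 (phi2 l) = 0" "s ~= 0 \<or> t ~= 0"
 proof (cases "B1 (phi1 l) = 0 \<and> B1 (phi2 l) = 0")
  case True
  show ?thesis
  proof (cases "B2 (phi1 l) = 0 \<and> B2 (phi2 l) = 0")
   case True' : True
   show ?thesis by (rule that[of 1 0]) (use True True' in auto)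
  next
   case False
   then show ?thesis by (intro that[of "- B2 (phi2 l)" "B2 (phi1 l)"]) (use True in auto)
  qed
 next
  case False
  then show ?thesis by (intro that[of "- B1 (phi2 l)" "B1 (phi1 l)"]) (use assms in \<open>auto simp: \<Delta>_def algebra_simps\<close>)
 qed
 have s: "sol l (%x. 0) (SOL l (vector [s, t]) (%x. 0))" by (rule SOL(1)) simp
 have s': "sol l (%x. 0 *s 0) (SOL l (vector [s, t]) (%x. 0))" by (rule sol_cong[OF s]) auto
 have i: "SOL l (vector [s, t]) (%x. 0) 0 = vector [s, t]" by (rule SOL(2)) simp
 show ?thesis using B_comb[OF s'] i st s by (intro exI[of _ "SOL l (vector [s, t]) (%x. 0)"]) (auto simp: bc_iff vec_eq_iff forall_2)
qed

lemma B_holomorphic: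
 assumes "aiv g"
 shows "(%l. B1 (SOL l v g)) holomorphic_on UNIV" "(%l. B2 (SOL l v g)) holomorphic_on UNIV"
 unfolding B1_def B2_def by (intro holomorphic_intros SOL_holomorphic assms; simp)+

lemma \<Delta>_holomorphic: "\<Delta> holomorphic_on UNIV"
 unfolding \<Delta>_def phi1_def phi2_def by (intro holomorphic_intros B_holomorphic) auto

lemma vv_holomorphic: "aiv g ==> (%l. vv g l $ i) holomorphic_on UNIV" using exhaust_2[of i] unfolding vv_def phi1_def phi2_def psi_def
 by (auto intro!: holomorphic_intros B_holomorphic)

text \<open>The coefficients inherit the boundary conditions because a power series that vanishes
  identically has zero coefficients. Where the Taylor coefficients of \<open>\<Delta>\<close>
  vanish, the equations for consecutive \<open>P k\<close> are the relations of a Jordan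
  chain.\<close>

lemma Y_series:
 assumes g: "aiv g"
 shows "\<exists>P dlt r. r > 0 \<and>
  (\<forall>k. sol mu (%x. dlt k *s g x + (if k = 0 then 0 else P (k - 1) x)) (P k) \<and> bc (P k)) \<and>
  (\<forall>w. norm w < r --> (%k. dlt k * w ^ k) sums \<Delta> (mu + w) \<and>
   (\<forall>h. aiv h --> (%k. pair (P k) h * w ^ k) sums pair (Y g (mu + w)) h))"
proof -
 obtain dlt M0 where dlt: "!!k. norm (dlt k) <= M0" "!!w. norm w < 1 ==> (%k. dlt k * w ^ k) sums \<Delta> (mu + w)"
  by (rule entire_coeffs[OF \<Delta>_holomorphic, of mu]) blast
 obtain c1 M1 where c1: "!!k. norm (c1 k) <= M1" "!!w. norm w < 1 ==> (%k. c1 k * w ^ k) sums (vv g (mu + w) $ 1)"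
  by (rule entire_coeffs[OF vv_holomorphic[OF g], of mu 1]) blast
 obtain c2 M2 where c2: "!!k. norm (c2 k) <= M2" "!!w. norm w < 1 ==> (%k. c2 k * w ^ k) sums (vv g (mu + w) $ 2)"
  by (rule entire_coeffs[OF vv_holomorphic[OF g], of mu 2]) blast
 define v :: "nat => complex^2" where "v k = vector [c1 k, c2 k]" for k
 define M where "M = \<bar>M0\<bar> + \<bar>M1\<bar> + \<bar>M2\<bar>"
 have Mb: "n1 (v k) <= M" "norm (dlt k) <= M" for k using dlt(1)[of k] c1(1)[of k] c2(1)[of k] by (auto simp: v_def n1_def M_def)
 define P where "P = pc mu v dlt g"
 obtain A D where "A >= 0 \<and> D >= 1 \<and> (\<forall>k. \<forall>x\<in>{0..1}. n1 (pc mu v dlt g k x) <= A * D ^ k)"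
  using pc_bound[of g v M dlt mu, OF g Mb] by blast
 then have AD: "A >= 0" "D >= 1" "!!k x. x \<in> {0..1} ==> n1 (pc mu v dlt g k x) <= A * D ^ k" by auto
 define r where "r = 1 / D"
 have r: "r > 0" "r <= 1" using AD by (auto simp: r_def)
 have vs: "(%k. v k $ i * w ^ k) sums (vv g (mu + w) $ i)" if "norm w < 1" for w i
  using exhaust_2[of i] c1(2)[OF that] c2(2)[OF that] by (auto simp: v_def)
 have wD: "norm w * D < 1" "norm w < 1" if "norm w < r" for w
 proof -
  show "norm w < 1" using that r(2) by linarith
  show "norm w * D < 1" using that AD(2) by (simp add: r_def field_simps)
 qed
 have Ys: "(%k. P k x $ i * w ^ k) sums (Y g (mu + w) x $ i)"
  "uniform_limit {0..1} (%n x. \<Sum>k<n. P k x $ i * w ^ k) (%x. Y g (mu + w) x $ i) sequentially"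
  if "norm w < r" "x \<in> {0..1}" for w x i
  unfolding P_def Y_def
  by (rule pc_series[OF g AD(3,1,2) wD(1)[OF that(1)] dlt(2)[OF wD(2)[OF that(1)]] vs[OF wD(2)[OF that(1)]] that(2)]; assumption)+
 have Psol: "sol mu (%x. dlt k *s g x + (if k = 0 then 0 else P (k - 1) x)) (P k)" for k unfolding P_def by (rule pc_sol[OF g])
 have Pc: "contv (P k)" for k by (rule sol_contv[OF Psol])
 have "B1 (P k) = 0" for k
 proof (rule powser_eq_0[OF r(1)])
  fix w :: complex assume w: "norm w < r"
  have "(%k. P k 0 $ 1 * w ^ k + b * (P k 0 $ 2 * w ^ k) + a * (P k 1 $ 1 * w ^ k)) sums B1 (Y g (mu + w))"
   unfolding B1_def by (intro sums_add sums_mult Ys w) auto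
  then show "(%k. B1 (P k) * w ^ k) sums 0" using Y(2)[OF g] by (simp add: B1_def bc_iff algebra_simps)
 qed
 moreover have "B2 (P k) = 0" for k
 proof (rule powser_eq_0[OF r(1)])
  fix w :: complex assume w: "norm w < r"
  have "(%k. d * (P k 0 $ 2 * w ^ k) + c * (P k 1 $ 1 * w ^ k) + P k 1 $ 2 * w ^ k) sums B2 (Y g (mu + w))"
   unfolding B2_def by (intro sums_add sums_mult Ys w) auto
  then show "(%k. B2 (P k) * w ^ k) sums 0" using Y(2)[OF g] by (simp add: B2_def bc_iff algebra_simps)
 qed
 moreover have "(%k. pair (P k) h * w ^ k) sums pair (Y g (mu + w)) h" if w: "norm w < r" and h: "aiv h" for w h
 proof -
  have hi: "(%x. h x $ i) absolutely_integrable_on {0..1}" for i using h by (simp add: aiv_def)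
  have e: "(\<Sum>k<n. pair (P k) h * w ^ k) = integral {0..1} (%x. h x $ 2 * (\<Sum>k<n. P k x $ 1 * w ^ k)) + integral {0..1} (%x. h x $ 1 * (\<Sum>k<n. P k x $ 2 * w ^ k))" for n
   using pair_sum[OF Pc h, where c = "%k. w ^ k" and n = n] by (simp add: pair_def mult.commute)
  have ct: "continuous_on {0..1} (%x. \<Sum>k<n. P k x $ i * w ^ k)" for n i
   using Pc by (auto simp: contv_def intro!: continuous_on_sum continuous_on_mult continuous_on_const)
  show ?thesis unfolding sums_def e unfolding pair_def by (intro tendsto_add tendsto_integral_mult_uniform hi ct Ys(2)[OF w, of 0]) auto
 qed
 ultimately show ?thesis using r dlt(2) wD(2) Psol by (intro exI[of _ P] exI[of _ dlt] exI[of _ r]) (auto simp: bc_iff)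
qed

text \<open>Integrate the derivative of \<open>y1 z2 / (i b1) + y2 z1 / (i b2)\<close>: the crossed
  components make the terms with \<open>p\<close> and \<open>q\<close> cancel. The transposed
  boundary conditions are those for which the boundary terms cancel as well.\<close>

lemma lagrange:
 assumes y: "sol l g y" "bc y" and z: "solves (-b2) (-b1) p q l' h z"
  "boundary_conds d (- b * b2 / b1) (- c * b1 / b2) a z"
  and ga: "aiv g" "aiv h"
 shows "(l - l') * pair y z + pair g z - pair y h = 0"
proof -
 note ya = sol_acd[OF y(1)]
 have za: "acd (%x. z x $ 1) (%x. \<i> * (-b2) * (l' * z x $ 1 + h x $ 1 - p x * z x $ 2))"
  "acd (%x. z x $ 2) (%x. \<i> * (-b1) * (l' * z x $ 2 + h x $ 2 - q x * z x $ 1))"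
  using z(1) by (auto simp: solves_def)
 have zc: "contv z" using za[THEN acd_continuous] by (simp add: contv_def forall_2)
 have yc: "contv y" by (rule sol_contv[OF y(1)])
 have nz: "b1 ~= 0" "b2 ~= 0" using b1 b2 by auto
 let ?H = "%x. (1 / (\<i> * b1)) * (y x $ 1 * z x $ 2) + (1 / (\<i> * b2)) * (y x $ 2 * z x $ 1)"
 have "acd ?H (%x. (1 / (\<i> * b1)) * (y x $ 1 * (\<i> * (-b1) * (l' * z x $ 2 + h x $ 2 - q x * z x $ 1)) + z x $ 2 * (\<i> * b1 * (l * y x $ 1 + g x $ 1 - p x * y x $ 2)))
   + (1 / (\<i> * b2)) * (y x $ 2 * (\<i> * (-b2) * (l' * z x $ 1 + h x $ 1 - p x * z x $ 2)) + z x $ 1 * (\<i> * b2 * (l * y x $ 2 + g x $ 2 - q x * y x $ 1))))"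
  by (intro acd_add acd_cmult acd_mult ya za)
 then have H: "acd ?H (%x. (l - l') * (z x $ 2 * y x $ 1 + z x $ 1 * y x $ 2) + (g x $ 1 * z x $ 2 + g x $ 2 * z x $ 1) - (h x $ 2 * y x $ 1 + h x $ 1 * y x $ 2))"
  by (rule acd_cong) (use nz in \<open>simp_all add: field_simps\<close>)
 have "?H 1 - ?H 0 = (l - l') * pair y z + pair g z - pair y h"
 proof -
  have i1: "(%x. z x $ i * y x $ j) integrable_on {0..1}" "(%x. g x $ i * z x $ j) integrable_on {0..1}" "(%x. h x $ i * y x $ j) integrable_on {0..1}" for i j
   using io_sub[OF pair_ai[OF yc contv_aiv[OF zc]], of 0 1] io_sub[OF pair_ai[OF zc ga(1)], of 0 1] io_sub[OF pair_ai[OF yc ga(2)], of 0 1] by auto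
  have "?H 1 - ?H 0 = integral {0..1} (%x. (l - l') * (z x $ 2 * y x $ 1 + z x $ 1 * y x $ 2) + (g x $ 1 * z x $ 2 + g x $ 2 * z x $ 1) - (h x $ 2 * y x $ 1 + h x $ 1 * y x $ 2))"
   using acd_diff_eq[OF H, of 0 1] by simp
  also have "\<dots> = (l - l') * (integral {0..1} (%x. z x $ 2 * y x $ 1) + integral {0..1} (%x. z x $ 1 * y x $ 2)) + (integral {0..1} (%x. g x $ 1 * z x $ 2) + integral {0..1} (%x. g x $ 2 * z x $ 1)) - (integral {0..1} (%x. h x $ 2 * y x $ 1) + integral {0..1} (%x. h x $ 1 * y x $ 2))"
   by (intro integral_unique has_integral_diff has_integral_add has_integral_mult_right integrable_integral i1)
  also have "integral {0..1} (%x. g x $ 1 * z x $ 2) + integral {0..1} (%x. g x $ 2 * z x $ 1) = pair g z"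
   by (simp add: pair_def mult.commute)
  finally show ?thesis by (simp add: pair_def)
 qed
 moreover have "?H 1 - ?H 0 = 0"
 proof -
  have e: "y 0 $ 1 = - (b * y 0 $ 2 + a * y 1 $ 1)" "y 1 $ 2 = - (d * y 0 $ 2 + c * y 1 $ 1)"
   using y(2) unfolding boundary_conds_def eq_neg_iff_add_eq_0 by (simp_all only: ac_simps)
  have f: "z 0 $ 1 = - (- b * b2 / b1 * z 0 $ 2 + d * z 1 $ 1)" "z 1 $ 2 = - (a * z 0 $ 2 + (- c * b1 / b2) * z 1 $ 1)"
   using z(2) unfolding boundary_conds_def eq_neg_iff_add_eq_0 by (simp_all only: ac_simps)
  show ?thesis unfolding e f using nz by (simp add: field_simps)
 qed
 ultimately show ?thesis by simp
qed

lemma power_kernel_Suc_iff: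
 "u \<in> power_kernel op mu (Suc n) \<longleftrightarrow>
   (\<exists>y g. u = abs_L2 y \<and> sol mu g y \<and> bc y \<and> sq_integrable g \<and> abs_L2 g \<in> power_kernel op mu n)"
proof -
 have nz: "b1 ~= 0" "b2 ~= 0" using b1 b2 by auto
 show ?thesis
 proof
  assume "u \<in> power_kernel op mu (Suc n)"
  then obtain v where v: "(u, v) \<in> op" "v - mu *\<^sub>C u \<in> power_kernel op mu n" by auto
  then obtain y g where y: "u = abs_L2 y" "v = abs_L2 g" "sq_integrable g" "sol 0 g y" "bc y" using L_op_iff[OF nz] by blast
  have sy: "sq_integrable y" by (rule contv_sq_integrable[OF sol_contv[OF y(4)]])
  have "sol mu (%x. g x - mu *s y x) y" by (rule sol_cong[OF y(4)]) auto
  moreover have "v - mu *\<^sub>C u = abs_L2 (%x. g x - mu *s y x)"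
   unfolding y abs_L2_scaleC[OF sy] by (rule abs_L2_minus[OF y(3) sq_integrable_scaleC[OF sy]])
  ultimately show "\<exists>y g. u = abs_L2 y \<and> sol mu g y \<and> bc y \<and> sq_integrable g \<and> abs_L2 g \<in> power_kernel op mu n"
   using y v(2) sq_integrable_diff[OF y(3) sq_integrable_scaleC[OF sy]] by metis
 next
  assume "\<exists>y g. u = abs_L2 y \<and> sol mu g y \<and> bc y \<and> sq_integrable g \<and> abs_L2 g \<in> power_kernel op mu n"
  then obtain y g where y: "u = abs_L2 y" "sol mu g y" "bc y" "sq_integrable g" "abs_L2 g \<in> power_kernel op mu n" by blast
  have sy: "sq_integrable y" by (rule contv_sq_integrable[OF sol_contv[OF y(2)]])
  let ?g = "%x. g x + mu *s y x"
  have sg: "sq_integrable ?g" by (rule sq_integrable_add[OF y(4) sq_integrable_scaleC[OF sy]])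
  have "sol 0 ?g y" by (rule sol_cong[OF y(2)]) (auto simp: add.commute)
  then have "(u, abs_L2 ?g) \<in> op" using L_op_iff[OF nz] y sg by blast
  moreover have "abs_L2 ?g - mu *\<^sub>C u = abs_L2 g"
   unfolding y(1) abs_L2_scaleC[OF sy] abs_L2_minus[OF sg sq_integrable_scaleC[OF sy]] by simp
  ultimately show "u \<in> power_kernel op mu (Suc n)" using y(5) by auto
 qed
qed

end

section \<open>Asymptotics of solutions\<close>

lemma ai_approx_C1:
 assumes f: "f absolutely_integrable_on {0..1}" and e: "e > 0"
 shows "\<exists>G G'. (\<forall>x. (G has_vector_derivative G' x) (at x)) \<and> continuous_on UNIV G' \<and>
  L1n (%x. f x - G x :: complex) < e"
proof -
 obtain g where g: "continuous_on UNIV g" "(\<integral>x. norm (f x - g x) \<partial>unit_leb) < e/2"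
  using absolutely_integrable_approx_continuous[OF f, of "e/2"] e by auto
 have cg: "continuous_on {0..1} g" using g(1) by (rule continuous_on_subset) simp
 from Stone_Weierstrass_polynomial_function[OF compact_Icc cg, of "e/2"] e
 obtain G where G: "polynomial_function G" "!!x. x \<in> {0..1} ==> norm (g x - G x) < e/2" by auto
 obtain G' where G': "polynomial_function G'" "!!x. (G has_vector_derivative G' x) (at x)"
  using has_vector_derivative_polynomial_function[OF G(1)] by blast
 have Ga: "(%x. g x - G x) absolutely_integrable_on {0..1}" by (intro ai_cont continuous_on_diff cg continuous_on_polymonial_function G)
 have fg: "(%x. f x - g x) absolutely_integrable_on {0..1}" by (intro set_integral_diff f ai_cont cg)
 have "L1n (%x. f x - G x) <= L1n (%x. f x - g x) + L1n (%x. g x - G x)" using L1n_add_le[OF fg Ga] by simp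
 also have "L1n (%x. f x - g x) < e/2" using g(2) integral_norm_unit[OF fg] by simp
 also have "L1n (%x. g x - G x) <= e/2" by (rule L1n_le_sup[OF Ga]) (use G(2) in \<open>auto intro: less_imp_le\<close>)
 finally show ?thesis using G' by (intro exI[of _ G] exI[of _ G']) (auto intro: continuous_on_polymonial_function)
qed

text \<open>Uniform in the interval and in the shift \<open>z\<close>, and valid for complex
  frequencies: of the exponential only the bound \<open>B\<close> is used. For a smooth
  approximation \<open>G\<close> an integration by parts gains the reciprocal of \<open>omg\<close>;
  the rest of \<open>f\<close> is small in L1.\<close>

lemma riemann_lebesgue:
 fixes f :: "real => complex"
 assumes f: "f absolutely_integrable_on {0..1}" and ep: "ep > 0" and B: "B > 0"
 shows "\<exists>R>0. \<forall>omg x y z. norm omg >= R --> 0 <= x --> x <= y --> y <= 1 -->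
  (\<forall>tau\<in>{x..y}. norm (exp (omg * of_real (tau - z))) <= B) -->
  norm (integral {x..y} (%tau. f tau * exp (omg * of_real (tau - z)))) <= ep"
proof -
 have "ep / (2 * B) > 0" using ep B by simp
 from ai_approx_C1[OF f this] obtain G G' where G: "!!x. (G has_vector_derivative G' x) (at x)" "continuous_on UNIV G'"
  "L1n (%x. f x - G x) < ep / (2 * B)" by blast
 have cG: "continuous_on UNIV G" using G(1) by (meson continuous_at_imp_continuous_on has_vector_derivative_continuous)
 have bnd: "\<exists>M\<ge>0. \<forall>x\<in>{0..1}. norm (h x) <= M" if "continuous_on UNIV h" for h :: "real => complex"
 proof -
  have "compact (h ` {0..1})" by (intro compact_continuous_image continuous_on_subset[OF that]) auto
  then obtain K where "\<forall>x\<in>h ` {0..1}. norm x <= K" using compact_imp_bounded bounded_iff by blast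
  then show ?thesis by (intro exI[of _ "max K 0"]) force
 qed
 obtain M1 where M1: "M1 >= 0" "!!x. x \<in> {0..1} ==> norm (G x) <= M1" using bnd[OF cG] by blast
 obtain M2 where M2: "M2 >= 0" "!!x. x \<in> {0..1} ==> norm (G' x) <= M2" using bnd[OF G(2)] by blast
 \<comment> \<open>The boundary terms and the integral with \<open>G'\<close> are at most
   \<open>B * (2 * M1 + M2)\<close>, which the first summand bounds by \<open>R * ep / 2\<close>;
   the 1 keeps \<open>R\<close> positive.\<close>
 define R where "R = 2 * B * (2 * M1 + M2) / ep + 1"
 have R: "R > 0" using ep B M1 M2 by (simp add: R_def add_nonneg_pos)
 show ?thesis
 proof (intro exI[of _ R] conjI allI impI R)
  fix omg :: complex and x y z :: real
  assume om: "R <= norm omg" and xy: "0 <= x" "x <= y" "y <= 1" and EB: "\<forall>tau\<in>{x..y}. norm (exp (omg * of_real (tau - z))) <= B"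
  define E where "E tau = exp (omg * of_real (tau - z))" for tau
  have EB: "norm (E tau) <= B" if "tau \<in> {x..y}" for tau using EB that by (simp add: E_def)
  have cE: "continuous_on UNIV E" unfolding E_def by (intro continuous_intros)
  have dE: "(E has_vector_derivative (omg * E tau)) (at tau)" for tau
  proof -
   have Eeq: "E = (%x. exp (omg * (of_real x - of_real z)))" by (simp add: E_def fun_eq_iff)
   have "((%w. exp (omg * (w - of_real z))) has_field_derivative omg * exp (omg * (of_real tau - of_real z))) (at (of_real tau))"
    by (auto intro!: derivative_eq_intros)
   from has_vector_derivative_real_field[OF this] show ?thesis unfolding Eeq .
  qed
  have c3: "continuous_on S G" "continuous_on S G'" "continuous_on S E" for S
   using continuous_on_subset[OF cG] continuous_on_subset[OF G(2)] continuous_on_subset[OF cE] by auto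
  have i1: "(%tau. G tau * E tau) integrable_on {x..y}" "(%tau. G' tau * E tau) integrable_on {x..y}"
   by (intro integrable_continuous_real continuous_on_mult c3)+
  have "((%tau. G' tau * E tau + omg * (G tau * E tau)) has_integral (G y * E y - G x * E x)) {x..y}"
  proof (rule fundamental_theorem_of_calculus[OF xy(2)])
   fix tau show "((%tau. G tau * E tau) has_vector_derivative (G' tau * E tau + omg * (G tau * E tau))) (at tau within {x..y})"
    by (rule has_vector_derivative_at_within) (use has_vector_derivative_mult[OF G(1) dE, of tau] in \<open>simp add: algebra_simps\<close>)
  qed
  then have "omg * integral {x..y} (%tau. G tau * E tau) = G y * E y - G x * E x - integral {x..y} (%tau. G' tau * E tau)"
   using has_integral_unique has_integral_add[OF integrable_integral[OF i1(2)] has_integral_mult_right[OF integrable_integral[OF i1(1)], of omg]]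
   by (metis add_diff_cancel_left')
  then have "norm omg * norm (integral {x..y} (%tau. G tau * E tau)) = norm (G y * E y - G x * E x - integral {x..y} (%tau. G' tau * E tau))"
   by (metis norm_mult)
  also have "\<dots> <= norm (G y * E y) + norm (G x * E x) + norm (integral {x..y} (%tau. G' tau * E tau))"
   by (meson add_mono norm_triangle_ineq4 order_refl order_trans)
  also have "\<dots> <= M1 * B + M1 * B + M2 * B * (y - x)"
  proof (intro add_mono)
   show "norm (G y * E y) <= M1 * B" "norm (G x * E x) <= M1 * B" unfolding norm_mult using xy M1 EB by (auto intro!: mult_mono)
   show "norm (integral {x..y} (%tau. G' tau * E tau)) <= M2 * B * (y - x)"
    by (rule integral_bound[OF xy(2)]) (use xy M2 EB in \<open>auto simp: norm_mult intro!: mult_mono continuous_on_mult c3\<close>)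
  qed
  also have "\<dots> <= B * (2 * M1 + M2)"
  proof -
   have "M2 * B * (y - x) <= M2 * B * 1" using M2 B xy by (intro mult_left_mono) auto
   then show ?thesis by (simp add: algebra_simps)
  qed
  also have "\<dots> <= (ep / 2) * R" using ep by (simp add: R_def field_simps)
  also have "\<dots> <= (ep / 2) * norm omg" using ep om by (intro mult_left_mono) auto
  finally have "norm omg * norm (integral {x..y} (%tau. G tau * E tau)) <= norm omg * (ep / 2)" by (simp only: mult.commute)
  moreover have "0 < norm omg" using om R by linarith
  ultimately have 1: "norm (integral {x..y} (%tau. G tau * E tau)) <= ep / 2" by (rule mult_left_le_imp_le)
  have Ga: "G absolutely_integrable_on {0..1}" by (intro ai_cont c3)
  have d: "(%tau. f tau - G tau) absolutely_integrable_on {0..1}" by (intro set_integral_diff f Ga)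
  have fE: "(%tau. (f tau - G tau) * E tau) absolutely_integrable_on {0..1}" using ai_cont_mult[OF d c3(3)] by (simp add: mult.commute)
  have "norm (integral {x..y} (%tau. (f tau - G tau) * E tau)) <= integral {x..y} (%tau. B * norm (f tau - G tau))"
  proof (rule integral_norm_bound_integral)
   show "(%tau. (f tau - G tau) * E tau) integrable_on {x..y}" by (rule io_sub[OF fE]) (use xy in auto)
   show "(%tau. B * norm (f tau - G tau)) integrable_on {x..y}" by (rule integrable_on_mult_right, rule norm_io_sub[OF d]) (use xy in auto)
   show "norm ((f tau - G tau) * E tau) <= B * norm (f tau - G tau)" if "tau \<in> {x..y}" for tau
    unfolding norm_mult using EB[OF that] by (subst mult.commute) (rule mult_right_mono, auto)
  qed
  also have "\<dots> = B * integral {x..y} (%tau. norm (f tau - G tau))" by (rule integral_mult_right)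
  also have "\<dots> <= B * (ep / (2 * B))" using integral_norm_subset_le[OF d, of x y] G(3) xy B by (intro mult_left_mono) auto
  finally have 2: "norm (integral {x..y} (%tau. (f tau - G tau) * E tau)) <= ep / 2" using B by simp
  have "integral {x..y} (%tau. f tau * E tau) = integral {x..y} (%tau. (f tau - G tau) * E tau + G tau * E tau)"
   by (simp add: algebra_simps)
  also have "\<dots> = integral {x..y} (%tau. (f tau - G tau) * E tau) + integral {x..y} (%tau. G tau * E tau)"
   by (rule integral_add[OF io_sub[OF fE] i1(1)]) (use xy in auto)
  finally show "norm (integral {x..y} (%tau. f tau * exp (omg * of_real (tau - z)))) <= ep"
   using norm_triangle_ineq[of "integral {x..y} (%tau. (f tau - G tau) * E tau)" "integral {x..y} (%tau. G tau * E tau)"] 1 2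
   unfolding E_def by simp
 qed
qed

lemma acd_exp: "acd (%x. exp (omg * of_real x)) (%x. omg * exp (omg * of_real x))"
proof (rule acd_of_C1)
 fix x show "((%x. exp (omg * complex_of_real x)) has_vector_derivative omg * exp (omg * complex_of_real x)) (at x within {0..1})"
  by (rule has_vector_derivative_real_field) (auto intro!: derivative_eq_intros)
qed (intro continuous_intros)

lemma ai_exp_mult:
 fixes f :: "real => complex"
 shows "f absolutely_integrable_on {0..1} ==> (%x. f x * exp (omg * of_real x)) absolutely_integrable_on {0..1}"
 using ai_cont_mult[of f "%x. exp (omg * of_real x)"] by (simp add: mult.commute continuous_intros)

context bvp begin

text \<open>The frequency with which \<open>p\<close> and \<open>q\<close> couple the two
  exponentials. It also dominates \<open>- b1\<close> and \<open>b2\<close>, so the single bound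
  \<open>exp (gam * H)\<close> serves for all exponentials.\<close>

definition gam :: real where "gam = b2 - b1"

lemma norm_exp_bound:
 assumes l: "- H <= Im l" and H: "H >= 0" and u: "0 <= u" "u <= 1" and e: "0 <= e" "e <= gam"
 shows "norm (exp (\<i> * l * of_real (e * u))) <= exp (gam * H)"
proof -
 have "Re (\<i> * l * of_real (e * u)) = - (Im l * (e * u))" by simp
 also have "\<dots> <= H * (e * u)" using l e u mult_right_mono[of "- Im l" H "e * u"] by simp
 also have "\<dots> <= H * (gam * 1)" using H e u by (intro mult_left_mono mult_mono) auto
 finally show ?thesis by (simp add: mult.commute)
qed

text \<open>The combinations \<open>y\<^sub>1 - i b\<^sub>1 F y\<^sub>2\<close> and \<open>y\<^sub>2 + i b\<^sub>2 G y\<^sub>1\<close> remove the off-diagonal terms to first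
  order; \<open>F\<close> and \<open>G\<close> are small by the Riemann--Lebesgue lemma.\<close>

lemma asymptotics_aux:
 assumes l: "- H <= Im l" and H: "H >= 0" and g: "aiv g" and y: "sol l g y"
  and F: "!!tau. tau \<in> {0..1} ==> norm (integral {tau..1} (%r. p r * exp (\<i> * gam * l * of_real (r - tau)))) <= ep"
  and G: "!!tau. tau \<in> {0..1} ==> norm (integral {0..tau} (%r. q r * exp (- \<i> * gam * l * of_real (r - tau)))) <= ep"
  and M: "!!x. x \<in> {0..1} ==> n1 (y x) <= M" and x: "x \<in> {0..1}"
 shows "norm (y x $ 1 - y 1 $ 1 * exp (- \<i> * b1 * l * of_real (1 - x))) \<le>
   \<bar>b1\<bar> * ep * M + exp (gam * H) * (\<bar>b1\<bar> * L1n (%x. g x $ 1) + \<bar>b1 * b2\<bar> * ep * (L1n (%x. g x $ 2) + L1n q * M))" (is ?t1)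
  "norm (y x $ 2 - y 0 $ 2 * exp (\<i> * b2 * l * of_real x)) \<le>
   \<bar>b2\<bar> * ep * M + exp (gam * H) * (\<bar>b2\<bar> * L1n (%x. g x $ 2) + \<bar>b1 * b2\<bar> * ep * (L1n (%x. g x $ 1) + L1n p * M))" (is ?t2)
proof -
 have gi: "(%x. g x $ i) absolutely_integrable_on {0..1}" for i using g by (simp add: aiv_def)
 have ym: "norm (y t $ i) <= M" if "t \<in> {0..1}" for t i using M[OF that] n1_nth_le order_trans by blast
 have eps: "ep >= 0" using order_trans[OF norm_ge_zero F[of 0]] by simp
 have M0: "M >= 0" using M[of 0] n1_nonneg[of "y 0"] by simp
 \<comment> \<open>\<open>Fn\<close> solves \<open>F' = - p - i gam l F\<close> with
   \<open>F 1 = 0\<close>, and \<open>Gn\<close> solves \<open>G' = q + i gam l G\<close> with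
   \<open>G 0 = 0\<close>. The equations cancel the coupling terms; the end conditions make the
   corrected components equal to \<open>y 1 $ 1\<close> and \<open>y 0 $ 2\<close> at the ends where
   the integration starts.\<close>
 define Fn where "Fn tau = exp (- \<i> * gam * l * of_real tau) * (integral {0..1} (%r. p r * exp (\<i> * gam * l * of_real r)) - integral {0..tau} (%r. p r * exp (\<i> * gam * l * of_real r)))" for tau :: real
 define Gn where "Gn tau = exp (\<i> * gam * l * of_real tau) * integral {0..tau} (%r. q r * exp (- \<i> * gam * l * of_real r))" for tau :: real
 note pe = ai_exp_mult[OF p, of "\<i> * gam * l"] and qe = ai_exp_mult[OF q, of "- \<i> * gam * l"]
 have Fe: "norm (Fn tau) <= ep" if t: "tau \<in> {0..1}" for tau
 proof -
  have eqI: "integral {0..tau} (%r. p r * exp (\<i> * gam * l * of_real r)) + integral {tau..1} (%r. p r * exp (\<i> * gam * l * of_real r)) = integral {0..1} (%r. p r * exp (\<i> * gam * l * of_real r))"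
   by (rule Henstock_Kurzweil_Integration.integral_combine) (use t io_sub[OF pe, of 0 1] in auto)
  have "Fn tau = exp (- \<i> * gam * l * of_real tau) * integral {tau..1} (%r. p r * exp (\<i> * gam * l * of_real r))"
   unfolding Fn_def eqI[symmetric] by (simp only: add_diff_cancel_left')
  also have "\<dots> = integral {tau..1} (%r. p r * exp (\<i> * gam * l * of_real (r - tau)))" unfolding integral_mult_right[symmetric]
   by (rule integral_cong) (simp add: exp_diff exp_minus right_diff_distrib field_simps)
  finally show ?thesis using F[OF t] by simp
 qed
 have Ge: "norm (Gn tau) <= ep" if t: "tau \<in> {0..1}" for tau
 proof -
  have "Gn tau = integral {0..tau} (%r. q r * exp (- \<i> * gam * l * of_real (r - tau)))" unfolding Gn_def integral_mult_right[symmetric]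
   by (rule integral_cong) (simp add: exp_diff exp_minus right_diff_distrib field_simps)
  then show ?thesis using G[OF t] by simp
 qed
 have "acd Fn (%tau. exp (- \<i> * gam * l * of_real tau) * (0 - p tau * exp (\<i> * gam * l * of_real tau)) +
   (integral {0..1} (%r. p r * exp (\<i> * gam * l * of_real r)) - (0 + integral {0..tau} (%r. p r * exp (\<i> * gam * l * of_real r)))) * (- \<i> * gam * l * exp (- \<i> * gam * l * of_real tau)))"
  unfolding Fn_def using acd_mult[OF acd_exp[of "- \<i> * gam * l"] acd_diff[OF acd_const[of "integral {0..1} (%r. p r * exp (\<i> * gam * l * of_real r))"] acd_indef[OF pe, of 0]]]
  by simp
 then have aF: "acd Fn (%tau. - p tau - \<i> * gam * l * Fn tau)" by (rule acd_cong) (simp_all add: Fn_def exp_minus field_simps)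
 have "acd Gn (%tau. exp (\<i> * gam * l * of_real tau) * (q tau * exp (- \<i> * gam * l * of_real tau)) +
   (0 + integral {0..tau} (%r. q r * exp (- \<i> * gam * l * of_real r))) * (\<i> * gam * l * exp (\<i> * gam * l * of_real tau)))"
  unfolding Gn_def using acd_mult[OF acd_exp[of "\<i> * gam * l"] acd_indef[OF qe, of 0]] by simp
 then have aG: "acd Gn (%tau. q tau + \<i> * gam * l * Gn tau)" by (rule acd_cong) (simp_all add: Gn_def exp_minus field_simps)
 note ya = sol_acd[OF y]
 let ?V = "%tau. exp (- \<i> * b1 * l * of_real tau) * (y tau $ 1 - \<i> * b1 * (Fn tau * y tau $ 2))"
 let ?V' = "%tau. exp (- \<i> * b1 * l * of_real tau) * (\<i> * b1 * g tau $ 1 + b1 * b2 * (Fn tau * (g tau $ 2 - q tau * y tau $ 1)))"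
 have V: "acd ?V ?V'"
  by (rule acd_cong[OF acd_mult[OF acd_exp[of "- \<i> * b1 * l"] acd_diff[OF ya(1) acd_cmult[OF acd_mult[OF aF ya(2)], where c = "\<i> * b1"]]]])
    (simp_all add: gam_def algebra_simps)
 let ?U = "%tau. exp (- \<i> * b2 * l * of_real tau) * (y tau $ 2 + \<i> * b2 * (Gn tau * y tau $ 1))"
 let ?U' = "%tau. exp (- \<i> * b2 * l * of_real tau) * (\<i> * b2 * g tau $ 2 - b1 * b2 * (Gn tau * (g tau $ 1 - p tau * y tau $ 2)))"
 have U: "acd ?U ?U'"
  by (rule acd_cong[OF acd_mult[OF acd_exp[of "- \<i> * b2 * l"] acd_add[OF ya(2) acd_cmult[OF acd_mult[OF aG ya(1)], where c = "\<i> * b2"]]]])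
    (simp_all add: gam_def algebra_simps)
 have x01: "0 <= x" "x <= 1" using x by auto
 have F1: "Fn 1 = 0" and G0: "Gn 0 = 0" by (simp_all add: Fn_def Gn_def)
 \<comment> \<open>The first component is integrated backwards from 1 and the second forwards from
   0; in these directions the exponentials stay bounded for \<open>Im l >= - H\<close>.\<close>
 have ebd: "norm (exp (\<i> * b1 * l * of_real x) * exp (- \<i> * b1 * l * of_real t)) <= exp (gam * H)" if "t \<in> {x..1}" for t
 proof -
  have "exp (\<i> * b1 * l * of_real x) * exp (- \<i> * b1 * l * of_real t) = exp (\<i> * l * of_real (\<bar>b1\<bar> * (t - x)))"
   unfolding exp_add[symmetric] using b1 by (simp add: algebra_simps)
  then show ?thesis using norm_exp_bound[OF l H, of "t - x" "\<bar>b1\<bar>"] that x01 b1 b2 by (simp only: gam_def) auto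
 qed
 have ebd2: "norm (exp (\<i> * b2 * l * of_real x) * exp (- \<i> * b2 * l * of_real t)) <= exp (gam * H)" if "t \<in> {0..x}" for t
 proof -
  have "exp (\<i> * b2 * l * of_real x) * exp (- \<i> * b2 * l * of_real t) = exp (\<i> * l * of_real (b2 * (x - t)))"
   unfolding exp_add[symmetric] by (simp add: algebra_simps)
  then show ?thesis using norm_exp_bound[OF l H, of "x - t" "b2"] that x01 b1 b2 by (simp only: gam_def) auto
 qed
 have int: "integral {u..v} (%t. e * (\<bar>k1\<bar> * norm (g t $ i) + \<bar>b1 * b2\<bar> * ep * (norm (g t $ j) + norm (r t) * M)))
   <= e * (\<bar>k1\<bar> * L1n (%x. g x $ i) + \<bar>b1 * b2\<bar> * ep * (L1n (%x. g x $ j) + L1n r * M))"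
  "(%t. e * (\<bar>k1\<bar> * norm (g t $ i) + \<bar>b1 * b2\<bar> * ep * (norm (g t $ j) + norm (r t) * M))) integrable_on {u..v}"
  if r: "r absolutely_integrable_on {0..1}" and uv: "0 <= u" "v <= 1" and e0: "e >= 0" for r :: "real => complex" and u v e k1 :: real and i j
 proof -
  let ?b = "%t. e * (\<bar>k1\<bar> * norm (g t $ i) + \<bar>b1 * b2\<bar> * ep * (norm (g t $ j) + norm (r t) * M))"
  have ab: "?b absolutely_integrable_on {0..1}" by (intro set_integrable_mult_right set_integral_add set_integrable_mult_left ai_norm gi r)
  show "?b integrable_on {u..v}" by (rule io_sub[OF ab uv])
  have "integral {u..v} ?b <= integral {0..1} ?b" by (rule nn_integral_subset_le[OF ab uv]) (use e0 eps M0 in auto)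
  also have "\<dots> = e * (\<bar>k1\<bar> * L1n (%x. g x $ i) + \<bar>b1 * b2\<bar> * ep * (L1n (%x. g x $ j) + L1n r * M))"
   by (intro integral_unique has_integral_mult_right has_integral_add has_integral_mult_left integrable_integral norm_io_sub gi r) auto
  finally show "integral {u..v} ?b <= e * (\<bar>k1\<bar> * L1n (%x. g x $ i) + \<bar>b1 * b2\<bar> * ep * (L1n (%x. g x $ j) + L1n r * M))" .
 qed
 show ?t1
 proof -
  have "?V 1 - ?V x = integral {x..1} ?V'" using acd_diff_eq[OF V x01(1,2)] by simp
  then have "exp (\<i> * b1 * l * of_real x) * (?V 1 - ?V x) = integral {x..1} (%tau. exp (\<i> * b1 * l * of_real x) * ?V' tau)"
   by (simp only: integral_mult_right)
  moreover have "exp (\<i> * b1 * l * of_real x) * (?V 1 - ?V x) = y 1 $ 1 * exp (- \<i> * b1 * l * of_real (1 - x)) - y x $ 1 + \<i> * b1 * (Fn x * y x $ 2)"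
   unfolding F1 by (simp add: algebra_simps exp_diff exp_minus exp_add divide_inverse)
  ultimately have eq: "y x $ 1 - y 1 $ 1 * exp (- \<i> * b1 * l * of_real (1 - x)) = \<i> * b1 * (Fn x * y x $ 2) - integral {x..1} (%tau. exp (\<i> * b1 * l * of_real x) * ?V' tau)"
   by (simp add: algebra_simps)
  have "norm (integral {x..1} (%tau. exp (\<i> * b1 * l * of_real x) * ?V' tau)) <= integral {x..1} (%t. exp (gam * H) * (\<bar>b1\<bar> * norm (g t $ 1) + \<bar>b1 * b2\<bar> * ep * (norm (g t $ 2) + norm (q t) * M)))"
  proof (rule integral_norm_bound_integral)
   show "(%tau. exp (\<i> * b1 * l * of_real x) * ?V' tau) integrable_on {x..1}"
    by (rule integrable_on_mult_right, rule io_sub[OF acd_ai[OF V]]) (use x in auto)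
   show "(%t. exp (gam * H) * (\<bar>b1\<bar> * norm (g t $ 1) + \<bar>b1 * b2\<bar> * ep * (norm (g t $ 2) + norm (q t) * M))) integrable_on {x..1}"
    by (rule int(2)[OF q]) (use x01 in auto)
   fix t assume t: "t \<in> {x..1}"
   then have t1: "t \<in> {0..1}" using x01 by auto
   have "norm (\<i> * b1 * g t $ 1 + b1 * b2 * (Fn t * (g t $ 2 - q t * y t $ 1))) <= \<bar>b1\<bar> * norm (g t $ 1) + \<bar>b1 * b2\<bar> * (norm (Fn t) * norm (g t $ 2 - q t * y t $ 1))"
    by (rule order_trans[OF norm_triangle_ineq]) (simp add: norm_mult abs_mult)
   also have "\<dots> <= \<bar>b1\<bar> * norm (g t $ 1) + \<bar>b1 * b2\<bar> * (ep * (norm (g t $ 2) + norm (q t) * M))"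
   proof (intro add_left_mono mult_left_mono mult_mono Fe t1 eps)
    show "norm (g t $ 2 - q t * y t $ 1) <= norm (g t $ 2) + norm (q t) * M"
     by (rule order_trans[OF norm_triangle_ineq4]) (use ym[OF t1] in \<open>auto simp: norm_mult intro!: mult_left_mono\<close>)
   qed auto
   finally have a: "norm (\<i> * b1 * g t $ 1 + b1 * b2 * (Fn t * (g t $ 2 - q t * y t $ 1))) <= \<bar>b1\<bar> * norm (g t $ 1) + \<bar>b1 * b2\<bar> * ep * (norm (g t $ 2) + norm (q t) * M)"
    by (simp only: mult.assoc)
   show "norm (exp (\<i> * b1 * l * of_real x) * ?V' t) <= exp (gam * H) * (\<bar>b1\<bar> * norm (g t $ 1) + \<bar>b1 * b2\<bar> * ep * (norm (g t $ 2) + norm (q t) * M))"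
    unfolding mult.assoc[symmetric, of "exp (\<i> * b1 * l * of_real x)"] unfolding norm_mult[of "_ * _"]
    by (rule mult_mono[OF ebd[OF t] a]) auto
  qed
  also have "\<dots> <= exp (gam * H) * (\<bar>b1\<bar> * L1n (%x. g x $ 1) + \<bar>b1 * b2\<bar> * ep * (L1n (%x. g x $ 2) + L1n q * M))"
   by (rule int(1)[OF q]) (use x01 in auto)
  finally have I: "norm (integral {x..1} (%tau. exp (\<i> * b1 * l * of_real x) * ?V' tau)) <= \<dots>" .
  have "norm (\<i> * b1 * (Fn x * y x $ 2)) <= \<bar>b1\<bar> * (ep * M)"
   unfolding norm_mult using Fe[OF x] ym[OF x] eps by (auto intro!: mult_left_mono mult_mono)
  with I show ?thesis unfolding eq by (intro order_trans[OF norm_triangle_ineq4]) (simp add: mult.assoc)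
 qed
 show ?t2
 proof -
  have "?U x - ?U 0 = integral {0..x} ?U'" using acd_diff_eq[OF U _ x01(1,2)] by simp
  then have "exp (\<i> * b2 * l * of_real x) * (?U x - ?U 0) = integral {0..x} (%tau. exp (\<i> * b2 * l * of_real x) * ?U' tau)"
   by (simp only: integral_mult_right)
  moreover have "exp (\<i> * b2 * l * of_real x) * (?U x - ?U 0) = y x $ 2 + \<i> * b2 * (Gn x * y x $ 1) - y 0 $ 2 * exp (\<i> * b2 * l * of_real x)"
   unfolding G0 by (simp add: algebra_simps exp_minus)
  ultimately have eq: "y x $ 2 - y 0 $ 2 * exp (\<i> * b2 * l * of_real x) = integral {0..x} (%tau. exp (\<i> * b2 * l * of_real x) * ?U' tau) - \<i> * b2 * (Gn x * y x $ 1)"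
   by (simp add: algebra_simps)
  have "norm (integral {0..x} (%tau. exp (\<i> * b2 * l * of_real x) * ?U' tau)) <= integral {0..x} (%t. exp (gam * H) * (\<bar>b2\<bar> * norm (g t $ 2) + \<bar>b1 * b2\<bar> * ep * (norm (g t $ 1) + norm (p t) * M)))"
  proof (rule integral_norm_bound_integral)
   show "(%tau. exp (\<i> * b2 * l * of_real x) * ?U' tau) integrable_on {0..x}"
    by (rule integrable_on_mult_right, rule io_sub[OF acd_ai[OF U]]) (use x in auto)
   show "(%t. exp (gam * H) * (\<bar>b2\<bar> * norm (g t $ 2) + \<bar>b1 * b2\<bar> * ep * (norm (g t $ 1) + norm (p t) * M))) integrable_on {0..x}"
    by (rule int(2)[OF p]) (use x01 in auto)
   fix t assume t: "t \<in> {0..x}"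
   then have t1: "t \<in> {0..1}" using x01 by auto
   have "norm (\<i> * b2 * g t $ 2 - b1 * b2 * (Gn t * (g t $ 1 - p t * y t $ 2))) <= \<bar>b2\<bar> * norm (g t $ 2) + \<bar>b1 * b2\<bar> * (norm (Gn t) * norm (g t $ 1 - p t * y t $ 2))"
    by (rule order_trans[OF norm_triangle_ineq4]) (simp add: norm_mult abs_mult)
   also have "\<dots> <= \<bar>b2\<bar> * norm (g t $ 2) + \<bar>b1 * b2\<bar> * (ep * (norm (g t $ 1) + norm (p t) * M))"
   proof (intro add_left_mono mult_left_mono mult_mono Ge t1 eps)
    show "norm (g t $ 1 - p t * y t $ 2) <= norm (g t $ 1) + norm (p t) * M"
     by (rule order_trans[OF norm_triangle_ineq4]) (use ym[OF t1] in \<open>auto simp: norm_mult intro!: mult_left_mono\<close>)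
   qed auto
   finally have a: "norm (\<i> * b2 * g t $ 2 - b1 * b2 * (Gn t * (g t $ 1 - p t * y t $ 2))) <= \<bar>b2\<bar> * norm (g t $ 2) + \<bar>b1 * b2\<bar> * ep * (norm (g t $ 1) + norm (p t) * M)"
    by (simp only: mult.assoc)
   show "norm (exp (\<i> * b2 * l * of_real x) * ?U' t) <= exp (gam * H) * (\<bar>b2\<bar> * norm (g t $ 2) + \<bar>b1 * b2\<bar> * ep * (norm (g t $ 1) + norm (p t) * M))"
    unfolding mult.assoc[symmetric, of "exp (\<i> * b2 * l * of_real x)"] unfolding norm_mult[of "_ * _"]
    by (rule mult_mono[OF ebd2[OF t] a]) auto
  qed
  also have "\<dots> <= exp (gam * H) * (\<bar>b2\<bar> * L1n (%x. g x $ 2) + \<bar>b1 * b2\<bar> * ep * (L1n (%x. g x $ 1) + L1n p * M))"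
   by (rule int(1)[OF p]) (use x01 in auto)
  finally have I: "norm (integral {0..x} (%tau. exp (\<i> * b2 * l * of_real x) * ?U' tau)) <= \<dots>" .
  have "norm (\<i> * b2 * (Gn x * y x $ 1)) <= \<bar>b2\<bar> * (ep * M)"
   unfolding norm_mult using Ge[OF x] ym[OF x] eps by (auto intro!: mult_left_mono mult_mono)
  with I show ?thesis unfolding eq by (intro order_trans[OF norm_triangle_ineq4]) (simp add: mult.assoc)
 qed
qed

text \<open>The remainder bounds contain the unknown supremum \<open>M\<close> of the solution with
  the small factor \<open>e * C1\<close>. Since \<open>M\<close> is at most \<open>E * sig\<close>
  plus the remainder, the choice \<open>e * C1 <= 1 / 2\<close> absorbs it. Only the radius depends
  on \<open>ep\<close>, not the constant in front of \<open>nrm1 g\<close>.\<close>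

lemma asymptotics:
 assumes H: "H >= 0"
 shows "\<exists>C\<ge>0. \<forall>ep>0. \<exists>R>0. \<forall>l g y x. - H <= Im l --> R <= norm l --> aiv g --> sol l g y --> x \<in> {0..1} -->
   norm (y x $ 1 - y 1 $ 1 * exp (- \<i> * b1 * l * of_real (1 - x))) + norm (y x $ 2 - y 0 $ 2 * exp (\<i> * b2 * l * of_real x))
   <= ep * (norm (y 0 $ 2) + norm (y 1 $ 1)) + C * nrm1 g"
proof -
 define E where "E = exp (gam * H)"
 define bb where "bb = \<bar>b1\<bar> + \<bar>b2\<bar>"
 define C1 where "C1 = bb + E * \<bar>b1 * b2\<bar> * (L1n p + L1n q) + 1"
 define C0 where "C0 = E * (bb + \<bar>b1 * b2\<bar>)"
 have pos: "E > 0" "bb >= 0" "L1n p >= 0" "L1n q >= 0" using L1n_nonneg p q by (auto simp: E_def bb_def)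
 have gam0: "gam > 0" using b1 b2 by (simp add: gam_def)
 have "0 <= E * \<bar>b1 * b2\<bar> * (L1n p + L1n q)" using pos by (intro mult_nonneg_nonneg) auto
 then have C: "C1 > 0" "C0 >= 0" using pos(2) unfolding C1_def apply linarith using pos by (simp add: C0_def)
 show ?thesis
 proof (rule exI[of _ "2 * C0"], intro conjI allI impI)
  fix ep :: real assume ep: "ep > 0"
  define e where "e = min 1 (min (1 / (2 * C1)) (ep / (2 * C1 * E)))"
  have e: "e > 0" "e <= 1" "e * C1 <= 1 / 2" "2 * (e * C1) * E <= ep"
  proof -
   show "e > 0" "e <= 1" using ep C pos by (auto simp: e_def)
   have "e <= 1 / (2 * C1)" "e <= ep / (2 * C1 * E)" by (auto simp: e_def)
   then show "e * C1 <= 1 / 2" "2 * (e * C1) * E <= ep" using C pos by (auto simp: field_simps)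
  qed
  obtain R1 where R1: "R1 > 0" "!!omg x y z. norm omg >= R1 ==> 0 <= x ==> x <= y ==> y <= 1 ==>
   (\<forall>tau\<in>{x..y}. norm (exp (omg * of_real (tau - z))) <= E) ==> norm (integral {x..y} (%tau. p tau * exp (omg * of_real (tau - z)))) <= e"
   using riemann_lebesgue[OF p e(1) pos(1)] by auto
  obtain R2 where R2: "R2 > 0" "!!omg x y z. norm omg >= R2 ==> 0 <= x ==> x <= y ==> y <= 1 ==>
   (\<forall>tau\<in>{x..y}. norm (exp (omg * of_real (tau - z))) <= E) ==> norm (integral {x..y} (%tau. q tau * exp (omg * of_real (tau - z)))) <= e"
   using riemann_lebesgue[OF q e(1) pos(1)] by auto
  define R where "R = (R1 + R2) / gam"
  show "\<exists>R>0. \<forall>l g y x. - H <= Im l --> R <= norm l --> aiv g --> sol l g y --> x \<in> {0..1} -->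
   norm (y x $ 1 - y 1 $ 1 * exp (- \<i> * b1 * l * of_real (1 - x))) + norm (y x $ 2 - y 0 $ 2 * exp (\<i> * b2 * l * of_real x))
   <= ep * (norm (y 0 $ 2) + norm (y 1 $ 1)) + 2 * C0 * nrm1 g"
  proof (intro exI[of _ R] conjI allI impI)
   show "R > 0" using R1 R2 gam0 by (simp add: R_def)
   fix l g y x assume l: "- H <= Im l" and lR: "R <= norm l" and g: "aiv g" and y: "sol l g y" and x: "x \<in> {0..1::real}"
   have lR': "R1 + R2 <= gam * norm l" using lR gam0 by (simp add: R_def field_simps)
   have F: "norm (integral {tau..1} (%r. p r * exp (\<i> * gam * l * of_real (r - tau)))) <= e" if "tau \<in> {0..1}" for tau
   proof (rule R1(2))
    show "R1 <= norm (\<i> * gam * l)" using lR' R2 gam0 by (simp add: norm_mult)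
    show "\<forall>t\<in>{tau..1}. norm (exp (\<i> * gam * l * of_real (t - tau))) <= E"
     using norm_exp_bound[OF l H, of "t - tau" gam for t] that gam0 by (auto simp: E_def mult_ac)
   qed (use that in auto)
   have G: "norm (integral {0..tau} (%r. q r * exp (- \<i> * gam * l * of_real (r - tau)))) <= e" if "tau \<in> {0..1}" for tau
   proof (rule R2(2))
    show "R2 <= norm (- \<i> * gam * l)" using lR' R1 gam0 by (simp add: norm_mult)
    show "\<forall>t\<in>{0..tau}. norm (exp (- \<i> * gam * l * of_real (t - tau))) <= E"
    proof
     fix t assume t: "t \<in> {0..tau}"
     have "- \<i> * gam * l * of_real (t - tau) = \<i> * l * of_real (gam * (tau - t))" by (simp add: algebra_simps)
     then show "norm (exp (- \<i> * gam * l * of_real (t - tau))) <= E"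
      using norm_exp_bound[OF l H, of "tau - t" gam] that t gam0 unfolding E_def by simp
    qed
   qed (use that in auto)
   have "continuous_on {0..1} (%x. n1 (y x))" unfolding n1_def by (intro continuous_intros sol_cont[OF y])
   from continuous_attains_sup[OF compact_Icc _ this]
   obtain x0 where x0: "x0 \<in> {0..1}" "!!x. x \<in> {0..1} ==> n1 (y x) <= n1 (y x0)" by auto
   define M where "M = n1 (y x0)"
   define sig where "sig = norm (y 0 $ 2) + norm (y 1 $ 1)"
   define er where "er x = norm (y x $ 1 - y 1 $ 1 * exp (- \<i> * b1 * l * of_real (1 - x))) + norm (y x $ 2 - y 0 $ 2 * exp (\<i> * b2 * l * of_real x))" for x :: real
   have M0: "M >= 0" by (simp add: M_def n1_nonneg)
   have gn: "L1n (%x. g x $ i) >= 0" for i by (rule L1n_nonneg) (use g in \<open>simp add: aiv_def\<close>)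
   have er: "er t <= C0 * nrm1 g + e * C1 * M" if t: "t \<in> {0..1}" for t
   proof -
    have "er t <= (\<bar>b1\<bar> * e * M + E * (\<bar>b1\<bar> * L1n (%x. g x $ 1) + \<bar>b1 * b2\<bar> * e * (L1n (%x. g x $ 2) + L1n q * M))) +
     (\<bar>b2\<bar> * e * M + E * (\<bar>b2\<bar> * L1n (%x. g x $ 2) + \<bar>b1 * b2\<bar> * e * (L1n (%x. g x $ 1) + L1n p * M)))"
     unfolding er_def E_def using asymptotics_aux[OF l H g y F G x0(2) t] by (intro add_mono) (auto simp: M_def)
    also have "\<dots> = (bb + E * \<bar>b1 * b2\<bar> * (L1n p + L1n q)) * (e * M) + E * (\<bar>b1\<bar> * L1n (%x. g x $ 1) + \<bar>b2\<bar> * L1n (%x. g x $ 2) + \<bar>b1 * b2\<bar> * (e * nrm1 g))"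
     by (simp add: bb_def nrm1_def algebra_simps)
    also have "\<dots> <= C1 * (e * M) + E * (bb * nrm1 g + \<bar>b1 * b2\<bar> * (1 * nrm1 g))"
    proof (intro add_mono mult_left_mono mult_right_mono)
     show "\<bar>b1\<bar> * L1n (%x. g x $ 1) + \<bar>b2\<bar> * L1n (%x. g x $ 2) <= bb * nrm1 g"
      using gn[of 1] gn[of 2] by (simp add: bb_def nrm1_def algebra_simps)
    qed (use e pos M0 nrm1_nonneg[OF g] in \<open>auto simp: C1_def\<close>)
    finally show ?thesis by (simp add: C0_def algebra_simps)
   qed
   have nb: "n1 (y t) <= E * sig + er t" if t: "t \<in> {0..1}" for t
   proof -
    have e1: "norm (exp (- \<i> * b1 * l * of_real (1 - t))) <= E"
    proof -
     have eq: "- \<i> * b1 * l * of_real (1 - t) = \<i> * l * of_real (\<bar>b1\<bar> * (1 - t))" using b1 by (simp add: algebra_simps)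
     show ?thesis unfolding eq E_def by (rule norm_exp_bound[OF l H]) (use t b1 b2 in \<open>auto simp: gam_def\<close>)
    qed
    have e2: "norm (exp (\<i> * b2 * l * of_real t)) <= E"
    proof -
     have eq: "\<i> * b2 * l * of_real t = \<i> * l * of_real (b2 * t)" by simp
     show ?thesis unfolding eq E_def by (rule norm_exp_bound[OF l H]) (use t b1 b2 in \<open>auto simp: gam_def\<close>)
    qed
    have "norm (y t $ 1) <= norm (y 1 $ 1) * E + norm (y t $ 1 - y 1 $ 1 * exp (- \<i> * b1 * l * of_real (1 - t)))"
     using norm_triangle_sub[of "y t $ 1" "y 1 $ 1 * exp (- \<i> * b1 * l * of_real (1 - t))"] mult_left_mono[OF e1, of "norm (y 1 $ 1)"]
     by (simp add: norm_mult)
    moreover have "norm (y t $ 2) <= norm (y 0 $ 2) * E + norm (y t $ 2 - y 0 $ 2 * exp (\<i> * b2 * l * of_real t))"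
     using norm_triangle_sub[of "y t $ 2" "y 0 $ 2 * exp (\<i> * b2 * l * of_real t)"] mult_left_mono[OF e2, of "norm (y 0 $ 2)"]
     by (simp add: norm_mult)
    ultimately show ?thesis by (simp add: n1_def er_def sig_def algebra_simps)
   qed
   have "e * C1 * M <= 1 / 2 * M" using e(3) M0 by (rule mult_right_mono)
   then have M: "M <= 2 * E * sig + 2 * C0 * nrm1 g" using nb[OF x0(1)] er[OF x0(1)] by (simp add: M_def)
   have "er x <= C0 * nrm1 g + e * C1 * (2 * E * sig + 2 * C0 * nrm1 g)"
    by (rule order_trans[OF er[OF x]], intro add_left_mono mult_left_mono M) (use e C in simp)
   also have "\<dots> = (C0 * nrm1 g + (e * C1) * (2 * C0 * nrm1 g)) + (2 * (e * C1) * E) * sig" by (simp add: algebra_simps)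
   also have "\<dots> <= (C0 * nrm1 g + 1 / 2 * (2 * C0 * nrm1 g)) + ep * sig"
    using e(3,4) C nrm1_nonneg[OF g] by (intro add_mono mult_right_mono order_refl) (auto simp: sig_def)
   finally show "norm (y x $ 1 - y 1 $ 1 * exp (- \<i> * b1 * l * of_real (1 - x))) + norm (y x $ 2 - y 0 $ 2 * exp (\<i> * b2 * l * of_real x))
    <= ep * (norm (y 0 $ 2) + norm (y 1 $ 1)) + 2 * C0 * nrm1 g"
    by (simp add: er_def sig_def algebra_simps)
  qed
 qed (use C in auto)
qed

end

section \<open>The characteristic determinant\<close>

text \<open>Size of the data that parametrize a solution for \<open>Im l\<close> bounded below: up
  to small errors the first component is propagated from the right end and the second from the left
  end.\<close>

definition sig :: "(real => complex^2) => real" where "sig y = norm (y 0 $ 2) + norm (y 1 $ 1)"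

lemma has_integral_reflect_unit:
 fixes f :: "real => 'a::euclidean_space"
 assumes "(f has_integral i) {u..v}" shows "((%x. f (1 - x)) has_integral i) {1 - v..1 - u}"
proof -
 have "(%x. 1 - x) ` {u..v} = {1 - v..1 - u}" by (auto intro!: image_eqI[of _ _ "1 - x" for x])
 then show ?thesis using has_integral_affinity[of f i u v "-1" 1] assms by (simp add: image_image)
qed

lemma ai_reflect:
 fixes f :: "real => complex"
 assumes "f absolutely_integrable_on {0..1}" shows "(%x. f (1 - x)) absolutely_integrable_on {0..1}"
 using has_integral_reflect_unit[OF integrable_integral[OF io_sub[OF assms, of 0 1]]]
  has_integral_reflect_unit[OF integrable_integral[OF norm_io_sub[OF assms, of 0 1]]]
 unfolding absolutely_integrable_on_def by (auto intro: has_integral_integrable)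

lemma ai_uminus:
 fixes f :: "real => complex"
 assumes "f absolutely_integrable_on {0..1}" shows "(%x. - f x) absolutely_integrable_on {0..1}"
 using ai_cont_mult[OF assms, of "%x. - 1"] by simp

lemma acd_reflect: assumes "acd F f" shows "acd (%x. F (1 - x)) (%x. - f (1 - x))" unfolding acd_def
proof (intro conjI ballI)
 show "(%x. - f (1 - x)) absolutely_integrable_on {0..1}" by (rule ai_uminus[OF ai_reflect[OF acd_ai[OF assms]]])
 fix x :: real assume x: "x \<in> {0..1}"
 have "integral {0..x} (%t. f (1 - t)) = integral {1 - x..1} f"
  using has_integral_reflect_unit[OF integrable_integral[OF io_sub[OF acd_ai[OF assms], of "1 - x" 1]]] x by (simp add: integral_unique)
 then show "F (1 - x) - F (1 - 0) = integral {0..x} (%t. - f (1 - t))"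
  using acd_diff_eq[OF assms, of "1 - x" 1] x by (simp add: algebra_simps)
qed

lemma solves_reflect:
 assumes "solves b1 b2 p q l g y"
 shows "solves b1 b2 (%x. - p (1 - x)) (%x. - q (1 - x)) (- l) (%x. - g (1 - x)) (%x. y (1 - x))"
proof -
 note y = assms[unfolded solves_def]
 show ?thesis unfolding solves_def
  by (intro conjI; rule acd_cong[OF acd_reflect[OF conjunct1[OF y]]] acd_cong[OF acd_reflect[OF conjunct2[OF y]]])
   (simp_all add: algebra_simps)
qed

lemma nrm1_reflect: assumes "aiv g" shows "aiv (%x. - g (1 - x))" "nrm1 (%x. - g (1 - x)) = nrm1 g"
proof -
 have i: "(%x. g x $ i) absolutely_integrable_on {0..1}" for i using assms by (simp add: aiv_def)
 have "integral {0..1} (%x. norm (g (1 - x) $ i)) = L1n (%x. g x $ i)" for i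
  using has_integral_reflect_unit[OF integrable_integral[OF norm_io_sub[OF i, of 0 1 i]]] by (simp add: integral_unique)
 then show "nrm1 (%x. - g (1 - x)) = nrm1 g" by (simp add: nrm1_def)
 show "aiv (%x. - g (1 - x))" using ai_uminus[OF ai_reflect[OF i]] by (simp add: aiv_def)
qed

section \<open>Translates of the leading determinant and lower bounds by compactness\<close>

context bvp begin

definition E1 :: "complex => complex" where "E1 l = exp (- \<i> * b1 * l)"
definition E2 :: "complex => complex" where "E2 l = exp (\<i> * b2 * l)"
text \<open>The leading determinant at \<open>l + z\<close>, with the exponentials at
  \<open>l\<close> replaced by free parameters. For \<open>l\<close> in a strip these parameters
  stay in a compact set, so every sequence of translates has a subsequence converging to a member of
  the family.\<close>

definition FF :: "complex => complex => complex => complex" where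
 "FF e1 e2 z = (a + e1 * E1 z) * (d + e2 * E2 z) - b * c"

text \<open>\<open>DD l = E1 l * char_det0 l\<close> is the leading part of the characteristic determinant.\<close>

definition DD :: "complex => complex" where "DD l = (a + E1 l) * (d + E2 l) - b * c"

lemma DD_shift: "DD (l + z) = FF (E1 l) (E2 l) z" by (simp add: DD_def FF_def E1_def E2_def exp_add[symmetric] algebra_simps)

lemma DD_char_det0: "DD l = E1 l * char_det0 b1 b2 a b c d l"
proof -
 have "E1 l * exp (\<i> * of_real (b1 + b2) * l) = E2 l" "E1 l * exp (\<i> * of_real b1 * l) = 1"
  unfolding E1_def E2_def exp_add[symmetric] by (simp_all add: algebra_simps)
 moreover have "exp (\<i> * of_real b2 * l) = E2 l" by (simp add: E2_def)
 ultimately show ?thesis unfolding DD_def char_det0_def by (simp only: distrib_left mult.left_commute[of "E1 l"]) (simp add: algebra_simps)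
qed

lemma norm_E1: "norm (E1 l) = exp (b1 * Im l)" and norm_E2: "norm (E2 l) = exp (- b2 * Im l)" by (simp_all add: E1_def E2_def)

lemma E_le: assumes "- H <= Im l" "H >= 0" shows "norm (E1 l) <= exp (gam * H)" "norm (E2 l) <= exp (gam * H)"
proof -
 have "b1 * Im l <= gam * H"
 proof -
  have "- b1 * (- Im l) <= - b1 * H" using assms b1 by (intro mult_left_mono) auto
  also have "\<dots> <= gam * H" using assms b2 by (intro mult_right_mono) (auto simp: gam_def)
  finally show ?thesis by simp
 qed
 moreover have "- b2 * Im l <= gam * H"
 proof -
  have "b2 * (- Im l) <= b2 * H" using assms b2 by (intro mult_left_mono) auto
  also have "\<dots> <= gam * H" using assms b1 by (intro mult_right_mono) (auto simp: gam_def)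
  finally show ?thesis by simp
 qed
 ultimately show "norm (E1 l) <= exp (gam * H)" "norm (E2 l) <= exp (gam * H)" unfolding norm_E1 norm_E2 by auto
qed

lemma small_perturbation:
 "\<exists>eta>0. \<forall>X Y :: complex. norm X <= eta --> norm Y <= eta --> norm ((a + X) * (d + Y) - b * c) >= norm (a * d - b * c) / 2"
proof -
 define dl where "dl = norm (a * d - b * c)"
 have dl: "dl > 0" using reg by (simp add: dl_def)
 define eta where "eta = min 1 (dl / (2 * (norm a + norm d + 1)))"
 have s: "norm a + norm d + 1 > 0" by (simp add: add_nonneg_pos)
 have eta: "eta > 0" "eta <= 1" using dl s by (auto simp: eta_def)
 have eta2: "(norm a + norm d + 1) * eta <= dl / 2"
 proof -
  have "eta <= dl / (2 * (norm a + norm d + 1))" by (simp add: eta_def)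
  then show ?thesis using s by (simp add: field_simps)
 qed
 show ?thesis
 proof (intro exI[of _ eta] conjI allI impI eta(1))
  fix X Y :: complex assume X: "norm X <= eta" and Y: "norm Y <= eta"
  have "norm (a * Y + d * X + X * Y) <= norm a * norm Y + norm d * norm X + norm X * norm Y"
   by (intro norm_triangle_le add_mono) (simp_all add: norm_mult)
  also have "\<dots> <= norm a * eta + norm d * eta + 1 * eta" using X Y eta by (intro add_mono mult_mono) auto
  also have "\<dots> <= dl / 2" using eta2 by (simp add: algebra_simps)
  finally have "norm (a * Y + d * X + X * Y) <= dl / 2" .
  moreover have "a * d - b * c = ((a + X) * (d + Y) - b * c) - (a * Y + d * X + X * Y)" by (simp add: algebra_simps)
  then have "dl <= norm ((a + X) * (d + Y) - b * c) + norm (a * Y + d * X + X * Y)" unfolding dl_def by (metis norm_triangle_ineq4)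
  ultimately show "norm ((a + X) * (d + Y) - b * c) >= norm (a * d - b * c) / 2" by (simp add: dl_def)
 qed
qed

lemma small_exponentials:
 assumes eta: "eta > 0" shows "\<exists>h\<ge>0. \<forall>l. h <= Im l --> norm (E1 l) <= eta \<and> norm (E2 l) <= eta"
proof -
 define h where "h = max 0 (max (ln eta / b1) (- ln eta / b2))"
 show ?thesis
 proof (intro exI[of _ h] conjI allI impI)
  show "h >= 0" by (simp add: h_def)
  fix l assume l: "h <= Im l"
  then have 1: "ln eta / b1 <= Im l" "- ln eta / b2 <= Im l" by (auto simp: h_def)
  then have "b1 * Im l <= ln eta" "- b2 * Im l <= ln eta" using b1 b2 by (auto simp: field_simps)
  then have "exp (b1 * Im l) <= exp (ln eta)" "exp (- b2 * Im l) <= exp (ln eta)" by auto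
  then show "norm (E1 l) <= eta" "norm (E2 l) <= eta" using eta by (simp_all add: norm_E1 norm_E2)
 qed
qed

text \<open>High in the upper half plane both exponentials are small and the determinant is close to
  its regular value \<open>a * d - b * c\<close>.\<close>

lemma DD_large: "\<exists>h\<ge>0. \<exists>dlt>0. \<forall>l. h <= Im l --> dlt <= norm (DD l)"
proof -
 obtain eta where eta: "eta > 0" "!!X Y. norm X <= eta ==> norm Y <= eta ==> norm ((a + X) * (d + Y) - b * c) >= norm (a * d - b * c) / 2"
  using small_perturbation by blast
 obtain h where h: "h >= 0" "!!l. h <= Im l ==> norm (E1 l) <= eta \<and> norm (E2 l) <= eta" using small_exponentials[OF eta(1)] by blast
 show ?thesis by (intro exI[of _ h] conjI exI[of _ "norm (a * d - b * c) / 2"]) (use h eta reg in \<open>auto simp: DD_def\<close>)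
qed

lemma FF_nonzero: "\<exists>z. FF e1 e2 z ~= 0"
proof -
 obtain eta where eta: "eta > 0" "!!X Y. norm X <= eta ==> norm Y <= eta ==> norm ((a + X) * (d + Y) - b * c) >= norm (a * d - b * c) / 2"
  using small_perturbation by blast
 define m where "m = norm e1 + norm e2 + 1"
 have m: "m > 0" "norm e1 <= m" "norm e2 <= m" by (auto simp: m_def add_nonneg_pos)
 obtain h where h: "!!l. h <= Im l ==> norm (E1 l) <= eta / m \<and> norm (E2 l) <= eta / m"
  using small_exponentials[of "eta / m"] eta(1) m by auto
 let ?z = "\<i> * of_real h"
 have hz: "norm (E1 ?z) <= eta / m" "norm (E2 ?z) <= eta / m" using h[of ?z] by simp_all
 have "norm (e1 * E1 ?z) <= m * (eta / m)" unfolding norm_mult by (rule mult_mono[OF m(2) hz(1)]) (use m in simp_all)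
 moreover have "norm (e2 * E2 ?z) <= m * (eta / m)" unfolding norm_mult by (rule mult_mono[OF m(3) hz(2)]) (use m in simp_all)
 ultimately have "norm (e1 * E1 ?z) <= eta" "norm (e2 * E2 ?z) <= eta" using m by simp_all
 then have "norm (FF e1 e2 ?z) >= norm (a * d - b * c) / 2" unfolding FF_def by (rule eta(2))
 then have "FF e1 e2 ?z ~= 0" using reg by auto
 then show ?thesis by blast
qed

lemma FF_holomorphic: "FF e1 e2 holomorphic_on S" unfolding FF_def E1_def E2_def by (intro holomorphic_intros)

lemma FF_isolated: assumes "r > 0" shows "\<exists>rho>0. rho < r \<and> (\<forall>z\<in>cball 0 rho - {0}. FF e1 e2 z ~= 0)"
proof (cases "FF e1 e2 0 = 0")
 case True
 obtain bet where "FF e1 e2 bet ~= 0" using FF_nonzero by blast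
 then have "\<exists>s>0. \<forall>z\<in>ball 0 s - {0}. FF e1 e2 z ~= 0"
  by (rule_tac isolated_zeros[OF FF_holomorphic[of e1 e2] open_UNIV connected_UNIV UNIV_I True UNIV_I, of bet]) auto
 then obtain s where s: "s > 0" "!!z. z \<in> ball 0 s - {0} ==> FF e1 e2 z ~= 0" by blast
 define rho where "rho = min s r / 2"
 have rho: "rho > 0" "rho < r" "rho < s" using s(1) assms by (auto simp: rho_def min_def)
 have "\<forall>z\<in>cball 0 rho - {0}. FF e1 e2 z ~= 0" by (rule ballI, rule s(2)) (use rho in simp)
 then show ?thesis using rho by blast
next
 case False
 have "isCont (FF e1 e2) 0" using holomorphic_on_imp_continuous_on[OF FF_holomorphic[of e1 e2 UNIV]] by (simp add: continuous_on_eq_continuous_at)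
 then have "\<exists>s>0. \<forall>z. dist 0 z < s --> FF e1 e2 z ~= 0" using False by (rule continuous_at_avoid)
 then obtain s where s: "s > 0" "!!z. dist 0 z < s ==> FF e1 e2 z ~= 0" by blast
 define rho where "rho = min s r / 2"
 have rho: "rho > 0" "rho < r" "rho < s" using s(1) assms by (auto simp: rho_def min_def)
 have "\<forall>z\<in>cball 0 rho - {0}. FF e1 e2 z ~= 0" by (rule ballI, rule s(2)) (use rho in simp)
 then show ?thesis using rho by blast
qed

lemma strip_subsequence:
 assumes l: "!!n. \<bar>Im (l n)\<bar> <= H"
 shows "\<exists>r e1 e2. strict_mono (r :: nat => nat) \<and> e1 ~= 0 \<and> e2 ~= 0 \<and> (%n. E1 (l (r n))) \<longlonglongrightarrow> e1 \<and> (%n. E2 (l (r n))) \<longlonglongrightarrow> e2"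
proof -
 have H: "H >= 0" using l[of 0] by linarith
 define m where "m = exp (- (gam * H))"
 define M where "M = exp (gam * H)"
 have low: "m <= norm (E1 (l n))" "m <= norm (E2 (l n))" for n
 proof -
  have *: "\<bar>b1 * Im (l n)\<bar> <= gam * H" "\<bar>b2 * Im (l n)\<bar> <= gam * H"
   unfolding abs_mult using b1 b2 H by (intro mult_mono l; simp add: gam_def)+
  show "m <= norm (E1 (l n))" "m <= norm (E2 (l n))" unfolding m_def norm_E1 norm_E2 using * by auto
 qed
 let ?K = "(cball 0 M - ball 0 m) \<times> (cball 0 M - ball 0 m) :: (complex \<times> complex) set"
 have "compact ?K" by (intro compact_Times compact_diff) auto
 moreover have "\<forall>n. (E1 (l n), E2 (l n)) \<in> ?K"
 proof
  fix n
  have "- H <= Im (l n)" using l[of n] by linarith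
  then show "(E1 (l n), E2 (l n)) \<in> ?K" using low[of n] E_le[of H "l n", OF _ H] by (simp add: M_def not_less)
 qed
 ultimately have "\<exists>e\<in>?K. \<exists>r. strict_mono r \<and> ((%n. (E1 (l n), E2 (l n))) \<circ> r) \<longlonglongrightarrow> e"
  by (rule seq_compactE[OF compact_imp_seq_compact]) (rule bexI exI conjI | assumption)+
 then obtain e r where e: "e \<in> ?K" "strict_mono r" "((%n. (E1 (l n), E2 (l n))) \<circ> r) \<longlonglongrightarrow> e" by blast
 have m0: "m > 0" by (simp add: m_def)
 have "(%n. E1 (l (r n))) \<longlonglongrightarrow> fst e" "(%n. E2 (l (r n))) \<longlonglongrightarrow> snd e"
  using tendsto_fst[OF e(3)] tendsto_snd[OF e(3)] by (simp_all add: o_def)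
 moreover have "fst e ~= 0" "snd e ~= 0" using e(1) m0 by (auto simp: mem_Times_iff)
 ultimately show ?thesis using e(2) by blast
qed

lemma FF_tendsto:
 assumes "e1n \<longlonglongrightarrow> e1" "e2n \<longlonglongrightarrow> e2" "z \<longlonglongrightarrow> z0"
 shows "(%n. FF (e1n n) (e2n n) (z n)) \<longlonglongrightarrow> FF e1 e2 z0"
 unfolding FF_def E1_def E2_def by (intro tendsto_intros assms)

text \<open>The bound \<open>ep\<close> does not depend on \<open>l\<close>, although the radius
  does. If it failed, there would be centres \<open>l n\<close> for which every circle of radius at
  most 1 carries a point with a tiny determinant. They lie in a strip because the determinant is
  bounded below high up, so the translates converge along a subsequence to some
  \<open>FF e1 e2\<close>, which is not identically zero; a circle around 0 free of its zeros gives
  the contradiction.\<close>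

lemma circle_bound:
 "\<exists>ep>0. \<forall>l. 0 <= Im l --> (\<exists>rho>0. rho <= 1 \<and> (\<forall>z\<in>sphere 0 rho. ep <= norm (DD (l + z))))"
proof (rule ccontr)
 assume n: "\<not> ?thesis"
 have "\<exists>l. 0 <= Im l \<and> (\<forall>rho. 0 < rho --> rho <= 1 --> (\<exists>z\<in>sphere 0 rho. norm (DD (l + z)) < 1 / real (Suc n)))" for n
 proof -
  have "1 / real (Suc n) > 0" by simp
  then show ?thesis using n by (metis not_le)
 qed
 then obtain l where l: "!!n. 0 <= Im (l n)" "!!n rho. 0 < rho ==> rho <= 1 ==> \<exists>z\<in>sphere 0 rho. norm (DD (l n + z)) < 1 / real (Suc n)"
  by metis
 obtain h dlt where h: "h >= 0" "dlt > 0" "!!l. h <= Im l ==> dlt <= norm (DD l)" using DD_large by blast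
 obtain N where N: "1 / real (Suc N) < dlt" using nat_approx_posE[OF h(2)] by blast
 have strip: "\<bar>Im (l (n + N))\<bar> <= h + 1" for n
 proof (rule ccontr)
  assume "\<not> ?thesis"
  then have big: "h + 1 < Im (l (n + N))" using l(1)[of "n + N"] by simp
  obtain z where z: "z \<in> sphere 0 1" "norm (DD (l (n + N) + z)) < 1 / real (Suc (n + N))" using l(2)[of 1 "n + N"] by auto
  have "h <= Im (l (n + N) + z)" using big abs_Im_le_cmod[of z] z(1) by simp
  then have "dlt <= norm (DD (l (n + N) + z))" by (rule h(3))
  moreover have "1 / real (Suc (n + N)) <= 1 / real (Suc N)" by (simp add: frac_le)
  ultimately show False using z(2) N by linarith
 qed
 obtain r e1 e2 where r: "strict_mono (r :: nat => nat)" "(%n. E1 (l (r n + N))) \<longlonglongrightarrow> e1" "(%n. E2 (l (r n + N))) \<longlonglongrightarrow> e2"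
  using strip_subsequence[of "%n. l (n + N)", OF strip] by blast
 obtain rho where rho: "rho > 0" "rho < 1" "!!z. z \<in> cball 0 rho - {0} ==> FF e1 e2 z ~= 0" using FF_isolated[of 1 e1 e2] zero_less_one by blast
 have "\<forall>n. \<exists>z\<in>sphere 0 rho. norm (DD (l (r n + N) + z)) < 1 / real (Suc (r n + N))"
  using l(2)[OF rho(1) less_imp_le[OF rho(2)]] by blast
 then obtain z where z: "!!n. z n \<in> sphere 0 rho" "!!n. norm (DD (l (r n + N) + z n)) < 1 / real (Suc (r n + N))" by metis
 have "compact (sphere (0::complex) rho)" by simp
 moreover have "\<forall>n. z n \<in> sphere 0 rho" using z(1) by blast
 ultimately have "\<exists>z0\<in>sphere 0 rho. \<exists>s. strict_mono s \<and> (z \<circ> s) \<longlonglongrightarrow> z0"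
  by (rule seq_compactE[OF compact_imp_seq_compact]) (rule bexI exI conjI | assumption)+
 then obtain z0 s where s: "z0 \<in> sphere 0 rho" "strict_mono s" "(z \<circ> s) \<longlonglongrightarrow> z0" by blast
 have "(%n. FF (E1 (l (r (s n) + N))) (E2 (l (r (s n) + N))) (z (s n))) \<longlonglongrightarrow> FF e1 e2 z0"
  using LIMSEQ_subseq_LIMSEQ[OF r(2) s(2)] LIMSEQ_subseq_LIMSEQ[OF r(3) s(2)] s(3)
  by (intro FF_tendsto) (auto simp: o_def)
 moreover have "(%n. FF (E1 (l (r (s n) + N))) (E2 (l (r (s n) + N))) (z (s n))) \<longlonglongrightarrow> 0"
 proof (rule Lim_null_comparison[OF always_eventually])
  show "\<forall>n. norm (FF (E1 (l (r (s n) + N))) (E2 (l (r (s n) + N))) (z (s n))) <= 1 / real (Suc n)"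
  proof
   fix n
   have "n <= s n" "s n <= r (s n)" using r(1) s(2) by (simp_all add: seq_suble)
   then have "1 / real (Suc (r (s n) + N)) <= 1 / real (Suc n)" by (intro frac_le) auto
   then show "norm (FF (E1 (l (r (s n) + N))) (E2 (l (r (s n) + N))) (z (s n))) <= 1 / real (Suc n)"
    using z(2)[of "s n"] unfolding DD_shift by linarith
  qed
  show "(%n. 1 / real (Suc n)) \<longlonglongrightarrow> 0" by (rule LIMSEQ_Suc[OF lim_1_over_n])
 qed
 ultimately have "FF e1 e2 z0 = 0" by (rule LIMSEQ_unique)
 then show False using rho(3)[of z0] s(1) rho(1) by auto
qed

text \<open>Inserting the asymptotics into the boundary conditions gives a 2 by 2 system for
  \<open>y 0 $ 2\<close> and \<open>y 1 $ 1\<close> with determinant \<open>- DD l\<close> and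
  right-hand sides \<open>e1\<close>, \<open>e2\<close>; Cramer's rule bounds \<open>DD l\<close>
  times the unknowns. At an eigenvalue, where \<open>g = 0\<close>, this says that
  \<open>DD l\<close> itself is small.\<close>

lemma boundary_asymptotics:
 assumes H: "H >= 0"
 shows "\<exists>K\<ge>0. \<forall>ep>0. \<exists>R>0. \<forall>l g y. - H <= Im l --> R <= norm l --> aiv g --> sol l g y --> bc y -->
  norm (DD l) * sig y <= ep * sig y + K * nrm1 g \<and> (\<forall>x\<in>{0..1}. n1 (y x) <= K * (sig y + nrm1 g))"
proof -
 define E where "E = exp (gam * H)"
 obtain C where C: "C >= 0" "!!ep. ep > 0 ==> \<exists>R>0. \<forall>l g y x. - H <= Im l --> R <= norm l --> aiv g --> sol l g y --> x \<in> {0..1} -->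
   norm (y x $ 1 - y 1 $ 1 * exp (- \<i> * b1 * l * of_real (1 - x))) + norm (y x $ 2 - y 0 $ 2 * exp (\<i> * b2 * l * of_real x))
   <= ep * (norm (y 0 $ 2) + norm (y 1 $ 1)) + C * nrm1 g"
  using asymptotics[OF H] by blast
 define Q where "Q = norm a + norm b + norm c + norm d + E + 1"
 have E1: "E >= 1" unfolding E_def using H b1 b2 by (simp add: gam_def)
 have Q: "Q >= 1" "norm b <= Q" "norm c <= Q" "norm a + E <= Q" "norm d + E <= Q"
  unfolding Q_def using E1 norm_ge_zero[of a] norm_ge_zero[of b] norm_ge_zero[of c] norm_ge_zero[of d] by linarith+
 define K where "K = 4 * Q * C + E + 1 + C"
 have K: "K >= 0" "4 * Q * C <= K" "E + 1 <= K" "C <= K" unfolding K_def using C(1) Q(1) E1 by auto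
 show ?thesis
 proof (rule exI[of _ K], intro conjI allI impI K(1))
  fix ep :: real assume ep: "ep > 0"
  define e where "e = min 1 (ep / (4 * Q))"
  have "e <= ep / (4 * Q)" by (simp add: e_def)
  then have "4 * Q * e <= ep" using Q(1) by (simp add: pos_le_divide_eq mult.commute mult.left_commute)
  moreover have "e > 0" "e <= 1" using ep Q(1) by (simp_all add: e_def)
  ultimately have e: "e > 0" "e <= 1" "4 * Q * e <= ep" by blast+
  obtain R where R: "R > 0" "!!l g y x. - H <= Im l ==> R <= norm l ==> aiv g ==> sol l g y ==> x \<in> {0..1} ==>
   norm (y x $ 1 - y 1 $ 1 * exp (- \<i> * b1 * l * of_real (1 - x))) + norm (y x $ 2 - y 0 $ 2 * exp (\<i> * b2 * l * of_real x))
   <= e * (norm (y 0 $ 2) + norm (y 1 $ 1)) + C * nrm1 g" using C(2)[OF e(1)] by blast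
  show "\<exists>R>0. \<forall>l g y. - H <= Im l --> R <= norm l --> aiv g --> sol l g y --> bc y -->
   norm (DD l) * sig y <= ep * sig y + K * nrm1 g \<and> (\<forall>x\<in>{0..1}. n1 (y x) <= K * (sig y + nrm1 g))"
  proof (rule exI[of _ R], rule conjI[OF R(1)], intro allI impI)
   fix l g y assume l: "- H <= Im l" "R <= norm l" and g: "aiv g" and y: "sol l g y" "bc y"
   define s where "s = y 0 $ 2" define t where "t = y 1 $ 1"
   define er where "er = e * sig y + C * nrm1 g"
   have g0: "nrm1 g >= 0" by (rule nrm1_nonneg[OF g])
   have s0: "sig y >= 0" by (simp add: sig_def)
   have as: "norm (y x $ 1 - t * exp (- \<i> * b1 * l * of_real (1 - x))) + norm (y x $ 2 - s * exp (\<i> * b2 * l * of_real x)) <= er"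
    if "x \<in> {0..1}" for x using R(2)[OF l g y(1) that] by (simp add: er_def sig_def s_def t_def)
   define e1 where "e1 = - (y 0 $ 1 - t * E1 l)" define e2 where "e2 = - (y 1 $ 2 - s * E2 l)"
   have e12: "norm e1 <= er" "norm e2 <= er"
    using as[of 0] as[of 1] unfolding e1_def e2_def E1_def E2_def norm_minus_cancel by (simp_all add: s_def t_def)
   have bc0: "y 0 $ 1 + b * s + a * t = 0" "d * s + c * t + y 1 $ 2 = 0" using y(2) unfolding boundary_conds_def s_def t_def by blast+
   have "e1 = (b * s + (a + E1 l) * t) - (y 0 $ 1 + b * s + a * t)" by (simp add: e1_def algebra_simps)
   then have r1: "b * s + (a + E1 l) * t = e1" unfolding bc0 by simp
   have "e2 = ((d + E2 l) * s + c * t) - (d * s + c * t + y 1 $ 2)" by (simp add: e2_def algebra_simps)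
   then have r2: "(d + E2 l) * s + c * t = e2" unfolding bc0 by simp
   have Ds: "DD l * s = (a + E1 l) * e2 - c * e1" unfolding DD_def r1[symmetric] r2[symmetric] by (simp add: algebra_simps)
   have Dt: "DD l * t = (d + E2 l) * e1 - b * e2" unfolding DD_def r1[symmetric] r2[symmetric] by (simp add: algebra_simps)
   have er0: "er >= 0" using e12(1) norm_ge_zero order_trans by blast
   have aE: "norm (a + E1 l) <= Q" "norm (d + E2 l) <= Q"
    using norm_triangle_ineq[of a "E1 l"] norm_triangle_ineq[of d "E2 l"] E_le[OF l(1) H] Q unfolding E_def[symmetric] by linarith+
   have "norm (DD l * s) <= Q * er + Q * er" unfolding Ds
    by (rule order_trans[OF norm_triangle_ineq4], unfold norm_mult, intro add_mono mult_mono) (use aE Q e12 er0 in simp_all)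
   moreover have "norm (DD l * t) <= Q * er + Q * er" unfolding Dt
    by (rule order_trans[OF norm_triangle_ineq4], unfold norm_mult, intro add_mono mult_mono) (use aE Q e12 er0 in simp_all)
   ultimately have "norm (DD l) * sig y <= 4 * Q * er" by (simp add: sig_def s_def t_def norm_mult distrib_left)
   also have "\<dots> = (4 * Q * e) * sig y + (4 * Q * C) * nrm1 g" by (simp add: er_def algebra_simps)
   also have "\<dots> <= ep * sig y + K * nrm1 g" using e K g0 s0 by (intro add_mono mult_right_mono) auto
   finally have 1: "norm (DD l) * sig y <= ep * sig y + K * nrm1 g" .
   have 2: "n1 (y x) <= K * (sig y + nrm1 g)" if x: "x \<in> {0..1}" for x
   proof -
    have e1: "norm (exp (- \<i> * b1 * l * of_real (1 - x))) <= E"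
    proof -
     have eq: "- \<i> * b1 * l * of_real (1 - x) = \<i> * l * of_real (\<bar>b1\<bar> * (1 - x))" using b1 by (simp add: algebra_simps)
     show ?thesis unfolding eq E_def by (rule norm_exp_bound[OF l(1) H]) (use x b1 b2 in \<open>auto simp: gam_def\<close>)
    qed
    have e2: "norm (exp (\<i> * b2 * l * of_real x)) <= E"
    proof -
     have eq: "\<i> * b2 * l * of_real x = \<i> * l * of_real (b2 * x)" by simp
     show ?thesis unfolding eq E_def by (rule norm_exp_bound[OF l(1) H]) (use x b1 b2 in \<open>auto simp: gam_def\<close>)
    qed
    have "norm (y x $ 1) <= norm t * E + norm (y x $ 1 - t * exp (- \<i> * b1 * l * of_real (1 - x)))"
     using norm_triangle_sub[of "y x $ 1" "t * exp (- \<i> * b1 * l * of_real (1 - x))"] mult_left_mono[OF e1, of "norm t"]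
     by (simp add: norm_mult)
    moreover have "norm (y x $ 2) <= norm s * E + norm (y x $ 2 - s * exp (\<i> * b2 * l * of_real x))"
     using norm_triangle_sub[of "y x $ 2" "s * exp (\<i> * b2 * l * of_real x)"] mult_left_mono[OF e2, of "norm s"]
     by (simp add: norm_mult)
    ultimately have "n1 (y x) <= E * sig y + er" using as[OF x] by (simp add: n1_def sig_def s_def t_def algebra_simps)
    also have "\<dots> = (E + e) * sig y + C * nrm1 g" by (simp add: er_def algebra_simps)
    also have "\<dots> <= K * sig y + K * nrm1 g" using e K s0 g0 by (intro add_mono mult_right_mono) auto
    finally show ?thesis by (simp add: algebra_simps)
   qed
   show "norm (DD l) * sig y <= ep * sig y + K * nrm1 g \<and> (\<forall>x\<in>{0..1}. n1 (y x) <= K * (sig y + nrm1 g))" using 1 2 by blast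
  qed
 qed
qed

section \<open>Resolvent bounds in the whole plane and the strip of eigenvalues\<close>

text \<open>An a priori estimate from L1 to the supremum norm without any claim of existence; its
  case \<open>g = 0\<close> shows that \<open>l\<close> is not an eigenvalue.\<close>

definition resolvent_bounded :: "real => complex => bool" where
 "resolvent_bounded K l \<longleftrightarrow> (\<forall>g y. aiv g --> sol l g y --> bc y --> (\<forall>x\<in>{0..1}. n1 (y x) <= K * nrm1 g))"

text \<open>With the asymptotic error \<open>ep / 2\<close>, the lower bound \<open>ep\<close> of
  the determinant on the circle absorbs \<open>sig y\<close>. The asymptotics are taken for
  \<open>Im l >= - 1\<close> because circles around points of the closed half plane may reach down
  by 1.\<close>

lemma half_plane_resolvent:
 "\<exists>K R. \<forall>l :: complex. 0 <= Im l --> R <= norm l --> (\<exists>rho>0. rho <= 1 \<and> (\<forall>z\<in>sphere 0 rho. resolvent_bounded K (l + z)))"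
proof -
 obtain ep where ep: "ep > 0" "!!l. 0 <= Im l ==> \<exists>rho>0. rho <= 1 \<and> (\<forall>z\<in>sphere 0 rho. ep <= norm (DD (l + z)))" using circle_bound by blast
 obtain K where K: "K >= 0" "!!ep. ep > 0 ==> \<exists>R>0. \<forall>l g y. - 1 <= Im l --> R <= norm l --> aiv g --> sol l g y --> bc y -->
  norm (DD l) * sig y <= ep * sig y + K * nrm1 g \<and> (\<forall>x\<in>{0..1}. n1 (y x) <= K * (sig y + nrm1 g))"
  using boundary_asymptotics[OF zero_le_one] by blast
 obtain R where R: "!!l g y. - 1 <= Im l ==> R <= norm l ==> aiv g ==> sol l g y ==> bc y ==>
  norm (DD l) * sig y <= ep / 2 * sig y + K * nrm1 g \<and> (\<forall>x\<in>{0..1}. n1 (y x) <= K * (sig y + nrm1 g))"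
  using K(2)[OF half_gt_zero[OF ep(1)]] by blast
 define K' where "K' = K * (2 * K / ep + 1)"
 show ?thesis
 proof (rule exI[of _ K'], rule exI[of _ "R + 1"], intro allI impI)
  fix l :: complex assume l: "0 <= Im l" "R + 1 <= norm l"
  obtain rho where rho: "rho > 0" "rho <= 1" "!!z. z \<in> sphere 0 rho ==> ep <= norm (DD (l + z))" using ep(2)[OF l(1)] by blast
  have "resolvent_bounded K' (l + z)" if z: "z \<in> sphere 0 rho" for z unfolding resolvent_bounded_def
  proof (intro allI impI ballI)
   fix g y x assume g: "aiv g" and y: "sol (l + z) g y" "bc y" and x: "x \<in> {0..1::real}"
   have zn: "norm z <= 1" using z rho by simp
   have "- 1 <= Im (l + z)" using l(1) abs_Im_le_cmod[of z] zn by simp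
   moreover have "R <= norm (l + z)" using l(2) zn norm_triangle_ineq4[of "l + z" z] by simp
   ultimately have *: "norm (DD (l + z)) * sig y <= ep / 2 * sig y + K * nrm1 g" "n1 (y x) <= K * (sig y + nrm1 g)"
    using R[OF _ _ g y] x by auto
   have s0: "sig y >= 0" by (simp add: sig_def)
   have "ep * sig y <= norm (DD (l + z)) * sig y" using rho(3)[OF z] s0 by (rule mult_right_mono)
   with *(1) have "sig y <= 2 * K / ep * nrm1 g" using ep(1) by (simp add: field_simps)
   then have "sig y + nrm1 g <= (2 * K / ep + 1) * nrm1 g" by (simp add: algebra_simps)
   with mult_left_mono[OF this K(1)] *(2) show "n1 (y x) <= K' * nrm1 g" by (simp add: K'_def mult.assoc)
  qed
  then show "\<exists>rho>0. rho <= 1 \<and> (\<forall>z\<in>sphere 0 rho. resolvent_bounded K' (l + z))" using rho by blast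
 qed
qed

lemma half_plane_strip: "\<exists>H\<ge>0. \<forall>l y. H <= Im l --> sol l (%x. 0) y --> bc y --> y 0 = 0"
proof -
 obtain h dlt where h: "h >= 0" "dlt > 0" "!!l. h <= Im l ==> dlt <= norm (DD l)" using DD_large by blast
 obtain K where K: "K >= 0" "!!ep. ep > 0 ==> \<exists>R>0. \<forall>l g y. - 0 <= Im l --> R <= norm l --> aiv g --> sol l g y --> bc y -->
  norm (DD l) * sig y <= ep * sig y + K * nrm1 g \<and> (\<forall>x\<in>{0..1}. n1 (y x) <= K * (sig y + nrm1 g))"
  using boundary_asymptotics[OF order_refl] by blast
 obtain R where R: "!!l g y. 0 <= Im l ==> R <= norm l ==> aiv g ==> sol l g y ==> bc y ==>
  norm (DD l) * sig y <= dlt / 2 * sig y + K * nrm1 g \<and> (\<forall>x\<in>{0..1}. n1 (y x) <= K * (sig y + nrm1 g))"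
  using K(2)[OF half_gt_zero[OF h(2)]] unfolding minus_zero by blast
 have z: "nrm1 (%x. 0) = 0" by (simp add: nrm1_def)
 show ?thesis
 proof (intro exI[of _ "max h R"] conjI allI impI)
  show "max h R >= 0" using h(1) by simp
  fix l y assume l: "max h R <= Im l" and y: "sol l (%x. 0) y" "bc y"
  have "R <= norm l" using l abs_Im_le_cmod[of l] by linarith
  then have *: "norm (DD l) * sig y <= dlt / 2 * sig y" "n1 (y 0) <= K * sig y" using R[OF _ _ aiv_zero y] l h(1) z by auto
  have "dlt * sig y <= norm (DD l) * sig y" using h(3)[of l] l by (intro mult_right_mono) (auto simp: sig_def)
  with *(1) have "dlt * sig y <= 0" by linarith
  then have "sig y <= 0" using h(2) by (simp add: mult_le_0_iff)
  then have "sig y = 0" by (simp add: sig_def add_nonneg_eq_0_iff antisym)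
  then show "y 0 = 0" using *(2) n1_nonneg[of "y 0"] n1_eq_0_iff by simp
 qed
qed

text \<open>Reflection exchanges the ends, so the conditions have to be solved for
  \<open>y 1 $ 1\<close> and \<open>y 0 $ 2\<close>: the new coefficients are the entries of the
  inverse of the matrix with rows \<open>(a, b)\<close> and \<open>(c, d)\<close>. As
  \<open>l\<close> turns into \<open>- l\<close>, upper half plane estimates for this problem are
  lower half plane estimates for the original one.\<close>

lemma bvp_reflect:
 "bvp b1 b2 (%x. - p (1 - x)) (%x. - q (1 - x)) (d / (a * d - b * c)) (- b / (a * d - b * c)) (- c / (a * d - b * c)) (a / (a * d - b * c))"
proof unfold_locales
 show "(%x. - p (1 - x)) absolutely_integrable_on {0..1}" "(%x. - q (1 - x)) absolutely_integrable_on {0..1}"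
  by (rule ai_uminus[OF ai_reflect[OF p]], rule ai_uminus[OF ai_reflect[OF q]])
 let ?D = "a * d - b * c"
 have "d / ?D * (a / ?D) - - b / ?D * (- c / ?D) = ?D / (?D * ?D)" by (simp add: diff_divide_distrib mult.commute)
 then show "d / ?D * (a / ?D) - - b / ?D * (- c / ?D) ~= 0" using reg by simp
qed (use b1 b2 in auto)

lemma bc_reflect:
 assumes "bc y"
 shows "boundary_conds (d / (a * d - b * c)) (- b / (a * d - b * c)) (- c / (a * d - b * c)) (a / (a * d - b * c)) (%x. y (1 - x))"
proof -
 define D where "D = a * d - b * c"
 have D: "D ~= 0" using reg by (simp add: D_def)
 have e: "y 0 $ 1 = - (b * y 0 $ 2 + a * y 1 $ 1)" "y 1 $ 2 = - (d * y 0 $ 2 + c * y 1 $ 1)"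
  using assms unfolding boundary_conds_def eq_neg_iff_add_eq_0 by (simp_all only: ac_simps)
 have "D * (y 1 $ 1 + - b / D * y 1 $ 2 + d / D * y 0 $ 1) = D * y 1 $ 1 - b * y 1 $ 2 + d * y 0 $ 1"
  "D * (a / D * y 1 $ 2 + - c / D * y 0 $ 1 + y 0 $ 2) = a * y 1 $ 2 - c * y 0 $ 1 + D * y 0 $ 2"
  using D by (simp_all add: field_simps)
 then have "D * (y 1 $ 1 + - b / D * y 1 $ 2 + d / D * y 0 $ 1) = 0" "D * (a / D * y 1 $ 2 + - c / D * y 0 $ 1 + y 0 $ 2) = 0"
  unfolding e by (simp_all add: D_def algebra_simps)
 then have "y 1 $ 1 + - b / D * y 1 $ 2 + d / D * y 0 $ 1 = 0" "a / D * y 1 $ 2 + - c / D * y 0 $ 1 + y 0 $ 2 = 0" using D by auto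
 then show ?thesis unfolding boundary_conds_def D_def by simp
qed

lemma plane_resolvent:
 "\<exists>K R. \<forall>l :: complex. R <= norm l --> (\<exists>rho>0. rho <= 1 \<and> (\<forall>z\<in>sphere 0 rho. resolvent_bounded K (l + z)))"
proof -
 let ?D = "a * d - b * c"
 interpret R: bvp b1 b2 "%x. - p (1 - x)" "%x. - q (1 - x)" "d / ?D" "- b / ?D" "- c / ?D" "a / ?D" by (rule bvp_reflect)
 have refl: "resolvent_bounded K l" if "R.resolvent_bounded K (- l)" for K l unfolding resolvent_bounded_def
 proof (intro allI impI ballI)
  fix g y x assume g: "aiv g" and y: "sol l g y" "bc y" and x: "x \<in> {0..1::real}"
  have "n1 (y (1 - (1 - x))) <= K * nrm1 (%x. - g (1 - x))"
   using that nrm1_reflect(1)[OF g] solves_reflect[OF y(1)] bc_reflect[OF y(2)] x unfolding R.resolvent_bounded_def by fastforce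
  then show "n1 (y x) <= K * nrm1 g" by (simp add: nrm1_reflect(2)[OF g])
 qed
 have mono: "resolvent_bounded K' l" if "resolvent_bounded K l" "K <= K'" for K K' l unfolding resolvent_bounded_def
 proof (intro allI impI ballI)
  fix g y x assume g: "aiv g" and y: "sol l g y" "bc y" and x: "x \<in> {0..1::real}"
  have "n1 (y x) <= K * nrm1 g" using that(1) g y x unfolding resolvent_bounded_def by blast
  also have "\<dots> <= K' * nrm1 g" using that(2) nrm1_nonneg[OF g] by (rule mult_right_mono)
  finally show "n1 (y x) <= K' * nrm1 g" .
 qed
 obtain K1 R1 where 1: "!!l. 0 <= Im l ==> R1 <= norm l ==> \<exists>rho>0. rho <= 1 \<and> (\<forall>z\<in>sphere 0 rho. resolvent_bounded K1 (l + z))"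
  using half_plane_resolvent by blast
 obtain K2 R2 where 2: "!!l. 0 <= Im l ==> R2 <= norm l ==> \<exists>rho>0. rho <= 1 \<and> (\<forall>z\<in>sphere 0 rho. R.resolvent_bounded K2 (l + z))"
  using R.half_plane_resolvent by blast
 show ?thesis
 proof (rule exI[of _ "max K1 K2"], rule exI[of _ "max R1 R2"], intro allI impI)
  fix l :: complex assume l: "max R1 R2 <= norm l"
  show "\<exists>rho>0. rho <= 1 \<and> (\<forall>z\<in>sphere 0 rho. resolvent_bounded (max K1 K2) (l + z))"
  proof (cases "0 <= Im l")
   case True
   then show ?thesis using 1[of l] l mono[of K1 _ "max K1 K2"] by (meson max.boundedE max.cobounded1)
  next
   case False
   then obtain rho where rho: "rho > 0" "rho <= 1" "!!z. z \<in> sphere 0 rho ==> R.resolvent_bounded K2 (- l + z)" using 2[of "- l"] l by auto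
   have "resolvent_bounded (max K1 K2) (l + z)" if "z \<in> sphere 0 rho" for z
   proof (rule mono[OF refl])
    show "R.resolvent_bounded K2 (- (l + z))" using rho(3)[of "- z"] that by simp
   qed simp
   then show ?thesis using rho by blast
  qed
 qed
qed

lemma resolvent_bounded_\<Delta>: assumes "resolvent_bounded K l" shows "\<Delta> l ~= 0"
proof
 assume "\<Delta> l = 0"
 then obtain y where y: "sol l (%x. 0) y" "bc y" "y 0 ~= 0" using eigenfunction_exists by blast
 have "n1 (y 0) <= K * nrm1 (%x. 0)" using assms y unfolding resolvent_bounded_def by auto
 then show False using y(3) n1_nonneg[of "y 0"] n1_eq_0_iff[of "y 0"] by (simp add: nrm1_def)
qed

lemma eigenvalue_strip: "\<exists>H\<ge>0. \<forall>l. \<Delta> l = 0 --> \<bar>Im l\<bar> <= H"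
proof -
 let ?D = "a * d - b * c"
 interpret R: bvp b1 b2 "%x. - p (1 - x)" "%x. - q (1 - x)" "d / ?D" "- b / ?D" "- c / ?D" "a / ?D" by (rule bvp_reflect)
 obtain H1 where H1: "H1 >= 0" "!!l y. H1 <= Im l ==> sol l (%x. 0) y ==> bc y ==> y 0 = 0" using half_plane_strip by blast
 obtain H2 where H2: "H2 >= 0" "!!l y. H2 <= Im l ==> R.sol l (%x. 0) y ==> R.bc y ==> y 0 = 0" using R.half_plane_strip by blast
 show ?thesis
 proof (intro exI[of _ "max H1 H2"] conjI allI impI)
  show "0 <= max H1 H2" using H1(1) by simp
  fix l assume "\<Delta> l = 0"
  then obtain y where y: "sol l (%x. 0) y" "bc y" "y 0 ~= 0" using eigenfunction_exists by blast
  have "\<not> H1 <= Im l" using H1(2)[OF _ y(1,2)] y(3) by blast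
  moreover have "\<not> H2 <= Im (- l)"
  proof
   assume h: "H2 <= Im (- l)"
   have z: "R.sol (- l) (%x. 0) (%x. y (1 - x))" using solves_reflect[OF y(1)] by simp
   from H2(2)[OF h z bc_reflect[OF y(2)]] have "y 1 = 0" by simp
   have "(%x. y (1 - x)) 1 = 0" using R.sol_unique[OF z R.sol_zero, of 1] \<open>y 1 = 0\<close> by simp
   then show False using y(3) by simp
  qed
  ultimately show "\<bar>Im l\<bar> <= max H1 H2" by auto
 qed
qed

end

section \<open>Strict regularity and the simplicity of far zeros of the leading determinant\<close>

context bvp begin

text \<open>Up to the factor \<open>i\<close>, the derivative of the leading determinant at
  \<open>l\<close> when \<open>e1 = E1 l\<close> and \<open>e2 = E2 l\<close>.\<close>

definition WW :: "complex => complex => complex" where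
 "WW e1 e2 = of_real b2 * e2 * (a + e1) - of_real b1 * e1 * (d + e2)"

lemma FF_deriv: "(FF e1 e2 has_field_derivative \<i> * WW e1 e2) (at 0)" unfolding FF_def E1_def E2_def WW_def
 by (rule derivative_eq_intros refl | simp)+ (simp add: algebra_simps)

lemma FF_zorder_pos: assumes "FF e1 e2 z0 = 0"
 shows "\<exists>(n::nat) (g :: complex => complex) (r::real). n > 0 \<and> zorder (FF e1 e2) z0 = int n \<and> r > 0 \<and> g holomorphic_on cball z0 r \<and>
  (\<forall>w\<in>cball z0 r. FF e1 e2 w = g w * (w - z0) ^ n \<and> g w ~= 0)"
proof -
 have "\<exists>w\<in>UNIV. FF e1 e2 w ~= 0" using FF_nonzero by blast
 from zorder_exist_zero[OF FF_holomorphic open_UNIV connected_UNIV UNIV_I this, of z0] assms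
 obtain r where r: "zorder (FF e1 e2) z0 > 0" "r > 0" "zor_poly (FF e1 e2) z0 holomorphic_on cball z0 r"
  "\<forall>w\<in>cball z0 r. FF e1 e2 w = zor_poly (FF e1 e2) z0 w * (w - z0) ^ nat (zorder (FF e1 e2) z0) \<and> zor_poly (FF e1 e2) z0 w ~= 0"
  by auto
 then show ?thesis by (intro exI[of _ "nat (zorder (FF e1 e2) z0)"] exI[of _ "zor_poly (FF e1 e2) z0"] exI[of _ r]) simp
qed

text \<open>At a zero of order 1 the difference quotient would tend to the nonzero value of the
  cofactor \<open>g\<close>, but its limit is a multiple of \<open>WW e1 e2\<close>.\<close>

lemma FF_double_zero: assumes "FF e1 e2 0 = 0" "WW e1 e2 = 0" shows "zorder (FF e1 e2) 0 >= 2"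
proof (rule ccontr)
 assume neg: "\<not> ?thesis"
 obtain n g r where n: "n > 0" "zorder (FF e1 e2) 0 = int n" "r > 0" "g holomorphic_on cball 0 r"
  "!!w. w \<in> cball 0 r ==> FF e1 e2 w = g w * (w - 0) ^ n \<and> g w ~= 0"
  using FF_zorder_pos[OF assms(1)] by blast
 have n1: "n = 1" using neg n(1,2) by linarith
 have "((%w. (FF e1 e2 w - FF e1 e2 0) / (w - 0)) \<longlongrightarrow> 0) (at 0)"
  using FF_deriv[of e1 e2] unfolding assms(2) has_field_derivative_iff by simp
 moreover have "eventually (%w. (FF e1 e2 w - FF e1 e2 0) / (w - 0) = g w) (at 0)"
  unfolding eventually_at by (rule exI[of _ r]) (use n(3,5) assms(1) n1 in \<open>auto simp: dist_norm\<close>)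
 ultimately have "(g \<longlongrightarrow> 0) (at 0)" by (rule Lim_transform_eventually)
 moreover have "isCont g 0" using holomorphic_on_imp_continuous_on[OF n(4)] n(3) by (intro continuous_on_interior[of "cball 0 r"]) auto
 then have "(g \<longlongrightarrow> g 0) (at 0)" by (simp add: isCont_def)
 ultimately have "g 0 = 0" using LIM_unique by blast
 then show False using n(3) n(5)[of 0] by simp
qed

lemma FF_finite_zeros: "finite {z \<in> cball 0 B. FF e1 e2 z = 0}"
proof (cases "FF e1 e2 constant_on UNIV")
 case True
 obtain z where z: "FF e1 e2 z ~= 0" using FF_nonzero by blast
 obtain k where k: "!!w. FF e1 e2 w = k" using True unfolding constant_on_def by blast
 then have "FF e1 e2 w ~= 0" for w using z by metis
 then have "{z \<in> cball 0 B. FF e1 e2 z = 0} = {}" by simp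
 then show ?thesis by (simp only: finite.emptyI)
next
 case False
 show ?thesis by (rule holomorphic_compact_finite_zeros[OF FF_holomorphic open_UNIV connected_UNIV _ _ False]) auto
qed

text \<open>Strict regularity counts zeros of \<open>char_det0\<close> with multiplicity; that
  function differs from \<open>DD\<close> by the factor \<open>E1\<close>, which has no
  zeros.\<close>

lemma zorder_FF: "zorder (FF (E1 l) (E2 l)) z0 = zorder (char_det0 b1 b2 a b c d) (l + z0)" if z: "FF (E1 l) (E2 l) z0 = 0"
proof -
 obtain n g r where n: "n > 0" "zorder (FF (E1 l) (E2 l)) z0 = int n" "r > 0" "g holomorphic_on cball z0 r"
  "!!w. w \<in> cball z0 r ==> FF (E1 l) (E2 l) w = g w * (w - z0) ^ n \<and> g w ~= 0"
  using FF_zorder_pos[OF z] by blast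
 have E1nz: "E1 w ~= 0" for w by (simp add: E1_def)
 have "zorder (char_det0 b1 b2 a b c d) (l + z0) = int n"
 proof (rule zorder_eqI[of "ball (l + z0) r" _ "%w. g (w - l) / E1 w"])
  have im: "(%w. w - l) ` ball (l + z0) r \<subseteq> cball z0 r" by (auto simp: dist_norm algebra_simps)
  have h: "(g \<circ> (%w. w - l)) holomorphic_on ball (l + z0) r"
   by (rule holomorphic_on_compose_gen[OF _ n(4) im]) (intro holomorphic_intros)
  show "(%w. g (w - l) / E1 w) holomorphic_on ball (l + z0) r"
  proof -
   have "E1 holomorphic_on ball (l + z0) r" unfolding E1_def by (intro holomorphic_intros)
   from holomorphic_on_divide[OF h this] show ?thesis using E1nz by (simp add: o_def)
  qed
  show "g (l + z0 - l) / E1 (l + z0) ~= 0" using n(3) n(5)[of z0] E1nz by simp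
  fix w assume w: "w \<in> ball (l + z0) r"
  have "w - l \<in> cball z0 r" using im w by blast
  from conjunct1[OF n(5)[OF this]] have "DD w = g (w - l) * (w - (l + z0)) ^ n" using DD_shift[of l "w - l"] by (simp add: algebra_simps)
  then show "char_det0 b1 b2 a b c d w = g (w - l) / E1 w * (w - (l + z0)) powi int n" using E1nz by (simp add: DD_char_det0 field_simps)
 qed (use n(3) in auto)
 then show ?thesis using n(2) by simp
qed

text \<open>Turns the separated enumeration into a local statement about far zeros. A multiple zero
  would be listed under several indices, which asymptotic separation forbids just as it forbids two
  close zeros.\<close>

lemma strictly_regular_zeros:
 assumes "strictly_regular_bc b1 b2 a b c d"
 shows "\<exists>dlt>0. \<exists>R. \<forall>l p q. R <= norm l --> norm p < dlt --> norm q < dlt --> DD (l + p) = 0 --> DD (l + q) = 0 -->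
  p = q \<and> zorder (FF (E1 l) (E2 l)) p <= 1"
proof -
 obtain z where z: "enumerates_zeros z (char_det0 b1 b2 a b c d)" "asymptotically_separated z"
  using assms by (auto simp: strictly_regular_bc_def)
 obtain dlt n0 where dlt: "dlt > 0" "!!j k. j ~= k ==> \<bar>j\<bar> >= int n0 ==> \<bar>k\<bar> >= int n0 ==> norm (z j - z k) > 2 * dlt"
  using z(2) unfolding asymptotically_separated_def by blast
 have fin: "finite {j. \<bar>j\<bar> < int n0}" by (rule finite_subset[of _ "{- int n0..int n0}"]) auto
 \<comment> \<open>A zero whose index is below \<open>n0\<close> in absolute value has modulus at
   most the sum, hence distance at least \<open>dlt\<close> from every \<open>l\<close> with
   \<open>norm l >= R\<close>.\<close>
 define R where "R = (\<Sum>j | \<bar>j\<bar> < int n0. norm (z j)) + dlt"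
 have E1nz: "E1 w ~= 0" for w by (simp add: E1_def)
 have big: "\<bar>j\<bar> >= int n0" if "R <= norm l" "norm (z j - l) < dlt" for j l
 proof (rule ccontr)
  assume "\<not> ?thesis"
  then have "norm (z j) <= (\<Sum>j | \<bar>j\<bar> < int n0. norm (z j))" using fin by (intro member_le_sum) auto
  then show False using that norm_triangle_ineq2[of l "z j"] by (simp add: R_def norm_minus_commute)
 qed
 have same: "j = k" if "R <= norm l" "norm (z j - l) < dlt" "norm (z k - l) < dlt" for j k l
 proof (rule ccontr)
  assume "j ~= k"
  from dlt(2)[OF this big[OF that(1,2)] big[OF that(1,3)]] show False using that norm_triangle_ineq4[of "z j - l" "z k - l"] by simp
 qed
 have idx: "\<exists>j. z j = w \<and> int (card {n. z n = w}) = zorder (char_det0 b1 b2 a b c d) w" if "DD w = 0" for w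
 proof -
  have c: "char_det0 b1 b2 a b c d w = 0" using that E1nz by (simp add: DD_char_det0)
  have f: "FF (E1 w) (E2 w) 0 = 0" using that DD_shift[of w 0] by simp
  have "zorder (char_det0 b1 b2 a b c d) w > 0" using zorder_FF[OF f] FF_zorder_pos[OF f] by auto
  moreover have i: "int (card {n. z n = w}) = zorder (char_det0 b1 b2 a b c d) w" using z(1) c by (simp add: enumerates_zeros_def)
  ultimately have "{n. z n = w} ~= {}" by (metis card.empty less_irrefl of_nat_0)
  then show ?thesis using i by blast
 qed
 show ?thesis
 proof (rule exI[of _ dlt], rule conjI[OF dlt(1)], rule exI[of _ R], intro allI impI)
  fix l p q assume l: "R <= norm l" and pq: "norm p < dlt" "norm q < dlt" and D: "DD (l + p) = 0" "DD (l + q) = 0"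
  obtain j where j: "z j = l + p" "int (card {n. z n = l + p}) = zorder (char_det0 b1 b2 a b c d) (l + p)" using idx[OF D(1)] by blast
  obtain k where k: "z k = l + q" using idx[OF D(2)] by blast
  have "j = k" by (rule same[OF l]) (use pq j k in auto)
  then have "p = q" using j(1) k by simp
  moreover have "{n. z n = l + p} \<subseteq> {j}"
  proof
   fix n assume "n \<in> {n. z n = l + p}"
   then have "n = j" by (intro same[OF l]) (use pq j in auto)
   then show "n \<in> {j}" by simp
  qed
  then have "card {n. z n = l + p} <= card {j}" by (intro card_mono) auto
  then have "zorder (FF (E1 l) (E2 l)) p <= 1" using j(2) zorder_FF[of l p] D(1) by (simp add: DD_shift)
  ultimately show "p = q \<and> zorder (FF (E1 l) (E2 l)) p <= 1" by blast
 qed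
qed

text \<open>A limit point of translates of \<open>DD\<close> with a double zero would, by Rouche's theorem, produce two
  zeros of \<open>DD\<close> which are far away and arbitrarily close to each other.\<close>

lemma simple_zeros:
 assumes sr: "strictly_regular_bc b1 b2 a b c d"
 shows "\<exists>kap>0. \<exists>R. \<forall>l. \<bar>Im l\<bar> <= H --> R <= norm l --> norm (DD l) < kap --> kap <= norm (WW (E1 l) (E2 l))"
proof (rule ccontr)
 assume neg: "\<not> ?thesis"
 have "\<exists>l. \<bar>Im l\<bar> <= H \<and> real n <= norm l \<and> norm (DD l) < 1 / real (Suc n) \<and> norm (WW (E1 l) (E2 l)) < 1 / real (Suc n)" for n
 proof -
  have "1 / real (Suc n) > 0" by simp
  then show ?thesis using neg by (meson not_le)
 qed
 then obtain l where l: "!!n. \<bar>Im (l n)\<bar> <= H" "!!n. real n <= norm (l n)" "!!n. norm (DD (l n)) < 1 / real (Suc n)"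
  "!!n. norm (WW (E1 (l n)) (E2 (l n))) < 1 / real (Suc n)" by metis
 obtain r e1 e2 where r: "strict_mono (r :: nat => nat)" "(%n. E1 (l (r n))) \<longlonglongrightarrow> e1" "(%n. E2 (l (r n))) \<longlonglongrightarrow> e2"
  using strip_subsequence[of l, OF l(1)] by blast
 have null: "X \<longlonglongrightarrow> 0" if "!!n. norm (X n :: complex) < 1 / real (Suc (r n))" for X
 proof (rule Lim_null_comparison[OF always_eventually])
  show "\<forall>n. norm (X n) <= 1 / real (Suc n)"
  proof
   fix n
   have "1 / real (Suc (r n)) <= 1 / real (Suc n)" using seq_suble[OF r(1), of n] by (intro frac_le) auto
   then show "norm (X n) <= 1 / real (Suc n)" using that[of n] by linarith
  qed
  show "(%n. 1 / real (Suc n)) \<longlonglongrightarrow> 0" by (rule LIMSEQ_Suc[OF lim_1_over_n])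
 qed
 have "(%n. FF (E1 (l (r n))) (E2 (l (r n))) 0) \<longlonglongrightarrow> FF e1 e2 0" by (rule FF_tendsto[OF r(2,3)]) simp
 moreover have "(%n. FF (E1 (l (r n))) (E2 (l (r n))) 0) \<longlonglongrightarrow> 0" by (rule null) (use l(3) DD_shift[of _ 0] in simp)
 ultimately have f0: "FF e1 e2 0 = 0" by (rule LIMSEQ_unique)
 have "(%n. WW (E1 (l (r n))) (E2 (l (r n)))) \<longlonglongrightarrow> WW e1 e2" unfolding WW_def by (intro tendsto_intros r)
 moreover have "(%n. WW (E1 (l (r n))) (E2 (l (r n)))) \<longlonglongrightarrow> 0" by (rule null) (rule l(4))
 ultimately have w0: "WW e1 e2 = 0" by (rule LIMSEQ_unique)
 obtain dlt R where dlt: "dlt > 0" "!!l p q. R <= norm l ==> norm p < dlt ==> norm q < dlt ==> DD (l + p) = 0 ==> DD (l + q) = 0 ==>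
  p = q \<and> zorder (FF (E1 l) (E2 l)) p <= 1" using strictly_regular_zeros[OF sr] by blast
 obtain rho' where rho': "rho' > 0" "rho' < min dlt 1" "!!z. z \<in> cball 0 rho' - {0} ==> FF e1 e2 z ~= 0"
  using FF_isolated[of "min dlt 1" e1 e2] dlt(1) by (metis min_less_iff_conj zero_less_one)
 define rho where "rho = rho' / 2"
 have rho: "rho > 0" "rho < rho'" "rho < dlt" "rho <= 1" using rho' by (auto simp: rho_def)
 define M where "M = exp (gam * 1)"
 \<comment> \<open>A majorant, uniform on the unit disc, of the difference between the translate and
   its limit. Once it is below the minimum \<open>m\<close> of the limit on the circle, Rouche's
   theorem applies.\<close>
 define u where "u n = norm (a * (E2 (l (r n)) - e2)) * M + norm (d * (E1 (l (r n)) - e1)) * M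
  + norm (E1 (l (r n)) * E2 (l (r n)) - e1 * e2) * (M * M)" for n
 have "u \<longlonglongrightarrow> norm (a * (e2 - e2)) * M + norm (d * (e1 - e1)) * M + norm (e1 * e2 - e1 * e2) * (M * M)"
  unfolding u_def by (intro tendsto_intros r)
 then have u0: "u \<longlonglongrightarrow> 0" by simp
 have ub: "norm (FF (E1 (l (r n))) (E2 (l (r n))) z - FF e1 e2 z) <= u n" if z: "norm z <= 1" for n z
 proof -
  have "- 1 <= Im z" using abs_Im_le_cmod[of z] z by linarith
  note E = E_le[OF this zero_le_one, folded M_def]
  have EE: "norm (E1 z * E2 z) <= M * M" unfolding norm_mult by (intro mult_mono E) (simp_all add: M_def)
  have "FF (E1 (l (r n))) (E2 (l (r n))) z - FF e1 e2 z = a * (E2 (l (r n)) - e2) * E2 z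
    + d * (E1 (l (r n)) - e1) * E1 z + (E1 (l (r n)) * E2 (l (r n)) - e1 * e2) * (E1 z * E2 z)"
   by (simp add: FF_def algebra_simps)
  also have "norm \<dots> <= norm (a * (E2 (l (r n)) - e2) * E2 z) + norm (d * (E1 (l (r n)) - e1) * E1 z)
    + norm ((E1 (l (r n)) * E2 (l (r n)) - e1 * e2) * (E1 z * E2 z))"
   by (intro norm_triangle_le add_right_mono norm_triangle_ineq)
  also have "\<dots> <= u n" unfolding u_def unfolding norm_mult[of "a * (E2 (l (r n)) - e2)"] norm_mult[of "d * (E1 (l (r n)) - e1)"]
    norm_mult[of "E1 (l (r n)) * E2 (l (r n)) - e1 * e2"]
   by (intro add_mono mult_left_mono E EE norm_ge_zero)
  finally show ?thesis .
 qed
 obtain m where m: "m > 0" "!!z. z \<in> sphere 0 rho ==> m <= norm (FF e1 e2 z)"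
 proof -
  have "sphere (0::complex) rho ~= {}" using rho(1) by (simp add: sphere_eq_empty)
  moreover have "continuous_on (sphere 0 rho) (%z. norm (FF e1 e2 z))"
   by (intro continuous_on_norm holomorphic_on_imp_continuous_on FF_holomorphic)
  ultimately obtain z0 where z0: "z0 \<in> sphere 0 rho" "\<forall>z\<in>sphere 0 rho. norm (FF e1 e2 z0) <= norm (FF e1 e2 z)"
   using continuous_attains_inf[OF compact_sphere] by blast
  have "z0 \<in> cball 0 rho' - {0}" using z0(1) rho by auto
  then have "norm (FF e1 e2 z0) > 0" using rho'(3) by simp
  then show ?thesis using that z0(2) by blast
 qed
 have "eventually (%n. u n < m \<and> R <= norm (l (r n))) sequentially"
 proof (rule eventually_conj)
  show "eventually (%n. u n < m) sequentially" using order_tendstoD(2)[OF u0 m(1)] .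
  show "eventually (%n. R <= norm (l (r n))) sequentially" using eventually_ge_at_top[of "nat \<lceil>R\<rceil>"]
  proof eventually_elim
   case (elim n)
   have "R <= real n" using elim by linarith
   also have "\<dots> <= real (r n)" using seq_suble[OF r(1), of n] by simp
   also have "\<dots> <= norm (l (r n))" by (rule l(2))
   finally show ?case .
  qed
 qed
 then obtain n where n: "u n < m" "R <= norm (l (r n))" by (auto dest: eventually_happens)
 define L where "L = l (r n)"
 define f where "f = FF e1 e2" define fn where "fn = FF (E1 L) (E2 L)"
 define g where "g z = fn z - f z" for z
 let ?s = "ball (0::complex) rho'" let ?gam = "circlepath (0::complex) rho"
 have fg': "f z + g z = fn z" for z by (simp add: g_def)
 have fg: "(%z. f z + g z) = fn" by (auto simp: g_def)
 have finfn: "finite {p \<in> ?s. fn p = 0}" by (rule finite_subset[OF _ FF_finite_zeros[of rho' "E1 L" "E2 L"]]) (auto simp: fn_def)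
 have "x = 0" if "x \<in> ?s" "f x = 0" for x by (rule ccontr) (use that rho'(3)[of x] in \<open>auto simp: f_def\<close>)
 then have zf: "{p \<in> ?s. f p = 0} = {0}" using rho'(1) f0 by (auto simp: f_def)
 have wn0: "winding_number ?gam z = 0" if "z \<notin> cball 0 rho" for z
  by (rule winding_number_zero_outside[OF path_circlepath convex_cball _ that]) (use rho(1) in auto)
 have "(\<Sum>p\<in>{p \<in> ?s. (%z. f z + g z) p = 0}. winding_number ?gam p * zorder (%z. f z + g z) p) =
   (\<Sum>p\<in>{p \<in> ?s. f p = 0}. winding_number ?gam p * zorder f p)"
 proof (rule Rouche_theorem)
  show "f holomorphic_on ?s" by (simp add: f_def FF_holomorphic)
  show "g holomorphic_on ?s" unfolding g_def f_def fn_def by (intro holomorphic_on_diff FF_holomorphic)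
  show "finite {p \<in> ?s. f p + g p = 0}" using finfn by (simp add: g_def)
  show "finite {p \<in> ?s. f p = 0}" unfolding zf by simp
  show "path_image ?gam \<subseteq> ?s" using rho(1,2) by auto
  show "\<forall>z\<in>path_image ?gam. norm (g z) < norm (f z)"
  proof
   fix z assume "z \<in> path_image ?gam"
   then have z: "z \<in> sphere 0 rho" using rho(1) by simp
   have "norm (g z) <= u n" unfolding g_def fn_def f_def L_def by (rule ub) (use z rho in simp)
   also have "\<dots> < m" by (rule n(1))
   also have "\<dots> <= norm (f z)" unfolding f_def by (rule m(2)[OF z])
   finally show "norm (g z) < norm (f z)" .
  qed
  show "\<forall>z. z \<notin> ?s --> winding_number ?gam z = 0" using wn0 rho(2) by auto
 qed auto
 also have "\<dots> = of_int (zorder f 0)" unfolding zf using rho(1) by (simp add: winding_number_circlepath_centre)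
 finally have "(\<Sum>p\<in>{p \<in> ?s. fn p = 0}. winding_number ?gam p * zorder fn p) = of_int (zorder f 0)" unfolding fg fg' .
 also have "(\<Sum>p\<in>{p \<in> ?s. fn p = 0}. winding_number ?gam p * zorder fn p) = (\<Sum>p\<in>{p \<in> ball 0 rho. fn p = 0}. of_int (zorder fn p))"
 proof (rule sum.mono_neutral_cong_right[OF finfn])
  show "{p \<in> ball 0 rho. fn p = 0} \<subseteq> {p \<in> ?s. fn p = 0}" using rho(2) by auto
  show "\<forall>p\<in>{p \<in> ?s. fn p = 0} - {p \<in> ball 0 rho. fn p = 0}. winding_number ?gam p * zorder fn p = 0"
  proof
   fix p assume p: "p \<in> {p \<in> ?s. fn p = 0} - {p \<in> ball 0 rho. fn p = 0}"
   have "norm p ~= rho"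
   proof
    assume "norm p = rho"
    then have p1: "norm p <= 1" "m <= norm (f p)" using rho m(2)[of p] by (auto simp: f_def)
    have "norm (g p) <= u n" unfolding g_def fn_def f_def L_def by (rule ub[OF p1(1)])
    then show False using p p1(2) n(1) by (simp add: g_def)
   qed
   then have "winding_number ?gam p = 0" using p by (intro wn0) auto
   then show "winding_number ?gam p * zorder fn p = 0" by simp
  qed
  fix p assume "p \<in> {p \<in> ball 0 rho. fn p = 0}"
  then have "winding_number ?gam p = 1" by (intro winding_number_circlepath) auto
  then show "winding_number ?gam p * zorder fn p = of_int (zorder fn p)" by simp
 qed
 also have "\<dots> = of_int (\<Sum>p\<in>{p \<in> ball 0 rho. fn p = 0}. zorder fn p)" by simp
 finally have eq: "(\<Sum>p\<in>{p \<in> ball 0 rho. fn p = 0}. zorder fn p) = zorder f 0" by (simp only: of_int_eq_iff)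
 have sm: "p = q \<and> zorder fn p <= 1" if "p \<in> ball 0 rho" "q \<in> ball 0 rho" "fn p = 0" "fn q = 0" for p q
  using dlt(2)[of L p q] that rho(3) n(2) by (auto simp: fn_def DD_shift L_def)
 have "(\<Sum>p\<in>{p \<in> ball 0 rho. fn p = 0}. zorder fn p) <= 1"
 proof (cases "{p \<in> ball 0 rho. fn p = 0} = {}")
  case False
  then obtain q where q: "q \<in> ball 0 rho" "fn q = 0" by blast
  have "{p \<in> ball 0 rho. fn p = 0} = {q}" using sm[OF _ q(1) _ q(2)] q by blast
  then show ?thesis using sm[OF q(1,1,2,2)] by simp
 next
  case True
  show ?thesis unfolding True by simp
 qed
 then show False using eq FF_double_zero[OF f0 w0] unfolding f_def by linarith
qed

end

section \<open>Lower bounds for the pairing with eigenfunctions of the transposed problem\<close>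

text \<open>\<open>(s, t)\<close> and \<open>(s', t')\<close> are approximate null vectors of the
  boundary matrices of the problem and of its transpose, with defects \<open>u1\<close>,
  \<open>u2\<close> and \<open>v1\<close>, \<open>v2\<close>. \<open>Z\<close> is the leading part
  of the pairing and \<open>W\<close> the derivative of the determinant. Each of the products
  \<open>s t'\<close>, \<open>t s'\<close>, \<open>s s'\<close>, \<open>t t'\<close>, multiplied by
  \<open>W\<close>, is a combination of \<open>Z\<close> and the defects. For nonzero exact null
  vectors \<open>W ~= 0\<close> therefore forces \<open>Z ~= 0\<close>.\<close>

lemma pairing_algebra:
 fixes s t s' t' e1 e2 A D b c :: complex and b1 b2 G Q M x y :: real
 assumes u: "norm (b * s + A * t) <= x" "norm (D * s + c * t) <= x"
  and v: "norm (- b * b2 * s' + b1 * D * t') <= y" "norm (b2 * A * s' - c * b1 * t') <= y"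
  and Q: "norm A <= Q" "norm D <= Q" "norm b <= Q" "norm c <= Q"
  and M: "norm e1 <= M" "norm e2 <= M" and G: "\<bar>b1\<bar> <= G" "\<bar>b2\<bar> <= G"
 shows "norm (b2 * e2 * A - b1 * e1 * D) * ((norm s + norm t) * (norm s' + norm t')) \<le>
  4 * G * Q * norm (s' * t * e1 + t' * s * e2) + 3 * M * ((norm s + norm t) * y) + 3 * M * G * (x * (norm s' + norm t'))"
proof -
 define Z where "Z = s' * t * e1 + t' * s * e2"
 define W where "W = b2 * e2 * A - b1 * e1 * D"
 define u1 where "u1 = b * s + A * t" define u2 where "u2 = D * s + c * t"
 define v1 where "v1 = - b * b2 * s' + b1 * D * t'" define v2 where "v2 = b2 * A * s' - c * b1 * t'"
 have nn: "x >= 0" "y >= 0" "Q >= 0" "M >= 0" "G >= 0" using u(1) v(1) Q(1) M(1) G(1) norm_ge_zero abs_ge_zero order_trans by blast+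
 have h: "norm (of_real k * X * Z + e * (r1 * v) + f * (of_real k' * r2 * w)) <= G * Q * norm Z + M * (norm r1 * y) + M * (G * norm r2 * x)"
  if "\<bar>k\<bar> <= G" "norm X <= Q" "norm e <= M" "norm f <= M" "norm v <= y" "\<bar>k'\<bar> <= G" "norm w <= x"
  for k k' :: real and X e f v w r1 r2 :: complex
 proof -
  have "norm (of_real k * X * Z + e * (r1 * v) + f * (of_real k' * r2 * w)) <= \<bar>k\<bar> * norm X * norm Z + norm e * (norm r1 * norm v) + norm f * (\<bar>k'\<bar> * norm r2 * norm w)"
   by (intro norm_triangle_le add_mono) (simp_all add: norm_mult)
  also have "\<dots> <= G * Q * norm Z + M * (norm r1 * y) + M * (G * norm r2 * x)"
   by (intro add_mono mult_mono mult_nonneg_nonneg order_refl norm_ge_zero abs_ge_zero that nn)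
  finally show ?thesis .
 qed
 have "W * (s * t') = of_real b2 * A * Z + (- e1) * (s * v1) + (- e1) * (of_real b2 * s' * u1)"
  unfolding W_def Z_def v1_def u1_def by algebra
 then have 1: "norm (W * (s * t')) <= G * Q * norm Z + M * (norm s * y) + M * (G * norm s' * x)"
  using h[of b2 A "- e1" "- e1" v1 b2 u1 s s'] G Q M v(1) u(1) by (simp add: v1_def u1_def)
 have "W * (t * s') = of_real (- b1) * D * Z + e2 * (s * v1) + e2 * (of_real b2 * s' * u1)"
  unfolding W_def Z_def v1_def u1_def of_real_minus by algebra
 then have 2: "norm (W * (t * s')) <= G * Q * norm Z + M * (norm s * y) + M * (G * norm s' * x)"
  using h[of "- b1" D e2 e2 v1 b2 u1 s s'] G Q M v(1) u(1) by (simp add: v1_def u1_def)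
 have "W * (s * s') = of_real b1 * c * Z + e2 * (s * v2) + e1 * (of_real (- b1) * s' * u2)"
  unfolding W_def Z_def v2_def u2_def of_real_minus by algebra
 then have 3: "norm (W * (s * s')) <= G * Q * norm Z + M * (norm s * y) + M * (G * norm s' * x)"
  using h[of b1 c e2 e1 v2 "- b1" u2 s s'] G Q M v(2) u(2) by (simp add: v2_def u2_def)
 have "W * (t * t') = of_real (- b2) * b * Z + (- e1) * (t * v1) + e2 * (of_real b2 * t' * u1)"
  unfolding W_def Z_def v1_def u1_def of_real_minus by algebra
 then have 4: "norm (W * (t * t')) <= G * Q * norm Z + M * (norm t * y) + M * (G * norm t' * x)"
  using h[of "- b2" b "- e1" e2 v1 b2 u1 t t'] G Q M v(1) u(1) by (simp add: v1_def u1_def)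
 have "norm W * ((norm s + norm t) * (norm s' + norm t')) = norm (W * (s * t')) + norm (W * (t * s')) + norm (W * (s * s')) + norm (W * (t * t'))"
  by (simp add: norm_mult algebra_simps)
 also have "\<dots> <= 4 * G * Q * norm Z + M * y * (3 * norm s + norm t) + M * G * x * (3 * norm s' + norm t')"
  using 1 2 3 4 by (simp add: algebra_simps)
 also have "\<dots> <= 4 * G * Q * norm Z + M * y * (3 * (norm s + norm t)) + M * G * x * (3 * (norm s' + norm t'))"
  by (intro add_mono mult_left_mono mult_nonneg_nonneg nn) auto
 finally show ?thesis unfolding Z_def W_def by (simp add: algebra_simps)
qed

context bvp begin

abbreviation "solT \<equiv> solves (- b2) (- b1) p q"
abbreviation "bcT \<equiv> boundary_conds d (- b * b2 / b1) (- c * b1 / b2) a"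

lemma bvp_transpose: "bvp (- b2) (- b1) p q d (- b * b2 / b1) (- c * b1 / b2) a"
 by unfold_locales (use b1 b2 p q reg in \<open>auto simp: field_simps\<close>)

lemma eigen_asymptotics:
 assumes "H >= 0" "ep > 0"
 shows "\<exists>R>0. \<forall>l y x. - H <= Im l --> R <= norm l --> sol l (%x. 0) y --> x \<in> {0..1} -->
   norm (y x $ 1 - y 1 $ 1 * exp (- \<i> * b1 * l * of_real (1 - x))) <= ep * sig y \<and> norm (y x $ 2 - y 0 $ 2 * exp (\<i> * b2 * l * of_real x)) <= ep * sig y"
proof -
 have z: "nrm1 (%x. 0) = 0" by (simp add: nrm1_def)
 obtain C where C: "!!ep. ep > 0 ==> \<exists>R>0. \<forall>l g y x. - H <= Im l --> R <= norm l --> aiv g --> sol l g y --> x \<in> {0..1} -->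
   norm (y x $ 1 - y 1 $ 1 * exp (- \<i> * b1 * l * of_real (1 - x))) + norm (y x $ 2 - y 0 $ 2 * exp (\<i> * b2 * l * of_real x))
   <= ep * (norm (y 0 $ 2) + norm (y 1 $ 1)) + C * nrm1 g"
  using asymptotics[OF assms(1)] by blast
 obtain R where R: "R > 0" "!!l g y x. - H <= Im l ==> R <= norm l ==> aiv g ==> sol l g y ==> x \<in> {0..1} ==>
   norm (y x $ 1 - y 1 $ 1 * exp (- \<i> * b1 * l * of_real (1 - x))) + norm (y x $ 2 - y 0 $ 2 * exp (\<i> * b2 * l * of_real x))
   <= ep * (norm (y 0 $ 2) + norm (y 1 $ 1)) + C * nrm1 g" using C[OF assms(2)] by blast
 show ?thesis
 proof (rule exI[of _ R], rule conjI[OF R(1)], intro allI impI)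
  fix l y x assume "- H <= Im l" "R <= norm l" "sol l (%x. 0) y" "x \<in> {0..1::real}"
  from R(2)[OF this(1,2) aiv_zero this(3,4)]
  show "norm (y x $ 1 - y 1 $ 1 * exp (- \<i> * b1 * l * of_real (1 - x))) <= ep * sig y \<and> norm (y x $ 2 - y 0 $ 2 * exp (\<i> * b2 * l * of_real x)) <= ep * sig y"
   unfolding z sig_def mult_zero_right add_0_right
   using norm_ge_zero[of "y x $ 1 - y 1 $ 1 * exp (- \<i> * b1 * l * of_real (1 - x))"] norm_ge_zero[of "y x $ 2 - y 0 $ 2 * exp (\<i> * b2 * l * of_real x)"]
   by linarith
 qed
qed

text \<open>The pairing multiplies an exponential at \<open>l\<close> by one at \<open>l'\<close>
  that runs in the opposite direction. For \<open>l = l'\<close> the product does not depend on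
  \<open>x\<close>; for nearby parameters in a strip it is almost constant.\<close>

lemma exp_near: assumes "H >= 0" "ep > 0"
 shows "\<exists>th>0. \<forall>l l' x bet. \<bar>Im l\<bar> <= H --> norm (l - l') <= th --> 0 <= x --> x <= 1 --> \<bar>bet\<bar> <= gam -->
  norm (exp (\<i> * of_real bet * (l' * of_real x + l * of_real (1 - x))) - exp (\<i> * of_real bet * l)) <= exp (gam * H) * ep"
proof -
 have "isCont (%z::complex. exp z) 0" by simp
 then obtain tau where tau: "tau > 0" "!!z::complex. norm z < tau ==> norm (exp z - 1) < ep"
  using assms(2) unfolding continuous_at_eps_delta by (auto simp: dist_norm)
 have gam0: "gam > 0" using b1 b2 by (simp add: gam_def)
 define th where "th = tau / (2 * gam)"
 have th: "th > 0" "gam * th < tau" using tau(1) gam0 by (simp_all add: th_def)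
 show ?thesis
 proof (rule exI[of _ th], rule conjI[OF th(1)], intro allI impI)
  fix l l' :: complex and x bet :: real
  assume l: "\<bar>Im l\<bar> <= H" "norm (l - l') <= th" and x: "0 <= x" "x <= 1" and bet: "\<bar>bet\<bar> <= gam"
  let ?z = "\<i> * of_real bet * (l' - l) * of_real x"
  have "norm ?z = \<bar>bet\<bar> * norm (l - l') * x" using x by (simp add: norm_mult norm_minus_commute)
  also have "\<dots> <= gam * th * 1" using l x bet th gam0 by (intro mult_mono) auto
  finally have "norm ?z < tau" using th by simp
  then have z: "norm (exp ?z - 1) <= ep" using tau(2) less_imp_le by blast
  have "\<bar>bet\<bar> * \<bar>Im l\<bar> <= gam * H" using l bet gam0 by (intro mult_mono) auto
  then have "norm (exp (\<i> * of_real bet * l)) <= exp (gam * H)" by (simp add: abs_mult[symmetric])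
  with z have "norm (exp (\<i> * of_real bet * l) * (exp ?z - 1)) <= exp (gam * H) * ep" unfolding norm_mult by (intro mult_mono) auto
  moreover have "exp (\<i> * of_real bet * l) * (exp ?z - 1) = exp (\<i> * of_real bet * (l' * of_real x + l * of_real (1 - x))) - exp (\<i> * of_real bet * l)"
   by (simp add: right_diff_distrib exp_add[symmetric]) (simp add: algebra_simps)
  ultimately show "norm (exp (\<i> * of_real bet * (l' * of_real x + l * of_real (1 - x))) - exp (\<i> * of_real bet * l)) <= exp (gam * H) * ep" by simp
 qed
qed

text \<open>Products of leading terms are almost constant in \<open>x\<close>, so the pairing is
  close to \<open>Z\<close>. At an eigenvalue \<open>DD l\<close> is small, hence
  \<open>simple_zeros\<close> bounds the derivative from below, and \<open>pairing_algebra\<close>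
  turns this into a lower bound for \<open>Z\<close>. Allowing \<open>l'\<close> to differ from
  \<open>l\<close> is what later separates the eigenvalues.\<close>

lemma pairing:
 assumes sr: "strictly_regular_bc b1 b2 a b c d" and H: "H >= 0"
 shows "\<exists>eta>0. \<exists>th>0. \<exists>R. \<forall>l l' u w. \<bar>Im l\<bar> <= H --> \<bar>Im l'\<bar> <= H --> R <= norm l --> R <= norm l' --> norm (l - l') <= th -->
  sol l (%x. 0) u --> bc u --> solT l' (%x. 0) w --> bcT w --> eta * (sig u * sig w) <= norm (pair u w)"
proof -
 interpret T: bvp "- b2" "- b1" p q d "- b * b2 / b1" "- c * b1 / b2" a by (rule bvp_transpose)
 have gamT: "T.gam = gam" by (simp add: gam_def T.gam_def)
 have gam0: "gam > 0" and bgam: "\<bar>b1\<bar> <= gam" "\<bar>b2\<bar> <= gam" using b1 b2 by (simp_all add: gam_def)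
 obtain kap R1 where kap: "kap > 0" "!!l. \<bar>Im l\<bar> <= H ==> R1 <= norm l ==> norm (DD l) < kap ==> kap <= norm (WW (E1 l) (E2 l))"
  using simple_zeros[OF sr] by blast
 define M where "M = exp (gam * H)"
 define Q where "Q = norm a + norm b + norm c + norm d + M"
 have M: "M >= 1" using H gam0 by (simp add: M_def)
 have Q: "norm a + M <= Q" "norm d + M <= Q" "norm b <= Q" "norm c <= Q" "Q >= 1"
  unfolding Q_def using M norm_ge_zero[of a] norm_ge_zero[of b] norm_ge_zero[of c] norm_ge_zero[of d] by linarith+
 \<comment> \<open>The first quotient lets the defects cost at most \<open>kap / 2\<close>; the
   second lets the error \<open>8 * M * ep\<close> of the leading term, multiplied by
   \<open>4 * gam * Q\<close>, cost at most \<open>kap / 4\<close>. The remaining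
   \<open>kap / 4\<close> determines \<open>eta\<close>.\<close>
 define ep where "ep = min 1 (min (kap / (32 * gam * M * M)) (kap / (128 * gam * Q * M)))"
 have ep: "ep > 0" "ep <= 1" using kap(1) gam0 M Q by (simp_all add: ep_def)
 have "ep <= kap / (32 * gam * M * M)" "ep <= kap / (128 * gam * Q * M)" by (simp_all add: ep_def)
 then have ep2: "16 * gam * M * M * ep <= kap / 2" "128 * gam * Q * M * ep <= kap"
  using gam0 M Q by (simp_all add: pos_le_divide_eq algebra_simps)
 obtain th where th: "th > 0" "!!l l' x bet. \<bar>Im l\<bar> <= H ==> norm (l - l') <= th ==> 0 <= x ==> x <= 1 ==> \<bar>bet\<bar> <= gam ==>
  norm (exp (\<i> * of_real bet * (l' * of_real x + l * of_real (1 - x))) - exp (\<i> * of_real bet * l)) <= M * ep"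
  using exp_near[OF H ep(1)] unfolding M_def by blast
 obtain R2 where R2: "!!l y x. - H <= Im l ==> R2 <= norm l ==> sol l (%x. 0) y ==> x \<in> {0..1} ==>
   norm (y x $ 1 - y 1 $ 1 * exp (- \<i> * b1 * l * of_real (1 - x))) <= ep * sig y \<and> norm (y x $ 2 - y 0 $ 2 * exp (\<i> * b2 * l * of_real x)) <= ep * sig y"
  using eigen_asymptotics[OF H ep(1)] by blast
 obtain R3 where R3: "!!l y x. - H <= Im l ==> R3 <= norm l ==> solT l (%x. 0) y ==> x \<in> {0..1} ==>
   norm (y x $ 1 - y 1 $ 1 * exp (- \<i> * of_real (- b2) * l * of_real (1 - x))) <= ep * sig y \<and> norm (y x $ 2 - y 0 $ 2 * exp (\<i> * of_real (- b1) * l * of_real x)) <= ep * sig y"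
  using T.eigen_asymptotics[OF H ep(1)] by blast
 obtain K where K: "!!ep. ep > 0 ==> \<exists>R>0. \<forall>l g y. - H <= Im l --> R <= norm l --> aiv g --> sol l g y --> bc y -->
  norm (DD l) * sig y <= ep * sig y + K * nrm1 g \<and> (\<forall>x\<in>{0..1}. n1 (y x) <= K * (sig y + nrm1 g))"
  using boundary_asymptotics[OF H] by blast
 obtain R4 where R4: "!!l g y. - H <= Im l ==> R4 <= norm l ==> aiv g ==> sol l g y ==> bc y ==>
  norm (DD l) * sig y <= kap / 2 * sig y + K * nrm1 g"
  using K[OF half_gt_zero[OF kap(1)]] by blast
 define R where "R = max (max R1 R2) (max R3 R4)"
 define eta where "eta = kap / (16 * gam * Q)"
 have eta: "eta > 0" using kap(1) gam0 Q by (simp add: eta_def)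
 show ?thesis
 proof (rule exI[of _ eta], rule conjI[OF eta], rule exI[of _ th], rule conjI[OF th(1)], rule exI[of _ R], intro allI impI)
  fix l l' u w
  assume l: "\<bar>Im l\<bar> <= H" "\<bar>Im l'\<bar> <= H" "R <= norm l" "R <= norm l'" "norm (l - l') <= th"
   and u: "sol l (%x. 0) u" "bc u" and w: "solT l' (%x. 0) w" "bcT w"
  have lR: "R1 <= norm l" "R2 <= norm l" "R4 <= norm l" "R3 <= norm l'" "- H <= Im l" "- H <= Im l'" using l by (auto simp: R_def)
  have E12: "norm (E1 l) <= M" "norm (E2 l) <= M" using E_le[OF lR(5) H] by (simp_all add: M_def)
  define s where "s = u 0 $ 2" define t where "t = u 1 $ 1"
  define s' where "s' = w 0 $ 2" define t' where "t' = w 1 $ 1"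
  define S where "S = sig u" define S' where "S' = sig w"
  have S: "S = norm s + norm t" "S' = norm s' + norm t'" "S >= 0" "S' >= 0" "norm s <= S" "norm t <= S" "norm s' <= S'" "norm t' <= S'"
   by (simp_all add: S_def S'_def sig_def s_def t_def s'_def t'_def)
  define ex1 where "ex1 x = exp (- \<i> * b1 * l * of_real (1 - x))" for x :: real
  define ex2 where "ex2 x = exp (\<i> * b2 * l * of_real x)" for x :: real
  define fx1 where "fx1 x = exp (- \<i> * of_real (- b2) * l' * of_real (1 - x))" for x :: real
  define fx2 where "fx2 x = exp (\<i> * of_real (- b1) * l' * of_real x)" for x :: real
  have au: "norm (u x $ 1 - t * ex1 x) <= ep * S" "norm (u x $ 2 - s * ex2 x) <= ep * S" if "x \<in> {0..1}" for x
   using R2[OF lR(5,2) u(1) that] by (simp_all add: S_def s_def t_def ex1_def ex2_def)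
  have aw: "norm (w x $ 1 - t' * fx1 x) <= ep * S'" "norm (w x $ 2 - s' * fx2 x) <= ep * S'" if "x \<in> {0..1}" for x
   using R3[OF lR(6,4) w(1) that] by (simp_all add: S'_def s'_def t'_def fx1_def fx2_def)
  have ee: "norm (fx2 x * ex1 x - E1 l) <= M * ep" "norm (fx1 x * ex2 x - E2 l) <= M * ep" if "x \<in> {0..1}" for x
  proof -
   have "norm (exp (\<i> * of_real (- b1) * (l' * of_real x + l * of_real (1 - x))) - exp (\<i> * of_real (- b1) * l)) <= M * ep"
    by (rule th(2)) (use l that bgam in auto)
   moreover have "fx2 x * ex1 x = exp (\<i> * of_real (- b1) * (l' * of_real x + l * of_real (1 - x)))"
    unfolding fx2_def ex1_def exp_add[symmetric] by (simp add: algebra_simps)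
   ultimately show "norm (fx2 x * ex1 x - E1 l) <= M * ep" by (simp add: E1_def)
   have "norm (exp (\<i> * of_real b2 * (l' * of_real (1 - x) + l * of_real (1 - (1 - x)))) - exp (\<i> * of_real b2 * l)) <= M * ep"
    by (rule th(2)) (use l that bgam in auto)
   moreover have "fx1 x * ex2 x = exp (\<i> * of_real b2 * (l' * of_real (1 - x) + l * of_real (1 - (1 - x))))"
    unfolding fx1_def ex2_def exp_add[symmetric] by (simp add: algebra_simps)
   ultimately show "norm (fx1 x * ex2 x - E2 l) <= M * ep" by (simp add: E2_def)
  qed
  have bex: "norm (ex1 x) <= M" "norm (ex2 x) <= M" "norm (fx1 x) <= M" "norm (fx2 x) <= M" if "x \<in> {0..1}" for x
  proof -
   have *: "norm (exp (\<i> * k * of_real bet)) <= M" if "- H <= Im k" "0 <= bet" "bet <= gam" for k bet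
    using norm_exp_bound[OF that(1) H zero_le_one order_refl that(2,3)] by (simp add: M_def)
   have x: "0 <= x" "x <= 1" using that by auto
   have cc: "0 <= bet * v" "bet * v <= gam" if "0 <= bet" "bet <= gam" "0 <= v" "v <= 1" for bet v :: real
    using that order_trans[OF mult_left_le[of v bet]] by auto
   have c: "0 <= \<bar>b1\<bar> * (1 - x)" "\<bar>b1\<bar> * (1 - x) <= gam" "0 <= b2 * x" "b2 * x <= gam" "0 <= b2 * (1 - x)" "b2 * (1 - x) <= gam" "0 <= \<bar>b1\<bar> * x" "\<bar>b1\<bar> * x <= gam"
    using cc[of "\<bar>b1\<bar>"] cc[of b2] bgam x less_imp_le[OF b2] by simp_all
   show "norm (ex1 x) <= M" "norm (ex2 x) <= M" "norm (fx1 x) <= M" "norm (fx2 x) <= M"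
    using *[OF lR(5) c(1,2)] *[OF lR(5) c(3,4)] *[OF lR(6) c(5,6)] *[OF lR(6) c(7,8)] b1
    by (simp_all add: ex1_def ex2_def fx1_def fx2_def algebra_simps)
  qed
  have prd: "norm (U * W - r * r' * e) <= 4 * M * ep * (S * S')"
   if U: "norm (U - r * x1) <= ep * S" and W: "norm (W - r' * x2) <= ep * S'" and r: "norm r <= S" "norm r' <= S'"
    and x: "norm x1 <= M" "norm x2 <= M" "norm (x2 * x1 - e) <= M * ep" for U W r r' x1 x2 e :: complex
  proof -
   have "U * W - r * r' * e = U * (W - r' * x2) + (r' * x2) * (U - r * x1) + r * r' * (x2 * x1 - e)" by (simp add: algebra_simps)
   then have "norm (U * W - r * r' * e) <= norm U * norm (W - r' * x2) + norm r' * norm x2 * norm (U - r * x1) + norm r * norm r' * norm (x2 * x1 - e)"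
    by (simp only:) (intro norm_triangle_le add_mono, simp_all add: norm_mult)
   also have "\<dots> <= (2 * M * S) * (ep * S') + S' * M * (ep * S) + S * S' * (M * ep)"
   proof (intro add_mono mult_mono)
    have "norm U <= norm (r * x1) + norm (U - r * x1)" by (rule norm_triangle_sub)
    also have "\<dots> <= S * M + ep * S" unfolding norm_mult using U r x S M by (intro add_mono mult_mono) auto
    also have "\<dots> <= S * M + M * S" using ep(2) M S by (intro add_left_mono mult_right_mono) auto
    finally show "norm U <= 2 * M * S" by (simp add: algebra_simps)
   qed (use U W r x S M ep in auto)
   finally show ?thesis by (simp add: algebra_simps)
  qed
  have cu: "continuous_on {0..1} (%x. u x $ i)" and cw: "continuous_on {0..1} (%x. w x $ i)" for i
   using sol_cont[OF u(1)] T.sol_cont[OF w(1)] by blast+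
  have int: "norm (integral {0..1} F - k) <= B" if c: "continuous_on {0..1} F" and B: "!!x. x \<in> {0..1} ==> norm (F x - k) <= B" for F :: "real => complex" and k B
  proof -
   have "norm (integral {0..1} (%x. F x - k)) <= B * (1 - 0)"
    by (rule integral_bound) (use c B in \<open>auto intro!: continuous_intros\<close>)
   moreover have "integral {0..1} (%x. F x - k) = integral {0..1} F - k"
    using c by (subst Henstock_Kurzweil_Integration.integral_diff) (auto intro!: integrable_continuous_real continuous_intros)
   ultimately show ?thesis by simp
  qed
  define Z where "Z = s' * t * E1 l + t' * s * E2 l"
  have "norm (integral {0..1} (%x. w x $ 2 * u x $ 1) - t * s' * E1 l) <= 4 * M * ep * (S * S')"
   using prd[OF au(1) aw(2) S(6,7) bex(1,4) ee(1)] by (intro int continuous_on_mult cu cw) (simp add: mult.commute[of "w _ $ 2"])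
  moreover have "norm (integral {0..1} (%x. w x $ 1 * u x $ 2) - s * t' * E2 l) <= 4 * M * ep * (S * S')"
   using prd[OF au(2) aw(1) S(5,8) bex(2,3) ee(2)] by (intro int continuous_on_mult cu cw) (simp add: mult.commute[of "w _ $ 1"])
  ultimately have pz: "norm (pair u w - Z) <= 8 * M * ep * (S * S')"
   unfolding pair_def Z_def using norm_triangle_mono by (fastforce simp: algebra_simps)
  show "eta * (sig u * sig w) <= norm (pair u w)"
  proof (cases "S = 0")
   case True
   then show ?thesis by (simp add: S_def)
  next
   case False
   then have Spos: "S > 0" using S(3) by linarith
   \<comment> \<open>For a nonzero eigenfunction one may divide by \<open>S\<close>, so
     \<open>DD l\<close> is below the threshold \<open>kap\<close> at which the zeros are known to
     be simple.\<close>
   have "norm (DD l) * S <= kap / 2 * S" using R4[OF lR(5,3) aiv_zero u] by (simp add: S_def nrm1_def)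
   then have "norm (DD l) <= kap / 2" using Spos by simp
   then have kapW: "kap <= norm (WW (E1 l) (E2 l))" using kap l(1) lR(1) by simp
   have bu: "u 0 $ 1 + b * s + a * t = 0" "d * s + c * t + u 1 $ 2 = 0" using u(2) by (simp_all add: boundary_conds_def s_def t_def)
   have bw: "w 0 $ 1 + (- b * b2 / b1) * s' + d * t' = 0" "a * s' + (- c * b1 / b2) * t' + w 1 $ 2 = 0" using w(2) by (simp_all add: boundary_conds_def s'_def t'_def)
   have nz: "of_real b1 ~= (0::complex)" "of_real b2 ~= (0::complex)" using b1 b2 by auto
   have e01: "ex1 0 = E1 l" "ex2 1 = E2 l" by (simp_all add: ex1_def ex2_def E1_def E2_def)
   have f01: "norm (fx1 0 - E2 l) <= M * ep" "norm (fx2 1 - E1 l) <= M * ep" using ee(2)[of 0] ee(1)[of 1] by (simp_all add: ex1_def ex2_def)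
   have "b * s + (a + E1 l) * t = (u 0 $ 1 + b * s + a * t) - (u 0 $ 1 - t * ex1 0)" by (simp add: e01 algebra_simps)
   then have 1: "norm (b * s + (a + E1 l) * t) <= ep * S" unfolding bu using au(1)[of 0] by (simp add: norm_minus_commute)
   have "(d + E2 l) * s + c * t = (d * s + c * t + u 1 $ 2) - (u 1 $ 2 - s * ex2 1)" by (simp add: e01 algebra_simps)
   then have 2: "norm ((d + E2 l) * s + c * t) <= ep * S" unfolding bu using au(2)[of 1] by (simp add: norm_minus_commute)
   have fin: "norm (of_real bet * (X + t'' * Y)) <= gam * (2 * M * ep * S')" if "\<bar>bet\<bar> <= gam" "norm X <= ep * S'" "norm t'' <= S'" "norm Y <= M * ep" for bet :: real and X t'' Y :: complex
   proof -
    have "norm (X + t'' * Y) <= ep * S' + S' * (M * ep)"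
     by (intro norm_triangle_le add_mono that) (use that S in \<open>auto simp: norm_mult intro!: mult_mono\<close>)
    also have "\<dots> <= M * (ep * S') + S' * (M * ep)" using mult_right_mono[OF M, of "ep * S'"] mult_nonneg_nonneg[OF less_imp_le[OF ep(1)] S(4)] by (simp add: ac_simps)
    finally show ?thesis unfolding norm_mult using that(1) by (intro mult_mono) (auto simp: algebra_simps)
   qed
   have "- b * b2 * s' + b1 * (d + E2 l) * t' = of_real b1 * (w 0 $ 1 + (- b * b2 / b1) * s' + d * t') + of_real b1 * (- (w 0 $ 1 - t' * fx1 0) + t' * (E2 l - fx1 0))"
    using nz by (simp add: field_simps)
   then have 3: "norm (- b * b2 * s' + b1 * (d + E2 l) * t') <= gam * (2 * M * ep * S')"
    unfolding bw using fin[OF bgam(1), of "- (w 0 $ 1 - t' * fx1 0)" t' "E2 l - fx1 0"] aw(1)[of 0] f01 S(8) by (simp add: norm_minus_commute)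
   have "b2 * (a + E1 l) * s' - c * b1 * t' = of_real b2 * (a * s' + (- c * b1 / b2) * t' + w 1 $ 2) + of_real b2 * (- (w 1 $ 2 - s' * fx2 1) + s' * (E1 l - fx2 1))"
    using nz by (simp add: field_simps)
   then have 4: "norm (b2 * (a + E1 l) * s' - c * b1 * t') <= gam * (2 * M * ep * S')"
    unfolding bw using fin[OF bgam(2), of "- (w 1 $ 2 - s' * fx2 1)" s' "E1 l - fx2 1"] aw(2)[of 1] f01 S(7) by (simp add: norm_minus_commute)
   have QE: "norm (a + E1 l) <= Q" "norm (d + E2 l) <= Q" using norm_triangle_ineq[of a "E1 l"] norm_triangle_ineq[of d "E2 l"] E12 Q by linarith+
   have "norm (WW (E1 l) (E2 l)) * (S * S') <= 4 * gam * Q * norm Z + 3 * M * (S * (gam * (2 * M * ep * S'))) + 3 * M * gam * (ep * S * S')"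
    unfolding WW_def Z_def S(1,2)
    using pairing_algebra[OF 1 2 3 4 QE Q(3,4) E12 bgam] by (simp add: S(1,2))
   also have "\<dots> <= 4 * gam * Q * norm Z + 16 * gam * M * M * ep * (S * S')"
   proof -
    have "3 * (M * gam * ep * S * S') * 1 <= 3 * (M * gam * ep * S * S') * M" using M gam0 ep S by (intro mult_left_mono) auto
    moreover have "0 <= M * M * gam * ep * S * S'" using M gam0 ep S by auto
    ultimately show ?thesis by (simp add: algebra_simps)
   qed
   also have "\<dots> <= 4 * gam * Q * norm Z + kap / 2 * (S * S')" using ep2(1) S by (intro add_left_mono mult_right_mono) auto
   finally have "kap * (S * S') <= 4 * gam * Q * norm Z + kap / 2 * (S * S')" using mult_right_mono[OF kapW, of "S * S'"] S by simp
   moreover have "norm Z <= norm (pair u w) + 8 * M * ep * (S * S')" using pz norm_triangle_ineq2[of Z "pair u w"] by (simp add: norm_minus_commute)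
   then have "4 * gam * Q * norm Z <= 4 * gam * Q * (norm (pair u w) + 8 * M * ep * (S * S'))" using gam0 Q by (intro mult_left_mono) auto
   moreover have "128 * gam * Q * M * ep * (S * S') <= kap * (S * S')" using ep2(2) S by (intro mult_right_mono) auto
   ultimately have "kap * (S * S') <= 16 * gam * Q * norm (pair u w)" by (simp add: algebra_simps)
   then show ?thesis using gam0 Q unfolding eta_def S_def S'_def by (simp add: field_simps)
  qed
 qed
qed

end

lemma contv_abs_L2_eq_0: assumes y: "contv y" and z: "abs_L2 y = 0" and x: "x \<in> {0..1}" shows "y x = 0"
proof -
 note c = contv_continuous[OF y]
 have c2: "continuous_on {0..1} (%x. (norm (y x))^2)" by (intro continuous_intros c)
 have "integral {0..1} (%x. (norm (y x))^2) = (\<integral>x. (norm (y x))^2 \<partial>unit_leb)"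
  by (rule lebesgue_integral_eq_integral[symmetric])
   (use absolutely_integrable_continuous_real[OF c2] in \<open>auto simp: absolutely_integrable_on_unit_iff\<close>)
 also have "\<dots> = 0" using norm_abs_sq[OF contv_sq_integrable[OF y]] by (simp add: z)
 finally have "\<forall>x\<in>{0..1}. (norm (y x))^2 = 0" using integral_eq_0_iff[OF c2] by simp
 then show ?thesis using x by simp
qed

lemma cinner_cc: assumes "sq_integrable f" "sq_integrable g" shows "cinner (abs_L2 f) (abs_L2 (cc g)) = cinner (abs_L2 g) (abs_L2 (cc f))"
 by (simp add: cinner_abs assms sq_integrable_cc sum_2 cc_def ac_simps)

lemma norm_cc: "sq_integrable f ==> norm (abs_L2 (cc f)) = norm (abs_L2 f)"
 by (rule power2_eq_imp_eq) (simp_all add: norm_abs_sq sq_integrable_cc norm_sq_vec2 cc_def add.commute)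

lemma sig_scale: "sig (%x. c *s y x) = norm c * sig y" by (simp add: sig_def norm_mult distrib_left)

section \<open>Root subspaces and far eigenvalues\<close>

context bvp begin

lemma cinner_cc_pair: "contv y ==> contv w ==> cinner (abs_L2 y) (abs_L2 (cc w)) = pair y w"
 using cinner_pair[of y "cc w"] sq_integrable_cc[OF contv_sq_integrable] by (simp add: cc_cc)

lemma pair_le: "contv y ==> contv w ==> norm (pair y w) <= norm (abs_L2 y) * norm (abs_L2 w)"
 using cinner_Cauchy_Schwarz[of "abs_L2 y" "abs_L2 (cc w)"] by (simp add: cinner_cc_pair norm_cc contv_sq_integrable)

lemma sol_AE_cong:
 assumes "sol l g y" "sq_integrable g" "sq_integrable g'" "abs_L2 g = abs_L2 g'" shows "sol l g' y"
proof -
 have e: "AE x in unit_leb. g x = g' x" using abs_L2_eq_iff assms by blast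
 show ?thesis unfolding solves_def
  by (intro conjI; rule acd_deriv_cong_AE[OF sol_acd(1)[OF assms(1)]] acd_deriv_cong_AE[OF sol_acd(2)[OF assms(1)]])
   (rule AE_mp[OF e], simp)+
qed

text \<open>Elements of the domain have continuous representatives, and changing \<open>g\<close> on
  a null set does not affect the integrated equation. All functions along a chain may thus be taken
  continuous, as the pairing lemmas require.\<close>

lemma power_kernel_Suc_contv:
 "u \<in> power_kernel op mu (Suc n) \<longleftrightarrow> (\<exists>y g. u = abs_L2 y \<and> sol mu g y \<and> bc y \<and> contv g \<and> abs_L2 g \<in> power_kernel op mu n)"
proof
 assume "u \<in> power_kernel op mu (Suc n)"
 then obtain y g where y: "u = abs_L2 y" "sol mu g y" "bc y" "sq_integrable g" "abs_L2 g \<in> power_kernel op mu n"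
  unfolding power_kernel_Suc_iff by blast
 have "\<exists>g'. contv g' \<and> abs_L2 g' = abs_L2 g"
 proof (cases n)
  case 0
  then have "abs_L2 (%x. 0) = abs_L2 g" using y(5) by (simp add: zero_L2.abs_eq)
  moreover have "contv (%x. 0)" by (simp add: contv_def)
  ultimately show ?thesis by blast
 next
  case (Suc m)
  then show ?thesis using y(5) power_kernel_Suc_iff sol_contv by metis
 qed
 then obtain g' where g': "contv g'" "abs_L2 g = abs_L2 g'" by metis
 have "sol mu g' y" by (rule sol_AE_cong[OF y(2,4) contv_sq_integrable[OF g'(1)] g'(2)])
 then show "\<exists>y g. u = abs_L2 y \<and> sol mu g y \<and> bc y \<and> contv g \<and> abs_L2 g \<in> power_kernel op mu n"
  using y g' by metis
next
 assume "\<exists>y g. u = abs_L2 y \<and> sol mu g y \<and> bc y \<and> contv g \<and> abs_L2 g \<in> power_kernel op mu n"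
 then show "u \<in> power_kernel op mu (Suc n)" unfolding power_kernel_Suc_iff using contv_sq_integrable by blast
qed

lemma root_subspace_zero: assumes "\<Delta> mu ~= 0" shows "root_subspace op mu = {0}"
proof -
 have "power_kernel op mu n = {0}" for n
 proof (induction n)
  case (Suc n)
  have z: "contv (%x. 0)" "bc (%x. 0)" by (simp_all add: contv_def boundary_conds_def)
  have a: "abs_L2 (%x. 0) = 0" by (simp add: zero_L2.abs_eq)
  show ?case
  proof (intro equalityI subsetI)
   fix u assume "u \<in> power_kernel op mu (Suc n)"
   then obtain y g where y: "u = abs_L2 y" "sol mu g y" "bc y" "contv g" "abs_L2 g = 0" unfolding power_kernel_Suc_contv Suc by blast
   have "sol mu (%x. 0) y" by (rule sol_AE_cong[OF y(2)]) (use y contv_sq_integrable z a in auto)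
   from zero_of_\<Delta>_nz[OF assms this y(3)] have "AE x in unit_leb. y x = 0" by (intro AE_I2) auto
   then show "u \<in> {0}" using y(1) abs_L2_cong_AE[OF contv_sq_integrable[OF sol_contv[OF y(2)]]] a by simp
  next
   fix u :: L2 assume "u \<in> {0}"
   then show "u \<in> power_kernel op mu (Suc n)" unfolding power_kernel_Suc_contv Suc using z a sol_zero by auto
  qed
 qed simp
 then show ?thesis by (auto simp: root_subspace_def)
qed

text \<open>An eigenvalue of the problem is one of the transposed problem: otherwise the transposed
  resolvent and Lagrange's identity show that an eigenfunction is orthogonal to everything.\<close>

lemma transposed_eigenfunction_exists:
 assumes "\<Delta> l = 0" shows "\<exists>w. solT l (%x. 0) w \<and> bcT w \<and> w 0 ~= 0"
proof (rule ccontr)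
 assume neg: "\<not> ?thesis"
 interpret T: bvp "- b2" "- b1" p q d "- b * b2 / b1" "- c * b1 / b2" a by (rule bvp_transpose)
 have D: "T.\<Delta> l ~= 0" using neg T.eigenfunction_exists by blast
 obtain u where u: "sol l (%x. 0) u" "bc u" "u 0 ~= 0" using eigenfunction_exists[OF assms] by blast
 have cu: "contv u" by (rule sol_contv[OF u(1)])
 have su: "sq_integrable (cc u)" by (rule sq_integrable_cc[OF contv_sq_integrable[OF cu]])
 have a: "aiv (cc u)" by (rule sq_integrable_aiv(1)[OF su])
 have "(l - l) * pair u (T.Y (cc u) l) + pair (%x. 0) (T.Y (cc u) l) - pair u (%x. T.\<Delta> l *s cc u x) = 0"
  by (rule lagrange[OF u(1,2) T.Y[OF a] aiv_zero aiv_scale[OF a]])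
 then have "pair u (%x. T.\<Delta> l *s cc u x) = 0" by (simp add: pair_def[of "%x. 0"])
 then have "pair (%x. T.\<Delta> l *s cc u x) u = 0" by (rule trans[OF pair_commute])
 then have "pair (cc u) u = 0" using D by (simp add: pair_scale)
 then have "cinner (abs_L2 u) (abs_L2 u) = 0" using cinner_pair[OF cu contv_sq_integrable[OF cu]] by (simp add: pair_commute)
 then show False using contv_abs_L2_eq_0[OF cu, of 0] u(3) by simp
qed

text \<open>Induction along the chain: Lagrange's identity gives
  \<open>(mu - l) * pair y w = - pair g w\<close>, and \<open>g\<close> has smaller height.\<close>

lemma root_vector_orthogonal:
 assumes w: "solT l (%x. 0) w" "bcT w" and u: "u \<in> root_subspace op mu" and ne: "mu ~= l"
 shows "cinner u (abs_L2 (cc w)) = 0"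
proof -
 interpret T: bvp "- b2" "- b1" p q d "- b * b2 / b1" "- c * b1 / b2" a by (rule bvp_transpose)
 have cw: "contv w" by (rule T.sol_contv[OF w(1)])
 have "cinner u (abs_L2 (cc w)) = 0" if "u \<in> power_kernel op mu n" for u n using that
 proof (induction n arbitrary: u)
  case (Suc n)
  then obtain y g where y: "u = abs_L2 y" "sol mu g y" "bc y" "contv g" "abs_L2 g \<in> power_kernel op mu n"
   unfolding power_kernel_Suc_contv by blast
  have "pair g w = 0" using Suc.IH[OF y(5)] by (simp add: cinner_cc_pair y(4) cw)
  moreover have "(mu - l) * pair y w + pair g w - pair y (%x. 0) = 0" by (rule lagrange[OF y(2,3) w contv_aiv[OF y(4)] aiv_zero])
  ultimately have "pair y w = 0" using ne by (simp add: pair_def)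
  then show ?case unfolding y(1) by (simp add: cinner_cc_pair sol_contv[OF y(2)] cw)
 qed simp
 then show ?thesis using u by (auto simp: root_subspace_def)
qed

text \<open>The outcome of the asymptotic analysis: far eigenvalues are simple and separated, and their
  eigenfunctions are comparable with the dual ones of the transposed problem.\<close>

lemma large_eigenvalues:
 assumes sr: "strictly_regular_bc b1 b2 a b c d"
 shows "\<exists>R K th. K > 0 \<and> th > 0 \<and>
  (\<forall>l l'. \<Delta> l = 0 --> \<Delta> l' = 0 --> R <= norm l --> R <= norm l' --> l ~= l' --> th < norm (l - l')) \<and>
  (\<forall>l u. \<Delta> l = 0 --> R <= norm l --> sol l (%x. 0) u --> bc u --> (\<forall>x\<in>{0..1}. n1 (u x) <= K * norm (abs_L2 u))) \<and>
  (\<forall>l. \<Delta> l = 0 --> R <= norm l --> (\<exists>u w. sol l (%x. 0) u \<and> bc u \<and> norm (abs_L2 u) = 1 \<and> solT l (%x. 0) w \<and> bcT w \<and>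
   (\<forall>x\<in>{0..1}. n1 (w x) <= K) \<and> pair u w = 1 \<and> root_subspace op l = L2.span {abs_L2 u}))"
proof -
 interpret T: bvp "- b2" "- b1" p q d "- b * b2 / b1" "- c * b1 / b2" a by (rule bvp_transpose)
 obtain H where H: "H >= 0" "!!l. \<Delta> l = 0 ==> \<bar>Im l\<bar> <= H" using eigenvalue_strip by blast
 obtain eta th R1 where eta: "eta > 0" "th > 0" and pairing: "!!l l' u w. \<bar>Im l\<bar> <= H ==> \<bar>Im l'\<bar> <= H ==> R1 <= norm l ==> R1 <= norm l' ==> norm (l - l') <= th ==>
  sol l (%x. 0) u ==> bc u ==> solT l' (%x. 0) w ==> bcT w ==> eta * (sig u * sig w) <= norm (pair u w)"
  using pairing[OF sr H(1)] by blast
 have z: "nrm1 (%x. 0) = 0" by (simp add: nrm1_def)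
 obtain K1 where K1: "!!ep. ep > 0 ==> \<exists>R>0. \<forall>l g y. - H <= Im l --> R <= norm l --> aiv g --> sol l g y --> bc y -->
  norm (DD l) * sig y <= ep * sig y + K1 * nrm1 g \<and> (\<forall>x\<in>{0..1}. n1 (y x) <= K1 * (sig y + nrm1 g))"
  using boundary_asymptotics[OF H(1)] by blast
 obtain R2 where R2: "!!l y x. - H <= Im l ==> R2 <= norm l ==> sol l (%x. 0) y ==> bc y ==> x \<in> {0..1} ==> n1 (y x) <= K1 * (sig y + nrm1 (%x. 0))"
  using K1[OF zero_less_one] aiv_zero by meson
 obtain K2 where K2: "!!ep. ep > 0 ==> \<exists>R>0. \<forall>l g y. - H <= Im l --> R <= norm l --> aiv g --> solT l g y --> bcT y -->
  norm (T.DD l) * sig y <= ep * sig y + K2 * nrm1 g \<and> (\<forall>x\<in>{0..1}. n1 (y x) <= K2 * (sig y + nrm1 g))"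
  using T.boundary_asymptotics[OF H(1)] by blast
 obtain R3 where R3: "!!l y x. - H <= Im l ==> R3 <= norm l ==> solT l (%x. 0) y ==> bcT y ==> x \<in> {0..1} ==> n1 (y x) <= K2 * (sig y + nrm1 (%x. 0))"
  using K2[OF zero_less_one] aiv_zero by meson
 define K where "K = max 1 (max K1 K2)"
 have K: "K >= 1" "K1 <= K" "K2 <= K" by (auto simp: K_def)
 define R where "R = max R1 (max R2 R3)"
 have sig0: "sig y >= 0" for y by (simp add: sig_def)
 have st: "- H <= Im l" if "\<Delta> l = 0" for l using H(2)[OF that] by linarith
 have bu: "n1 (y x) <= K * sig y" if "\<Delta> l = 0" "R <= norm l" "sol l (%x. 0) y" "bc y" "x \<in> {0..1}" for l y x
  using R2[OF st[OF that(1)] _ that(3-5)] that(2) mult_right_mono[OF K(2) sig0, of y] by (simp add: z R_def)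
 have bw: "n1 (y x) <= K * sig y" if "\<Delta> l = 0" "R <= norm l" "solT l (%x. 0) y" "bcT y" "x \<in> {0..1}" for l y x
  using R3[OF st[OF that(1)] _ that(3-5)] that(2) mult_right_mono[OF K(3) sig0, of y] by (simp add: z R_def)
 have pr: "eta * (sig u * sig w) <= norm (pair u w)" if "\<Delta> l = 0" "\<Delta> l' = 0" "R <= norm l" "R <= norm l'" "norm (l - l') <= th"
  "sol l (%x. 0) u" "bc u" "solT l' (%x. 0) w" "bcT w" for l l' u w
  by (rule pairing[OF H(2)[OF that(1)] H(2)[OF that(2)] _ _ that(5-9)]) (use that in \<open>auto simp: R_def\<close>)
 have sigpos: "sig y > 0" if "!!x. x \<in> {0..1} ==> n1 (y x) <= K * sig y" "y 0 ~= 0" for y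
  using that(1)[of 0] that(2) n1_nonneg[of "y 0"] n1_eq_0_iff[of "y 0"] sig0[of y] by (cases "sig y = 0") auto
 have dual: "\<exists>w. solT l (%x. 0) w \<and> bcT w \<and> sig w = 1" if l: "\<Delta> l = 0" "R <= norm l" for l
 proof -
  obtain w where w: "solT l (%x. 0) w" "bcT w" "w 0 ~= 0" using transposed_eigenfunction_exists[OF l(1)] by blast
  have s: "sig w > 0" using sigpos[OF bw[OF l w(1,2)] w(3)] .
  have "solT l (%x. 0) (%x. of_real (1 / sig w) *s w x)" using T.sol_scale[OF w(1), of "of_real (1 / sig w)"] by simp
  moreover have "sig (%x. of_real (1 / sig w) *s w x) = 1" using s by (simp add: sig_scale norm_divide)
  ultimately show ?thesis using T.bc_scale[OF w(2)] by blast
 qed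
 define K' where "K' = max K (K * K / eta)"
 have lo: "eta * sig u <= K * norm (abs_L2 u)" if l: "\<Delta> l = 0" "R <= norm l" and u: "sol l (%x. 0) u" "bc u" for l u
 proof -
  obtain w where w: "solT l (%x. 0) w" "bcT w" "sig w = 1" using dual[OF l] by blast
  have cw: "contv w" "contv u" using T.sol_contv[OF w(1)] sol_contv[OF u(1)] by auto
  have "eta * (sig u * sig w) <= norm (pair u w)" by (rule pr[OF l(1,1,2,2) _ u w(1,2)]) (use eta in simp)
  also have "\<dots> <= norm (abs_L2 u) * norm (abs_L2 w)" by (rule pair_le[OF cw(2,1)])
  also have "norm (abs_L2 w) <= K" by (rule norm_contv_le[OF cw(1)]) (use bw[OF l w(1,2)] w(3) in simp)
  then have "norm (abs_L2 u) * norm (abs_L2 w) <= norm (abs_L2 u) * K" by (rule mult_left_mono) simp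
  finally show ?thesis using w(3) by (simp add: mult.commute)
 qed
 have sup: "n1 (u x) <= K' * norm (abs_L2 u)" if l: "\<Delta> l = 0" "R <= norm l" and u: "sol l (%x. 0) u" "bc u" and x: "x \<in> {0..1}" for l u x
 proof -
  have "sig u <= K / eta * norm (abs_L2 u)" using lo[OF l u] eta(1) by (simp add: field_simps)
  then have "K * sig u <= K * (K / eta * norm (abs_L2 u))" using K(1) by (intro mult_left_mono) auto
  also have "\<dots> <= K' * norm (abs_L2 u)" unfolding K'_def mult.assoc[symmetric] by (intro mult_right_mono) auto
  finally show ?thesis using bu[OF l u x] by linarith
 qed
 \<comment> \<open>At distinct eigenvalues Lagrange's identity makes the pairing vanish, which its
   lower bound forbids at distance at most \<open>th\<close>.\<close>
 have sep: "th < norm (l - l')" if l: "\<Delta> l = 0" "\<Delta> l' = 0" "R <= norm l" "R <= norm l'" "l ~= l'" for l l'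
 proof (rule ccontr)
  assume n: "\<not> ?thesis"
  obtain u where u: "sol l (%x. 0) u" "bc u" "u 0 ~= 0" using eigenfunction_exists[OF l(1)] by blast
  obtain w where w: "solT l' (%x. 0) w" "bcT w" "sig w = 1" using dual[OF l(2,4)] by blast
  have "(l - l') * pair u w + pair (%x. 0) w - pair u (%x. 0) = 0" by (rule lagrange[OF u(1,2) w(1,2) aiv_zero aiv_zero])
  then have "pair u w = 0" using l(5) by (simp add: pair_def)
  moreover have "eta * (sig u * sig w) <= norm (pair u w)" by (rule pr[OF l(1-4) _ u(1,2) w(1,2)]) (use n in simp)
  ultimately show False using sigpos[OF bu[OF l(1,3) u(1,2)] u(3)] w(3) eta(1) by (simp add: mult_le_0_iff)
 qed
 have ex: "\<exists>u w. sol l (%x. 0) u \<and> bc u \<and> norm (abs_L2 u) = 1 \<and> solT l (%x. 0) w \<and> bcT w \<and>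
   (\<forall>x\<in>{0..1}. n1 (w x) <= K') \<and> pair u w = 1 \<and> root_subspace op l = L2.span {abs_L2 u}" if l: "\<Delta> l = 0" "R <= norm l" for l
 proof -
  obtain v where v: "sol l (%x. 0) v" "bc v" "v 0 ~= 0" using eigenfunction_exists[OF l(1)] by blast
  have cv: "contv v" by (rule sol_contv[OF v(1)])
  have nv: "norm (abs_L2 v) > 0" using contv_abs_L2_eq_0[OF cv, of 0] v(3) by auto
  define u where "u = (%x. of_real (1 / norm (abs_L2 v)) *s v x)"
  have u: "sol l (%x. 0) u" "bc u" using sol_scale[OF v(1), of "of_real (1 / norm (abs_L2 v))"] bc_scale[OF v(2)] by (simp_all add: u_def)
  have "abs_L2 u = of_real (1 / norm (abs_L2 v)) *\<^sub>C abs_L2 v" unfolding u_def by (rule abs_L2_scaleC[OF contv_sq_integrable[OF cv], symmetric])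
  then have un: "norm (abs_L2 u) = 1" using nv by (simp add: norm_scaleC norm_divide)
  have cu: "contv u" by (rule sol_contv[OF u(1)])
  obtain w0 where w0: "solT l (%x. 0) w0" "bcT w0" "sig w0 = 1" using dual[OF l] by blast
  have low: "eta * sig y <= norm (pair y w0)" if "sol l (%x. 0) y" "bc y" for y using pr[OF l(1,1,2,2) _ that w0(1,2)] eta(2) w0(3) by simp
  have zero: "y x = 0" if y: "sol l (%x. 0) y" "bc y" "pair y w0 = 0" "x \<in> {0..1}" for y x
  proof -
   have "sig y = 0" using low[OF y(1,2)] y(3) eta(1) sig0[of y] by (simp add: mult_le_0_iff)
   then show ?thesis using bu[OF l y(1,2,4)] n1_nonneg[of "y x"] n1_eq_0_iff[of "y x"] by simp
  qed
  define alp where "alp = pair u w0"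
  have su: "1 <= K * sig u" using norm_contv_le[OF cu bu[OF l u]] un by simp
  have K0: "K > 0" using K(1) by simp
  have "eta * 1 <= eta * (K * sig u)" using su eta(1) by (intro mult_left_mono) auto
  also have "\<dots> <= K * norm alp" using mult_left_mono[OF low[OF u] less_imp_le[OF K0]] by (simp add: alp_def algebra_simps)
  finally have alp: "eta <= K * norm alp" by simp
  have alp0: "alp ~= 0" using alp eta(1) by auto
  define w where "w = (%x. (1 / alp) *s w0 x)"
  have w: "solT l (%x. 0) w" "bcT w" using T.sol_scale[OF w0(1), of "1 / alp"] T.bc_scale[OF w0(2)] by (simp_all add: w_def)
  have "n1 (w x) <= K'" if "x \<in> {0..1}" for x
  proof -
   have "n1 (w x) = n1 (w0 x) / norm alp" by (simp add: w_def n1_scale norm_divide)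
   also have "\<dots> <= K / norm alp" using bw[OF l w0(1,2) that] w0(3) by (intro divide_right_mono) auto
   also have "\<dots> <= K * K / eta"
   proof -
    have "K * eta <= K * (K * norm alp)" using alp K0 by (intro mult_left_mono) auto
    then show ?thesis using alp0 eta(1) by (simp add: field_simps)
   qed
   finally show ?thesis by (simp add: K'_def)
  qed
  moreover have "pair u w = 1 / alp * pair w0 u" unfolding w_def by (rule trans[OF pair_commute pair_scale])
  then have "pair u w = 1" using alp0 by (simp add: alp_def pair_commute[of w0 u])
  moreover have "root_subspace op l = L2.span {abs_L2 u}"
  proof -
   have a0: "abs_L2 (%x. 0) = 0" and c0: "contv (%x. 0)" by (simp_all add: zero_L2.abs_eq contv_def)
   \<comment> \<open>Geometric simplicity: subtracting the multiple of \<open>u\<close> with the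
     same pairing leaves an eigenfunction that pairs to 0 with \<open>w0\<close> and therefore
     vanishes.\<close>
   have e1: "abs_L2 y \<in> L2.span {abs_L2 u}" if y: "sol l (%x. 0) y" "bc y" for y
   proof -
    have cy: "contv y" by (rule sol_contv[OF y(1)])
    define k where "k = pair y w0 / alp"
    have s: "sol l (%x. 0) (%x. y x - k *s u x)" "bc (%x. y x - k *s u x)"
     using sol_diff[OF y(1) sol_scale[OF u(1), of k]] bc_diff[OF y(2) bc_scale[OF u(2)]] by simp_all
    have "pair (%x. y x + (- k) *s u x) w0 = pair y w0 + pair (%x. (- k) *s u x) w0"
     using sol_contv[OF sol_scale[OF u(1), of "- k"]] by (intro pair_add cy contv_aiv T.sol_contv[OF w0(1)]) simp
    also have "\<dots> = 0" using alp0 unfolding pair_scale k_def alp_def[symmetric] by simp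
    also have "(%x. y x + (- k) *s u x) = (%x. y x - k *s u x)" by (simp add: fun_eq_iff vec_eq_iff)
    finally have "pair (%x. y x - k *s u x) w0 = 0" .
    then have "y x - k *s u x = 0" if "x \<in> {0..1}" for x using zero[OF s _ that] by simp
    then have "abs_L2 y = abs_L2 (%x. k *s u x)" by (intro abs_L2_cong_AE[OF contv_sq_integrable[OF cy]] AE_I2) simp
    also have "\<dots> = k *\<^sub>C abs_L2 u" by (rule abs_L2_scaleC[OF contv_sq_integrable[OF cu], symmetric])
    finally show ?thesis by (simp add: L2.span_base L2.span_scale)
   qed
   have p1: "\<exists>y. v = abs_L2 y \<and> sol l (%x. 0) y \<and> bc y" if "v \<in> power_kernel op l n" for v n using that
   proof (induction n arbitrary: v)
    case 0
    then show ?case using a0 sol_zero bc_scale[OF v(2), of 0] by (intro exI[of _ "%x. 0"]) simp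
   next
    case (Suc n)
    then obtain y g where y: "v = abs_L2 y" "sol l g y" "bc y" "contv g" "abs_L2 g \<in> power_kernel op l n"
     unfolding power_kernel_Suc_contv by blast
    obtain g' where g': "abs_L2 g = abs_L2 g'" "sol l (%x. 0) g'" "bc g'" using Suc.IH[OF y(5)] by blast
    have cg: "contv g'" by (rule sol_contv[OF g'(2)])
    have y': "sol l g' y" by (rule sol_AE_cong[OF y(2) contv_sq_integrable[OF y(4)] contv_sq_integrable[OF cg] g'(1)])
    \<comment> \<open>Algebraic simplicity: the right-hand side \<open>g'\<close> is an
      eigenfunction or zero, and it pairs to 0 with \<open>w0\<close>; hence it vanishes and
      \<open>y\<close> solves the homogeneous equation.\<close>
    have "(l - l) * pair y w0 + pair g' w0 - pair y (%x. 0) = 0" by (rule lagrange[OF y' y(3) w0(1,2) contv_aiv[OF cg] aiv_zero])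
    then have "pair g' w0 = 0" by (simp add: pair_def)
    from zero[OF g'(2,3) this] have "sol l (%x. 0) y" by (intro sol_cong[OF y']) auto
    then show ?case using y by blast
   qed
   have "abs_L2 u \<in> power_kernel op l (Suc 0)" unfolding power_kernel_Suc_contv using u a0 c0 by auto
   then have uin: "abs_L2 u \<in> root_subspace op l" unfolding root_subspace_def by blast
   have "k *\<^sub>C abs_L2 u \<in> root_subspace op l" for k
   proof -
    have "k *\<^sub>C abs_L2 u = abs_L2 (%x. k *s u x)" by (rule abs_L2_scaleC[OF contv_sq_integrable[OF cu]])
    moreover have "sol l (%x. 0) (%x. k *s u x)" "bc (%x. k *s u x)" using sol_scale[OF u(1), of k] bc_scale[OF u(2)] by simp_all
    ultimately have "k *\<^sub>C abs_L2 u \<in> power_kernel op l (Suc 0)" unfolding power_kernel_Suc_contv using a0 c0 by auto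
    then show ?thesis unfolding root_subspace_def by blast
   qed
   then have "L2.span {abs_L2 u} \<subseteq> root_subspace op l" by (auto simp: L2.span_singleton)
   moreover have "root_subspace op l \<subseteq> L2.span {abs_L2 u}" using p1 e1 unfolding root_subspace_def by blast
   ultimately show ?thesis by blast
  qed
  ultimately show ?thesis using u un w by blast
 qed
 have "K' > 0" using K(1) by (simp add: K'_def)
 then show ?thesis using eta sep sup ex by (rule_tac exI[of _ R], rule_tac exI[of _ K'], rule_tac exI[of _ th]) blast
qed

end

section \<open>Bessel inequalities\<close>

text \<open>Bessel's inequality for the exponentials on the unit interval, applied to the function
  cut off at \<open>x\<close>; the bound is independent of \<open>x\<close>. The exponent in
  \<open>e k\<close> is negative so that the conjugation in the inner product restores the
  integrand.\<close>

lemma trig_bessel: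
 assumes phi: "sq_integrable phi" and x: "x \<in> {0..1}" and F: "finite F"
 shows "(\<Sum>k\<in>F. (cmod (integral {0..x} (%t. phi t $ i * exp (2 * pi * \<i> * of_int k * of_real t))))^2) <= (norm (abs_L2 phi))^2"
proof -
 define psi where "psi = (%t. indicator {..x} t *\<^sub>R phi t)"
 define e where "e k = (%t::real. (\<chi> j. if j = i then exp (- (2 * pi * \<i> * of_int k * of_real t)) else 0) :: complex^2)" for k :: int
 have "contv (e k)" for k unfolding contv_def
 proof
  fix j show "continuous_on {0..1} (%x. e k x $ j)" by (cases "j = i") (auto simp: e_def intro!: continuous_intros)
 qed
 then have se: "sq_integrable (e k)" for k by (rule contv_sq_integrable)
 have mi: "(%t. indicator {..x} t :: real) \<in> borel_measurable unit_leb"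
  by (rule measurable_restrict_space1, rule borel_measurable_indicator) auto
 have mphi: "phi \<in> borel_measurable unit_leb" "integrable unit_leb (%t. (norm (phi t))^2)" using phi by (auto simp: sq_integrable_def)
 have mpsi: "psi \<in> borel_measurable unit_leb" unfolding psi_def by (rule borel_measurable_scaleR[OF mi mphi(1)])
 have le: "(norm (psi t))^2 <= (norm (phi t))^2" for t by (auto simp: psi_def indicator_def)
 have ipsi: "integrable unit_leb (%t. (norm (psi t))^2)" by (rule Bochner_Integration.integrable_bound[OF mphi(2)]) (use mpsi le in auto)
 have spsi: "sq_integrable psi" using mpsi ipsi by (simp add: sq_integrable_def)
 have n: "(norm (abs_L2 psi))^2 <= (norm (abs_L2 phi))^2"
  unfolding norm_abs_sq[OF spsi] norm_abs_sq[OF phi] by (rule integral_mono[OF ipsi mphi(2) le])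
 have ex: "integral {0..1} (%t. exp (2 * pi * \<i> * of_int m * of_real t)) = (if m = 0 then 1 else 0)" for m :: int
 proof (cases "m = 0")
  case False
  define omg where "omg = 2 * pi * \<i> * of_int m"
  have "exp omg = 1" unfolding omg_def using exp_integer_2pi[of "of_int m"] by (simp add: mult_ac)
  then have "integral {0..1} (%t. omg * exp (omg * of_real t)) = 0" using acd_diff_eq[OF acd_exp[where omg = omg], of 0 1] by simp
  then show ?thesis using False by (simp add: omg_def)
 qed simp
 have on: "cinner (abs_L2 (e j)) (abs_L2 (e k)) = (if j = k then 1 else 0)" for j k
 proof -
  have eq: "(\<Sum>l\<in>UNIV. e j t $ l * cnj (e k t $ l)) = exp (2 * pi * \<i> * of_int (k - j) * of_real t)" for t
   using exhaust_2[of i] by (auto simp: sum_2 e_def exp_cnj exp_add[symmetric] algebra_simps)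
  have "cinner (abs_L2 (e j)) (abs_L2 (e k)) = (\<integral>t. exp (2 * pi * \<i> * of_int (k - j) * of_real t) \<partial>unit_leb)"
   unfolding cinner_abs[OF se se] eq ..
  also have "\<dots> = integral {0..1} (%t. exp (2 * pi * \<i> * of_int (k - j) * of_real t))" by (rule lebesgue_integral_eq_integral)
    (use ai_cont in \<open>auto simp flip: absolutely_integrable_on_unit_iff intro!: continuous_intros ai_cont\<close>)
  finally show ?thesis unfolding ex by simp
 qed
 have co: "cinner (abs_L2 psi) (abs_L2 (e k)) = integral {0..x} (%t. phi t $ i * exp (2 * pi * \<i> * of_int k * of_real t))" for k
 proof -
  have eq: "(\<Sum>l\<in>UNIV. psi t $ l * cnj (e k t $ l)) = (if t \<in> {..x} then phi t $ i * exp (2 * pi * \<i> * of_int k * of_real t) else 0)" for t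
   using exhaust_2[of i] by (auto simp: sum_2 e_def psi_def exp_cnj)
  have int: "integrable unit_leb (%t. \<Sum>l\<in>UNIV. psi t $ l * cnj (e k t $ l))"
   by (intro Bochner_Integration.integrable_sum integrable_nth_cnj spsi se)
  have "cinner (abs_L2 psi) (abs_L2 (e k)) = integral {0..1} (%t. \<Sum>l\<in>UNIV. psi t $ l * cnj (e k t $ l))"
   unfolding cinner_abs[OF spsi se] by (rule lebesgue_integral_eq_integral[OF int]) simp
  also have "\<dots> = integral ({0..1} \<inter> {..x}) (%t. phi t $ i * exp (2 * pi * \<i> * of_int k * of_real t))"
   unfolding eq Henstock_Kurzweil_Integration.integral_restrict_Int by (simp add: Int_commute)
  also have "{0..1} \<inter> {..x} = {0..x}" using x by auto
  finally show ?thesis .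
 qed
 have "(\<Sum>k\<in>F. (cmod (cinner (abs_L2 psi) (abs_L2 (e k))))^2) <= (norm (abs_L2 psi))^2"
  by (rule orthonormal_bessel[OF F]) (simp_all add: on)
 then show ?thesis using n unfolding co by linarith
qed

text \<open>Expand \<open>(f x - s)^2 * xi x >= 0\<close> with \<open>s = B / A\<close>; this choice
  works for every positive upper bound \<open>A\<close> of the total weight.\<close>

lemma weighted_Cauchy_Schwarz:
 fixes f xi :: "real => real"
 assumes i: "xi integrable_on S" "(%x. f x * xi x) integrable_on S" "(%x. (f x)^2 * xi x) integrable_on S"
  and pos: "!!x. x \<in> S ==> xi x >= 0" and A: "integral S xi <= A" "A > 0"
 shows "(integral S (%x. f x * xi x))^2 <= A * integral S (%x. (f x)^2 * xi x)"
proof -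
 define B where "B = integral S (%x. f x * xi x)"
 define s where "s = B / A"
 have "integral S (%x. 2 * s * (f x * xi x)) <= integral S (%x. (f x)^2 * xi x + s^2 * xi x)"
 proof (rule integral_le)
  show "(%x. 2 * s * (f x * xi x)) integrable_on S" "(%x. (f x)^2 * xi x + s^2 * xi x) integrable_on S"
   by (intro integrable_add integrable_on_mult_right i)+
  fix x assume "x \<in> S"
  have "0 <= (f x - s)^2 * xi x" using pos[OF \<open>x \<in> S\<close>] by simp
  then show "2 * s * (f x * xi x) <= (f x)^2 * xi x + s^2 * xi x" by (simp add: power2_diff algebra_simps)
 qed
 also have "\<dots> = integral S (%x. (f x)^2 * xi x) + s^2 * integral S xi" using i by (simp add: integral_add integrable_on_mult_right)
 also have "\<dots> <= integral S (%x. (f x)^2 * xi x) + s^2 * A" using A by (intro add_left_mono mult_left_mono) auto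
 finally have "2 * s * B <= integral S (%x. (f x)^2 * xi x) + s^2 * A" by (simp add: B_def)
 moreover have "s^2 * A = s * B" "s * B = B^2 / A" using A(2) by (simp_all add: s_def power2_eq_square)
 ultimately have "B^2 / A <= integral S (%x. (f x)^2 * xi x)" by simp
 then show ?thesis using A(2) by (simp add: B_def field_simps)
qed

text \<open>Writing \<open>z\<^sub>n(x) = e\<^bsup>2\<pi>ikx\<^esup> m(x)\<close> with \<open>k\<close> close to \<open>\<beta> \<mu>\<^sub>n / 2\<pi>\<close>, the factor \<open>m\<close> has a derivative with an
  integrable majorant independent of \<open>n\<close>. Integration by parts then reduces the claim to Bessel's inequality for
  exponentials on the intervals \<open>[0,x]\<close>, each \<open>k\<close> occurring boundedly often.\<close>

lemma scalar_bessel: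
 fixes mu :: "nat => complex" and bet :: real and z r :: "nat => real => complex" and kap :: "real => real"
 assumes bet: "bet ~= 0" and th: "th > 0" and sep: "!!m n. m \<in> I ==> n \<in> I ==> m ~= n ==> th < norm (mu m - mu n)"
  and H: "!!n. n \<in> I ==> \<bar>Im (mu n)\<bar> <= H" and K: "K >= 0"
  and z: "!!n. n \<in> I ==> acd (z n) (%x. \<i> * bet * (mu n * z n x + r n x))"
  and zb: "!!n x. n \<in> I ==> x \<in> {0..1} ==> norm (z n x) <= K" "!!n x. n \<in> I ==> x \<in> {0..1} ==> norm (r n x) <= K * kap x"
  and kap: "kap absolutely_integrable_on {0..1}" "!!x. kap x >= 0"
 shows "\<exists>C\<ge>0. \<forall>phi i F. sq_integrable phi --> finite F --> F \<subseteq> I -->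
  (\<Sum>n\<in>F. (cmod (integral {0..1} (%x. phi x $ i * z n x)))^2) <= C * (norm (abs_L2 phi))^2"
proof (cases "I = {}")
 case True
 then show ?thesis by (intro exI[of _ 0]) auto
next
 case False
 then have H0: "H >= 0" using H by fastforce
 define tau where "tau = th * \<bar>bet\<bar> / 2"
 have tau: "tau > 0" using th bet by (simp add: tau_def)
 \<comment> \<open>After removal of the integer frequency \<open>k n\<close> the remaining complex
   frequency lies in a fixed rectangle, which \<open>k1\<close> and \<open>k2\<close> divide into
   squares of side \<open>tau\<close>. Two indices with the same three labels would have parameters
   at distance at most \<open>th\<close>; so the labels determine \<open>n\<close>, and each
   \<open>k\<close> occurs at most \<open>card J\<close> times.\<close>
 define k where "k n = \<lfloor>bet * Re (mu n) / (2 * pi)\<rfloor>" for n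
 define k1 where "k1 n = \<lfloor>(bet * Re (mu n) - 2 * pi * k n) / tau\<rfloor>" for n
 define k2 where "k2 n = \<lfloor>bet * Im (mu n) / tau\<rfloor>" for n
 have kb: "0 <= bet * Re (mu n) - 2 * pi * k n" "bet * Re (mu n) - 2 * pi * k n <= 2 * pi" for n
 proof -
  let ?v = "bet * Re (mu n) / (2 * pi)"
  have "2 * pi * k n <= 2 * pi * ?v" "2 * pi * ?v <= 2 * pi * (k n + 1)"
   unfolding k_def using floor_correct[of ?v] by (intro mult_left_mono; simp)+
  then show "0 <= bet * Re (mu n) - 2 * pi * k n" "bet * Re (mu n) - 2 * pi * k n <= 2 * pi" by (simp_all add: algebra_simps)
 qed
 define J where "J = {0..\<lfloor>2 * pi / tau\<rfloor>} \<times> {\<lfloor>- (\<bar>bet\<bar> * H / tau)\<rfloor>..\<lfloor>\<bar>bet\<bar> * H / tau\<rfloor>}"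
 have bI: "\<bar>bet * Im (mu n)\<bar> <= \<bar>bet\<bar> * H" if "n \<in> I" for n unfolding abs_mult using H[OF that] by (rule mult_left_mono) simp
 have J: "(k1 n, k2 n) \<in> J" if "n \<in> I" for n
 proof -
  have "0 <= k1 n" "k1 n <= \<lfloor>2 * pi / tau\<rfloor>" unfolding k1_def using kb[of n] tau by (auto intro!: floor_mono divide_right_mono)
  moreover have "- (\<bar>bet\<bar> * H / tau) <= bet * Im (mu n) / tau" "bet * Im (mu n) / tau <= \<bar>bet\<bar> * H / tau"
   using bI[OF that] tau unfolding minus_divide_left by (intro divide_right_mono; linarith)+
  then have "\<lfloor>- (\<bar>bet\<bar> * H / tau)\<rfloor> <= k2 n" "k2 n <= \<lfloor>\<bar>bet\<bar> * H / tau\<rfloor>" unfolding k2_def by (auto intro: floor_mono)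
  ultimately show ?thesis by (simp add: J_def)
 qed
 have fl: "\<bar>u - v\<bar> <= tau" if "\<lfloor>u / tau\<rfloor> = \<lfloor>v / tau\<rfloor>" for u v
 proof -
  have "\<bar>u / tau - v / tau\<bar> <= 1" using that floor_correct[of "u / tau"] floor_correct[of "v / tau"] by linarith
  then show ?thesis using tau by (simp add: diff_divide_distrib[symmetric] field_simps abs_divide)
 qed
 have inj: "inj_on (%n. (k n, (k1 n, k2 n))) I"
 proof (rule inj_onI)
  fix m n assume mn: "m \<in> I" "n \<in> I" and eq: "(k m, (k1 m, k2 m)) = (k n, (k1 n, k2 n))"
  have "\<bar>(bet * Re (mu m) - 2 * pi * k m) - (bet * Re (mu n) - 2 * pi * k n)\<bar> <= tau" "\<bar>bet * Im (mu m) - bet * Im (mu n)\<bar> <= tau"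
   by (rule fl, unfold k1_def[symmetric] k2_def[symmetric], use eq in simp)+
  then have "\<bar>bet * Re (mu m - mu n)\<bar> <= tau" "\<bar>bet * Im (mu m - mu n)\<bar> <= tau" using eq by (auto simp: algebra_simps)
  then have "\<bar>bet\<bar> * (\<bar>Re (mu m - mu n)\<bar> + \<bar>Im (mu m - mu n)\<bar>) <= 2 * tau" by (simp add: abs_mult distrib_left)
  then have "\<bar>bet\<bar> * norm (mu m - mu n) <= \<bar>bet\<bar> * th"
   using mult_left_mono[OF cmod_le[of "mu m - mu n"], of "\<bar>bet\<bar>"] by (simp add: tau_def mult.commute)
  then have "norm (mu m - mu n) <= th" using bet by simp
  then show "m = n" using sep[OF mn] by fastforce
 qed
 \<comment> \<open>A majorant for the derivative of \<open>m\<close> below, common to all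
   \<open>n\<close>: the residual frequency is at most \<open>2 * pi + |bet| * H\<close>, and the
   remainder \<open>r n\<close> contributes the last term.\<close>
 define xi where "xi x = K * (2 * pi + \<bar>bet\<bar> * H + \<bar>bet\<bar> * kap x)" for x
 have xiai: "xi absolutely_integrable_on {0..1}"
  unfolding xi_def by (intro set_integral_add set_integrable_mult_right kap(1) absolutely_integrable_continuous_real continuous_intros)
 have xi0: "xi x >= 0" for x unfolding xi_def using K H0 kap(2)[of x] by simp
 define A where "A = integral {0..1} xi + 1"
 have A: "integral {0..1} xi <= A" "A > 0" using integral_nonneg[OF io_sub[OF xiai]] xi0 by (auto simp: A_def add_nonneg_pos)
 define C where "C = real (card J) * (2 * K^2 + 2 * A * A)"
 have C: "C >= 0" using A by (simp add: C_def)
 show ?thesis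
 proof (rule exI[of _ C], rule conjI[OF C], intro allI impI)
  fix phi :: "real => complex^2" and i and F :: "nat set"
  assume phi: "sq_integrable phi" and F: "finite F" "F \<subseteq> I"
  define N where "N = (norm (abs_L2 phi))^2"
  define Phi where "Phi j x = integral {0..x} (%t. phi t $ i * exp (2 * pi * \<i> * of_int j * of_real t))" for j :: int and x
  have phiai: "(%t. phi t $ i) absolutely_integrable_on {0..1}" using sq_integrable_aiv(1)[OF phi] by (simp add: aiv_def)
  have Phiacd: "acd (Phi j) (%t. phi t $ i * exp (2 * pi * \<i> * of_int j * of_real t))" for j
   using acd_indef[of "%t. phi t $ i * exp (2 * pi * \<i> * of_int j * of_real t)" 0]
    ai_cont_mult[OF phiai, of "%t. exp (2 * pi * \<i> * of_int j * of_real t)"]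
   by (simp add: Phi_def[abs_def] mult.commute continuous_intros)
  have Phic: "continuous_on {0..1} (Phi j)" for j by (rule acd_continuous[OF Phiacd])
  have cm: "(%x. h x * xi x) absolutely_integrable_on {0..1}" if "continuous_on {0..1} h" for h :: "real => real"
   using that absolutely_integrable_bounded_measurable_product_real[OF _ _ _ xiai, of h]
    continuous_imp_measurable_on_sets_lebesgue[of "{0..1}" h] compact_imp_bounded[OF compact_continuous_image[of "{0..1}" h]] by simp
  define G where "G j = 2 * K^2 * (norm (Phi j 1))^2 + 2 * A * integral {0..1} (%x. (norm (Phi j x))^2 * xi x)" for j
  have iG: "(%x. (norm (Phi j x))^2 * xi x) integrable_on {0..1}" for j by (rule io_sub[OF cm]) (auto intro!: continuous_intros Phic)
  have G0: "G j >= 0" for j unfolding G_def using A xi0 by (intro add_nonneg_nonneg mult_nonneg_nonneg integral_nonneg iG) auto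
  have one: "(norm (integral {0..1} (%x. phi x $ i * z n x)))^2 <= G (k n)" if n: "n \<in> I" for n
  proof -
   define omg where "omg = - (2 * pi * \<i> * of_int (k n))"
   define m where "m x = exp (omg * of_real x) * z n x" for x
   define m' where "m' x = exp (omg * of_real x) * (\<i> * bet * (mu n * z n x + r n x)) + z n x * (omg * exp (omg * of_real x))" for x
   have mac: "acd m m'" unfolding m_def[abs_def] m'_def[abs_def] by (rule acd_mult[OF acd_exp z[OF n]])
   have e1: "norm (exp (omg * of_real x)) = 1" for x :: real by (simp add: omg_def)
   have mb: "norm (m x) <= K" if "x \<in> {0..1}" for x using zb(1)[OF n that] unfolding m_def norm_mult e1 by simp
   have mb': "norm (m' x) <= xi x" if x: "x \<in> {0..1}" for x
   proof -
    have "m' x = exp (omg * of_real x) * ((\<i> * bet * mu n + omg) * z n x + \<i> * bet * r n x)" by (simp add: m'_def algebra_simps)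
    then have "norm (m' x) = norm ((\<i> * bet * mu n + omg) * z n x + \<i> * bet * r n x)" by (simp only: norm_mult e1 mult_1)
    also have "\<dots> <= norm (\<i> * bet * mu n + omg) * norm (z n x) + \<bar>bet\<bar> * norm (r n x)"
     by (intro norm_triangle_le add_mono) (simp_all add: norm_mult)
    also have "\<dots> <= (2 * pi + \<bar>bet\<bar> * H) * K + \<bar>bet\<bar> * (K * kap x)"
    proof (intro add_mono mult_mono zb n x)
     have "\<i> * bet * mu n + omg = \<i> * Complex (bet * Re (mu n) - 2 * pi * k n) (bet * Im (mu n))"
      by (simp add: omg_def complex_eq_iff)
     then have "norm (\<i> * bet * mu n + omg) <= \<bar>bet * Re (mu n) - 2 * pi * k n\<bar> + \<bar>bet * Im (mu n)\<bar>"
      using cmod_le[of "Complex (bet * Re (mu n) - 2 * pi * k n) (bet * Im (mu n))"] by (simp add: norm_mult)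
     also have "\<dots> <= 2 * pi + \<bar>bet\<bar> * H" using kb[of n] bI[OF n] by linarith
     finally show "norm (\<i> * bet * mu n + omg) <= 2 * pi + \<bar>bet\<bar> * H" .
    qed (use H0 in auto)
    finally show ?thesis by (simp add: xi_def algebra_simps)
   qed
   define P where "P = integral {0..1} (%x. norm (Phi (k n) x) * xi x)"
   have ee: "exp (omg * of_real x) * exp (2 * pi * \<i> * of_int (k n) * of_real x) = 1" for x :: real
    unfolding exp_add[symmetric] by (simp add: omg_def)
   have mf: "m x * (phi x $ i * exp (2 * pi * \<i> * of_int (k n) * of_real x)) = phi x $ i * z n x" for x
    using ee[of x] by (simp add: m_def algebra_simps)
   have ai1: "(%x. Phi (k n) x * m' x) absolutely_integrable_on {0..1}" by (rule ai_cont_mult[OF acd_ai[OF mac] Phic])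
   have ai2: "(%x. z n x * phi x $ i) absolutely_integrable_on {0..1}" by (rule ai_cont_mult[OF phiai acd_continuous[OF z[OF n]]])
   then have ai2: "(%x. phi x $ i * z n x) absolutely_integrable_on {0..1}" by (simp add: mult.commute)
   \<comment> \<open>Integration by parts with the primitive \<open>Phi (k n)\<close> of the
     modulated \<open>phi\<close>, which vanishes at 0.\<close>
   have "Phi (k n) 1 * m 1 - Phi (k n) 0 * m 0 = integral {0..1} (%x. Phi (k n) x * m' x + phi x $ i * z n x)"
    using acd_diff_eq[OF acd_mult[OF Phiacd mac], of 0 1 "k n"] unfolding mf by simp
   also have "\<dots> = integral {0..1} (%x. Phi (k n) x * m' x) + integral {0..1} (%x. phi x $ i * z n x)"
    by (rule integral_add[OF io_sub[OF ai1] io_sub[OF ai2]]) auto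
   finally have "integral {0..1} (%x. phi x $ i * z n x) = Phi (k n) 1 * m 1 - integral {0..1} (%x. Phi (k n) x * m' x)"
    by (simp add: Phi_def algebra_simps)
   then have "norm (integral {0..1} (%x. phi x $ i * z n x)) <= norm (Phi (k n) 1 * m 1) + norm (integral {0..1} (%x. Phi (k n) x * m' x))"
    using norm_triangle_ineq4 by simp
   also have "norm (integral {0..1} (%x. Phi (k n) x * m' x)) <= P" unfolding P_def
    by (rule integral_norm_bound_integral[OF io_sub[OF ai1] io_sub[OF cm]])
     (auto simp: norm_mult intro!: mult_left_mono mb' continuous_intros Phic)
   also have "norm (Phi (k n) 1 * m 1) <= norm (Phi (k n) 1) * K" unfolding norm_mult by (intro mult_left_mono mb) auto
   finally have le: "norm (integral {0..1} (%x. phi x $ i * z n x)) <= norm (Phi (k n) 1) * K + P" by simp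
   have P2: "P^2 <= A * integral {0..1} (%x. (norm (Phi (k n) x))^2 * xi x)" unfolding P_def
    by (rule weighted_Cauchy_Schwarz[OF io_sub[OF xiai] io_sub[OF cm] iG xi0 A]) (auto intro!: continuous_intros Phic)
   have "(norm (integral {0..1} (%x. phi x $ i * z n x)))^2 <= (norm (Phi (k n) 1) * K + P)^2" by (rule power_mono[OF le]) simp
   also have "\<dots> <= 2 * (norm (Phi (k n) 1) * K)^2 + 2 * P^2"
    using zero_le_power2[of "norm (Phi (k n) 1) * K - P"] by (simp add: power2_diff power2_sum)
   also have "\<dots> <= G (k n)" using P2 by (simp add: G_def power_mult_distrib)
   finally show ?thesis .
  qed
  have "(\<Sum>n\<in>F. (cmod (integral {0..1} (%x. phi x $ i * z n x)))^2) <= (\<Sum>n\<in>F. G (k n))"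
   by (rule sum_mono) (use one F(2) in auto)
  also have "\<dots> = (\<Sum>w\<in>(%n. (k n, (k1 n, k2 n))) ` F. G (fst w))" by (subst sum.reindex[OF inj_on_subset[OF inj F(2)]]) simp
  also have "\<dots> <= (\<Sum>w\<in>(k ` F) \<times> J. G (fst w))" by (rule sum_mono2) (use F J G0 in \<open>auto simp: J_def\<close>)
  also have "\<dots> = real (card J) * (\<Sum>j\<in>k ` F. G j)"
   using sum.cartesian_product[of "%j c. G j" J "k ` F"] by (simp add: case_prod_unfold sum_distrib_left)
  also have "\<dots> <= real (card J) * ((2 * K^2 + 2 * A * A) * N)"
  proof (rule mult_left_mono)
   have tb: "(\<Sum>j\<in>k ` F. (norm (Phi j x))^2) <= N" if "x \<in> {0..1}" for x
    unfolding Phi_def N_def by (rule trig_bessel[OF phi that]) (use F in simp)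
   have "(\<Sum>j\<in>k ` F. integral {0..1} (%x. (norm (Phi j x))^2 * xi x)) = integral {0..1} (%x. \<Sum>j\<in>k ` F. (norm (Phi j x))^2 * xi x)"
    by (rule integral_sum[symmetric]) (use F iG in auto)
   also have "\<dots> <= integral {0..1} (%x. N * xi x)"
   proof (rule integral_le)
    show "(%x. \<Sum>j\<in>k ` F. (norm (Phi j x))^2 * xi x) integrable_on {0..1}" by (rule integrable_sum) (use F iG in auto)
    show "(%x. N * xi x) integrable_on {0..1}" by (intro integrable_on_mult_right io_sub[OF xiai]) auto
   qed (use tb xi0 in \<open>auto simp flip: sum_distrib_right intro!: mult_right_mono\<close>)
   also have "\<dots> <= N * A" using A by (simp add: N_def mult_left_mono)
   finally have "2 * A * (\<Sum>j\<in>k ` F. integral {0..1} (%x. (norm (Phi j x))^2 * xi x)) <= 2 * A * (N * A)" using A by (intro mult_left_mono) auto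
   moreover have "2 * K^2 * (\<Sum>j\<in>k ` F. (norm (Phi j 1))^2) <= 2 * K^2 * N" using tb[of 1] by (intro mult_left_mono) auto
   ultimately show "(\<Sum>j\<in>k ` F. G j) <= (2 * K^2 + 2 * A * A) * N"
    unfolding G_def sum.distrib sum_distrib_left[symmetric] by (simp add: algebra_simps)
  qed simp
  finally show "(\<Sum>n\<in>F. (cmod (integral {0..1} (%x. phi x $ i * z n x)))^2) <= C * (norm (abs_L2 phi))^2"
   by (simp add: C_def N_def mult.assoc)
 qed
qed

context ode begin

text \<open>Each component solves a scalar equation whose coupling term is a remainder dominated by
  \<open>norm (p x)\<close> or \<open>norm (q x)\<close>, so \<open>scalar_bessel\<close> applies.
  The version with \<open>cc\<close> is the one for the dual family.\<close>

lemma solutions_bessel: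
 assumes b: "b1 ~= 0" "b2 ~= 0" and th: "th > 0" and sep: "!!m n. m \<in> I ==> n \<in> I ==> m ~= n ==> th < norm (mu m - mu n)"
  and H: "!!n. n \<in> I ==> \<bar>Im (mu n)\<bar> <= H" and K: "K >= 0"
  and y: "!!n. n \<in> I ==> sol (mu n) (%x. 0) (y n)" and yb: "!!n x. n \<in> I ==> x \<in> {0..1} ==> n1 (y n x) <= K"
 shows "\<exists>C. bessel C (%n. if n \<in> I then abs_L2 (y n) else 0)" "\<exists>C. bessel C (%n. if n \<in> I then abs_L2 (cc (y n)) else 0)"
proof -
 have yc: "contv (y n)" if "n \<in> I" for n using sol_cont[OF y[OF that]] by (simp add: contv_def)
 have nb: "norm (y n x $ i) <= K" if "n \<in> I" "x \<in> {0..1}" for n x i using yb[OF that] n1_nth_le[of "y n x" i] by linarith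
 have rb: "norm (- s x * y n x $ i) <= K * norm (s x)" if "n \<in> I" "x \<in> {0..1}" for n x i s
  unfolding norm_mult norm_minus_cancel using mult_right_mono[OF nb[OF that], of "norm (s x)"] by (simp add: mult.commute)
 have a1: "acd (%x. y n x $ 1) (%x. \<i> * b1 * (mu n * y n x $ 1 + - p x * y n x $ 2))" if "n \<in> I" for n
  using sol_acd(1)[OF y[OF that]] by simp
 have a2: "acd (%x. y n x $ 2) (%x. \<i> * b2 * (mu n * y n x $ 2 + - q x * y n x $ 1))" if "n \<in> I" for n
  using sol_acd(2)[OF y[OF that]] by simp
 obtain C1 where C1: "C1 >= 0" "!!phi i F. sq_integrable phi ==> finite F ==> F \<subseteq> I ==>
  (\<Sum>n\<in>F. (cmod (integral {0..1} (%x. phi x $ i * y n x $ 1)))^2) <= C1 * (norm (abs_L2 phi))^2"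
  using scalar_bessel[where I = I and mu = mu and z = "%n x. y n x $ 1" and r = "%n x. - p x * y n x $ 2" and kap = "%x. norm (p x)",
   OF b(1) th sep H K a1 nb[where i = 1] rb[where s = p and i = 2] ai_norm[OF p] norm_ge_zero[of "p x" for x]] by blast
 obtain C2 where C2: "C2 >= 0" "!!phi i F. sq_integrable phi ==> finite F ==> F \<subseteq> I ==>
  (\<Sum>n\<in>F. (cmod (integral {0..1} (%x. phi x $ i * y n x $ 2)))^2) <= C2 * (norm (abs_L2 phi))^2"
  using scalar_bessel[where I = I and mu = mu and z = "%n x. y n x $ 2" and r = "%n x. - q x * y n x $ 1" and kap = "%x. norm (q x)",
   OF b(2) th sep H K a2 nb[where i = 2] rb[where s = q and i = 1] ai_norm[OF q] norm_ge_zero[of "q x" for x]] by blast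
 define C where "C = 2 * C1 + 2 * C2"
 have main: "(\<Sum>n\<in>F. (cmod (pair (y n) phi))^2) <= C * (norm (abs_L2 phi))^2" if "sq_integrable phi" "finite F" "F \<subseteq> I" for phi F
 proof -
  have "(cmod (pair (y n) phi))^2 <= 2 * (cmod (integral {0..1} (%x. phi x $ 2 * y n x $ 1)))^2 + 2 * (cmod (integral {0..1} (%x. phi x $ 1 * y n x $ 2)))^2" for n
   unfolding pair_def by (rule norm_add_sq_le)
  then have "(\<Sum>n\<in>F. (cmod (pair (y n) phi))^2) <= 2 * (\<Sum>n\<in>F. (cmod (integral {0..1} (%x. phi x $ 2 * y n x $ 1)))^2) + 2 * (\<Sum>n\<in>F. (cmod (integral {0..1} (%x. phi x $ 1 * y n x $ 2)))^2)"
   unfolding sum_distrib_left sum.distrib[symmetric] by (rule sum_mono)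
  then show ?thesis using C1(2)[OF that, of 2] C2(2)[OF that, of 1] by (simp add: C_def algebra_simps)
 qed
 have C0: "C >= 0" using C1(1) C2(1) by (simp add: C_def)
 have red: "bessel C (%n. if n \<in> I then v n else 0)"
  if v: "!!f F. finite F ==> F \<subseteq> I ==> (\<Sum>n\<in>F. (cmod (cinner f (v n)))^2) <= C * (norm f)^2" for v
  unfolding bessel_def
 proof (intro conjI allI impI C0)
  fix f :: L2 and F :: "nat set" assume F: "finite F"
  have "(\<Sum>n\<in>F. (cmod (cinner f (if n \<in> I then v n else 0)))^2) = (\<Sum>n\<in>F \<inter> I. (cmod (cinner f (v n)))^2)"
   by (rule sum.mono_neutral_cong_right[OF F]) auto
  then show "(\<Sum>n\<in>F. (cmod (cinner f (if n \<in> I then v n else 0)))^2) <= C * (norm f)^2" using v[of "F \<inter> I" f] F by simp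
 qed
 have "bessel C (%n. if n \<in> I then abs_L2 (y n) else 0)"
 proof (rule red)
  fix f F assume F: "finite F" "F \<subseteq> I"
  obtain phi where phi: "sq_integrable phi" "f = abs_L2 phi" by (rule L2_cases)
  have "cmod (cinner f (abs_L2 (y n))) = cmod (pair (y n) (cc phi))" if "n \<in> F" for n
   using cinner_commute[of f "abs_L2 (y n)"] cinner_pair[OF yc phi(1)] that F(2) phi(2) by auto
  then show "(\<Sum>n\<in>F. (cmod (cinner f (abs_L2 (y n))))^2) <= C * (norm f)^2"
   using main[OF sq_integrable_cc[OF phi(1)] F] by (simp add: phi(2) norm_cc[OF phi(1)])
 qed
 moreover have "bessel C (%n. if n \<in> I then abs_L2 (cc (y n)) else 0)"
 proof (rule red)
  fix f F assume F: "finite F" "F \<subseteq> I"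
  obtain phi where phi: "sq_integrable phi" "f = abs_L2 phi" by (rule L2_cases)
  have "cinner f (abs_L2 (cc (y n))) = pair (y n) phi" if "n \<in> F" for n
   using cinner_cc[OF phi(1) contv_sq_integrable[OF yc]] cinner_pair[OF yc sq_integrable_cc[OF phi(1)]] that F(2) phi(2) by (auto simp: cc_cc)
  then show "(\<Sum>n\<in>F. (cmod (cinner f (abs_L2 (cc (y n)))))^2) <= C * (norm f)^2" using main[OF phi(1) F] by (simp add: phi(2))
 qed
 ultimately show "\<exists>C. bessel C (%n. if n \<in> I then abs_L2 (y n) else 0)" "\<exists>C. bessel C (%n. if n \<in> I then abs_L2 (cc (y n)) else 0)" by blast+
qed

end

section \<open>Completeness of the root vectors\<close>

lemma powser_factor:
 fixes a :: "nat => complex"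
 assumes r: "r > 0" and z: "!!k. k < m ==> a k = 0" and s: "!!w. norm w < r ==> (%k. a k * w ^ k) sums F w"
 shows "\<exists>F1. F1 holomorphic_on ball 0 r \<and> F1 0 = a m \<and> (\<forall>w\<in>ball 0 r. F w = w ^ m * F1 w)"
proof -
 define F1 where "F1 w = (\<Sum>k. a (k + m) * w ^ k)" for w
 have F1: "(%k. a (k + m) * w ^ k) sums F1 w \<and> F w = w ^ m * F1 w" if w: "w \<in> ball 0 r" for w
 proof (cases "w = 0")
  case True
  have "(%k. a (k + m) * 0 ^ k) sums a (0 + m)" by (rule powser_sums_zero)
  then have 1: "(%k. a (k + m) * w ^ k) sums F1 w" "F1 w = a m" using True by (auto simp: F1_def sums_iff)
  have "F w = a 0" using sums_unique2[OF s[of w] powser_sums_zero[of a, folded True]] w by simp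
  then show ?thesis using 1 z[of 0] True by (cases m) auto
 next
  case False
  have "(%k. a (k + m) * w ^ (k + m)) sums (F w - (\<Sum>k<m. a k * w ^ k))" using s[of w] w by (subst sums_iff_shift) simp
  then have *: "(%k. w ^ m * (a (k + m) * w ^ k)) sums F w" using z by (simp add: power_add mult_ac)
  have "summable (%k. a (k + m) * w ^ k)" using sums_summable[OF *] False by (simp add: summable_cmult_iff)
  then have 1: "(%k. a (k + m) * w ^ k) sums F1 w" unfolding F1_def by (rule summable_sums)
  from sums_unique2[OF * sums_mult[OF this]] show ?thesis using 1 by blast
 qed
 have "F1 holomorphic_on ball 0 r" using F1 by (intro power_series_holomorphic[where a = "%k. a (k + m)"]) auto
 moreover have "F1 0 = a m" using powser_sums_zero[of "%k. a (k + m)"] by (auto simp: F1_def sums_iff)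
 ultimately show ?thesis using F1 by blast
qed

lemma holomorphic_on_UNIV_local: "(!!mu. \<exists>r>0. f holomorphic_on ball mu r) ==> f holomorphic_on UNIV"
proof -
 assume l: "!!mu. \<exists>r>0. f holomorphic_on ball mu r"
 have "f field_differentiable at mu" for mu
 proof -
  obtain r where "r > 0" "f holomorphic_on ball mu r" using l by blast
  then show ?thesis by (intro holomorphic_on_imp_differentiable_at[of f "ball mu r"]) auto
 qed
 then show ?thesis unfolding holomorphic_on_def using field_differentiable_at_within by blast
qed

context bvp begin

lemma zero_function: "contv (%x. 0)" "bc (%x. 0)" "abs_L2 (%x. 0) = 0" by (simp_all add: contv_def boundary_conds_def zero_L2.abs_eq)

lemma \<Delta>_nonzero: "\<exists>l. \<Delta> l ~= 0"
proof -
 obtain K R where "\<forall>l. R <= norm l --> (\<exists>rho>0. rho <= 1 \<and> (\<forall>z\<in>sphere 0 rho. resolvent_bounded K (l + z)))"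
  using plane_resolvent by blast
 then obtain rho where "rho > 0" "\<forall>z\<in>sphere 0 rho. resolvent_bounded K (of_real \<bar>R\<bar> + z)"
  using norm_of_real[of "\<bar>R\<bar>"] by (metis abs_abs abs_ge_self)
 then show ?thesis using resolvent_bounded_\<Delta>[of K "of_real \<bar>R\<bar> + of_real rho"] by (intro exI[of _ "of_real \<bar>R\<bar> + of_real rho"]) simp
qed

text \<open>\<open>m\<close> is the order of the zero of \<open>\<Delta>\<close> at
  \<open>mu\<close>. The Taylor coefficients of \<open>Y\<close> below \<open>m\<close> see no
  inhomogeneity and form a Jordan chain. A function \<open>h\<close> that annihilates them gives the
  numerator of the resolvent a zero of order \<open>m\<close>, which cancels that of
  \<open>\<Delta>\<close>. The case \<open>m = 0\<close> covers points that are not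
  eigenvalues.\<close>

lemma resolvent_local:
 assumes g: "aiv g"
 shows "\<exists>m P D1 r. r > 0 \<and> (\<forall>k<m. sol mu (if k = 0 then (%x. 0) else P (k - 1)) (P k) \<and> bc (P k)) \<and>
  D1 holomorphic_on ball 0 r \<and> (\<forall>w\<in>ball 0 r. D1 w ~= 0 \<and> \<Delta> (mu + w) = w ^ m * D1 w) \<and>
  (\<forall>h. aiv h --> (\<forall>k<m. pair (P k) h = 0) --> (\<exists>N1. N1 holomorphic_on ball 0 r \<and> (\<forall>w\<in>ball 0 r. pair (Y g (mu + w)) h = w ^ m * N1 w)))"
proof -
 obtain P dlt r where r: "r > 0" and P: "!!k. sol mu (%x. dlt k *s g x + (if k = 0 then 0 else P (k - 1) x)) (P k)" "!!k. bc (P k)"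
  and dlt: "!!w. norm w < r ==> (%k. dlt k * w ^ k) sums \<Delta> (mu + w)"
  and N: "!!w h. norm w < r ==> aiv h ==> (%k. pair (P k) h * w ^ k) sums pair (Y g (mu + w)) h"
  using Y_series[OF g, of mu] by blast
 have "\<exists>k. dlt k ~= 0"
 proof (rule ccontr)
  assume n: "\<not> ?thesis"
  have z: "\<Delta> (mu + w) = 0" if "norm w < r" for w using dlt[OF that] n by (simp add: sums_iff)
  obtain l where "\<Delta> l ~= 0" using \<Delta>_nonzero by blast
  then have "\<exists>s>0. \<forall>z\<in>ball mu s - {mu}. \<Delta> z ~= 0"
   by (rule_tac isolated_zeros[OF \<Delta>_holomorphic open_UNIV connected_UNIV UNIV_I _ UNIV_I, of mu l]) (use z[of 0] r in auto)
  then obtain s where s: "s > 0" "!!z. z \<in> ball mu s - {mu} ==> \<Delta> z ~= 0" by blast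
  define t where "t = min r s / 2"
  have "t > 0" "t < r" "t < s" using r s(1) by (auto simp: t_def min_def)
  then show False using z[of "of_real t"] s(2)[of "mu + of_real t"] by (simp add: dist_norm)
 qed
 define m where "m = (LEAST k. dlt k ~= 0)"
 have m: "dlt m ~= 0" "!!k. k < m ==> dlt k = 0"
  unfolding m_def using LeastI_ex[OF \<open>\<exists>k. dlt k ~= 0\<close>] not_less_Least by blast+
 obtain D1 where D1: "D1 holomorphic_on ball 0 r" "D1 0 = dlt m" "!!w. w \<in> ball 0 r ==> \<Delta> (mu + w) = w ^ m * D1 w"
  using powser_factor[OF r m(2) dlt, of m] by blast
 have "isCont D1 0" using holomorphic_on_imp_continuous_on[OF D1(1)] r by (simp add: continuous_on_eq_continuous_at)
 then have "\<exists>s>0. \<forall>w. dist 0 w < s --> D1 w ~= 0" by (rule continuous_at_avoid) (use D1(2) m(1) in simp)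
 then obtain s where s: "s > 0" "!!w. dist 0 w < s ==> D1 w ~= 0" by blast
 define r' where "r' = min r s"
 have r': "r' > 0" "ball 0 r' \<subseteq> ball (0::complex) r" "!!w. w \<in> ball 0 r' ==> D1 w ~= 0" using r s by (auto simp: r'_def)
 have P': "sol mu (if k = 0 then (%x. 0) else P (k - 1)) (P k) \<and> bc (P k)" if "k < m" for k
  using P(1)[of k] P(2)[of k] m(2)[OF that] by (cases "k = 0") simp_all
 have N': "\<exists>N1. N1 holomorphic_on ball 0 r' \<and> (\<forall>w\<in>ball 0 r'. pair (Y g (mu + w)) h = w ^ m * N1 w)"
  if h: "aiv h" "\<forall>k<m. pair (P k) h = 0" for h
 proof -
  obtain N1 where "N1 holomorphic_on ball 0 r" "!!w. w \<in> ball 0 r ==> pair (Y g (mu + w)) h = w ^ m * N1 w"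
   using powser_factor[OF r, of m "%k. pair (P k) h" "%w. pair (Y g (mu + w)) h"] N[OF _ h(1)] h(2) by blast
  then show ?thesis using r'(2) holomorphic_on_subset by blast
 qed
 have "D1 holomorphic_on ball 0 r'" using D1(1) r'(2) holomorphic_on_subset by blast
 then show ?thesis using r' P' N' D1(3) by (rule_tac exI[of _ m], rule_tac exI[of _ P], rule_tac exI[of _ D1], rule_tac exI[of _ r']) blast
qed

lemma isCont_pair_Y: assumes "aiv g" "aiv h" shows "isCont (%w. pair (Y g (mu + w)) h) 0"
proof -
 obtain P dlt r where r: "r > 0" "!!w. norm w < r ==> (%k. pair (P k) h * w ^ k) sums pair (Y g (mu + w)) h"
  using Y_series[OF assms(1), of mu] assms(2) by blast
 have "(%w. pair (Y g (mu + w)) h) holomorphic_on ball 0 r"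
  by (rule power_series_holomorphic[where a = "%k. pair (P k) h"]) (use r(2) in auto)
 from holomorphic_on_imp_continuous_on[OF this] show ?thesis using r(1) by (simp add: continuous_on_eq_continuous_at)
qed

definition res :: "complex => (real => complex^2) => real => complex^2" where
 "res l g = (%x. (1 / \<Delta> l) *s Y g l x)"

lemma res: assumes "\<Delta> l ~= 0" "aiv g" shows "sol l g (res l g)" "bc (res l g)" "pair (res l g) h = pair (Y g l) h / \<Delta> l"
proof -
 show "sol l g (res l g)" unfolding res_def
  by (rule sol_cong[OF sol_scale[OF Y(1)[OF assms(2)], of l "1 / \<Delta> l"]]) (use assms(1) in auto)
 show "bc (res l g)" unfolding res_def by (rule bc_scale[OF Y(2)[OF assms(2)]])
 show "pair (res l g) h = pair (Y g l) h / \<Delta> l" unfolding res_def pair_scale by simp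
qed

text \<open>Injectivity of the resolvent: the zero function has derivative zero, which determines
  its right-hand side almost everywhere.\<close>

lemma sol_zero_rhs:
 assumes y: "sol l g y" and z: "!!x. x \<in> {0..1} ==> y x = 0"
 shows "AE x in unit_leb. g x = 0"
proof -
 have nz: "b1 ~= 0" "b2 ~= 0" using b1 b2 by auto
 have ae: "AE x in unit_leb. f x = 0" if "acd (%x. 0) f" for f using lebesgue_differentiation[OF that] AE_space
 proof eventually_elim
  case (elim x)
  then have "x \<in> {0..1}" by simp
  then show ?case using vector_derivative_unique_within_closed_interval[of 0 1 x "%x. 0" "f x" 0] elim(1) by simp
 qed
 have "acd (%x. 0) (%x. \<i> * b1 * g x $ 1)" "acd (%x. 0) (%x. \<i> * b2 * g x $ 2)"
  by (rule acd_cong[OF sol_acd(1)[OF y]] acd_cong[OF sol_acd(2)[OF y]]; use z in simp)+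
 from ae[OF this(1)] ae[OF this(2)] show ?thesis by eventually_elim (use nz in \<open>simp add: vec_eq_iff forall_2\<close>)
qed

text \<open>If \<open>f\<close> is orthogonal to all root vectors, then \<open>\<langle>R(\<lambda>)g, f\<rangle>\<close> extends to a bounded entire function, hence
  does not depend on \<open>\<lambda>\<close>; the resolvent identity then shows that \<open>f\<close> is orthogonal to the range of \<open>R(\<lambda>)\<^sup>2\<close>.\<close>

lemma resolvent_constant:
 assumes f: "!!mu u. u \<in> root_subspace op mu ==> cinner u f = 0" and phi: "sq_integrable phi" "f = abs_L2 phi" and g: "aiv g"
 shows "\<exists>c. \<forall>l. \<Delta> l ~= 0 --> pair (res l g) (cc phi) = c"
proof -
 define h where "h = cc phi"
 have h: "aiv h" unfolding h_def by (rule sq_integrable_aiv(1)[OF sq_integrable_cc[OF phi(1)]])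
 define N where "N l = pair (Y g l) h" for l
 \<comment> \<open>All singularities turn out to be removable; the limit supplies the value of the
   entire extension at the zeros of \<open>\<Delta>\<close>.\<close>
 define G where "G l = (if \<Delta> l ~= 0 then N l / \<Delta> l else Lim (at l) (%l. N l / \<Delta> l))" for l
 have "\<exists>s>0. G holomorphic_on ball mu s" for mu
 proof -
  obtain m P D1 r where r: "r > 0" and P: "!!k. k < m ==> sol mu (if k = 0 then (%x. 0) else P (k - 1)) (P k) \<and> bc (P k)"
   and D1: "D1 holomorphic_on ball 0 r" "!!w. w \<in> ball 0 r ==> D1 w ~= 0 \<and> \<Delta> (mu + w) = w ^ m * D1 w"
   and N1: "!!h. aiv h ==> \<forall>k<m. pair (P k) h = 0 ==> \<exists>N1. N1 holomorphic_on ball 0 r \<and> (\<forall>w\<in>ball 0 r. pair (Y g (mu + w)) h = w ^ m * N1 w)"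
   using resolvent_local[OF g, of mu] by blast
  have pk: "abs_L2 (P k) \<in> power_kernel op mu (Suc k)" if "k < m" for k using that
  proof (induction k)
   case 0
   then show ?case unfolding power_kernel_Suc_contv using P[of 0] zero_function by auto
  next
   case (Suc k)
   then have "contv (P k)" "abs_L2 (P k) \<in> power_kernel op mu (Suc k)" using P[of k] sol_contv by auto
   then show ?case unfolding power_kernel_Suc_contv[of _ _ "Suc k"] using P[of "Suc k"] Suc.prems by auto
  qed
  have "pair (P k) h = 0" if "k < m" for k
  proof -
   have "cinner (abs_L2 (P k)) f = 0" using pk[OF that] by (intro f) (auto simp only: root_subspace_def)
   then show ?thesis using cinner_pair[OF sol_contv[OF conjunct1[OF P[OF that]]] phi(1)] by (simp add: phi(2) h_def)
  qed
  then obtain N1 where N1: "N1 holomorphic_on ball 0 r" "!!w. w \<in> ball 0 r ==> N (mu + w) = w ^ m * N1 w"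
   using N1[OF h] unfolding N_def by blast
  define Q where "Q w = N1 w / D1 w" for w
  have Q: "Q holomorphic_on ball 0 r" unfolding Q_def using N1(1) D1 by (intro holomorphic_on_divide) auto
  have quo: "N (mu + w) / \<Delta> (mu + w) = Q w" "\<Delta> (mu + w) ~= 0" if "w \<in> ball 0 r" "w ~= 0" for w
   using N1(2)[OF that(1)] D1(2)[OF that(1)] that(2) by (auto simp: Q_def)
  have eq: "G l = Q (l - mu)" if l: "l \<in> ball mu r" for l
  proof (cases "l = mu")
   case False
   then show ?thesis using quo[of "l - mu"] l by (simp add: G_def dist_norm norm_minus_commute)
  next
   case True
   have 0: "0 \<in> ball (0::complex) r" using r by simp
   show ?thesis
   proof (cases "\<Delta> mu = 0")
    case False
    then have "m = 0" using D1(2)[OF 0] by (cases m) auto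
    then show ?thesis using N1(2)[OF 0] D1(2)[OF 0] False by (simp add: G_def True Q_def)
   next
    case z: True
    have "isCont Q 0" using holomorphic_on_imp_continuous_on[OF Q] r by (simp add: continuous_on_eq_continuous_at)
    then have "((%l. Q (l - mu)) \<longlongrightarrow> Q 0) (at mu)" unfolding isCont_def by (rule_tac LIM_offset_zero_cancel) simp
    moreover have "eventually (%l. Q (l - mu) = N l / \<Delta> l) (at mu)"
     unfolding eventually_at using r quo(1)[of "_ - mu"] by (intro exI[of _ r]) (auto simp: dist_norm norm_minus_commute)
    ultimately have "((%l. N l / \<Delta> l) \<longlongrightarrow> Q 0) (at mu)" by (rule Lim_transform_eventually)
    then have "Lim (at mu) (%l. N l / \<Delta> l) = Q 0" by (intro tendsto_Lim) auto
    then show ?thesis using z by (simp add: G_def True)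
   qed
  qed
  have "(Q \<circ> (%l. l - mu)) holomorphic_on ball mu r"
   by (rule holomorphic_on_compose_gen[OF _ Q]) (auto intro!: holomorphic_intros simp: dist_norm norm_minus_commute)
  then have "G holomorphic_on ball mu r" by (rule holomorphic_transform) (simp add: eq)
  then show ?thesis using r by blast
 qed
 then have G: "G holomorphic_on UNIV" by (rule holomorphic_on_UNIV_local)
 obtain K R where K: "!!l. R <= norm l ==> \<exists>rho>0. rho <= 1 \<and> (\<forall>z\<in>sphere 0 rho. resolvent_bounded K (l + z))"
  using plane_resolvent by blast
 define B where "B = K * nrm1 g * norm f"
 have far: "norm (G l) <= B" if l: "R <= norm l" for l
 proof -
  obtain rho where rho: "rho > 0" "!!z. z \<in> sphere 0 rho ==> resolvent_bounded K (l + z)" using K[OF l] by blast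
  show ?thesis
  \<comment> \<open>The resolvent is bounded on a circle around \<open>l\<close>, possibly not at
    \<open>l\<close> itself; the maximum principle for the extension carries the bound to the
    centre.\<close>
  proof (rule maximum_modulus_frontier[of G "cball l rho"])
   show "G holomorphic_on interior (cball l rho)" "continuous_on (closure (cball l rho)) G"
    using G holomorphic_on_subset holomorphic_on_imp_continuous_on by blast+
   fix w assume "w \<in> frontier (cball l rho)"
   then have "w - l \<in> sphere 0 rho" using rho(1) by (simp add: dist_norm norm_minus_commute)
   from rho(2)[OF this] have rb: "resolvent_bounded K w" by simp
   have D: "\<Delta> w ~= 0" by (rule resolvent_bounded_\<Delta>[OF rb])
   note y = res[OF D g]
   have cy: "contv (res w g)" by (rule sol_contv[OF y(1)])
   have "norm (abs_L2 (res w g)) <= K * nrm1 g"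
    by (rule norm_contv_le[OF cy]) (use rb g y in \<open>auto simp: resolvent_bounded_def\<close>)
   then have "norm (cinner (abs_L2 (res w g)) f) <= B" unfolding B_def
    using cinner_Cauchy_Schwarz[of "abs_L2 (res w g)" f] mult_right_mono[of _ _ "norm f"] norm_ge_zero order_trans by blast
   then show "norm (G w) <= B" using D y(3)[of h] cinner_pair[OF cy phi(1)] by (simp add: G_def N_def phi(2) h_def)
  qed (use rho(1) in auto)
 qed
 have "bounded (G ` cball 0 R)"
  by (intro compact_imp_bounded compact_continuous_image holomorphic_on_imp_continuous_on holomorphic_on_subset[OF G]) auto
 then obtain B' where B': "!!l. l \<in> cball 0 R ==> norm (G l) <= B'" unfolding bounded_iff by blast
 have "bounded (range G)" unfolding bounded_iff
 proof (rule exI[of _ "max B B'"], intro ballI)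
  fix v assume "v \<in> range G"
  then obtain l where "v = G l" by blast
  then show "norm v <= max B B'" using far[of l] B'[of l] by (cases "R <= norm l") auto
 qed
 from Liouville_theorem[OF G this] obtain c where "!!l. G l = c" unfolding constant_on_def by blast
 then have "pair (res l g) (cc phi) = c" if "\<Delta> l ~= 0" for l using res(3)[OF that g, of h] that unfolding G_def N_def h_def by metis
 then show ?thesis by blast
qed

text \<open>In the resolvent identity \<open>R(l0) g - R(l1) g = (l0 - l1) R(l0) R(l1) g\<close> the
  left side pairs to 0 with \<open>h\<close>, since the pairing does not depend on \<open>l\<close>;
  using this independence once more, \<open>R(l1) R(l1) g\<close> pairs to 0 with \<open>h\<close>
  for every \<open>g\<close>. Lagrange's identity moves both resolvents to the transposed problem,
  so the square of its resolvent kills \<open>h\<close>, and injectivity gives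
  \<open>h = 0\<close>.\<close>

theorem completeness:
 assumes f: "!!mu u. u \<in> root_subspace op mu ==> cinner u f = 0"
 shows "f = 0"
proof -
 interpret T: bvp "- b2" "- b1" p q d "- b * b2 / b1" "- c * b1 / b2" a by (rule bvp_transpose)
 obtain phi where phi: "sq_integrable phi" "f = abs_L2 phi" by (rule L2_cases)
 define h where "h = cc phi"
 have sh: "sq_integrable h" unfolding h_def by (rule sq_integrable_cc[OF phi(1)])
 have h: "aiv h" by (rule sq_integrable_aiv(1)[OF sh])
 have const: "\<exists>c. \<forall>l. \<Delta> l ~= 0 --> pair (res l g) h = c" if "aiv g" for g
  unfolding h_def by (rule resolvent_constant[OF _ phi that]) (rule f)
 obtain H1 where H1: "H1 >= 0" "!!l. \<Delta> l = 0 ==> \<bar>Im l\<bar> <= H1" using eigenvalue_strip by blast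
 obtain H2 where H2: "H2 >= 0" "!!l. T.\<Delta> l = 0 ==> \<bar>Im l\<bar> <= H2" using T.eigenvalue_strip by blast
 \<comment> \<open>Both points lie above the strips that contain the eigenvalues of the problem and
   of its transpose.\<close>
 define l0 where "l0 = \<i> * of_real (H1 + H2 + 1)"
 define l1 where "l1 = \<i> * of_real (H1 + H2 + 2)"
 have nz: "\<Delta> l0 ~= 0" "\<Delta> l1 ~= 0" "T.\<Delta> l1 ~= 0" "l0 - l1 ~= 0"
  using H1(1) H2(1) H1(2)[of l0] H1(2)[of l1] H2(2)[of l1] by (auto simp: l0_def l1_def)
 have sq: "pair (res l1 (res l1 g)) h = 0" if g: "aiv g" for g
 proof -
  define y where "y = res l1 g"
  have y: "sol l1 g y" "bc y" unfolding y_def by (rule res[OF nz(2) g])+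
  have ya: "aiv y" by (rule sol_aiv[OF y(1)])
  note r0 = res[OF nz(1) g] and r1 = res[OF nz(1) ya]
  have "sol l0 (%x. (g x + (- 1) *s (g x + (l1 - l0) *s y x)) + (l1 - l0) *s y x) (%x. (res l0 g x + (- 1) *s y x) + (l1 - l0) *s res l0 y x)"
   by (intro sol_add sol_scale sol_shift r0 r1 y)
  then have s: "sol l0 (%x. 0) (%x. (res l0 g x + (- 1) *s y x) + (l1 - l0) *s res l0 y x)" by (rule sol_cong) (simp_all add: vec_eq_iff)
  have z: "(res l0 g x + (- 1) *s y x) + (l1 - l0) *s res l0 y x = 0" if "x \<in> {0..1}" for x
   by (rule zero_of_\<Delta>_nz[OF nz(1) s _ that]) (intro bc_add bc_scale r0 r1 y)
  have c: "contv (res l0 g)" "contv y" "contv (res l0 y)" using r0(1) r1(1) y(1) sol_contv by blast+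
  have cs: "contv (%x. k *s v x)" if "contv v" for k v using that by (simp add: contv_def continuous_on_mult_left)
  have ca: "contv (%x. res l0 g x + (- 1) *s y x)" using c(1) cs[OF c(2), of "- 1"] unfolding contv_def by (simp only: vector_add_component) (intro allI continuous_on_add; blast)
  have "pair (%x. (res l0 g x + (- 1) *s y x) + (l1 - l0) *s res l0 y x) h = pair (%x. 0) h"
   unfolding pair_def using z by (intro arg_cong2[of _ _ _ _ "(+)"] Henstock_Kurzweil_Integration.integral_cong) (auto simp: vec_eq_iff)
  then have "pair (res l0 g) h - pair y h + (l1 - l0) * pair (res l0 y) h = 0"
   unfolding pair_add[OF ca cs[OF c(3)] h] pair_add[OF c(1) cs[OF c(2)] h] pair_scale by (simp add: pair_def[of "%x. 0"])
  moreover have "pair (res l0 g) h = pair y h" unfolding y_def using const[OF g] nz by blast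
  ultimately have "pair (res l0 y) h = 0" using nz(4) by simp
  then show ?thesis unfolding y_def[symmetric] using const[OF ya] nz by metis
 qed
 define z where "z = T.res l1 h"
 have z: "solT l1 h z" "bcT z" unfolding z_def by (rule T.res[OF nz(3) h])+
 have cz: "contv z" by (rule T.sol_contv[OF z(1)])
 define z2 where "z2 = T.res l1 z"
 have z2: "solT l1 z z2" "bcT z2" unfolding z2_def by (rule T.res[OF nz(3) contv_aiv[OF cz]])+
 have cz2: "contv z2" by (rule T.sol_contv[OF z2(1)])
 have "pair g z2 = 0" if g: "aiv g" for g
 proof -
  note y = res[OF nz(2) g]
  note y2 = res[OF nz(2) sol_aiv[OF y(1)]]
  have "(l1 - l1) * pair (res l1 (res l1 g)) z + pair (res l1 g) z - pair (res l1 (res l1 g)) h = 0"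
   by (rule lagrange[OF y2(1,2) z sol_aiv[OF y(1)] h])
  moreover have "(l1 - l1) * pair (res l1 g) z2 + pair g z2 - pair (res l1 g) z = 0" by (rule lagrange[OF y(1,2) z2 g contv_aiv[OF cz]])
  ultimately show ?thesis using sq[OF g] by simp
 qed
 from this[OF sq_integrable_aiv(1)[OF sq_integrable_cc[OF contv_sq_integrable[OF cz2]]]]
 have "pair z2 (cc z2) = 0" unfolding pair_commute[of z2] .
 then have "cinner (abs_L2 z2) (abs_L2 z2) = 0" using cinner_pair[OF cz2 contv_sq_integrable[OF cz2]] by simp
 then have "abs_L2 z2 = 0" by simp
 then have "AE x in unit_leb. z x = 0" using T.sol_zero_rhs[OF z2(1)] contv_abs_L2_eq_0[OF cz2] by blast
 from abs_L2_cong_AE[OF contv_sq_integrable[OF cz] this] have "abs_L2 z = 0" by (simp add: zero_function(3))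
 then have "AE x in unit_leb. h x = 0" using T.sol_zero_rhs[OF z(1)] contv_abs_L2_eq_0[OF cz] by blast
 from abs_L2_cong_AE[OF sh this] have "abs_L2 h = 0" by (simp add: zero_function(3))
 then have "norm (abs_L2 phi) = 0" using norm_cc[OF phi(1)] by (simp add: h_def)
 then show ?thesis by (simp add: phi(2))
qed

end

section \<open>Density of spans and the algebra of root subspaces\<close>

text \<open>The frame operator of the Gram-Schmidt vectors with themselves is the orthogonal
  projection onto the closed span. What it leaves of \<open>f\<close> is orthogonal to
  \<open>A\<close>, hence 0, so \<open>f\<close> is the limit of its own expansion.\<close>

lemma total_dense:
 assumes A: "countable A" and total: "!!f. (!!x. x \<in> A ==> cinner x f = 0) ==> f = 0"
 shows "closure (L2.span A) = UNIV"
proof -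
 \<comment> \<open>Adding 0 makes the set nonempty, so that it can be enumerated, and leaves the
   span unchanged.\<close>
 define u where "u = from_nat_into (insert 0 A)"
 have u: "range u = insert 0 A" unfolding u_def by (rule range_from_nat_into) (use A in auto)
 have sp: "L2.span (u ` {..n}) \<subseteq> L2.span A" for n
 proof -
  have "u ` {..n} \<subseteq> insert 0 A" using u by blast
  from L2.span_mono[OF this] show ?thesis by simp
 qed
 define g where "g = gs u"
 define P where "P = frame_op g g"
 have b: "bessel 1 g" unfolding g_def by (rule bessel_gs)
 have fix_g: "P (g m) = g m" for m
 proof -
  have "P (g m) = (if gsw u m = 0 then 0 else 1) *\<^sub>C g m" unfolding P_def by (rule frame_op_single) (auto simp: g_def gs_cinner)
  moreover have "g m = 0" if "gsw u m = 0" using gs_norm[of u m] that by (simp add: g_def)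
  ultimately show ?thesis by auto
 qed
 have "f \<in> closure (L2.span A)" for f
 proof -
  have g0: "cinner (g m) (f - P f) = 0" for m
  proof -
   have "cinner (g m) (P f) = cinner (P (g m)) f" unfolding P_def by (rule cinner_frame_op[OF b b, symmetric])
   then show ?thesis unfolding cinner_diff_right fix_g by simp
  qed
  have "cinner x (f - P f) = 0" if x: "x \<in> A" for x
  proof -
   obtain n where n: "x = u n" using x u by blast
   have "u n \<in> L2.span (g ` {..n})" unfolding g_def by (rule in_span_gs)
   then have "cinner (u n) (f - P f) = 0" by (induction rule: L2.span_induct_alt) (auto simp: cinner_add_left cinner_scaleC_left g0)
   then show ?thesis using n by simp
  qed
  from total[OF this] have Pf: "P f = f" by simp
  have gA: "g n \<in> L2.span A" for n using gs_in_span[of u n] sp[of n] by (auto simp: g_def)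
  have "(%n. \<Sum>k<n. cinner f (g k) *\<^sub>C g k) \<longlonglongrightarrow> f"
   using frame_op_sums[OF b b, of f] Pf by (simp add: sums_def P_def)
  moreover have "(\<Sum>k<n. cinner f (g k) *\<^sub>C g k) \<in> L2.span A" for n by (intro L2.span_sum L2.span_scale gA)
  ultimately show ?thesis unfolding closure_sequential by (intro exI[of _ "%n. \<Sum>k<n. cinner f (g k) *\<^sub>C g k"]) blast
 qed
 then show ?thesis by blast
qed

context bvp begin

lemma op_linear:
 assumes "(u, v) \<in> op" "(u', v') \<in> op" shows "(k *\<^sub>C u + u', k *\<^sub>C v + v') \<in> op"
proof -
 have nz: "b1 ~= 0" "b2 ~= 0" using b1 b2 by auto
 obtain y g where y: "u = abs_L2 y" "v = abs_L2 g" "sq_integrable g" "sol 0 g y" "bc y" using assms(1) L_op_iff[OF nz] by blast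
 obtain y' g' where y': "u' = abs_L2 y'" "v' = abs_L2 g'" "sq_integrable g'" "sol 0 g' y'" "bc y'" using assms(2) L_op_iff[OF nz] by blast
 have s: "sq_integrable y" "sq_integrable y'" using contv_sq_integrable sol_contv y(4) y'(4) by blast+
 have "k *\<^sub>C u + u' = abs_L2 (%x. k *s y x + y' x)" "k *\<^sub>C v + v' = abs_L2 (%x. k *s g x + g' x)"
  unfolding y y' by (simp_all add: abs_L2_scaleC abs_L2_plus sq_integrable_scaleC s y(3) y'(3))
 moreover have "sol 0 (%x. k *s g x + g' x) (%x. k *s y x + y' x)" "bc (%x. k *s y x + y' x)" "sq_integrable (%x. k *s g x + g' x)"
  by (intro sol_add sol_scale bc_add bc_scale sq_integrable_add sq_integrable_scaleC y y')+
 ultimately show ?thesis unfolding L_op_iff[OF nz] by blast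
qed

lemma op_scale: assumes "(u, v) \<in> op" shows "(k *\<^sub>C u, k *\<^sub>C v) \<in> op"
 using op_linear[OF assms op_linear[OF assms assms, of "- 1"], of k] by simp

text \<open>The graph is that of a function: a continuous representative of 0 vanishes on the
  interval, and then so does its right-hand side almost everywhere.\<close>

lemma op_zero: assumes "(0, v) \<in> op" shows "v = 0"
proof -
 have nz: "b1 ~= 0" "b2 ~= 0" using b1 b2 by auto
 obtain y g where y: "0 = abs_L2 y" "v = abs_L2 g" "sq_integrable g" "sol 0 g y" "bc y" using assms L_op_iff[OF nz] by blast
 have "AE x in unit_leb. g x = 0" by (rule sol_zero_rhs[OF y(4)]) (rule contv_abs_L2_eq_0[OF sol_contv[OF y(4)] y(1)[symmetric]])
 from abs_L2_cong_AE[OF y(3) this] show ?thesis using y(2) by (simp add: zero_function(3))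
qed

lemma op_unique: assumes "(u, v) \<in> op" "(u, v') \<in> op" shows "v = v'"
 using op_zero[of "v' - v"] op_linear[OF assms, of "- 1"] by simp

lemma op_sum: assumes "finite M" "!!mu. mu \<in> M ==> (f mu, g mu) \<in> op" shows "(\<Sum>mu\<in>M. f mu, \<Sum>mu\<in>M. g mu) \<in> op"
 using assms
proof (induction M)
 case empty
 have "b1 ~= 0" "b2 ~= 0" using b1 b2 by auto
 from L_op_iff[OF this] have "(abs_L2 (%x. 0), abs_L2 (%x. 0)) \<in> op" using sol_zero[of 0] zero_function(2) sq_integrable_zero by blast
 then show ?case by (simp add: zero_function(3))
next
 case (insert mu M)
 then show ?case using op_linear[of "f mu" "g mu" "\<Sum>mu\<in>M. f mu" "\<Sum>mu\<in>M. g mu" 1] by simp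
qed

lemma power_kernel_scale: "u \<in> power_kernel op mu n ==> k *\<^sub>C u \<in> power_kernel op mu n"
proof (induction n arbitrary: u)
 case (Suc n)
 then obtain v where v: "(u, v) \<in> op" "v - mu *\<^sub>C u \<in> power_kernel op mu n" by auto
 have "k *\<^sub>C v - mu *\<^sub>C (k *\<^sub>C u) \<in> power_kernel op mu n"
  using Suc.IH[OF v(2)] by (simp add: L2.scale_right_diff_distrib mult.commute)
 then show ?case using op_scale[OF v(1), of k] by auto
qed simp

lemma power_kernel_eigenvector:
 assumes "u \<in> power_kernel op mu n" "(u, nu *\<^sub>C u) \<in> op" "nu ~= mu" shows "u = 0"
 using assms(1)
proof (induction n)
 case (Suc n)
 then obtain v where v: "(u, v) \<in> op" "v - mu *\<^sub>C u \<in> power_kernel op mu n" by auto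
 have "v = nu *\<^sub>C u" by (rule op_unique[OF v(1) assms(2)])
 then have "(nu - mu) *\<^sub>C u \<in> power_kernel op mu n" using v(2) by (simp add: L2.scale_left_diff_distrib)
 from power_kernel_scale[OF this, of "1 / (nu - mu)"] have "u \<in> power_kernel op mu n" using assms(3) by simp
 then show ?case by (rule Suc.IH)
qed simp

text \<open>Outer induction on the set of parameters, inner induction on the height of the component
  at \<open>nu\<close>. Applying \<open>L - nu\<close> lowers that height and keeps the other
  components in their root subspaces, so by induction it annihilates those; but an eigenvector for
  \<open>nu\<close> that lies in the root subspace of another \<open>mu\<close> is 0.\<close>

lemma root_subspaces_independent:
 assumes sub: "!!mu. L2.subspace (root_subspace op mu)" and M: "finite M"
  and f: "!!mu. mu \<in> M ==> f mu \<in> root_subspace op mu" and sum: "(\<Sum>mu\<in>M. f mu) = 0"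
 shows "\<forall>mu\<in>M. f mu = 0"
 using M f sum
proof (induction M arbitrary: f)
 case (insert nu M)
 have step: "x = 0 \<and> (\<forall>mu\<in>M. f mu = 0)"
  if "x \<in> power_kernel op nu n" "!!mu. mu \<in> M ==> f mu \<in> root_subspace op mu" "x + (\<Sum>mu\<in>M. f mu) = 0" for x n f
  using that
 proof (induction n arbitrary: x f)
  case 0
  then have x: "x = 0" by simp
  then have "(\<Sum>mu\<in>M. f mu) = 0" using 0(3) by simp
  from insert.IH[OF 0(2) this] show ?case using x by blast
 next
  case (Suc n)
  obtain v where v: "(x, v) \<in> op" "v - nu *\<^sub>C x \<in> power_kernel op nu n" using Suc.prems(1) by auto
  have "\<exists>w. (f mu, w) \<in> op \<and> w - mu *\<^sub>C f mu \<in> root_subspace op mu" if mu: "mu \<in> M" for mu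
  proof -
   obtain k where k: "f mu \<in> power_kernel op mu k" using Suc.prems(2)[OF mu] by (auto simp: root_subspace_def)
   show ?thesis
   proof (cases k)
    case 0
    then have "f mu = 0" using k by simp
    moreover have "(0, 0) \<in> op" using op_sum[of "{}"] by simp
    moreover have "0 \<in> root_subspace op mu" by (rule L2.subspace_0[OF sub])
    ultimately show ?thesis by (intro exI[of _ 0]) simp
   next
    case (Suc j)
    then show ?thesis using k by (auto simp: root_subspace_def)
   qed
  qed
  then obtain w where w: "!!mu. mu \<in> M ==> (f mu, w mu) \<in> op" "!!mu. mu \<in> M ==> w mu - mu *\<^sub>C f mu \<in> root_subspace op mu" by metis
  define f' where "f' mu = w mu - nu *\<^sub>C f mu" for mu
  have f': "f' mu \<in> root_subspace op mu" if "mu \<in> M" for mu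
  proof -
   have "f' mu = (w mu - mu *\<^sub>C f mu) + (mu - nu) *\<^sub>C f mu" by (simp add: f'_def L2.scale_left_diff_distrib)
   then show ?thesis using L2.subspace_add[OF sub w(2)[OF that] L2.subspace_scale[OF sub Suc.prems(2)[OF that]]] by simp
  qed
  have "(x + (\<Sum>mu\<in>M. f mu), v + (\<Sum>mu\<in>M. w mu)) \<in> op"
   using op_linear[OF v(1) op_sum[where f = f and g = w, OF insert.hyps(1) w(1)], where k = 1] by simp
  then have "v + (\<Sum>mu\<in>M. w mu) = 0" unfolding Suc.prems(3) by (rule op_zero)
  moreover have "(v - nu *\<^sub>C x) + (\<Sum>mu\<in>M. f' mu) = (v + (\<Sum>mu\<in>M. w mu)) - nu *\<^sub>C (x + (\<Sum>mu\<in>M. f mu))"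
   by (simp add: f'_def sum_subtractf L2.scale_sum_right L2.scale_right_distrib)
  ultimately have "(v - nu *\<^sub>C x) + (\<Sum>mu\<in>M. f' mu) = 0" using Suc.prems(3) by simp
  from Suc.IH[OF v(2) f' this] have z: "\<forall>mu\<in>M. f' mu = 0" by blast
  have "f mu = 0" if mu: "mu \<in> M" for mu
  proof -
   obtain k where k: "f mu \<in> power_kernel op mu k" using Suc.prems(2)[OF mu] by (auto simp: root_subspace_def)
   have "w mu = nu *\<^sub>C f mu" using z mu by (simp add: f'_def)
   then show ?thesis using power_kernel_eigenvector[OF k, of nu] w(1)[OF mu] insert.hyps(2) mu by auto
  qed
  then show ?case using Suc.prems(3) by simp
 qed
 obtain n where n: "f nu \<in> power_kernel op nu n" using insert.prems(1)[of nu] by (auto simp: root_subspace_def)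
 have "f nu + (\<Sum>mu\<in>M. f mu) = 0" using insert.prems(2) insert.hyps by simp
 from step[OF n insert.prems(1) this] show ?case by auto
qed simp

text \<open>A solution of the equation at \<open>mu\<close> with right-hand side \<open>g\<close> is
  a combination of the two fundamental solutions and of \<open>T g\<close>, the solution with zero
  initial value. \<open>T\<close> is linear, so a finite spanning set of one kernel yields one for
  the next.\<close>

lemma power_kernel_finite_span: "\<exists>F. finite F \<and> power_kernel op mu n \<subseteq> L2.span F"
proof (induction n)
 case 0
 show ?case by (intro exI[of _ "{}"]) simp
next
 case (Suc n)
 then obtain F where F: "finite F" "power_kernel op mu n \<subseteq> L2.span F" by blast
 define T where "T v = abs_L2 (SOL mu 0 (rep_L2 v))" for v
 have rep: "aiv (rep_L2 v)" for v by (rule sq_integrable_aiv(1)[OF sq_integrable_rep])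
 have SR: "sol mu (rep_L2 v) (SOL mu 0 (rep_L2 v))" "SOL mu 0 (rep_L2 v) 0 = 0" for v using SOL(1,2)[OF rep] by blast+
 have cS: "contv (SOL mu 0 (rep_L2 v))" for v by (rule sol_contv[OF SR(1)])
 have Tl: "T (k *\<^sub>C u + v) = k *\<^sub>C T u + T v" for k u v
 proof -
  let ?y = "%x. k *s SOL mu 0 (rep_L2 u) x + SOL mu 0 (rep_L2 v) x"
  have s: "sq_integrable (%x. k *s rep_L2 u x + rep_L2 v x)" by (intro sq_integrable_add sq_integrable_scaleC sq_integrable_rep)
  have "sol mu (%x. k *s rep_L2 u x + rep_L2 v x) ?y" by (intro sol_add sol_scale SR)
  moreover have "abs_L2 (%x. k *s rep_L2 u x + rep_L2 v x) = k *\<^sub>C u + v"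
   using abs_L2_plus[OF sq_integrable_scaleC[OF sq_integrable_rep] sq_integrable_rep] abs_L2_scaleC[OF sq_integrable_rep] by (simp add: abs_rep_L2)
  ultimately have "sol mu (rep_L2 (k *\<^sub>C u + v)) ?y" by (intro sol_AE_cong[OF _ s sq_integrable_rep]) (simp_all add: abs_rep_L2)
  from sol_unique[OF SR(1) this] have "T (k *\<^sub>C u + v) = abs_L2 ?y" unfolding T_def
   by (intro abs_L2_cong_AE[OF contv_sq_integrable[OF cS]] AE_I2) (simp add: SR(2))
  also have "\<dots> = k *\<^sub>C T u + T v" unfolding T_def
   by (simp add: abs_L2_scaleC abs_L2_plus sq_integrable_scaleC contv_sq_integrable[OF cS])
  finally show ?thesis .
 qed
 have T0: "T 0 = 0" using Tl[of "- 1" 0 0] by simp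
 have TF: "T v \<in> L2.span (T ` F)" if "v \<in> L2.span F" for v using that
 proof (induction rule: L2.span_induct_alt)
  case (step k x y)
  then show ?case unfolding Tl by (intro L2.span_add L2.span_scale) (auto intro: L2.span_base)
 qed (simp add: T0 L2.span_zero)
 define F' where "F' = {abs_L2 (phi1 mu), abs_L2 (phi2 mu)} \<union> T ` F"
 have "u \<in> L2.span F'" if u: "u \<in> power_kernel op mu (Suc n)" for u
 proof -
  obtain y g where y: "u = abs_L2 y" "sol mu g y" "bc y" "contv g" "abs_L2 g \<in> power_kernel op mu n"
   using u unfolding power_kernel_Suc_contv by blast
  define G where "G = rep_L2 (abs_L2 g)"
  have sG: "sq_integrable G" "abs_L2 G = abs_L2 g" by (simp_all add: G_def sq_integrable_rep abs_rep_L2)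
  have "sol mu G y" by (rule sol_AE_cong[OF y(2) contv_sq_integrable[OF y(4)] sG(1) sG(2)[symmetric]])
  then have sy: "sol mu (%x. 1 *s G x) y" by simp
  have cphi: "contv (phi1 mu)" "contv (phi2 mu)" unfolding phi1_def phi2_def using SOL(1)[OF aiv_zero] sol_contv by blast+
  have sq: "sq_integrable (phi1 mu)" "sq_integrable (phi2 mu)" "sq_integrable (psi G mu)"
   using cphi cS[of "abs_L2 g"] by (auto simp: contv_sq_integrable psi_def G_def)
  have "u = abs_L2 (%x. y 0 $ 1 *s phi1 mu x + y 0 $ 2 *s phi2 mu x + 1 *s psi G mu x)" unfolding y(1)
   by (rule abs_L2_cong_AE[OF contv_sq_integrable[OF sol_contv[OF y(2)]] AE_I2]) (rule sol_comb[OF sy], simp_all add: sq_integrable_aiv(1)[OF sG(1)])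
  also have "\<dots> = y 0 $ 1 *\<^sub>C abs_L2 (phi1 mu) + y 0 $ 2 *\<^sub>C abs_L2 (phi2 mu) + 1 *\<^sub>C T (abs_L2 g)"
   unfolding T_def by (simp add: abs_L2_scaleC abs_L2_plus sq_integrable_scaleC sq_integrable_add sq flip: psi_def G_def)
  also have "\<dots> \<in> L2.span F'"
  proof (intro L2.span_add L2.span_scale)
   show "abs_L2 (phi1 mu) \<in> L2.span F'" "abs_L2 (phi2 mu) \<in> L2.span F'" by (auto simp: F'_def intro: L2.span_base)
   have "T (abs_L2 g) \<in> L2.span (T ` F)" using TF F(2) y(5) by blast
   then show "T (abs_L2 g) \<in> L2.span F'" using L2.span_mono[of "T ` F" F'] by (auto simp: F'_def)
  qed
  finally show ?thesis .
 qed
 then show ?case using F(1) by (intro exI[of _ F']) (auto simp: F'_def)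
qed

text \<open>Along a chain \<open>(L - \<mu>)y\<^sub>j = y\<^bsub>j+1\<^esub>\<close> the resolvent at \<open>\<mu> + w\<close> is \<open>-\<Sum>\<^sub>j w\<^bsup>-j-1\<^esup> y\<^sub>j\<close>. Its pole order
  cannot exceed the multiplicity of the zero \<open>\<mu>\<close> of \<open>\<Delta>\<close>, so that the chains are bounded in length.\<close>

lemma power_kernel_stable: "\<exists>m. \<forall>n\<ge>m. power_kernel op mu (Suc n) \<subseteq> power_kernel op mu n"
proof -
 obtain m D1 r where r: "r > 0" "D1 holomorphic_on ball 0 r" "!!w. w \<in> ball 0 r ==> D1 w ~= 0 \<and> \<Delta> (mu + w) = w ^ m * D1 w"
  using resolvent_local[OF aiv_zero, of mu] by blast
 have "u \<in> power_kernel op mu n" if n: "m <= n" and u: "u \<in> power_kernel op mu (Suc n)" for u n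
 proof -
  have "\<exists>y. (\<forall>j. contv (y j)) \<and> (\<forall>j<k. sol mu (y (Suc j)) (y j) \<and> bc (y j)) \<and> abs_L2 (y k) = 0 \<and> u = abs_L2 (y 0)"
   if "u \<in> power_kernel op mu k" for u k
   using that
  proof (induction k arbitrary: u)
   case 0
   then show ?case using zero_function by (intro exI[of _ "%j x. 0"]) simp
  next
   case (Suc k)
   then obtain z g where z: "u = abs_L2 z" "sol mu g z" "bc z" "contv g" "abs_L2 g \<in> power_kernel op mu k"
    unfolding power_kernel_Suc_contv by blast
   obtain y where y: "!!j. contv (y j)" "!!j. j < k ==> sol mu (y (Suc j)) (y j) \<and> bc (y j)" "abs_L2 (y k) = 0" "abs_L2 g = abs_L2 (y 0)"
    using Suc.IH[OF z(5)] by blast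
   have s: "sol mu (y 0) z" by (rule sol_AE_cong[OF z(2) contv_sq_integrable[OF z(4)] contv_sq_integrable[OF y(1)] y(4)])
   define y' where "y' j = (case j of 0 => z | Suc i => y i)" for j
   have "contv (y' j)" for j using y(1) sol_contv[OF s] by (cases j) (auto simp: y'_def)
   moreover have "sol mu (y' (Suc j)) (y' j) \<and> bc (y' j)" if "j < Suc k" for j using that y(2) s z(3) by (cases j) (auto simp: y'_def)
   moreover have "abs_L2 (y' (Suc k)) = 0" "u = abs_L2 (y' 0)" using y(3) z(1) by (simp_all add: y'_def)
   ultimately show ?case by blast
  qed
  from this[OF u] obtain y where y: "!!j. contv (y j)" "!!j. j < Suc n ==> sol mu (y (Suc j)) (y j) \<and> bc (y j)" "abs_L2 (y (Suc n)) = 0" "u = abs_L2 (y 0)"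
   by blast
  have ya: "aiv (y j)" for j by (rule contv_aiv[OF y(1)])
  define h where "h = cc (y n)"
  have h: "aiv h" unfolding h_def by (rule sq_integrable_aiv(1)[OF sq_integrable_cc[OF contv_sq_integrable[OF y(1)]]])
  \<comment> \<open>\<open>Z w N\<close> is the sum over \<open>j < N\<close> of
    \<open>w ^ (N - 1 - j)\<close> times \<open>y j\<close>, in Horner form. It solves the equation
    at \<open>mu + w\<close> with right-hand side \<open>y N - w ^ N * y 0\<close>; for
    \<open>N = Suc n\<close> the chain has ended and only the second term is left.\<close>
  define Z where "Z w = rec_nat (%x::real. 0 :: complex^2) (%N z x. w *s z x + y N x)" for w
  have Z0: "Z w 0 = (%x. 0)" and ZS: "Z w (Suc N) = (%x. w *s Z w N x + y N x)" for w N by (simp_all add: Z_def)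
  have cZ: "contv (Z w N)" for w N
  proof (induction N)
   case (Suc N)
   then show ?case using y(1)[of N] unfolding contv_def ZS
    by (simp only: vector_add_component vector_smult_component) (intro allI continuous_on_add continuous_on_mult continuous_on_const; blast)
  qed (simp add: Z0 zero_function)
  have sZ: "sol (mu + w) (%x. y N x + (- (w ^ N)) *s y 0 x) (Z w N) \<and> bc (Z w N)" if "N <= Suc n" for w N using that
  proof (induction N)
   case 0
   have "sol (mu + w) (%x. y 0 x + (- (w ^ 0)) *s y 0 x) (%x. 0)" by (rule sol_cong[OF sol_zero]) (auto simp: vec_eq_iff)
   then show ?case unfolding Z0 using zero_function by blast
  next
   case (Suc N)
   have s: "sol mu (y (Suc N)) (y N)" "bc (y N)" using y(2)[of N] Suc.prems by auto
   have "sol (mu + w) (%x. w *s (y N x + (- (w ^ N)) *s y 0 x) + (y (Suc N) x + (mu - (mu + w)) *s y N x)) (Z w (Suc N))"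
    unfolding ZS using Suc by (intro sol_add sol_scale sol_shift s) auto
   then have "sol (mu + w) (%x. y (Suc N) x + (- (w ^ Suc N)) *s y 0 x) (Z w (Suc N))"
    by (rule sol_cong) (auto simp: vec_eq_iff algebra_simps)
   moreover have "bc (Z w (Suc N))" unfolding ZS using Suc s(2) by (intro bc_add bc_scale) auto
   ultimately show ?case by blast
  qed
  have cp: "isCont (%w. pair (Z w N) h) 0" for N
  proof (induction N)
   case 0
   then show ?case by (simp add: Z0)
  next
   case (Suc N)
   have c2: "contv (%x. w *s Z w N x)" for w using cZ[of w N] by (simp add: contv_def continuous_on_mult_left)
   show ?case unfolding ZS pair_add[OF c2 y(1) h] pair_scale by (intro continuous_intros Suc)
  qed
  have yz: "y (Suc n) x = 0" if "x \<in> {0..1}" for x by (rule contv_abs_L2_eq_0[OF y(1,3) that])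
  \<comment> \<open>Both sides express the resolvent at \<open>mu + w\<close> applied to
    \<open>y 0\<close>, with the common factor \<open>w ^ m\<close> cancelled. Since
    \<open>n >= m\<close>, the left side tends to 0 with \<open>w\<close>, while
    \<open>Z 0 (Suc n) = y n\<close>; hence the last member of the chain vanishes.\<close>
  have key: "w ^ (Suc n - m) * pair (Y (y 0) (mu + w)) h = - (D1 w * pair (Z w (Suc n)) h)" if w: "w \<in> ball 0 r" "w ~= 0" for w
  proof -
   have D: "D1 w ~= 0" "\<Delta> (mu + w) = w ^ m * D1 w" "\<Delta> (mu + w) ~= 0" using r(3)[OF w(1)] w(2) by auto
   let ?V = "%x. w ^ Suc n *s Y (y 0) (mu + w) x + \<Delta> (mu + w) *s Z w (Suc n) x"
   have "sol (mu + w) (%x. w ^ Suc n *s (\<Delta> (mu + w) *s y 0 x) + \<Delta> (mu + w) *s (y (Suc n) x + (- (w ^ Suc n)) *s y 0 x)) ?V"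
    using sZ[OF order_refl, of w] by (intro sol_add sol_scale Y ya) auto
   then have "sol (mu + w) (%x. 0) ?V" by (rule sol_cong) (simp_all add: yz vec_eq_iff)
   moreover have "bc ?V" using sZ[OF order_refl, of w] by (intro bc_add bc_scale Y ya) auto
   ultimately have "?V x = 0" if "x \<in> {0..1}" for x using zero_of_\<Delta>_nz[OF D(3) _ _ that] by blast
   then have "pair ?V h = pair (%x. 0) h" unfolding pair_def
    by (intro arg_cong2[of _ _ _ _ "(+)"] Henstock_Kurzweil_Integration.integral_cong) (auto simp: vec_eq_iff)
   moreover have c: "contv (%x. k *s v x)" if "contv v" for k v using that by (simp add: contv_def continuous_on_mult_left)
   ultimately have eq: "w ^ Suc n * pair (Y (y 0) (mu + w)) h + \<Delta> (mu + w) * pair (Z w (Suc n)) h = 0"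
    unfolding pair_add[OF c[OF sol_contv[OF Y(1)[OF ya]]] c[OF cZ] h] pair_scale by (simp add: pair_def[of "%x. 0"])
   have "w ^ Suc n = w ^ m * w ^ (Suc n - m)" using n by (simp only: power_add[symmetric]) simp
   from eq[unfolded this] have "w ^ m * (w ^ (Suc n - m) * pair (Y (y 0) (mu + w)) h + D1 w * pair (Z w (Suc n)) h) = 0"
    unfolding D(2) by (simp add: algebra_simps)
   then show ?thesis using w(2) by (simp add: add_eq_0_iff2)
  qed
  have iD: "isCont D1 0" using holomorphic_on_imp_continuous_on[OF r(2)] r(1) by (simp add: continuous_on_eq_continuous_at)
  have "isCont (%w. w ^ (Suc n - m) * pair (Y (y 0) (mu + w)) h + D1 w * pair (Z w (Suc n)) h) 0"
   by (intro continuous_intros isCont_pair_Y[OF ya h] iD cp)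
  then have "((%w. w ^ (Suc n - m) * pair (Y (y 0) (mu + w)) h + D1 w * pair (Z w (Suc n)) h) \<longlongrightarrow>
    0 ^ (Suc n - m) * pair (Y (y 0) (mu + 0)) h + D1 0 * pair (Z 0 (Suc n)) h) (at 0)" unfolding isCont_def .
  moreover have "eventually (%w. w ^ (Suc n - m) * pair (Y (y 0) (mu + w)) h + D1 w * pair (Z w (Suc n)) h = 0) (at 0)"
   unfolding eventually_at using r(1) key by (intro exI[of _ r]) (auto simp: dist_norm)
  then have "((%w. w ^ (Suc n - m) * pair (Y (y 0) (mu + w)) h + D1 w * pair (Z w (Suc n)) h) \<longlongrightarrow> 0) (at 0)"
   by (rule tendsto_eventually)
  ultimately have "0 ^ (Suc n - m) * pair (Y (y 0) (mu + 0)) h + D1 0 * pair (Z 0 (Suc n)) h = 0" by (rule LIM_unique)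
  moreover have "(0::complex) ^ (Suc n - m) = 0" using n by simp
  ultimately have "D1 0 * pair (Z 0 (Suc n)) h = 0" by simp
  then have "pair (Z 0 (Suc n)) h = 0" using r(3)[of 0] r(1) by simp
  then have "pair (y n) h = 0" unfolding ZS by simp
  then have "abs_L2 (y n) = 0" using cinner_pair[OF y(1) contv_sq_integrable[OF y(1)], of n n] by (simp add: h_def)
  moreover have "abs_L2 (y (n - i)) \<in> power_kernel op mu i" if "i <= n" "abs_L2 (y n) = 0" for i using that(1)
  proof (induction i)
   case 0
   then show ?case using that(2) by simp
  next
   case (Suc i)
   then have e: "n - i = Suc (n - Suc i)" "n - Suc i < Suc n" by auto
   show ?case unfolding power_kernel_Suc_contv using y(1,2)[of "n - i"] y(2)[OF e(2)] Suc e(1) by auto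
  qed
  ultimately show ?thesis using y(4) by (metis diff_self_eq_0 order_refl)
 qed
 then show ?thesis by blast
qed

lemma root_subspace_finite_span: "\<exists>F. finite F \<and> root_subspace op mu \<subseteq> L2.span F"
proof -
 obtain m where m: "!!n. m <= n ==> power_kernel op mu (Suc n) \<subseteq> power_kernel op mu n" using power_kernel_stable by blast
 have up: "power_kernel op mu (m + k) \<subseteq> power_kernel op mu m" for k
 proof (induction k)
  case (Suc k)
  have "power_kernel op mu (m + Suc k) \<subseteq> power_kernel op mu (m + k)" using m[of "m + k"] by (simp del: power_kernel.simps)
  then show ?case using Suc by blast
 qed simp
 have mono: "power_kernel op mu n \<subseteq> power_kernel op mu (Suc n)" for n
 proof (induction n)
  case 0
  have "0 \<in> power_kernel op mu (Suc 0)" unfolding power_kernel_Suc_contv using zero_function sol_zero by fastforce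
  then show ?case by simp
 next
  case (Suc n)
  then show ?case by auto
 qed
 have "root_subspace op mu \<subseteq> power_kernel op mu m"
 proof
  fix u assume "u \<in> root_subspace op mu"
  then obtain n where n: "u \<in> power_kernel op mu n" by (auto simp: root_subspace_def)
  have "u \<in> power_kernel op mu (m + n)" using lift_Suc_mono_le[of "power_kernel op mu" n "m + n"] mono n by auto
  then show "u \<in> power_kernel op mu m" using up by blast
 qed
 then show ?thesis using power_kernel_finite_span[of mu m] by blast
qed

end

section \<open>Assembling the Riesz basis\<close>

context bvp begin

lemma \<Delta>_finite_zeros: "finite {l. norm l <= r \<and> \<Delta> l = 0}"
proof (cases "\<Delta> constant_on UNIV")
 case True
 then obtain k where k: "!!l. \<Delta> l = k" unfolding constant_on_def by blast
 have "k ~= 0" using \<Delta>_nonzero k by auto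
 then show ?thesis by (simp add: k)
next
 case False
 have "{l. norm l <= r \<and> \<Delta> l = 0} = {l \<in> cball 0 r. \<Delta> l = 0}" by auto
 then show ?thesis using holomorphic_compact_finite_zeros[OF \<Delta>_holomorphic open_UNIV connected_UNIV compact_cball subset_UNIV False] by (simp only:)
qed

lemma \<Delta>_countable_zeros: "countable {l. \<Delta> l = 0}"
proof -
 have "{l. \<Delta> l = 0} = (\<Union>n::nat. {l. norm l <= real n \<and> \<Delta> l = 0})" using real_arch_simple by auto
 moreover have "countable {l. norm l <= real n \<and> \<Delta> l = 0}" for n by (rule countable_finite[OF \<Delta>_finite_zeros])
 ultimately show ?thesis by simp
qed

text \<open>The system is given, not chosen: the near eigenvalues contribute the finite independent
  set \<open>W\<close>, every far one a single unit vector. The dual functions have to be adapted to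
  these vectors before the criterion with a finite set can be applied.\<close>

theorem root_vectors_riesz_basis:
 assumes sr: "strictly_regular_bc b1 b2 a b c d" and S: "root_vectors_system op S"
 shows "riesz_basis S"
proof -
 interpret T: bvp "- b2" "- b1" p q d "- b * b2 / b1" "- c * b1 / b2" a by (rule bvp_transpose)
 obtain B where B: "!!mu. L2.independent (B mu)" "!!mu. L2.span (B mu) = root_subspace op mu" "!!mu v. v \<in> B mu ==> norm v = 1" "S = (\<Union>mu. B mu)"
  using S unfolding root_vectors_system_def by blast
 have sub: "L2.subspace (root_subspace op mu)" for mu unfolding B(2)[symmetric] by (rule L2.subspace_span)
 have Br: "v \<in> root_subspace op mu" if "v \<in> B mu" for v mu using that B(2) L2.span_base by blast
 have B0: "B mu = {}" if "\<Delta> mu ~= 0" for mu using Br[of _ mu] B(3)[of _ mu] root_subspace_zero[OF that] by fastforce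
 have Bfin: "finite (B mu)" for mu
 proof -
  obtain F where "finite F" "root_subspace op mu \<subseteq> L2.span F" using root_subspace_finite_span by blast
  then show ?thesis using L2.independent_span_bound[OF _ B(1)] Br by blast
 qed
 obtain H where H: "!!l. \<Delta> l = 0 ==> \<bar>Im l\<bar> <= H" using eigenvalue_strip by blast
 obtain R K th where K: "K > 0" and th: "th > 0"
  and sep: "!!l l'. \<Delta> l = 0 ==> \<Delta> l' = 0 ==> R <= norm l ==> R <= norm l' ==> l ~= l' ==> th < norm (l - l')"
  and sup: "!!l u x. \<Delta> l = 0 ==> R <= norm l ==> sol l (%x. 0) u ==> bc u ==> x \<in> {0..1} ==> n1 (u x) <= K * norm (abs_L2 u)"
  and ex: "!!l. \<Delta> l = 0 ==> R <= norm l ==> \<exists>u w. sol l (%x. 0) u \<and> bc u \<and> norm (abs_L2 u) = 1 \<and> solT l (%x. 0) w \<and> bcT w \<and>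
   (\<forall>x\<in>{0..1}. n1 (w x) <= K) \<and> pair u w = 1 \<and> root_subspace op l = L2.span {abs_L2 u}"
  using large_eigenvalues[OF sr] by blast
 define E where "E = {l. \<Delta> l = 0 \<and> R <= norm l}"
 define E0 where "E0 = {l. \<Delta> l = 0 \<and> norm l < R}"
 have E0: "finite E0" by (rule finite_subset[OF _ \<Delta>_finite_zeros[of R]]) (auto simp: E0_def)
 have E: "countable E" by (rule countable_subset[OF _ \<Delta>_countable_zeros]) (auto simp: E_def)
 have "\<exists>y w. sol e (%x. 0) y \<and> (\<forall>x\<in>{0..1}. n1 (y x) <= K) \<and> B e = {abs_L2 y} \<and> solT e (%x. 0) w \<and> bcT w \<and>
   (\<forall>x\<in>{0..1}. n1 (w x) <= K) \<and> pair y w = 1" if e: "e \<in> E" for e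
 proof -
  have De: "\<Delta> e = 0" "R <= norm e" using e by (auto simp: E_def)
  obtain u w where u: "sol e (%x. 0) u" "bc u" "norm (abs_L2 u) = 1" and w: "solT e (%x. 0) w" "bcT w" "!!x. x \<in> {0..1} ==> n1 (w x) <= K"
   and uw: "pair u w = 1" "root_subspace op e = L2.span {abs_L2 u}" using ex[OF De] by blast
  have su: "sq_integrable u" by (rule contv_sq_integrable[OF sol_contv[OF u(1)]])
  have mult: "\<exists>k. v = k *\<^sub>C abs_L2 u \<and> norm k = 1" if v: "v \<in> B e" for v
  proof -
   obtain k where "v = k *\<^sub>C abs_L2 u" using Br[OF v] unfolding uw(2) L2.span_singleton by blast
   then show ?thesis using B(3)[OF v] u(3) by (auto simp: norm_scaleC)
  qed
  have "B e ~= {}"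
  proof
   assume "B e = {}"
   then have "root_subspace op e = {0}" using B(2)[of e] by simp
   moreover have "abs_L2 u \<in> root_subspace op e" unfolding uw(2) by (rule L2.span_base) simp
   ultimately show False using u(3) by simp
  qed
  then obtain v where v: "v \<in> B e" by blast
  then obtain k where k: "v = k *\<^sub>C abs_L2 u" "norm k = 1" using mult by blast
  have k0: "k ~= 0" using k(2) by auto
  have "v' = v" if v': "v' \<in> B e" for v'
  proof (rule ccontr)
   assume ne: "v' ~= v"
   obtain k' where "v' = k' *\<^sub>C abs_L2 u" using mult[OF v'] by blast
   then have "v' = (k' / k) *\<^sub>C v" using k0 by (simp add: k(1))
   then have "v' \<in> L2.span (B e - {v'})" using v ne by (simp add: L2.span_base L2.span_scale)
   then show False using B(1)[of e] v' unfolding L2.dependent_def by blast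
  qed
  then have "B e = {v}" using v by blast
  then have Be: "B e = {abs_L2 (%x. k *s u x)}" unfolding k(1) abs_L2_scaleC[OF su] .
  \<comment> \<open>The given vector is the constructed eigenfunction times a number
    \<open>k\<close> of modulus 1; dividing the dual function by \<open>k\<close> keeps the pairing
    equal to 1 and the bounds unchanged.\<close>
  have sy: "sol e (%x. 0) (%x. k *s u x)" "solT e (%x. 0) (%x. (1 / k) *s w x)"
   using sol_scale[OF u(1), of k] T.sol_scale[OF w(1), of "1 / k"] by simp_all
  have "n1 (k *s u x) <= K" "n1 ((1 / k) *s w x) <= K" if "x \<in> {0..1}" for x
   using sup[OF De u(1,2) that] u(3) w(3)[OF that] k(2) by (simp_all add: n1_scale norm_divide)
  moreover have "pair (%x. k *s u x) (%x. (1 / k) *s w x) = k * (1 / k * pair w u)"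
   unfolding pair_scale pair_commute[of u "%x. (1 / k) *s w x"] ..
  then have "pair (%x. k *s u x) (%x. (1 / k) *s w x) = 1" using uw(1) k0 by (simp add: pair_commute)
  ultimately show ?thesis using sy Be T.bc_scale[OF w(2), of "1 / k"] by blast
 qed
 then have "\<forall>e. \<exists>y w. e \<in> E --> sol e (%x. 0) y \<and> (\<forall>x\<in>{0..1}. n1 (y x) <= K) \<and> B e = {abs_L2 y} \<and> solT e (%x. 0) w \<and> bcT w \<and>
   (\<forall>x\<in>{0..1}. n1 (w x) <= K) \<and> pair y w = 1" by blast
 from choice[OF this] obtain y where "\<forall>e. \<exists>w. e \<in> E --> sol e (%x. 0) (y e) \<and> (\<forall>x\<in>{0..1}. n1 (y e x) <= K) \<and> B e = {abs_L2 (y e)} \<and> solT e (%x. 0) w \<and> bcT w \<and>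
   (\<forall>x\<in>{0..1}. n1 (w x) <= K) \<and> pair (y e) w = 1" by blast
 from choice[OF this] obtain w where yw: "!!e. e \<in> E ==> sol e (%x. 0) (y e) \<and> (\<forall>x\<in>{0..1}. n1 (y e x) <= K) \<and> B e = {abs_L2 (y e)} \<and> solT e (%x. 0) (w e) \<and> bcT (w e) \<and>
   (\<forall>x\<in>{0..1}. n1 (w e x) <= K) \<and> pair (y e) (w e) = 1" by blast
 \<comment> \<open>The countable set of far eigenvalues is coded by a set of natural numbers,
   outside of which both families are 0; finitely and infinitely many far eigenvalues are treated
   alike.\<close>
 define I where "I = to_nat_on E ` E"
 define mu where "mu n = from_nat_into E n" for n
 have mut: "mu (to_nat_on E e) = e" if "e \<in> E" for e unfolding mu_def by (rule from_nat_into_to_nat_on[OF E that])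
 have muE: "mu n \<in> E" if "n \<in> I" for n using that mut by (auto simp: I_def)
 have muinj: "mu m ~= mu n" if "m \<in> I" "n \<in> I" "m ~= n" for m n using that mut by (auto simp: I_def)
 have mu0: "\<Delta> (mu n) = 0" "R <= norm (mu n)" if "n \<in> I" for n using muE[OF that] by (auto simp: E_def)
 define u where "u n = (if n \<in> I then abs_L2 (y (mu n)) else 0)" for n
 define v where "v n = (if n \<in> I then abs_L2 (cc (w (mu n))) else 0)" for n
 have nz: "b1 ~= 0" "b2 ~= 0" "- b1 ~= 0" "- b2 ~= 0" using b1 b2 by auto
 have sepI: "th < norm (mu m - mu n)" if "m \<in> I" "n \<in> I" "m ~= n" for m n by (rule sep) (use that mu0 muinj in auto)
 have "\<exists>C. bessel C u" unfolding u_def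
  by (rule solutions_bessel(1)[where mu = mu and I = I, OF nz(1,2) th sepI H[OF mu0(1)] less_imp_le[OF K]]) (use yw[OF muE] in blast)+
 then obtain C1 where C1: "bessel C1 u" by blast
 have "\<exists>C. bessel C v" unfolding v_def
  by (rule T.solutions_bessel(2)[where mu = mu and I = I, OF nz(4,3) th sepI H[OF mu0(1)] less_imp_le[OF K]]) (use yw[OF muE] in blast)+
 then obtain C2 where C2: "bessel C2 v" by blast
 have uB: "u n \<in> B (mu n)" if "n \<in> I" for n using yw[OF muE[OF that]] that by (simp add: u_def)
 have orth: "cinner s (v n) = 0" if "s \<in> B nu" "n \<in> I" "nu ~= mu n" for s nu n
  using root_vector_orthogonal[OF _ _ Br[OF that(1)] that(3)] yw[OF muE[OF that(2)]] that(2) by (simp add: v_def)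
 have bi: "cinner (u m) (v n) = (if m = n \<and> n \<in> I then 1 else 0)" for m n
 proof (cases "m \<in> I \<and> n \<in> I")
  case False
  then show ?thesis by (auto simp: u_def v_def)
 next
  case True
  show ?thesis
  proof (cases "m = n")
   case mn: True
   have "contv (y (mu n))" "contv (w (mu n))" using yw[OF muE] True sol_contv T.sol_contv by blast+
   from cinner_cc_pair[OF this] show ?thesis using True mn yw[OF muE] by (simp add: u_def v_def)
  next
   case False
   then show ?thesis using orth[OF uB, of m n] muinj[of m n] True by simp
  qed
 qed
 define W where "W = (\<Union>nu\<in>E0. B nu)"
 have Wfin: "finite W" unfolding W_def using E0 Bfin by simp
 have disj: "B nu \<inter> B nu' = {}" if ne: "nu ~= nu'" for nu nu'
 proof (rule ccontr)
  assume "B nu \<inter> B nu' ~= {}"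
  then obtain s where s: "s \<in> B nu" "s \<in> B nu'" by blast
  have "\<forall>mu\<in>{nu, nu'}. (if mu = nu then s else - s) = 0"
   by (rule root_subspaces_independent[OF sub]) (use s Br ne L2.subspace_neg[OF sub] in auto)
  then show False using B(3)[OF s(1)] by simp
 qed
 have Wind: "L2.independent W"
 proof (rule L2.independent_if_scalars_zero[OF Wfin])
  fix k s assume sum: "(\<Sum>x\<in>W. k x *\<^sub>C x) = 0" and s: "s \<in> W"
  have "(\<Sum>nu\<in>E0. \<Sum>x\<in>B nu. k x *\<^sub>C x) = 0"
   using sum unfolding W_def by (subst (asm) sum.UNION_disjoint) (use E0 Bfin disj in auto)
  moreover have "(\<Sum>x\<in>B nu. k x *\<^sub>C x) \<in> root_subspace op nu" for nu
   by (intro L2.subspace_sum[OF sub] L2.subspace_scale[OF sub] Br)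
  ultimately have z: "\<forall>nu\<in>E0. (\<Sum>x\<in>B nu. k x *\<^sub>C x) = 0" by (intro root_subspaces_independent[OF sub E0])
  obtain nu where nu: "nu \<in> E0" "s \<in> B nu" using s by (auto simp: W_def)
  show "k s = 0" by (rule L2.independentD[OF B(1)[of nu] Bfin order_refl _ nu(2)]) (use z nu(1) in blast)
 qed
 have Worth: "cinner s (v n) = 0" if s: "s \<in> W" for s n
 proof (cases "n \<in> I")
  case True
  obtain nu where nu: "nu \<in> E0" "s \<in> B nu" using s by (auto simp: W_def)
  have "nu ~= mu n" using nu(1) mu0(2)[OF True] by (auto simp: E0_def)
  then show ?thesis by (rule orth[OF nu(2) True])
 qed (simp add: v_def)
 have SW: "S = W \<union> u ` I"
 proof (intro equalityI subsetI)
  fix s assume "s \<in> S"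
  then obtain nu where nu: "s \<in> B nu" using B(4) by blast
  then have "\<Delta> nu = 0" using B0 by fastforce
  show "s \<in> W \<union> u ` I"
  proof (cases "norm nu < R")
   case True
   then show ?thesis using nu \<open>\<Delta> nu = 0\<close> by (auto simp: W_def E0_def)
  next
   case False
   then have e: "nu \<in> E" using \<open>\<Delta> nu = 0\<close> by (simp add: E_def)
   then have i: "to_nat_on E nu \<in> I" by (simp add: I_def)
   then have "s = u (to_nat_on E nu)" using yw[OF e] nu by (simp add: u_def mut[OF e])
   then show ?thesis using i by blast
  qed
 next
  fix s assume "s \<in> W \<union> u ` I"
  then show "s \<in> S" using uB B(4) by (auto simp: W_def)
 qed
 have dense: "closure (L2.span (W \<union> u ` I)) = UNIV"
 proof (rule total_dense)
  show "countable (W \<union> u ` I)" by (intro countable_Un countable_finite[OF Wfin] countable_image countableI_type)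
  fix f assume f: "!!x. x \<in> W \<union> u ` I ==> cinner x f = 0"
  show "f = 0"
  proof (rule completeness)
   fix nu s assume "s \<in> root_subspace op nu"
   then have "s \<in> L2.span (B nu)" unfolding B(2) .
   moreover have "cinner x f = 0" if "x \<in> B nu" for x using f that B(4) unfolding SW by blast
   ultimately show "cinner s f = 0" by (induction rule: L2.span_induct_alt) (auto simp: cinner_add_left cinner_scaleC_left)
  qed
 qed
 show ?thesis unfolding SW by (rule riesz_basis_criterion_finite[OF C1 C2 bi _ Wfin Wind Worth dense]) (simp add: u_def)
qed

end

theorem theorem1p1:
  fixes b1 b2 :: real and a b c d :: complex and Q12 Q21 :: "real \<Rightarrow> complex" and S :: "L2 set"
  assumes "b1 < 0" and "0 < b2"
    and "integrable (lebesgue_on {0..1}) Q12" and "integrable (lebesgue_on {0..1}) Q21"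
    and "a * d - b * c \<noteq> 0"
    and "strictly_regular_bc b1 b2 a b c d"
    and "root_vectors_system (L_op b1 b2 (Q_mat Q12 Q21) a b c d) S"
  shows "riesz_basis S"
proof -
  interpret bvp b1 b2 Q12 Q21 a b c d
    by unfold_locales (use assms in \<open>simp_all add: absolutely_integrable_on_unit_iff\<close>)
  show ?thesis using root_vectors_riesz_basis assms(6,7) by blast
qed

end
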